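(* For every $L$ there is a constant $c>0$ depending only on $L$ such that the following holds. Let $\xi=(\xi_j)_{j=1}^m$ be a random vector with independent, mean-zero, variance one, $L$-subgaussian entries. Let $\Psi_h\in\mathbb{C}^{m\times m^2}$ be the random Gabor synthesis matrix generated by $h=\frac1{\sqrt m}\xi$. If, for $s\in\mathbb{N}$ and $\delta,\eta\in(0,1)$, $$m\ge c\,\delta^{-2}\,s\,\max\{(\log s)^2(\log m)^2,\ \log(\eta^{-1})\},$$ then with probability at least $1-\eta$ the restricted isometry constant $\delta_s$ of $\Psi_h$ satisfies $\delta_s\le\delta$.
   Context: Here $\mathbb{N}$ denotes the positive integers. A mean-zero, variance-one random variable $X$ is $L$-subgaussian if $\mathbb{P}(|X|\ge t)\le2\exp(-t^2/(2L^2))$ for all $t>0$. The translation and modulation operators on $\mathbb{C}^m$ are $(Th)_j=h_{j\ominus1}$ and $(Mh)_j=\omega^jh_j$, where $\omega=e^{2\pi i/m}$ and $\ominus$ is subtraction modulo $m$; thus $(T^kh)_j=h_{j\ominus k}$ and $(M^\ell h)_j=\omega^{\ell j}h_j$. For $\lambda=(k,\ell)\in\mathbb{Z}_m^2=\{0,\dots,m-1\}^2$ the time-frequency shift is $\pi(\lambda)=M^\ell T^k$. The Gabor synthesis matrix $\Psi_h\in\mathbb{C}^{m\times m^2}$ generated by $h\in\mathbb{C}^m$ is the matrix whose columns are the vectors $\pi(\lambda)h$, $\lambda\in\mathbb{Z}_m^2$. A vector is $s$-sparse if it has at most $s$ nonzero entries. The restricted isometry constant $\delta_s$ of a matrix $\Psi\in\mathbb{C}^{m\times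 n}$ (here $n=m^2$) is the smallest number such that $(1-\delta_s)\|x\|_2^2\le\|\Psi x\|_2^2\le(1+\delta_s)\|x\|_2^2$ for all $s$-sparse $x\in\mathbb{C}^n$.
   Formalization: For s=1 or m=1 it is assumed that η≤1/2: there the log² term vanishes and the claim fails as η→1 (m=s=1, ξ=±√(1/2),±√(3/2), δ=0.4). L>0 is assumed. c is stated per sample-space type; passing to the law of ξ gives one c for all. *)

theory Defs
  imports "Jordan_Normal_Form.Matrix" "HOL-Probability.Probability"
begin

unbundle no vec_syntax
hide_type (open) Finite_Cartesian_Product.vec
hide_const (open) Finite_Cartesian_Product.vec Finite_Cartesian_Product.mat
  Finite_Cartesian_Product.vec_nth Finite_Cartesian_Product.row Finite_Cartesian_Product.column

section \<open>Subgaussian random variables\<close>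

text \<open>Random variables are complex-valued, since they serve as the entries of a vector in
  \<open>\<complex>\<^sup>m\<close>; real-valued ones are included through the embedding of the reals. In particular the
  variance is the mean of the squared modulus of the centred variable.\<close>

context prob_space
begin

definition complex_variance :: "('a \<Rightarrow> complex) \<Rightarrow> real" where
  "complex_variance X = expectation (\<lambda>\<omega>. (cmod (X \<omega> - expectation X))\<^sup>2)"

definition subgaussian :: "real \<Rightarrow> ('a \<Rightarrow> complex) \<Rightarrow> bool" where
  "subgaussian L X \<longleftrightarrow>
     (\<forall>t>0. prob {\<omega> \<in> space M. cmod (X \<omega>) \<ge> t} \<le> 2 * exp (- (t\<^sup>2 / (2 * L\<^sup>2))))"

end

section \<open>Time-frequency shifts and the Gabor synthesis matrix\<close>

text \<open>Entries are indexed by \<open>{0..<m}\<close>, where \<open>m\<close> is the dimension of the vector.\<close>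

definition translation_op :: "complex vec \<Rightarrow> complex vec" where
  "translation_op h =
     (let m = dim_vec h in vec m (\<lambda>j. h $ nat ((int j - 1) mod int m)))"

definition modulation_op :: "complex vec \<Rightarrow> complex vec" where
  "modulation_op h =
     (let m = dim_vec h in vec m (\<lambda>j. exp (2 * of_real pi * \<i> / of_nat m) ^ j * h $ j))"

definition time_freq_shift :: "nat \<times> nat \<Rightarrow> complex vec \<Rightarrow> complex vec" where
  "time_freq_shift = (\<lambda>(k, l) h. (modulation_op ^^ l) ((translation_op ^^ k) h))"

text \<open>The columns are ordered lexicographically in \<open>(k, l)\<close>.\<close>

definition gabor_synthesis_mat :: "complex vec \<Rightarrow> complex mat" where
  "gabor_synthesis_mat h =
     (let m = dim_vec h
      in mat_of_cols m (map (\<lambda>p. time_freq_shift p h) (List.product [0..<m] [0..<m])))"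

section \<open>Sparse vectors and the restricted isometry constant\<close>

definition sparse_vec :: "nat \<Rightarrow> complex vec \<Rightarrow> bool" where
  "sparse_vec s x \<longleftrightarrow> card {i. i < dim_vec x \<and> x $ i \<noteq> 0} \<le> s"

definition l2_norm :: "complex vec \<Rightarrow> real" where
  "l2_norm x = L2_set (\<lambda>i. cmod (x $ i)) {..<dim_vec x}"

definition restricted_isometry :: "nat \<Rightarrow> complex mat \<Rightarrow> real \<Rightarrow> bool" where
  "restricted_isometry s A d \<longleftrightarrow>
     (\<forall>x \<in> carrier_vec (dim_col A). sparse_vec s x \<longrightarrow>
        (1 - d) * (l2_norm x)\<^sup>2 \<le> (l2_norm (A *\<^sub>v x))\<^sup>2 \<and>
        (l2_norm (A *\<^sub>v x))\<^sup>2 \<le> (1 + d) * (l2_norm x)\<^sup>2)"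

text \<open>The least element exists as soon as \<open>s > 0\<close> and \<open>A\<close> has a column.\<close>

definition ri_const :: "nat \<Rightarrow> complex mat \<Rightarrow> real" where
  "ri_const s A = (LEAST d. restricted_isometry s A d)"

section \<open>Basic properties\<close>

lemma dim_translation_op [simp]: "dim_vec (translation_op h) = dim_vec h"
  by (simp add: translation_op_def Let_def)

lemma dim_modulation_op [simp]: "dim_vec (modulation_op h) = dim_vec h"
  by (simp add: modulation_op_def Let_def)

lemma dim_translation_op_pow [simp]: "dim_vec ((translation_op ^^ k) h) = dim_vec h"
  by (induction k) auto

lemma dim_modulation_op_pow [simp]: "dim_vec ((modulation_op ^^ k) h) = dim_vec h"
  by (induction k) auto

lemma index_translation_op:
  "j < dim_vec h \<Longrightarrow> translation_op h $ j = h $ nat ((int j - 1) mod int (dim_vec h))"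
  by (simp add: translation_op_def Let_def)

lemma index_translation_op_pow:
  assumes "j < dim_vec h"
  shows "(translation_op ^^ k) h $ j = h $ nat ((int j - int k) mod int (dim_vec h))"
  using assms
proof (induction k arbitrary: j)
  case (Suc k)
  let ?m = "dim_vec h"
  let ?i = "nat ((int j - 1) mod int ?m)"
  have i: "?i < ?m"
    using Suc.prems by (simp add: nat_less_iff)
  have "(int ?i - int k) mod int ?m = (int j - int (Suc k)) mod int ?m"
    using Suc.prems by (simp add: mod_diff_left_eq) (simp add: diff_diff_eq)
  then show ?case
    using Suc.IH[OF i] Suc.prems by (simp add: index_translation_op)
qed simp

lemma index_modulation_op_pow:
  assumes "j < dim_vec h"
  shows "(modulation_op ^^ l) h $ j = exp (2 * of_real pi * \<i> / of_nat (dim_vec h)) ^ (l * j) * h $ j"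
  using assms
  by (induction l) (simp_all add: modulation_op_def Let_def power_add)

lemma index_time_freq_shift:
  assumes "j < dim_vec h"
  shows "time_freq_shift (k, l) h $ j =
    exp (2 * of_real pi * \<i> / of_nat (dim_vec h)) ^ (l * j) *
    h $ nat ((int j - int k) mod int (dim_vec h))"
  using assms by (simp add: time_freq_shift_def index_modulation_op_pow index_translation_op_pow)

lemma gabor_synthesis_mat_carrier:
  "gabor_synthesis_mat h \<in> carrier_mat (dim_vec h) ((dim_vec h)\<^sup>2)"
  by (rule carrier_matI) (simp_all add: gabor_synthesis_mat_def Let_def power2_eq_square)

lemma l2_norm_sq: "(l2_norm x)\<^sup>2 = (\<Sum>i<dim_vec x. (cmod (x $ i))\<^sup>2)"
  by (simp add: l2_norm_def L2_set_def sum_nonneg)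

lemma restricted_isometry_mono:
  assumes "restricted_isometry s A d" "d \<le> e"
  shows "restricted_isometry s A e"
proof -
  have "(1 - e) * (l2_norm x)\<^sup>2 \<le> (1 - d) * (l2_norm x)\<^sup>2"
       "(1 + d) * (l2_norm x)\<^sup>2 \<le> (1 + e) * (l2_norm x)\<^sup>2" for x
    using assms(2) by (auto intro!: mult_right_mono)
  then show ?thesis
    using assms(1) unfolding restricted_isometry_def by (meson order_trans)
qed

lemma restricted_isometry_nonneg:
  assumes "restricted_isometry s A d" "s > 0" "dim_col A > 0"
  shows "d \<ge> 0"
proof -
  let ?x = "unit_vec (dim_col A) 0 :: complex vec"
  have supp: "{i. i < dim_vec ?x \<and> ?x $ i \<noteq> 0} \<subseteq> {0}"
    by (auto split: if_splits)
  have "sparse_vec s ?x"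
    using card_mono[OF _ supp] assms(2) by (simp add: sparse_vec_def)
  then have "(1 - d) * (l2_norm ?x)\<^sup>2 \<le> (1 + d) * (l2_norm ?x)\<^sup>2"
    using assms(1) unfolding restricted_isometry_def by (meson order_trans unit_vec_carrier)
  moreover have "(l2_norm ?x)\<^sup>2 = (\<Sum>i<dim_col A. if i = 0 then 1 else 0)"
    unfolding l2_norm_sq by (intro sum.cong) auto
  then have "(l2_norm ?x)\<^sup>2 = 1"
    using assms(3) by simp
  ultimately show ?thesis by simp
qed

lemma l2_norm_mult_mat_vec_le:
  assumes "x \<in> carrier_vec (dim_col A)"
  shows "(l2_norm (A *\<^sub>v x))\<^sup>2 \<le>
    (\<Sum>i<dim_row A. \<Sum>j<dim_col A. (cmod (A $$ (i, j)))\<^sup>2) * (l2_norm x)\<^sup>2"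
proof -
  have "(cmod ((A *\<^sub>v x) $ i))\<^sup>2 \<le> (\<Sum>j<dim_col A. (cmod (A $$ (i, j)))\<^sup>2) * (l2_norm x)\<^sup>2"
    if "i < dim_row A" for i
  proof -
    have "(A *\<^sub>v x) $ i = (\<Sum>j<dim_col A. A $$ (i, j) * x $ j)"
      using that assms by (auto simp: scalar_prod_def atLeast0LessThan intro!: sum.cong)
    then have "cmod ((A *\<^sub>v x) $ i) \<le> (\<Sum>j<dim_col A. cmod (A $$ (i, j)) * cmod (x $ j))"
      by (simp add: norm_mult[symmetric] norm_sum)
    then have "(cmod ((A *\<^sub>v x) $ i))\<^sup>2 \<le> (\<Sum>j<dim_col A. cmod (A $$ (i, j)) * cmod (x $ j))\<^sup>2"
      by (intro power_mono) auto
    also have "\<dots> \<le> (\<Sum>j<dim_col A. (cmod (A $$ (i, j)))\<^sup>2) * (\<Sum>j<dim_col A. (cmod (x $ j))\<^sup>2)"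
      by (rule Cauchy_Schwarz_ineq_sum)
    finally show ?thesis
      using assms by (simp add: l2_norm_sq)
  qed
  then have "(\<Sum>i<dim_row A. (cmod ((A *\<^sub>v x) $ i))\<^sup>2) \<le>
      (\<Sum>i<dim_row A. (\<Sum>j<dim_col A. (cmod (A $$ (i, j)))\<^sup>2) * (l2_norm x)\<^sup>2)"
    by (intro sum_mono) auto
  then show ?thesis
    by (simp add: l2_norm_sq sum_distrib_right)
qed

lemma restricted_isometry_ex: "\<exists>d. restricted_isometry s A d"
proof -
  define C where "C = (\<Sum>i<dim_row A. \<Sum>j<dim_col A. (cmod (A $$ (i, j)))\<^sup>2)"
  have "C \<ge> 0" by (simp add: C_def sum_nonneg)
  have "(1 - (1 + C)) * (l2_norm x)\<^sup>2 \<le> (l2_norm (A *\<^sub>v x))\<^sup>2 \<and>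
        (l2_norm (A *\<^sub>v x))\<^sup>2 \<le> (1 + (1 + C)) * (l2_norm x)\<^sup>2"
    if "x \<in> carrier_vec (dim_col A)" for x
  proof -
    have "C * (l2_norm x)\<^sup>2 \<le> (1 + (1 + C)) * (l2_norm x)\<^sup>2"
      by (intro mult_right_mono) auto
    moreover have "(1 - (1 + C)) * (l2_norm x)\<^sup>2 \<le> 0"
      using \<open>C \<ge> 0\<close> by simp
    ultimately show ?thesis
      using l2_norm_mult_mat_vec_le[OF that] unfolding C_def[symmetric]
      by (smt (verit) zero_le_power2)
  qed
  then show ?thesis unfolding restricted_isometry_def by blast
qed

lemma restricted_isometry_ri_const:
  assumes "s > 0" "dim_col A > 0"
  shows "restricted_isometry s A (ri_const s A)"
    and "restricted_isometry s A d \<Longrightarrow> ri_const s A \<le> d"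
proof -
  let ?P = "restricted_isometry s A"
  define d0 where "d0 = Inf {d. ?P d}"
  have bdd: "bdd_below {d. ?P d}"
    using restricted_isometry_nonneg[OF _ assms] by (auto intro!: bdd_belowI)
  have "closed {d. ?P d}"
    unfolding restricted_isometry_def Ball_def
    by (intro closed_Collect_all closed_Collect_imp closed_Collect_conj closed_Collect_le
        continuous_intros) auto
  then have "?P d0"
    using closed_contains_Inf[OF _ bdd] restricted_isometry_ex by (auto simp: d0_def)
  moreover have "d0 \<le> d" if "?P d" for d
    using cInf_lower[OF _ bdd] that by (simp add: d0_def)
  ultimately have "(LEAST d. ?P d) = d0"
    by (intro Least_equality) auto
  with \<open>?P d0\<close> \<open>\<And>d. ?P d \<Longrightarrow> d0 \<le> d\<close>
  show "?P (ri_const s A)" "?P d \<Longrightarrow> ri_const s A \<le> d"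
    by (simp_all add: ri_const_def)
qed

lemma ri_const_le_iff:
  assumes "s > 0" "dim_col A > 0"
  shows "ri_const s A \<le> d \<longleftrightarrow> restricted_isometry s A d"
  using restricted_isometry_ri_const[OF assms] restricted_isometry_mono by blast

end

theory Submission
  imports Defs "HOL-Probability.Hoeffding"
begin

text \<open>The deviation of \<open>\<parallel>\<Psi>\<^sub>h x\<parallel>\<^sup>2\<close> from \<open>\<parallel>x\<parallel>\<^sup>2\<close> is the centred quadratic form of \<open>\<xi>\<close> with the operator
  \<open>A x = m\<^sup>-\<^sup>1\<^sup>/\<^sup>2 \<Sum>\<lambda>. x \<lambda> \<cdot> \<pi>(\<lambda>)\<close>, whose Frobenius norm is \<open>\<parallel>x\<parallel>\<close> and whose operator norm is at most
  \<open>sqrt (s / m)\<close> when \<open>x\<close> is an \<open>s\<close>-sparse unit vector. Exchanging the entries of \<open>\<xi>\<close> one at a time for complex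
  Gaussian ones bounds the \<open>p\<close>-th moment of the supremum of these forms over a finite grid by that of a decoupled
  Gaussian chaos. Given one of its two Gaussian vectors, the chaos is a Gaussian process whose increments are
  controlled by the operator norm of \<open>A x - A y\<close>, and chaining applies. The approximations of the chain come
  from thinning: a grid point is a sum of unit multiples of basis vectors, and signs for which the signed sum
  of time-frequency shifts has small operator norm (found with moments of traces) allow one to drop half of the
  summands and double the rest. After \<open>k\<close> rounds few summands remain, hence few values are possible. Markov's
  inequality with \<open>p\<close> about \<open>ln (1 / \<eta>)\<close> and the passage from the grid to all sparse vectors finish the proof.\<close>

section \<open>Moments of Gaussian and subgaussian variables\<close>

text \<open>Exchanging one entry requires a quantity that is affine in that entry, and a quadratic
  form contains its squared modulus. So the form is split: the off-diagonal part is affine in each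
  \<open>\<xi> j\<close>, the diagonal part in each centred squared modulus, whose tail is only
  exponential and is matched with a product of two Gaussians. Both parts end as the same kind of
  decoupled chaos. Its increments are linear in \<open>a\<close> once \<open>b\<close> is fixed;
  conditioning leaves a factor \<open>max_norm\<close>, removed by an inequality that bounds the
  moment by itself. The logarithms arise thus. A sum thinned to about 2^r ln m summands takes at
  most exp(O(2^r (ln m)^2)) values, and its error is of order 2^(-r/2) sqrt(s/m). The root of the
  logarithm of the number of values times the error is sqrt(s/m) ln m at every level, and there are
  O(ln s) levels. For \<open>s = 1\<close> the factor ln s vanishes, which no chain over a fine grid
  can match; that case gets a net with a single nonzero point.\<close>

lemma nn_integral_PiM_coord_mono:
  fixes \<mu> \<nu> :: "'i \<Rightarrow> 'b measure"
  assumes "finite J"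
    and \<mu>: "\<And>j. prob_space (\<mu> j)" "\<And>j. sets (\<mu> j) = sets B"
    and \<nu>: "\<And>j. prob_space (\<nu> j)" "\<And>j. sets (\<nu> j) = sets B"
    and "\<Phi> \<in> borel_measurable (PiM J (\<lambda>_. B))"
    and "\<And>j w. j \<in> J \<Longrightarrow> (\<integral>\<^sup>+y. \<Phi> (w(j := y)) \<partial>\<mu> j) \<le> (\<integral>\<^sup>+y. \<Phi> (w(j := y)) \<partial>\<nu> j)"
  shows "(\<integral>\<^sup>+w. \<Phi> w \<partial>PiM J \<mu>) \<le> (\<integral>\<^sup>+w. \<Phi> w \<partial>PiM J \<nu>)"
  using assms(1,6,7)
proof (induction J arbitrary: \<Phi>)
  case empty
  show ?case by (simp add: PiM_empty)
next
  case (insert i J)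
  \<comment> \<open>The hybrid measure in which only coordinate \<open>i\<close> has been exchanged.
    With \<open>i\<close> as the inner variable of Fubini the assumption for \<open>i\<close>
    applies; with \<open>i\<close> as the outer variable the induction hypothesis applies for each
    fixed value \<open>y\<close>.\<close>
  define \<kappa> where "\<kappa> = \<mu>(i := \<nu> i)"
  have \<kappa>: "prob_space (\<kappa> j)" "sets (\<kappa> j) = sets B" for j
    using \<mu> \<nu> by (auto simp: \<kappa>_def)
  interpret \<mu>: product_sigma_finite \<mu>
    using \<mu>(1) by (simp add: product_sigma_finite_def prob_space_imp_sigma_finite)
  interpret \<nu>: product_sigma_finite \<nu>
    using \<nu>(1) by (simp add: product_sigma_finite_def prob_space_imp_sigma_finite)
  interpret \<kappa>: product_sigma_finite \<kappa>
    using \<kappa>(1) by (simp add: product_sigma_finite_def prob_space_imp_sigma_finite)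
  have [measurable]: "\<Phi> \<in> borel_measurable (PiM (insert i J) \<mu>)"
    "\<Phi> \<in> borel_measurable (PiM (insert i J) \<nu>)" "\<Phi> \<in> borel_measurable (PiM (insert i J) \<kappa>)"
    using insert.prems(1) \<mu>(2) \<nu>(2) \<kappa>(2)
    by (simp_all cong: measurable_cong_sets sets_PiM_cong)
  have J\<kappa>: "PiM J \<kappa> = PiM J \<mu>"
    using insert.hyps by (intro PiM_cong) (auto simp: \<kappa>_def)
  have \<kappa>i: "\<kappa> i = \<nu> i" by (simp add: \<kappa>_def)
  have "(\<integral>\<^sup>+w. \<Phi> w \<partial>PiM (insert i J) \<mu>) = (\<integral>\<^sup>+x. (\<integral>\<^sup>+y. \<Phi> (x(i := y)) \<partial>\<mu> i) \<partial>PiM J \<mu>)"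
    using insert.hyps by (intro \<mu>.product_nn_integral_insert) auto
  also have "\<dots> \<le> (\<integral>\<^sup>+x. (\<integral>\<^sup>+y. \<Phi> (x(i := y)) \<partial>\<nu> i) \<partial>PiM J \<mu>)"
    by (intro nn_integral_mono insert.prems(2)) auto
  also have "\<dots> = (\<integral>\<^sup>+w. \<Phi> w \<partial>PiM (insert i J) \<kappa>)"
    using insert.hyps by (subst \<kappa>.product_nn_integral_insert) (auto simp: J\<kappa> \<kappa>i)
  also have "\<dots> = (\<integral>\<^sup>+y. (\<integral>\<^sup>+x. \<Phi> (x(i := y)) \<partial>PiM J \<mu>) \<partial>\<nu> i)"
    using insert.hyps by (subst \<kappa>.product_nn_integral_insert_rev) (auto simp: J\<kappa> \<kappa>i)
  also have "\<dots> \<le> (\<integral>\<^sup>+y. (\<integral>\<^sup>+x. \<Phi> (x(i := y)) \<partial>PiM J \<nu>) \<partial>\<nu> i)"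
  proof (intro nn_integral_mono insert.IH)
    fix y assume "y \<in> space (\<nu> i)"
    then have y: "y \<in> space B" using sets_eq_imp_space_eq[OF \<nu>(2)] by auto
    have "(\<lambda>x. x(i := y)) \<in> PiM J (\<lambda>_. B) \<rightarrow>\<^sub>M PiM (insert i J) (\<lambda>_. B)"
      using y by (intro measurable_fun_upd[where J = J]) auto
    then show "(\<lambda>x. \<Phi> (x(i := y))) \<in> borel_measurable (PiM J (\<lambda>_. B))"
      using insert.prems(1) by (rule measurable_compose)
  next
    fix y :: 'b and j w assume "j \<in> J"
    then have "w(j := z, i := y) = (w(i := y))(j := z)" for z
      using insert.hyps by (auto simp: fun_eq_iff)
    then show "(\<integral>\<^sup>+z. \<Phi> (w(j := z, i := y)) \<partial>\<mu> j) \<le> (\<integral>\<^sup>+z. \<Phi> (w(j := z, i := y)) \<partial>\<nu> j)"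
      using insert.prems(2)[of j "w(i := y)"] \<open>j \<in> J\<close> by (simp del: fun_upd_apply)
  qed
  also have "\<dots> = (\<integral>\<^sup>+w. \<Phi> w \<partial>PiM (insert i J) \<nu>)"
    using insert.hyps by (subst \<nu>.product_nn_integral_insert_rev) auto
  finally show ?case .
qed

text \<open>A vector of independent pairs has the same law as a pair of independent vectors. The
  first view suits maps that mix two vectors coordinate by coordinate, the second suits conditioning
  on one of the vectors.\<close>

lemma nn_integral_PiM_pair:
  fixes \<mu> :: "'i \<Rightarrow> 'b measure" and \<nu> :: "'i \<Rightarrow> 'c measure"
  assumes "finite J" and \<mu>: "\<And>j. prob_space (\<mu> j)" and \<nu>: "\<And>j. prob_space (\<nu> j)"
    and "(\<lambda>(a, b). \<Phi> a b) \<in> borel_measurable (PiM J \<mu> \<Otimes>\<^sub>M PiM J \<nu>)"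
  shows "(\<integral>\<^sup>+w. \<Phi> (\<lambda>j\<in>J. fst (w j)) (\<lambda>j\<in>J. snd (w j)) \<partial>PiM J (\<lambda>j. \<mu> j \<Otimes>\<^sub>M \<nu> j)) =
    (\<integral>\<^sup>+a. \<integral>\<^sup>+b. \<Phi> a b \<partial>PiM J \<nu> \<partial>PiM J \<mu>)"
  using assms(1,4)
proof (induction J arbitrary: \<Phi>)
  case empty
  show ?case by (simp add: PiM_empty nn_integral_count_space_finite restrict_def)
next
  case (insert i J)
  interpret \<mu>: product_sigma_finite \<mu>
    using \<mu> by (simp add: product_sigma_finite_def prob_space_imp_sigma_finite)
  interpret \<nu>: product_sigma_finite \<nu>
    using \<nu> by (simp add: product_sigma_finite_def prob_space_imp_sigma_finite)
  have psf: "sigma_finite_measure (\<mu> j \<Otimes>\<^sub>M \<nu> j)" for j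
    using \<mu> \<nu> by (intro prob_space_imp_sigma_finite prob_space_pair) auto
  interpret p: product_sigma_finite "\<lambda>j. \<mu> j \<Otimes>\<^sub>M \<nu> j"
    using psf by (simp add: product_sigma_finite_def)

  interpret \<nu>J: sigma_finite_measure "PiM J \<nu>" using \<nu>.sigma_finite[OF insert.hyps(1)] .
  interpret sw: pair_sigma_finite "\<mu> i" "PiM J \<nu>" ..
  note [measurable] = insert.prems[unfolded split_beta']
  note h[simp] = insert.hyps
  have up[measurable]: "(\<lambda>x. (f x)(i := g x)) \<in> N \<rightarrow>\<^sub>M PiM (insert i J) M"
    if "f \<in> N \<rightarrow>\<^sub>M PiM J M" "g \<in> N \<rightarrow>\<^sub>M M i" for f g N and M :: "'i \<Rightarrow> 'd measure"
    using that by (intro measurable_fun_upd[where J = J]) auto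
  define \<Psi> where "\<Psi> a b = (\<integral>\<^sup>+u. \<integral>\<^sup>+v. \<Phi> (a(i := u)) (b(i := v)) \<partial>\<nu> i \<partial>\<mu> i)" for a b
  have m4: "(\<lambda>(((a, b), u), v). \<Phi> (a(i := u)) (b(i := v))) \<in>
      borel_measurable ((((PiM J \<mu>) \<Otimes>\<^sub>M (PiM J \<nu>)) \<Otimes>\<^sub>M \<mu> i) \<Otimes>\<^sub>M \<nu> i)"
    unfolding split_beta'
    by (rule measurable_compose[OF _ insert.prems, unfolded split_beta', where f = "\<lambda>p. ((fst (fst (fst p)))(i := snd (fst p)), (snd (fst (fst p)))(i := snd p))", simplified])
      measurable
  have m\<Psi>: "(\<lambda>(a, b). \<Psi> a b) \<in> borel_measurable (PiM J \<mu> \<Otimes>\<^sub>M PiM J \<nu>)"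
    unfolding \<Psi>_def split_beta' using m4[unfolded split_beta']
    by measurable
  have "(\<integral>\<^sup>+w. \<Phi> (\<lambda>j\<in>insert i J. fst (w j)) (\<lambda>j\<in>insert i J. snd (w j)) \<partial>PiM (insert i J) (\<lambda>j. \<mu> j \<Otimes>\<^sub>M \<nu> j))
    = (\<integral>\<^sup>+w. \<integral>\<^sup>+y. \<Phi> (\<lambda>j\<in>insert i J. fst ((w(i := y)) j)) (\<lambda>j\<in>insert i J. snd ((w(i := y)) j))
        \<partial>(\<mu> i \<Otimes>\<^sub>M \<nu> i) \<partial>PiM J (\<lambda>j. \<mu> j \<Otimes>\<^sub>M \<nu> j))"
  proof (rule p.product_nn_integral_insert)
    have a: "(\<lambda>w. (\<lambda>j\<in>insert i J. fst (w j))) \<in> PiM (insert i J) (\<lambda>j. \<mu> j \<Otimes>\<^sub>M \<nu> j) \<rightarrow>\<^sub>M PiM (insert i J) \<mu>"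
      by (intro measurable_restrict) measurable
    have b: "(\<lambda>w. (\<lambda>j\<in>insert i J. snd (w j))) \<in> PiM (insert i J) (\<lambda>j. \<mu> j \<Otimes>\<^sub>M \<nu> j) \<rightarrow>\<^sub>M PiM (insert i J) \<nu>"
      by (intro measurable_restrict) measurable
    show "(\<lambda>w. \<Phi> (\<lambda>j\<in>insert i J. fst (w j)) (\<lambda>j\<in>insert i J. snd (w j)))
        \<in> borel_measurable (PiM (insert i J) (\<lambda>j. \<mu> j \<Otimes>\<^sub>M \<nu> j))"
      using measurable_compose[OF measurable_Pair[OF a b] insert.prems] by simp
  qed auto
  also have "\<dots> = (\<integral>\<^sup>+w. \<Psi> (\<lambda>j\<in>J. fst (w j)) (\<lambda>j\<in>J. snd (w j)) \<partial>PiM J (\<lambda>j. \<mu> j \<Otimes>\<^sub>M \<nu> j))"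
  proof (rule nn_integral_cong)
    fix w assume w: "w \<in> space (PiM J (\<lambda>j. \<mu> j \<Otimes>\<^sub>M \<nu> j))"
    let ?a = "\<lambda>j\<in>J. fst (w j)" and ?b = "\<lambda>j\<in>J. snd (w j)"
    have sp: "?a \<in> space (PiM J \<mu>)" "?b \<in> space (PiM J \<nu>)"
      using w by (auto simp: space_PiM space_pair_measure PiE_iff extensional_def)
    have "(\<lambda>j\<in>insert i J. fst ((w(i := y)) j)) = ?a(i := fst y)"
      "(\<lambda>j\<in>insert i J. snd ((w(i := y)) j)) = ?b(i := snd y)" for y
      by (auto simp: fun_eq_iff)
    then have "(\<integral>\<^sup>+y. \<Phi> (\<lambda>j\<in>insert i J. fst ((w(i := y)) j)) (\<lambda>j\<in>insert i J. snd ((w(i := y)) j)) \<partial>(\<mu> i \<Otimes>\<^sub>M \<nu> i))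
      = (\<integral>\<^sup>+y. (\<lambda>(u, v). \<Phi> (?a(i := u)) (?b(i := v))) y \<partial>(\<mu> i \<Otimes>\<^sub>M \<nu> i))"
      by (simp add: split_beta')
    also have "\<dots> = \<Psi> ?a ?b"
      unfolding \<Psi>_def
    proof (subst sigma_finite_measure.nn_integral_fst[OF prob_space_imp_sigma_finite[OF \<nu>], symmetric])
      have "(\<lambda>p. (((?a, ?b), fst p), snd p)) \<in> \<mu> i \<Otimes>\<^sub>M \<nu> i \<rightarrow>\<^sub>M (((PiM J \<mu>) \<Otimes>\<^sub>M (PiM J \<nu>)) \<Otimes>\<^sub>M \<mu> i) \<Otimes>\<^sub>M \<nu> i"
        using sp by (intro measurable_Pair measurable_const) (auto simp: space_pair_measure)
      from measurable_compose[OF this m4]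
      show "(\<lambda>(u, v). \<Phi> (?a(i := u)) (?b(i := v))) \<in> borel_measurable (\<mu> i \<Otimes>\<^sub>M \<nu> i)"
        by (simp add: split_beta')
    qed simp
    finally show "(\<integral>\<^sup>+y. \<Phi> (\<lambda>j\<in>insert i J. fst ((w(i := y)) j)) (\<lambda>j\<in>insert i J. snd ((w(i := y)) j)) \<partial>(\<mu> i \<Otimes>\<^sub>M \<nu> i)) = \<Psi> ?a ?b" .
  qed
  also have "\<dots> = (\<integral>\<^sup>+a. \<integral>\<^sup>+b. \<Psi> a b \<partial>PiM J \<nu> \<partial>PiM J \<mu>)"
    by (rule insert.IH[OF m\<Psi>])
  also have "\<dots> = (\<integral>\<^sup>+a. \<integral>\<^sup>+u. \<integral>\<^sup>+b. \<integral>\<^sup>+v. \<Phi> (a(i := u)) (b(i := v)) \<partial>\<nu> i \<partial>PiM J \<nu> \<partial>\<mu> i \<partial>PiM J \<mu>)"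
  proof (rule nn_integral_cong)
    fix a assume a: "a \<in> space (PiM J \<mu>)"
    have "(\<lambda>p. (((a, snd (fst p)), fst (fst p)), snd p)) \<in> (\<mu> i \<Otimes>\<^sub>M PiM J \<nu>) \<Otimes>\<^sub>M \<nu> i \<rightarrow>\<^sub>M (((PiM J \<mu>) \<Otimes>\<^sub>M (PiM J \<nu>)) \<Otimes>\<^sub>M \<mu> i) \<Otimes>\<^sub>M \<nu> i"
      using a by (intro measurable_Pair measurable_const) auto
    from measurable_compose[OF this m4]
    have "(\<lambda>((u, b), v). \<Phi> (a(i := u)) (b(i := v))) \<in> borel_measurable ((\<mu> i \<Otimes>\<^sub>M PiM J \<nu>) \<Otimes>\<^sub>M \<nu> i)"
      by (simp add: split_beta')
    then have "(\<lambda>(u, b). \<integral>\<^sup>+v. \<Phi> (a(i := u)) (b(i := v)) \<partial>\<nu> i) \<in> borel_measurable (\<mu> i \<Otimes>\<^sub>M PiM J \<nu>)"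
      unfolding split_beta' by measurable
    from sw.Fubini'[OF this]
    show "(\<integral>\<^sup>+b. \<Psi> a b \<partial>PiM J \<nu>) = (\<integral>\<^sup>+u. \<integral>\<^sup>+b. \<integral>\<^sup>+v. \<Phi> (a(i := u)) (b(i := v)) \<partial>\<nu> i \<partial>PiM J \<nu> \<partial>\<mu> i)"
      by (simp add: \<Psi>_def)
  qed
  also have "\<dots> = (\<integral>\<^sup>+a. \<integral>\<^sup>+u. \<integral>\<^sup>+b. \<Phi> (a(i := u)) b \<partial>PiM (insert i J) \<nu> \<partial>\<mu> i \<partial>PiM J \<mu>)"
  proof (intro nn_integral_cong)
    fix a u assume "a \<in> space (PiM J \<mu>)" "u \<in> space (\<mu> i)"
    then have "a(i := u) \<in> space (PiM (insert i J) \<mu>)"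
      by (auto simp: space_PiM PiE_iff extensional_def)
    then have "(\<lambda>b. \<Phi> (a(i := u)) b) \<in> borel_measurable (PiM (insert i J) \<nu>)"
      using measurable_compose[OF measurable_Pair1' insert.prems] by simp
    then show "(\<integral>\<^sup>+b. \<integral>\<^sup>+v. \<Phi> (a(i := u)) (b(i := v)) \<partial>\<nu> i \<partial>PiM J \<nu>) = (\<integral>\<^sup>+b. \<Phi> (a(i := u)) b \<partial>PiM (insert i J) \<nu>)"
      by (subst \<nu>.product_nn_integral_insert) auto
  qed
  also have "\<dots> = (\<integral>\<^sup>+a. \<integral>\<^sup>+b. \<Phi> a b \<partial>PiM (insert i J) \<nu> \<partial>PiM (insert i J) \<mu>)"
  proof -
    interpret \<nu>I: sigma_finite_measure "PiM (insert i J) \<nu>" using \<nu>.sigma_finite[of "insert i J"] by simp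
    have "(\<lambda>a. \<integral>\<^sup>+b. \<Phi> a b \<partial>PiM (insert i J) \<nu>) \<in> borel_measurable (PiM (insert i J) \<mu>)"
      by measurable
    then show ?thesis
      by (subst \<mu>.product_nn_integral_insert) auto
  qed
  finally show ?case .
qed

section \<open>Gaussian measures: sign symmetry, rotation invariance, exponential moments\<close>

definition std_gauss :: "real measure" where
  "std_gauss = density lborel std_normal_density"

text \<open>Real and imaginary part both have variance one, so the mean of the squared modulus is 2.
  This is the origin of the terms \<open>2 * frob_sq\<close> further on.\<close>

definition cgauss :: "complex measure" where
  "cgauss = distr (std_gauss \<Otimes>\<^sub>M std_gauss) borel (\<lambda>(x, y). Complex x y)"

lemma sets_std_gauss [simp, measurable_cong]: "sets std_gauss = sets borel"
  by (simp add: std_gauss_def)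

lemma space_std_gauss [simp]: "space std_gauss = UNIV"
  by (simp add: std_gauss_def)

lemma sets_cgauss [simp, measurable_cong]: "sets cgauss = sets borel"
  by (simp add: cgauss_def)

lemma space_cgauss [simp]: "space cgauss = UNIV"
  by (simp add: cgauss_def)

lemma prob_space_std_gauss: "prob_space std_gauss"
  unfolding std_gauss_def by (rule prob_space_normal_density) simp

interpretation std_gauss: prob_space std_gauss by (rule prob_space_std_gauss)

lemma measurable_Complex [measurable (raw)]:
  assumes "f \<in> borel_measurable M" "g \<in> borel_measurable M"
  shows "(\<lambda>x. Complex (f x) (g x)) \<in> borel_measurable M"
  unfolding Complex_eq using assms by measurable

lemma prob_space_cgauss: "prob_space cgauss"
  unfolding cgauss_def
  by (intro prob_space.prob_space_distr prob_space_pair prob_space_std_gauss) measurable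

interpretation cgauss: prob_space cgauss by (rule prob_space_cgauss)

lemma nn_integral_cgauss:
  assumes "f \<in> borel_measurable borel"
  shows "(\<integral>\<^sup>+z. f z \<partial>cgauss) = (\<integral>\<^sup>+x. \<integral>\<^sup>+y. f (Complex x y) \<partial>std_gauss \<partial>std_gauss)"
proof -
  have "(\<integral>\<^sup>+z. f z \<partial>cgauss) = (\<integral>\<^sup>+p. f (case p of (x, y) \<Rightarrow> Complex x y) \<partial>(std_gauss \<Otimes>\<^sub>M std_gauss))"
    unfolding cgauss_def using assms by (subst nn_integral_distr) auto
  also have "\<dots> = (\<integral>\<^sup>+x. \<integral>\<^sup>+y. f (Complex x y) \<partial>std_gauss \<partial>std_gauss)"
  proof -
    have "(\<lambda>p. f (case p of (x, y) \<Rightarrow> Complex x y)) \<in> borel_measurable (std_gauss \<Otimes>\<^sub>M std_gauss)"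
      using assms by measurable
    from std_gauss.nn_integral_fst[OF this] show ?thesis by simp
  qed
  finally show ?thesis .
qed

lemma std_gauss_mgf: "(\<integral>\<^sup>+x. ennreal (exp (t * x)) \<partial>std_gauss) = ennreal (exp (t\<^sup>2 / 2))"
proof -
  have e: "std_normal_density x * exp (t * x) = exp (t\<^sup>2 / 2) * normal_density t 1 x" for x
    by (simp add: normal_density_def exp_add[symmetric] field_simps power2_eq_square flip: exp_add)
  have "(\<integral>\<^sup>+x. ennreal (exp (t * x)) \<partial>std_gauss) = (\<integral>\<^sup>+x. ennreal (exp (t\<^sup>2 / 2)) * ennreal (normal_density t 1 x) \<partial>lborel)"
    unfolding std_gauss_def by (subst nn_integral_density) (auto simp: e ennreal_mult'[symmetric])
  also have "\<dots> = ennreal (exp (t\<^sup>2 / 2)) * (\<integral>\<^sup>+x. ennreal (normal_density t 1 x) \<partial>lborel)"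
    by (intro nn_integral_cmult) auto
  also have "(\<integral>\<^sup>+x. ennreal (normal_density t 1 x) \<partial>lborel) = 1"
    by (subst nn_integral_eq_integral) auto
  finally show ?thesis by simp
qed

lemma std_gauss_uminus:
  assumes [measurable]: "f \<in> borel_measurable borel"
  shows "(\<integral>\<^sup>+x. f (- x) \<partial>std_gauss) = (\<integral>\<^sup>+x. f x \<partial>std_gauss)"
  unfolding std_gauss_def
  by (simp add: nn_integral_density nn_integral_real_affine[where c = "-1" and t = 0 and f = "\<lambda>x. ennreal (std_normal_density x) * f x"])
    (simp add: std_normal_density_def)

text \<open>The joint density \<open>g\<close> depends on x^2 + y^2 only. Two one-dimensional
  substitutions suffice: u = (x + y) / sqrt 2 with y fixed, then v = u - sqrt 2 y with u fixed.
  Their Jacobian factors sqrt 2 and 1 / sqrt 2 cancel.\<close>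

lemma std_gauss_rotate:
  assumes [measurable]: "(\<lambda>(x, y). f x y) \<in> borel_measurable (borel \<Otimes>\<^sub>M borel)"
  shows "(\<integral>\<^sup>+x. \<integral>\<^sup>+y. f ((x + y) / sqrt 2) ((x - y) / sqrt 2) \<partial>std_gauss \<partial>std_gauss) =
    (\<integral>\<^sup>+x. \<integral>\<^sup>+y. f x y \<partial>std_gauss \<partial>std_gauss)"
proof -
  define g where "g r = ennreal (exp (- r / 2) / (2 * pi))" for r :: real
  have [measurable]: "g \<in> borel_measurable borel" by (simp add: g_def[abs_def])
  have [measurable]: "(\<lambda>x. f (a x) (b x)) \<in> borel_measurable N"
    if "a \<in> borel_measurable N" "b \<in> borel_measurable N" for a b and N :: "'z measure"
    using measurable_compose[OF measurable_Pair[OF that] assms] by simp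
  have dens: "ennreal (std_normal_density x) * (ennreal (std_normal_density y) * c) = g (x\<^sup>2 + y\<^sup>2) * c" for x y c
  proof -
    have "std_normal_density x * std_normal_density y = exp (- (x\<^sup>2 + y\<^sup>2) / 2) / (2 * pi)"
      by (simp add: std_normal_density_def exp_add[symmetric] add_divide_distrib diff_divide_distrib)
    then show ?thesis
      unfolding g_def mult.assoc[symmetric] by (simp add: ennreal_mult'[symmetric])
  qed
  have swap: "(\<integral>\<^sup>+x. \<integral>\<^sup>+y. h x y \<partial>lborel \<partial>lborel) = (\<integral>\<^sup>+y. \<integral>\<^sup>+x. h x y \<partial>lborel \<partial>lborel)"
    if "(\<lambda>(x, y). h x y) \<in> borel_measurable (borel \<Otimes>\<^sub>M borel)" for h :: "real \<Rightarrow> real \<Rightarrow> ennreal"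
    using that by (intro lborel_pair.Fubini') (simp add: measurable_lborel1 cong: measurable_cong_sets)
  have L: "(\<integral>\<^sup>+x. \<integral>\<^sup>+y. h x y \<partial>std_gauss \<partial>std_gauss) = (\<integral>\<^sup>+x. \<integral>\<^sup>+y. g (x\<^sup>2 + y\<^sup>2) * h x y \<partial>lborel \<partial>lborel)"
    if [measurable]: "(\<lambda>(x, y). h x y) \<in> borel_measurable (borel \<Otimes>\<^sub>M borel)" for h
  proof -
    have [measurable]: "(\<lambda>y. h x y) \<in> borel_measurable borel" for x
      using measurable_compose[OF measurable_Pair[OF measurable_const[of x] measurable_ident] that] by simp
    have "(\<lambda>(x, y). ennreal (std_normal_density y) * h x y) \<in> borel_measurable (borel \<Otimes>\<^sub>M lborel)"
      using that by (simp add: split_beta' cong: measurable_cong_sets)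
    then have [measurable]: "(\<lambda>x. \<integral>\<^sup>+y. ennreal (std_normal_density y) * h x y \<partial>lborel) \<in> borel_measurable borel"
      by measurable
    show ?thesis
      unfolding std_gauss_def
      by (simp add: nn_integral_density nn_integral_cmult[symmetric] dens)
  qed
  have "(\<integral>\<^sup>+x. \<integral>\<^sup>+y. f ((x + y) / sqrt 2) ((x - y) / sqrt 2) \<partial>std_gauss \<partial>std_gauss)
      = (\<integral>\<^sup>+x. \<integral>\<^sup>+y. g (x\<^sup>2 + y\<^sup>2) * f ((x + y) / sqrt 2) ((x - y) / sqrt 2) \<partial>lborel \<partial>lborel)"
    by (subst L) (auto simp: split_beta')
  also have "\<dots> = (\<integral>\<^sup>+y. \<integral>\<^sup>+x. g (x\<^sup>2 + y\<^sup>2) * f ((x + y) / sqrt 2) ((x - y) / sqrt 2) \<partial>lborel \<partial>lborel)"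
    by (rule swap) (simp add: split_beta')
  also have "\<dots> = (\<integral>\<^sup>+y. sqrt 2 * (\<integral>\<^sup>+u. g ((sqrt 2 * u - y)\<^sup>2 + y\<^sup>2) * f u (u - sqrt 2 * y) \<partial>lborel) \<partial>lborel)"
  proof (rule nn_integral_cong)
    fix y :: real
    have e: "(sqrt 2 * u - y + y) / sqrt 2 = u" "(sqrt 2 * u - y - y) / sqrt 2 = u - sqrt 2 * y"
      "- y + sqrt 2 * u = sqrt 2 * u - y" for u
      by (simp_all add: field_simps)
    show "(\<integral>\<^sup>+x. g (x\<^sup>2 + y\<^sup>2) * f ((x + y) / sqrt 2) ((x - y) / sqrt 2) \<partial>lborel) =
      sqrt 2 * (\<integral>\<^sup>+u. g ((sqrt 2 * u - y)\<^sup>2 + y\<^sup>2) * f u (u - sqrt 2 * y) \<partial>lborel)"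
      by (subst nn_integral_real_affine[where c = "sqrt 2" and t = "- y"]) (simp_all only: e, auto)
  qed
  also have "\<dots> = (\<integral>\<^sup>+y. (\<integral>\<^sup>+u. sqrt 2 * (g ((sqrt 2 * u - y)\<^sup>2 + y\<^sup>2) * f u (u - sqrt 2 * y)) \<partial>lborel) \<partial>lborel)"
    by (subst nn_integral_cmult) auto
  also have "\<dots> = (\<integral>\<^sup>+u. (\<integral>\<^sup>+y. sqrt 2 * (g ((sqrt 2 * u - y)\<^sup>2 + y\<^sup>2) * f u (u - sqrt 2 * y)) \<partial>lborel) \<partial>lborel)"
    by (rule swap) (simp add: split_beta')
  also have "\<dots> = (\<integral>\<^sup>+u. (\<integral>\<^sup>+v. g (u\<^sup>2 + v\<^sup>2) * f u v \<partial>lborel) \<partial>lborel)"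
  proof (rule nn_integral_cong)
    fix u
    have eq: "(sqrt 2 * u - (u / sqrt 2 + (- 1 / sqrt 2) * v))\<^sup>2 + (u / sqrt 2 + (- 1 / sqrt 2) * v)\<^sup>2 = u\<^sup>2 + v\<^sup>2" for v
    proof -
      have "sqrt 2 * u = 2 * u / sqrt 2" by (simp add: field_simps)
      then have "sqrt 2 * u - (u / sqrt 2 + (- 1 / sqrt 2) * v) = (u + v) / sqrt 2"
        by (simp add: field_simps)
      moreover have "u / sqrt 2 + (- 1 / sqrt 2) * v = (u - v) / sqrt 2" by (simp add: field_simps)
      ultimately show ?thesis by (simp only: power_divide) (simp add: power2_eq_square field_simps)
    qed
    have eq2: "u - sqrt 2 * (u / sqrt 2 + (- 1 / sqrt 2) * v) = v" for v
      by (simp add: field_simps)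
    have "(\<integral>\<^sup>+y. sqrt 2 * (g ((sqrt 2 * u - y)\<^sup>2 + y\<^sup>2) * f u (u - sqrt 2 * y)) \<partial>lborel) =
      ennreal \<bar>- 1 / sqrt 2\<bar> * (\<integral>\<^sup>+v. sqrt 2 * (g (u\<^sup>2 + v\<^sup>2) * f u v) \<partial>lborel)"
      by (subst nn_integral_real_affine[where c = "- 1 / sqrt 2" and t = "u / sqrt 2"])
        (simp_all only: eq eq2, auto)
    also have "\<dots> = ennreal \<bar>- 1 / sqrt 2\<bar> * (ennreal (sqrt 2) * (\<integral>\<^sup>+v. (g (u\<^sup>2 + v\<^sup>2) * f u v) \<partial>lborel))"
      by (subst nn_integral_cmult) auto
    also have "\<dots> = (\<integral>\<^sup>+v. g (u\<^sup>2 + v\<^sup>2) * f u v \<partial>lborel)"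
      by (simp add: mult.assoc[symmetric] ennreal_mult'[symmetric])
    finally show "(\<integral>\<^sup>+y. sqrt 2 * (g ((sqrt 2 * u - y)\<^sup>2 + y\<^sup>2) * f u (u - sqrt 2 * y)) \<partial>lborel) = (\<integral>\<^sup>+v. g (u\<^sup>2 + v\<^sup>2) * f u v \<partial>lborel)" .
  qed
  also have "\<dots> = (\<integral>\<^sup>+x. \<integral>\<^sup>+y. f x y \<partial>std_gauss \<partial>std_gauss)"
    by (subst L) (use assms in auto)
  finally show ?thesis .
qed

text \<open>Real and imaginary parts are rotated separately; the four real integrals are first
  reordered so that the two variables that get mixed are adjacent.\<close>

lemma cgauss_rotate:
  assumes m: "(\<lambda>(x, y). f x y) \<in> borel_measurable (borel \<Otimes>\<^sub>M borel)"
  shows "(\<integral>\<^sup>+z. \<integral>\<^sup>+w. f ((z + w) / of_real (sqrt 2)) ((z - w) / of_real (sqrt 2)) \<partial>cgauss \<partial>cgauss) =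
    (\<integral>\<^sup>+z. \<integral>\<^sup>+w. f z w \<partial>cgauss \<partial>cgauss)"
proof -
  have [measurable]: "(\<lambda>x. f (a x) (b x)) \<in> borel_measurable N"
    if "a \<in> borel_measurable N" "b \<in> borel_measurable N" for a b and N :: "'z measure"
    using measurable_compose[OF measurable_Pair[OF that] m] by simp
  interpret S: pair_sigma_finite std_gauss std_gauss ..
  have [measurable]: "(\<lambda>x. \<integral>\<^sup>+w. g (a x) w \<partial>cgauss) \<in> borel_measurable N"
    if "(\<lambda>(x, y). g x y) \<in> borel_measurable (borel \<Otimes>\<^sub>M borel)" "a \<in> borel_measurable N"
    for g :: "complex \<Rightarrow> complex \<Rightarrow> ennreal" and a and N :: "'z measure"
  proof -
    have "(\<lambda>x. \<integral>\<^sup>+w. g x w \<partial>cgauss) \<in> borel_measurable borel"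
      using that(1) by (intro cgauss.borel_measurable_nn_integral) (simp cong: measurable_cong_sets)
    from measurable_compose[OF that(2) this] show ?thesis .
  qed
  have four: "(\<integral>\<^sup>+z. \<integral>\<^sup>+w. g z w \<partial>cgauss \<partial>cgauss) =
      (\<integral>\<^sup>+x. \<integral>\<^sup>+x'. \<integral>\<^sup>+y. \<integral>\<^sup>+y'. g (Complex x y) (Complex x' y') \<partial>std_gauss \<partial>std_gauss \<partial>std_gauss \<partial>std_gauss)"
    if g: "(\<lambda>(x, y). g x y) \<in> borel_measurable (borel \<Otimes>\<^sub>M borel)" for g :: "complex \<Rightarrow> complex \<Rightarrow> ennreal"
  proof -
    have [measurable]: "(\<lambda>x. g (a x) (b x)) \<in> borel_measurable N"
      if "a \<in> borel_measurable N" "b \<in> borel_measurable N" for a b and N :: "'z measure"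
      using measurable_compose[OF measurable_Pair[OF that] g] by simp
    have "(\<integral>\<^sup>+z. \<integral>\<^sup>+w. g z w \<partial>cgauss \<partial>cgauss) =
      (\<integral>\<^sup>+x. \<integral>\<^sup>+y. \<integral>\<^sup>+x'. \<integral>\<^sup>+y'. g (Complex x y) (Complex x' y') \<partial>std_gauss \<partial>std_gauss \<partial>std_gauss \<partial>std_gauss)"
      using g by (simp add: nn_integral_cgauss)
    also have "\<dots> = (\<integral>\<^sup>+x. \<integral>\<^sup>+x'. \<integral>\<^sup>+y. \<integral>\<^sup>+y'. g (Complex x y) (Complex x' y') \<partial>std_gauss \<partial>std_gauss \<partial>std_gauss \<partial>std_gauss)"
      by (intro nn_integral_cong S.Fubini') measurable
    finally show ?thesis .
  qed
  let ?r = "\<lambda>x y. (x + y) / sqrt 2" and ?s = "\<lambda>x y. (x - y) / sqrt 2"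
  have c: "(Complex x y + Complex x' y') / of_real (sqrt 2) = Complex (?r x x') (?r y y')"
    "(Complex x y - Complex x' y') / of_real (sqrt 2) = Complex (?s x x') (?s y y')" for x y x' y'
    by (simp_all add: complex_eq_iff)
  have "(\<integral>\<^sup>+z. \<integral>\<^sup>+w. f ((z + w) / of_real (sqrt 2)) ((z - w) / of_real (sqrt 2)) \<partial>cgauss \<partial>cgauss) =
    (\<integral>\<^sup>+x. \<integral>\<^sup>+x'. \<integral>\<^sup>+y. \<integral>\<^sup>+y'. f (Complex (?r x x') (?r y y')) (Complex (?s x x') (?s y y'))
       \<partial>std_gauss \<partial>std_gauss \<partial>std_gauss \<partial>std_gauss)"
    by (subst four) (simp_all only: c, simp add: split_beta')
  also have "\<dots> = (\<integral>\<^sup>+x. \<integral>\<^sup>+x'. \<integral>\<^sup>+y. \<integral>\<^sup>+y'. f (Complex (?r x x') y) (Complex (?s x x') y')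
       \<partial>std_gauss \<partial>std_gauss \<partial>std_gauss \<partial>std_gauss)"
    by (intro nn_integral_cong std_gauss_rotate) (simp add: split_beta')
  also have "\<dots> = (\<integral>\<^sup>+x. \<integral>\<^sup>+x'. \<integral>\<^sup>+y. \<integral>\<^sup>+y'. f (Complex x y) (Complex x' y')
       \<partial>std_gauss \<partial>std_gauss \<partial>std_gauss \<partial>std_gauss)"
    by (rule std_gauss_rotate[where f = "\<lambda>x x'. \<integral>\<^sup>+y. \<integral>\<^sup>+y'. f (Complex x y) (Complex x' y') \<partial>std_gauss \<partial>std_gauss"])
      (simp add: split_beta')
  also have "\<dots> = (\<integral>\<^sup>+z. \<integral>\<^sup>+w. f z w \<partial>cgauss \<partial>cgauss)"
    by (rule four[OF m, symmetric])
  finally show ?thesis .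
qed

lemma cgauss_uminus:
  assumes [measurable]: "f \<in> borel_measurable borel"
  shows "(\<integral>\<^sup>+z. f (- z) \<partial>cgauss) = (\<integral>\<^sup>+z. f z \<partial>cgauss)"
proof -
  have "(\<integral>\<^sup>+z. f (- z) \<partial>cgauss) = (\<integral>\<^sup>+x. \<integral>\<^sup>+y. f (Complex (- x) (- y)) \<partial>std_gauss \<partial>std_gauss)"
    by (subst nn_integral_cgauss) (auto intro!: nn_integral_cong arg_cong[of _ _ f] simp: complex_eq_iff)
  also have "\<dots> = (\<integral>\<^sup>+x. \<integral>\<^sup>+y. f (Complex (- x) y) \<partial>std_gauss \<partial>std_gauss)"
    by (intro nn_integral_cong std_gauss_uminus) simp
  also have "\<dots> = (\<integral>\<^sup>+x. \<integral>\<^sup>+y. f (Complex x y) \<partial>std_gauss \<partial>std_gauss)"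
    by (rule std_gauss_uminus[where f = "\<lambda>x. \<integral>\<^sup>+y. f (Complex x y) \<partial>std_gauss"]) simp
  finally show ?thesis by (simp add: nn_integral_cgauss)
qed

lemma cgauss_mgf: "(\<integral>\<^sup>+z. ennreal (exp (Re (z * cnj w))) \<partial>cgauss) = ennreal (exp ((cmod w)\<^sup>2 / 2))"
proof -
  have "(\<integral>\<^sup>+z. ennreal (exp (Re (z * cnj w))) \<partial>cgauss) =
    (\<integral>\<^sup>+x. \<integral>\<^sup>+y. ennreal (exp (Re w * x)) * ennreal (exp (Im w * y)) \<partial>std_gauss \<partial>std_gauss)"
    by (subst nn_integral_cgauss) (auto simp: exp_add ennreal_mult' mult_ac)
  also have "\<dots> = (\<integral>\<^sup>+x. ennreal (exp (Re w * x)) * ennreal (exp ((Im w)\<^sup>2 / 2)) \<partial>std_gauss)"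
    by (simp add: nn_integral_cmult std_gauss_mgf)
  also have "\<dots> = ennreal (exp ((Re w)\<^sup>2 / 2)) * ennreal (exp ((Im w)\<^sup>2 / 2))"
    by (simp add: nn_integral_multc std_gauss_mgf)
  also have "\<dots> = ennreal (exp ((cmod w)\<^sup>2 / 2))"
    by (simp add: ennreal_mult'[symmetric] exp_add[symmetric] cmod_power2 add_divide_distrib)
  finally show ?thesis .
qed

section \<open>Even moments from exponential moments\<close>

lemma power_div_fact_le_exp:
  fixes x :: real
  assumes "x \<ge> 0"
  shows "x ^ n / fact n \<le> exp x"
proof -
  have "x ^ n /\<^sub>R fact n \<le> (\<Sum>k. x ^ k /\<^sub>R fact k)"
    using assms sum_le_suminf[OF summable_exp_generic[of x], of "{n}"]
    by (auto intro!: mult_nonneg_nonneg)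
  then show ?thesis by (simp add: exp_def divide_inverse mult.commute)
qed

text \<open>The factor 2 gained here pays for adding the exponential moments at \<open>t\<close> and
  at \<open>-t\<close> in \<open>even_power_le_exp_moment\<close>, so the final moment bounds carry
  no leading constant.\<close>

lemma fact_le_power_half: "n \<ge> 2 \<Longrightarrow> 2 * fact n \<le> (real n) ^ n"
proof (induction n rule: dec_induct)
  case (step n)
  have "2 * fact (Suc n) = real (Suc n) * (2 * fact n)" by simp
  also have "\<dots> \<le> real (Suc n) * real n ^ n" using step by (intro mult_left_mono) auto
  also have "\<dots> \<le> real (Suc n) * real (Suc n) ^ n" by (intro mult_left_mono power_mono) auto
  finally show ?case by simp
qed (simp add: power2_eq_square)

lemma even_power_le_exp_moment:
  fixes x :: real
  assumes "q \<ge> 1"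
  shows "x ^ (2 * q) \<le> real (2 * q) ^ (2 * q) / 2 * (exp x + exp (- x))"
proof -
  have "x ^ (2 * q) = \<bar>x\<bar> ^ (2 * q)" by (simp add: power_even_abs)
  also have "\<dots> \<le> fact (2 * q) * exp \<bar>x\<bar>"
    using power_div_fact_le_exp[of "\<bar>x\<bar>" "2 * q"] by (simp add: field_simps)
  also have "\<dots> \<le> real (2 * q) ^ (2 * q) / 2 * exp \<bar>x\<bar>"
    using fact_le_power_half[of "2 * q"] assms by (intro mult_right_mono) auto
  also have "\<dots> \<le> real (2 * q) ^ (2 * q) / 2 * (exp x + exp (- x))"
    by (intro mult_left_mono) (auto simp: abs_if)
  finally show ?thesis .
qed

lemma prob_space_PiM_cgauss: "prob_space (PiM J (\<lambda>_. cgauss))"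
  by (intro prob_space_PiM prob_space_cgauss)

lemma PiM_cgauss_mgf:
  assumes "finite J"
  shows "(\<integral>\<^sup>+a. ennreal (exp (\<Sum>j\<in>J. Re (a j * cnj (w j)))) \<partial>PiM J (\<lambda>_. cgauss)) =
    ennreal (exp ((\<Sum>j\<in>J. (cmod (w j))\<^sup>2) / 2))"
proof -
  interpret product_sigma_finite "\<lambda>_. cgauss"
    by (simp add: product_sigma_finite_def cgauss.sigma_finite_measure_axioms)
  have "(\<integral>\<^sup>+a. ennreal (exp (\<Sum>j\<in>J. Re (a j * cnj (w j)))) \<partial>PiM J (\<lambda>_. cgauss)) =
      (\<integral>\<^sup>+a. (\<Prod>j\<in>J. ennreal (exp (Re (a j * cnj (w j))))) \<partial>PiM J (\<lambda>_. cgauss))"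
    using assms by (simp add: exp_sum prod_ennreal)
  also have "\<dots> = (\<Prod>j\<in>J. ennreal (exp ((cmod (w j))\<^sup>2 / 2)))"
    using assms by (subst product_nn_integral_prod) (auto simp: cgauss_mgf simp del: times_complex.sel)
  finally show ?thesis
    using assms by (simp add: exp_sum prod_ennreal sum_divide_distrib)
qed

text \<open>The scale \<open>t = sqrt (2 q) / \<sigma>\<close> is optimal when the moment is estimated by the
  moment generating function at \<open>t\<close> and \<open>-t\<close>.\<close>

lemma PiM_cgauss_moment:
  assumes J: "finite J" and q: "q \<ge> 1"
  shows "(\<integral>\<^sup>+a. ennreal ((\<Sum>j\<in>J. Re (a j * cnj (w j))) ^ (2 * q)) \<partial>PiM J (\<lambda>_. cgauss)) \<le>
    ennreal ((2 * exp 1 * q * (\<Sum>j\<in>J. (cmod (w j))\<^sup>2)) ^ q)"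
proof -
  let ?P = "PiM J (\<lambda>_. cgauss)"
  define \<sigma> where "\<sigma> = sqrt (\<Sum>j\<in>J. (cmod (w j))\<^sup>2)"
  define X where "X a = (\<Sum>j\<in>J. Re (a j * cnj (w j)))" for a
  have [measurable]: "X \<in> borel_measurable ?P" by (simp add: X_def[abs_def])
  have \<sigma>2: "(\<Sum>j\<in>J. (cmod (w j))\<^sup>2) = \<sigma>\<^sup>2" by (simp add: \<sigma>_def sum_nonneg)
  show ?thesis
  proof (cases "\<sigma> = 0")
    case True
    then have "w j = 0" if "j \<in> J" for j
      using \<sigma>2 J that by (simp add: sum_nonneg_eq_0_iff)
    then show ?thesis using q by (simp add: True \<sigma>2 power_0_left)
  next
    case False
    moreover have "\<sigma> \<ge> 0" by (simp add: \<sigma>_def sum_nonneg)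
    ultimately have \<sigma>: "\<sigma> > 0" by simp
    define t where "t = sqrt (2 * q) / \<sigma>"
    have t: "t > 0" using \<sigma> q by (simp add: t_def)
    define C where "C = real (2 * q) ^ (2 * q) / 2 / t ^ (2 * q)"
    have C: "C \<ge> 0" using t by (simp add: C_def)
    have mg: "(\<integral>\<^sup>+a. ennreal (exp (c * X a)) \<partial>?P) = ennreal (exp (c\<^sup>2 * \<sigma>\<^sup>2 / 2))" for c
    proof -
      have "(\<Sum>j\<in>J. Re (a j * cnj (of_real c * w j))) = c * X a" for a
        unfolding X_def sum_distrib_left by (intro sum.cong) (auto simp: algebra_simps)
      moreover have "(\<Sum>j\<in>J. (cmod (of_real c * w j))\<^sup>2) = c\<^sup>2 * \<sigma>\<^sup>2"
        by (simp add: norm_mult power_mult_distrib sum_distrib_left flip: \<sigma>2)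
      ultimately show ?thesis
        using PiM_cgauss_mgf[OF J, of "\<lambda>j. of_real c * w j"] by simp
    qed
    have "X a ^ (2 * q) \<le> C * (exp (t * X a) + exp (- t * X a))" for a
      using even_power_le_exp_moment[OF q, of "t * X a"] t
      by (simp add: C_def power_mult_distrib field_simps)
    then have "(\<integral>\<^sup>+a. ennreal (X a ^ (2 * q)) \<partial>?P) \<le> (\<integral>\<^sup>+a. ennreal C * (ennreal (exp (t * X a)) + ennreal (exp (- t * X a))) \<partial>?P)"
      using C by (intro nn_integral_mono) (simp add: ennreal_mult'[symmetric] ennreal_plus[symmetric] ennreal_leI del: ennreal_plus)
    also have "\<dots> = ennreal C * (ennreal (exp (t\<^sup>2 * \<sigma>\<^sup>2 / 2)) + ennreal (exp (t\<^sup>2 * \<sigma>\<^sup>2 / 2)))"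
      by (subst nn_integral_cmult) (auto simp: nn_integral_add mg mg[of "- t", simplified])
    also have "\<dots> = ennreal (C * (2 * exp (t\<^sup>2 * \<sigma>\<^sup>2 / 2)))"
      using C by (simp add: ennreal_mult'[symmetric] ennreal_plus[symmetric] del: ennreal_plus)
    also have "C * (2 * exp (t\<^sup>2 * \<sigma>\<^sup>2 / 2)) = (2 * exp 1 * q * \<sigma>\<^sup>2) ^ q"
    proof -
      have "t\<^sup>2 * \<sigma>\<^sup>2 = 2 * q" using \<sigma> by (simp add: t_def power_divide)
      moreover have "t ^ (2 * q) = (2 * q / \<sigma>\<^sup>2) ^ q"
        by (simp add: t_def power_mult power_divide)
      moreover have "exp (real q) = exp 1 ^ q" by (simp add: exp_of_nat_mult[symmetric])
      ultimately have "C * (2 * exp (t\<^sup>2 * \<sigma>\<^sup>2 / 2)) = ((real (2 * q))\<^sup>2) ^ q / (2 * q / \<sigma>\<^sup>2) ^ q * exp 1 ^ q"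
        by (simp add: C_def power_mult)
      also have "\<dots> = ((real (2 * q))\<^sup>2 / (2 * q / \<sigma>\<^sup>2) * exp 1) ^ q"
        by (simp only: power_divide power_mult_distrib)
      also have "(real (2 * q))\<^sup>2 / (2 * q / \<sigma>\<^sup>2) * exp 1 = 2 * exp 1 * q * \<sigma>\<^sup>2"
        using q by (simp add: power2_eq_square)
      finally show ?thesis .
    qed
    finally show ?thesis by (simp add: X_def \<sigma>2)
  qed
qed

section \<open>Convex functions of a single coordinate\<close>

lemma convex_on_abs_power: "convex_on UNIV (\<lambda>x :: real. \<bar>x\<bar> ^ p)"
proof (rule convex_onI)
  fix t x y :: real assume t: "0 < t" "t < 1"
  have *: "convex_on {0..} (\<lambda>x :: real. x ^ p)"
    by (cases "even p") (auto intro: convex_power_odd convex_on_subset[OF convex_power_even])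
  have "\<bar>(1 - t) *\<^sub>R x + t *\<^sub>R y\<bar> \<le> (1 - t) *\<^sub>R \<bar>x\<bar> + t *\<^sub>R \<bar>y\<bar>"
    using t abs_triangle_ineq[of "(1 - t) *\<^sub>R x" "t *\<^sub>R y"] by (simp add: abs_mult)
  then have "\<bar>(1 - t) *\<^sub>R x + t *\<^sub>R y\<bar> ^ p \<le> ((1 - t) *\<^sub>R \<bar>x\<bar> + t *\<^sub>R \<bar>y\<bar>) ^ p"
    by (intro power_mono) auto
  also have "\<dots> \<le> (1 - t) * \<bar>x\<bar> ^ p + t * \<bar>y\<bar> ^ p"
    using t by (intro convex_onD[OF *]) auto
  finally show "\<bar>(1 - t) *\<^sub>R x + t *\<^sub>R y\<bar> ^ p \<le> (1 - t) * \<bar>x\<bar> ^ p + t * \<bar>y\<bar> ^ p" .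
qed simp

text \<open>Jensen's inequality with a nonnegative integral on the right: if that integral is
  infinite there is nothing to show, so finiteness of the moment is not assumed.\<close>

lemma (in prob_space) abs_expectation_power_le:
  fixes f :: "'a \<Rightarrow> real"
  assumes f: "integrable M f"
  shows "ennreal (\<bar>expectation f\<bar> ^ p) \<le> (\<integral>\<^sup>+x. ennreal (\<bar>f x\<bar> ^ p) \<partial>M)"
proof (cases "(\<integral>\<^sup>+x. ennreal (\<bar>f x\<bar> ^ p) \<partial>M) = \<infinity>")
  case False
  have [measurable]: "f \<in> borel_measurable M" using f by simp
  have "integrable M (\<lambda>x. \<bar>f x\<bar> ^ p)"
    using False by (intro integrableI_bounded) (auto simp: less_top)
  then have "\<bar>expectation f\<bar> ^ p \<le> expectation (\<lambda>x. \<bar>f x\<bar> ^ p)" and "(\<integral>\<^sup>+x. ennreal (\<bar>f x\<bar> ^ p) \<partial>M) = ennreal (expectation (\<lambda>x. \<bar>f x\<bar> ^ p))"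
    by (auto intro!: jensens_inequality[OF f _ _ _ convex_on_abs_power] nn_integral_eq_integral)
  then show ?thesis by (simp add: ennreal_leI)
qed simp

text \<open>The form that the supremum takes when all coordinates but one are frozen: the p-th power
  of the modulus of an affine function, maximized over the index set. The argument lives in a
  Euclidean space so that complex entries and real squared moduli are both covered.\<close>

definition sup_affine :: "nat \<Rightarrow> 'x set \<Rightarrow> ('x \<Rightarrow> real) \<Rightarrow> ('x \<Rightarrow> 'v :: euclidean_space) \<Rightarrow> 'v \<Rightarrow> ennreal" where
  "sup_affine p F \<alpha> \<beta> y = (SUP x\<in>F. ennreal (\<bar>\<alpha> x + inner (\<beta> x) y\<bar> ^ p))"

lemma sup_affine_measurable [measurable]:
  assumes "finite F"
  shows "sup_affine p F \<alpha> \<beta> \<in> borel_measurable borel"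
  unfolding sup_affine_def[abs_def] using countable_finite[OF assms]
  by (intro borel_measurable_SUP) auto

lemma (in prob_space) sup_affine_expectation_le:
  assumes X: "integrable M X"
  shows "sup_affine p F \<alpha> \<beta> (expectation X) \<le> (\<integral>\<^sup>+w. sup_affine p F \<alpha> \<beta> (X w) \<partial>M)"
  unfolding sup_affine_def
proof (rule SUP_least)
  fix x assume x: "x \<in> F"
  have "\<alpha> x + inner (\<beta> x) (expectation X) = expectation (\<lambda>w. \<alpha> x + inner (\<beta> x) (X w))"
    using X by (simp add: prob_space)
  then have "ennreal (\<bar>\<alpha> x + inner (\<beta> x) (expectation X)\<bar> ^ p) \<le> (\<integral>\<^sup>+w. ennreal (\<bar>\<alpha> x + inner (\<beta> x) (X w)\<bar> ^ p) \<partial>M)"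
    using abs_expectation_power_le[of "\<lambda>w. \<alpha> x + inner (\<beta> x) (X w)" p] X
    by (simp del: Bochner_Integration.integral_add)
  also have "\<dots> \<le> (\<integral>\<^sup>+w. (SUP x\<in>F. ennreal (\<bar>\<alpha> x + inner (\<beta> x) (X w)\<bar> ^ p)) \<partial>M)"
    using x by (intro nn_integral_mono SUP_upper)
  finally show "ennreal (\<bar>\<alpha> x + inner (\<beta> x) (expectation X)\<bar> ^ p) \<le> \<dots>" .
qed

lemma sup_affine_convex:
  assumes "0 \<le> t" "t \<le> 1"
  shows "sup_affine p F \<alpha> \<beta> ((1 - t) *\<^sub>R y + t *\<^sub>R z) \<le>
    ennreal (1 - t) * sup_affine p F \<alpha> \<beta> y + ennreal t * sup_affine p F \<alpha> \<beta> z"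
  unfolding sup_affine_def
proof (rule SUP_least)
  fix x assume x: "x \<in> F"
  have "\<alpha> x + inner (\<beta> x) ((1 - t) *\<^sub>R y + t *\<^sub>R z) = (1 - t) *\<^sub>R (\<alpha> x + inner (\<beta> x) y) + t *\<^sub>R (\<alpha> x + inner (\<beta> x) z)"
    by (simp add: inner_add_right algebra_simps)
  then have "\<bar>\<alpha> x + inner (\<beta> x) ((1 - t) *\<^sub>R y + t *\<^sub>R z)\<bar> ^ p \<le>
      (1 - t) * \<bar>\<alpha> x + inner (\<beta> x) y\<bar> ^ p + t * \<bar>\<alpha> x + inner (\<beta> x) z\<bar> ^ p"
    using convex_onD[OF convex_on_abs_power, of t] assms by simp
  then have "ennreal (\<bar>\<alpha> x + inner (\<beta> x) ((1 - t) *\<^sub>R y + t *\<^sub>R z)\<bar> ^ p) \<le>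
      ennreal (1 - t) * ennreal (\<bar>\<alpha> x + inner (\<beta> x) y\<bar> ^ p) + ennreal t * ennreal (\<bar>\<alpha> x + inner (\<beta> x) z\<bar> ^ p)"
    using assms by (simp add: ennreal_mult'[symmetric] ennreal_plus[symmetric] ennreal_leI del: ennreal_plus)
  also have "\<dots> \<le> ennreal (1 - t) * (SUP x\<in>F. ennreal (\<bar>\<alpha> x + inner (\<beta> x) y\<bar> ^ p)) +
      ennreal t * (SUP x\<in>F. ennreal (\<bar>\<alpha> x + inner (\<beta> x) z\<bar> ^ p))"
    using x by (intro add_mono mult_left_mono SUP_upper) auto
  finally show "ennreal (\<bar>\<alpha> x + inner (\<beta> x) ((1 - t) *\<^sub>R y + t *\<^sub>R z)\<bar> ^ p) \<le> \<dots>" .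
qed

lemma sup_affine_midpoint:
  "sup_affine p F \<alpha> \<beta> (y + z) \<le> (sup_affine p F \<alpha> \<beta> (2 *\<^sub>R y) + sup_affine p F \<alpha> \<beta> (2 *\<^sub>R z)) / 2"
proof -
  have "ennreal (1 - 1 / 2) = inverse 2" "ennreal (1 / 2) = inverse 2"
    using ennreal_1 ennreal_numeral[of "num.Bit0 num.One"]
    by (simp_all add: inverse_ennreal[symmetric] flip: ennreal_numeral)
  with sup_affine_convex[of "1 / 2" p F \<alpha> \<beta> "2 *\<^sub>R y" "2 *\<^sub>R z"] show ?thesis
    by (simp add: divide_ennreal_def distrib_left mult.commute)
qed

lemma ennreal_add_self_half: "(x + x) / 2 = (x :: ennreal)"
  by (simp add: mult_2_right[symmetric] mult_divide_eq_ennreal)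

section \<open>Comparing integrals through tails\<close>

lemma nn_integral_layer_cake:
  assumes "sigma_finite_measure M" and g: "g \<in> borel_measurable M"
  shows "(\<integral>\<^sup>+w. g w \<partial>M) = (\<integral>\<^sup>+s. indicator {0..} s * emeasure M {w \<in> space M. ennreal s < g w} \<partial>lborel)"
proof -
  interpret sigma_finite_measure M by fact
  interpret L: pair_sigma_finite lborel M ..
  note g[measurable]
  have c: "(\<integral>\<^sup>+s. indicator {0..} s * indicator {s. ennreal s < c} s \<partial>lborel) = c" for c :: ennreal
  proof (cases c)
    case (real r)
    then have "(\<integral>\<^sup>+s. indicator {0..} s * indicator {s. ennreal s < c} s \<partial>lborel) = (\<integral>\<^sup>+s. indicator {0..<r} s \<partial>lborel)"
      by (intro nn_integral_cong) (auto simp: indicator_def ennreal_less_iff)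
    then show ?thesis using real by simp
  next
    case top
    have "(\<integral>\<^sup>+s. indicator {0..} s * indicator {s. ennreal s < c} s \<partial>lborel) = (\<integral>\<^sup>+s. indicator {0::real..} s \<partial>lborel)"
      using top by (intro nn_integral_cong) (auto simp: indicator_def)
    also have "\<dots> = \<infinity>"
    proof -
      have "of_nat n \<le> emeasure lborel {0::real..}" for n
        using emeasure_mono[of "{0..real n}" "{0::real..}" lborel] by (simp add: ennreal_of_nat_eq_real_of_nat)
      then show ?thesis using ennreal_Ex_less_of_nat[of "emeasure lborel {0::real..}"]
        by (auto simp: less_top[symmetric] leD not_less)
    qed
    finally show ?thesis using top by simp
  qed
  have "(\<integral>\<^sup>+w. g w \<partial>M) = (\<integral>\<^sup>+w. (\<integral>\<^sup>+s. indicator {0..} s * indicator {s. ennreal s < g w} s \<partial>lborel) \<partial>M)"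
    by (simp add: c)
  also have "\<dots> = (\<integral>\<^sup>+s. (\<integral>\<^sup>+w. indicator {0..} s * indicator {s. ennreal s < g w} s \<partial>M) \<partial>lborel)"
    by (rule L.Fubini') (simp add: split_beta' indicator_def[abs_def])
  also have "\<dots> = (\<integral>\<^sup>+s. indicator {0..} s * (\<integral>\<^sup>+w. indicator {w \<in> space M. ennreal s < g w} w \<partial>M) \<partial>lborel)"
    by (intro nn_integral_cong, subst nn_integral_cmult[symmetric])
      (auto intro!: nn_integral_cong simp: indicator_def)
  finally show ?thesis by simp
qed

text \<open>Superlevel sets of a monotone function are up-sets of the line, hence empty, the whole
  line, or closed or open rays. An open ray is an increasing union of closed ones, so the tail
  assumption covers all cases, and the layer cake formula integrates the inequality.\<close>

lemma nn_integral_mono_tail: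
  fixes X :: "'a \<Rightarrow> real" and Z :: "'b \<Rightarrow> real"
  assumes M: "prob_space M" and N: "prob_space N"
    and X[measurable]: "X \<in> borel_measurable M" and Z[measurable]: "Z \<in> borel_measurable N"
    and tail: "\<And>t. emeasure M {w \<in> space M. t \<le> X w} \<le> emeasure N {w \<in> space N. t \<le> Z w}"
    and g: "mono g" and gm[measurable]: "g \<in> borel_measurable borel"
  shows "(\<integral>\<^sup>+w. g (X w) \<partial>M) \<le> (\<integral>\<^sup>+w. g (Z w) \<partial>N)"
proof -
  interpret M: prob_space M by fact
  interpret N: prob_space N by fact
  have up: "emeasure M {w \<in> space M. X w \<in> U} \<le> emeasure N {w \<in> space N. Z w \<in> U}"
    if U: "\<And>s t. s \<in> U \<Longrightarrow> s \<le> t \<Longrightarrow> t \<in> U" and Um: "U \<in> sets borel" for U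
  proof -
    consider "U = {}" | "U = UNIV" | a where "U = {a..}" | a where "U = {a<..}"
    proof (cases "U = {} \<or> \<not> bdd_below U")
      case True
      moreover have "U = UNIV" if nb: "\<not> bdd_below U"
      proof -
        have "x \<in> U" for x
        proof (rule ccontr)
          assume "x \<notin> U"
          then have "x \<le> y" if "y \<in> U" for y using U[OF that, of x] that by (cases "y \<le> x") auto
          then show False using nb by (auto simp: bdd_below_def)
        qed
        then show ?thesis by auto
      qed
      ultimately show ?thesis using that(1,2) by metis
    next
      case False
      define a where "a = Inf U"
      have "a \<le> x" if "x \<in> U" for x using False that by (simp add: a_def cInf_lower)
      moreover have "x \<in> U" if "a < x" for x
        using that U False cInf_lessD[of U x] by (auto simp: a_def)
      ultimately have "U = {a..} \<or> U = {a<..}"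
        by (cases "a \<in> U") (auto simp: less_le)
      then show ?thesis using that by blast
    qed
    then show ?thesis
    proof cases
      case 2
      then show ?thesis by (simp add: M.emeasure_space_1 N.emeasure_space_1)
    next
      case (3 a)
      then show ?thesis using tail[of a] by simp
    next
      case (4 a)
      have eq: "{w \<in> space M. X w \<in> U} = (\<Union>n. {w \<in> space M. a + 1 / real (Suc n) \<le> X w})"
        for M :: "'z measure" and X
      proof -
        have "(\<exists>n. a + 1 / real (Suc n) \<le> y)" if "a < y" for y
        proof -
          obtain n where "inverse (real (Suc n)) < y - a"
            using reals_Archimedean[of "y - a"] \<open>a < y\<close> by auto
          then show ?thesis by (intro exI[of _ n]) (simp add: inverse_eq_divide)
        qed
        moreover have "a < y" if "a + 1 / real (Suc n) \<le> y" for n y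
          using that by (smt (verit) of_nat_0_less_iff zero_less_Suc divide_pos_pos)
        ultimately show ?thesis using 4 by auto
      qed
      have inc: "incseq (\<lambda>n. {w \<in> space M. a + 1 / real (Suc n) \<le> X w})" for M :: "'z measure" and X
      proof (intro monoI Collect_mono impI conjI)
        fix i j :: nat and w assume "i \<le> j" and w: "w \<in> space M \<and> a + 1 / real (Suc i) \<le> X w"
        then have "1 / real (Suc j) \<le> 1 / real (Suc i)" by (intro divide_left_mono) auto
        then show "w \<in> space M" "a + 1 / real (Suc j) \<le> X w" using w by linarith+
      qed
      have "emeasure M {w \<in> space M. X w \<in> U} = (SUP n. emeasure M {w \<in> space M. a + 1 / real (Suc n) \<le> X w})"
        unfolding eq by (rule SUP_emeasure_incseq[symmetric, OF _ inc]) auto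
      also have "\<dots> \<le> (SUP n. emeasure N {w \<in> space N. a + 1 / real (Suc n) \<le> Z w})"
        by (intro SUP_mono') (rule tail)
      also have "\<dots> = emeasure N {w \<in> space N. Z w \<in> U}"
        unfolding eq by (rule SUP_emeasure_incseq[OF _ inc]) auto
      finally show ?thesis .
    qed simp
  qed
  have "(\<integral>\<^sup>+w. g (X w) \<partial>M) = (\<integral>\<^sup>+s. indicator {0..} s * emeasure M {w \<in> space M. ennreal s < g (X w)} \<partial>lborel)"
    by (rule nn_integral_layer_cake) (auto intro: M.sigma_finite_measure_axioms)
  also have "\<dots> \<le> (\<integral>\<^sup>+s. indicator {0..} s * emeasure N {w \<in> space N. ennreal s < g (Z w)} \<partial>lborel)"
  proof (intro nn_integral_mono mult_left_mono)
    fix s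
    have "{t. ennreal s < g t} \<in> sets borel" by simp
    then show "emeasure M {w \<in> space M. ennreal s < g (X w)} \<le> emeasure N {w \<in> space N. ennreal s < g (Z w)}"
      using up[of "{t. ennreal s < g t}"] g by (auto simp: mono_def intro: less_le_trans)
  qed simp
  also have "\<dots> = (\<integral>\<^sup>+w. g (Z w) \<partial>N)"
    by (rule nn_integral_layer_cake[symmetric]) (auto intro: N.sigma_finite_measure_axioms)
  finally show ?thesis .
qed

text \<open>Tail comparison controls moduli only. Symmetrizing makes the function even, and an even
  convex function is monotone in the modulus along every line through 0.\<close>

definition even_affine :: "nat \<Rightarrow> 'x set \<Rightarrow> ('x \<Rightarrow> real) \<Rightarrow> ('x \<Rightarrow> 'v :: euclidean_space) \<Rightarrow> 'v \<Rightarrow> ennreal" where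
  "even_affine p F \<alpha> \<beta> y = (sup_affine p F \<alpha> \<beta> y + sup_affine p F \<alpha> \<beta> (- y)) / 2"

lemma even_affine_measurable [measurable]:
  "finite F \<Longrightarrow> even_affine p F \<alpha> \<beta> \<in> borel_measurable borel"
  unfolding even_affine_def[abs_def] by measurable

text \<open>The point \<open>s *\<^sub>R v\<close> is a convex combination of
  \<open>t *\<^sub>R v\<close> and its negative, with weight \<open>r = (1 - s / t) / 2\<close> on
  the negative; convexity at both signs gives the claim.\<close>

lemma even_affine_scale_mono:
  assumes "\<bar>s\<bar> \<le> \<bar>t\<bar>"
  shows "even_affine p F \<alpha> \<beta> (s *\<^sub>R v) \<le> even_affine p F \<alpha> \<beta> (t *\<^sub>R v)"
proof (cases "t = 0")
  case True then show ?thesis using assms by simp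
next
  case False
  let ?f = "sup_affine p F \<alpha> \<beta>"
  define r where "r = (1 - s / t) / 2"
  have "\<bar>s / t\<bar> \<le> 1" using assms False by (simp add: field_simps)
  then have "s / t \<le> 1" "- 1 \<le> s / t" unfolding abs_le_iff by auto
  then have r: "0 \<le> r" "r \<le> 1" by (simp_all add: r_def)
  have e: "(1 - r) *\<^sub>R (t *\<^sub>R v) + r *\<^sub>R (- (t *\<^sub>R v)) = s *\<^sub>R v"
    "r *\<^sub>R (- (t *\<^sub>R v)) + (1 - r) *\<^sub>R (t *\<^sub>R v) = s *\<^sub>R v"
    "(1 - r) *\<^sub>R (- (t *\<^sub>R v)) + r *\<^sub>R (t *\<^sub>R v) = - (s *\<^sub>R v)"
    using False by (simp_all add: r_def field_simps flip: scaleR_add_left scaleR_diff_left)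
  have s: "ennreal (1 - r) * c + ennreal r * c = c" for c
    using r by (simp add: distrib_right[symmetric] ennreal_plus[symmetric] del: ennreal_plus)
  have "?f (s *\<^sub>R v) + ?f (- (s *\<^sub>R v)) \<le>
      (ennreal (1 - r) * ?f (t *\<^sub>R v) + ennreal r * ?f (- (t *\<^sub>R v))) +
      (ennreal (1 - r) * ?f (- (t *\<^sub>R v)) + ennreal r * ?f (t *\<^sub>R v))"
    using sup_affine_convex[OF r, of p F \<alpha> \<beta> "t *\<^sub>R v" "- (t *\<^sub>R v)"]
      sup_affine_convex[OF r, of p F \<alpha> \<beta> "- (t *\<^sub>R v)" "t *\<^sub>R v"]
    unfolding e by (rule add_mono)
  also have "\<dots> = (ennreal (1 - r) * (?f (t *\<^sub>R v)) + ennreal r * (?f (t *\<^sub>R v))) +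
     (ennreal (1 - r) * (?f (- (t *\<^sub>R v))) + ennreal r * (?f (- (t *\<^sub>R v))))"
    by (simp add: ac_simps)
  also have "\<dots> = ?f (t *\<^sub>R v) + ?f (- (t *\<^sub>R v))" by (simp only: s)
  finally show ?thesis
    unfolding even_affine_def by (rule divide_right_mono_ennreal)
qed

lemma even_affine_midpoint:
  "even_affine p F \<alpha> \<beta> (y + z) \<le> (even_affine p F \<alpha> \<beta> (2 *\<^sub>R y) + even_affine p F \<alpha> \<beta> (2 *\<^sub>R z)) / 2"
proof -
  have "sup_affine p F \<alpha> \<beta> (y + z) + sup_affine p F \<alpha> \<beta> (- (y + z)) \<le>
     (sup_affine p F \<alpha> \<beta> (2 *\<^sub>R y) + sup_affine p F \<alpha> \<beta> (2 *\<^sub>R z)) / 2 +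
     (sup_affine p F \<alpha> \<beta> (- (2 *\<^sub>R y)) + sup_affine p F \<alpha> \<beta> (- (2 *\<^sub>R z))) / 2"
    using sup_affine_midpoint[of p F \<alpha> \<beta> y z] sup_affine_midpoint[of p F \<alpha> \<beta> "- y" "- z"]
    by (intro add_mono) simp_all
  then have "even_affine p F \<alpha> \<beta> (y + z) \<le> ((sup_affine p F \<alpha> \<beta> (2 *\<^sub>R y) + sup_affine p F \<alpha> \<beta> (2 *\<^sub>R z)) / 2 +
     (sup_affine p F \<alpha> \<beta> (- (2 *\<^sub>R y)) + sup_affine p F \<alpha> \<beta> (- (2 *\<^sub>R z))) / 2) / 2"
    unfolding even_affine_def by (rule divide_right_mono_ennreal)
  also have "\<dots> = (even_affine p F \<alpha> \<beta> (2 *\<^sub>R y) + even_affine p F \<alpha> \<beta> (2 *\<^sub>R z)) / 2"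
    unfolding even_affine_def by (simp only: add_divide_distrib_ennreal ac_simps)
  finally show ?thesis .
qed

text \<open>\<open>X w - c\<close> is the mean of \<open>X w - X w'\<close> over an independent
  copy. Jensen's inequality and the midpoint inequality then separate the two variables, at the
  price of the factor 2 in the argument.\<close>

lemma (in prob_space) sup_affine_symmetrize:
  assumes F: "finite F" and X: "integrable M X" and c: "expectation X = c"
  shows "(\<integral>\<^sup>+w. sup_affine p F \<alpha> \<beta> (X w - c) \<partial>M) \<le> (\<integral>\<^sup>+w. even_affine p F \<alpha> \<beta> (2 *\<^sub>R X w) \<partial>M)"
proof -
  let ?f = "sup_affine p F \<alpha> \<beta>"
  note sup_affine_measurable[OF F, measurable]
  have [measurable]: "X \<in> borel_measurable M" using X by simp
  have "?f (X w - c) \<le> (?f (2 *\<^sub>R X w) + (\<integral>\<^sup>+w'. ?f (- (2 *\<^sub>R X w')) \<partial>M)) / 2" for w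
  proof -
    have "expectation (\<lambda>w'. X w - X w') = X w - c"
      using X c by (simp add: prob_space)
    then have "?f (X w - c) \<le> (\<integral>\<^sup>+w'. ?f (X w - X w') \<partial>M)"
      using sup_affine_expectation_le[of "\<lambda>w'. X w - X w'" p F \<alpha> \<beta>] X by simp
    also have "\<dots> \<le> (\<integral>\<^sup>+w'. (?f (2 *\<^sub>R X w) + ?f (- (2 *\<^sub>R X w'))) / 2 \<partial>M)"
      using sup_affine_midpoint[of p F \<alpha> \<beta> "X w" "- X w'" for w'] by (intro nn_integral_mono) simp
    also have "\<dots> = (?f (2 *\<^sub>R X w) + (\<integral>\<^sup>+w'. ?f (- (2 *\<^sub>R X w')) \<partial>M)) / 2"
      by (simp add: nn_integral_divide nn_integral_add emeasure_space_1)
    finally show ?thesis .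
  qed
  then have "(\<integral>\<^sup>+w. ?f (X w - c) \<partial>M) \<le> (\<integral>\<^sup>+w. (?f (2 *\<^sub>R X w) + (\<integral>\<^sup>+w'. ?f (- (2 *\<^sub>R X w')) \<partial>M)) / 2 \<partial>M)"
    by (intro nn_integral_mono)
  also have "\<dots> = (\<integral>\<^sup>+w. even_affine p F \<alpha> \<beta> (2 *\<^sub>R X w) \<partial>M)"
    unfolding even_affine_def
    by (simp add: nn_integral_divide nn_integral_add emeasure_space_1)
  finally show ?thesis .
qed

text \<open>The constant \<open>1\<close> in the tail bound is absorbed by Jensen's inequality, since \<open>\<bar>W\<bar>\<close> has
  positive mean.\<close>

lemma even_affine_tail_dominated:
  fixes W :: "'b \<Rightarrow> real" and X :: "'a \<Rightarrow> real"
  assumes F: "finite F" and M: "prob_space M" and N: "prob_space N"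
    and X[measurable]: "X \<in> borel_measurable M" and X0: "\<And>w. 0 \<le> X w"
    and W: "integrable N W" and \<mu>: "(\<integral>w. \<bar>W w\<bar> \<partial>N) = \<mu>" "\<mu> > 0" and \<kappa>: "\<kappa> > 0"
    and tail: "\<And>t. emeasure M {w \<in> space M. t \<le> X w} \<le> emeasure N {w \<in> space N. t \<le> \<kappa> * (1 + \<bar>W w\<bar>)}"
  shows "(\<integral>\<^sup>+w. even_affine p F \<alpha> \<beta> (X w *\<^sub>R v) \<partial>M) \<le>
    (\<integral>\<^sup>+w. even_affine p F \<alpha> \<beta> ((2 * \<kappa> * (1 + 1 / \<mu>) * W w) *\<^sub>R v) \<partial>N)"
proof -
  interpret N: prob_space N by fact
  let ?f = "\<lambda>t. even_affine p F \<alpha> \<beta> (t *\<^sub>R v)"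
  define C where "C = 2 * \<kappa> * (1 + 1 / \<mu>)"
  have C: "C > 0" "2 * \<kappa> \<le> C" "2 * \<kappa> \<le> C * \<mu>"
    using \<kappa> \<mu>(2) by (auto simp: C_def field_simps intro!: add_pos_pos)
  note even_affine_measurable[OF F, measurable] sup_affine_measurable[OF F, measurable]
  have [measurable]: "W \<in> borel_measurable N" using W by simp
  have ac: "?f \<bar>t\<bar> = ?f t" for t
    using even_affine_scale_mono[of "\<bar>t\<bar>" t p F \<alpha> \<beta> v] even_affine_scale_mono[of t "\<bar>t\<bar>" p F \<alpha> \<beta> v] by (simp add: antisym)
  \<comment> \<open>Truncation at 0 makes the even function monotone on the whole line, as
    \<open>nn_integral_mono_tail\<close> demands.\<close>
  have "(\<integral>\<^sup>+w. ?f (X w) \<partial>M) = (\<integral>\<^sup>+w. ?f (max 0 (X w)) \<partial>M)"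
    using X0 by (simp add: max_def)
  also have "\<dots> \<le> (\<integral>\<^sup>+w. ?f (max 0 (\<kappa> * (1 + \<bar>W w\<bar>))) \<partial>N)"
    by (rule nn_integral_mono_tail[OF M N _ _ tail, where g = "\<lambda>t. ?f (max 0 t)"])
      (auto intro!: monoI even_affine_scale_mono)
  also have "\<dots> \<le> (\<integral>\<^sup>+w. (?f (C * \<mu>) + ?f (C * W w)) / 2 \<partial>N)"
  proof (rule nn_integral_mono)
    fix w
    have "max 0 (\<kappa> * (1 + \<bar>W w\<bar>)) = \<kappa> + \<kappa> * \<bar>W w\<bar>" using \<kappa> by (simp add: distrib_left)
    then have "?f (max 0 (\<kappa> * (1 + \<bar>W w\<bar>))) \<le> (?f (2 * \<kappa>) + ?f (2 * \<kappa> * \<bar>W w\<bar>)) / 2"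
      using even_affine_midpoint[of p F \<alpha> \<beta> "\<kappa> *\<^sub>R v" "(\<kappa> * \<bar>W w\<bar>) *\<^sub>R v"] by (simp add: scaleR_add_left mult.assoc)
    also have "\<dots> \<le> (?f (C * \<mu>) + ?f (C * W w)) / 2"
      using C \<kappa> \<mu>(2) by (intro divide_right_mono_ennreal add_mono even_affine_scale_mono)
        (auto simp: abs_mult intro!: mult_right_mono)
    finally show "?f (max 0 (\<kappa> * (1 + \<bar>W w\<bar>))) \<le> (?f (C * \<mu>) + ?f (C * W w)) / 2" .
  qed
  also have "\<dots> = (?f (C * \<mu>) + (\<integral>\<^sup>+w. ?f (C * W w) \<partial>N)) / 2"
    by (simp add: nn_integral_divide nn_integral_add N.emeasure_space_1)
  also have "\<dots> \<le> ((\<integral>\<^sup>+w. ?f (C * W w) \<partial>N) + (\<integral>\<^sup>+w. ?f (C * W w) \<partial>N)) / 2"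
  proof (intro divide_right_mono_ennreal add_right_mono)
    let ?s = "sup_affine p F \<alpha> \<beta>"
    have i: "integrable N (\<lambda>w. (C * \<bar>W w\<bar>) *\<^sub>R v)" using W by auto
    have e: "(\<integral>w. (C * \<bar>W w\<bar>) *\<^sub>R v \<partial>N) = (C * \<mu>) *\<^sub>R v"
      using W \<mu> by simp
    have "?s ((C * \<mu>) *\<^sub>R v) \<le> (\<integral>\<^sup>+w. ?s ((C * \<bar>W w\<bar>) *\<^sub>R v) \<partial>N)"
      using N.sup_affine_expectation_le[OF i, of p F \<alpha> \<beta>] by (simp add: e)
    moreover have "?s (- ((C * \<mu>) *\<^sub>R v)) \<le> (\<integral>\<^sup>+w. ?s (- ((C * \<bar>W w\<bar>) *\<^sub>R v)) \<partial>N)"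
      using N.sup_affine_expectation_le[of "\<lambda>w. - ((C * \<bar>W w\<bar>) *\<^sub>R v)" p F \<alpha> \<beta>] i by (simp add: e)
    ultimately have "?f (C * \<mu>) \<le> (\<integral>\<^sup>+w. ?f (C * \<bar>W w\<bar>) \<partial>N)"
      unfolding even_affine_def
      by (simp add: nn_integral_divide nn_integral_add divide_right_mono_ennreal add_mono)
    also have "\<dots> = (\<integral>\<^sup>+w. ?f (C * W w) \<partial>N)"
      using ac[of "C * W w" for w] C by (simp add: abs_mult)
    finally show "?f (C * \<mu>) \<le> (\<integral>\<^sup>+w. ?f (C * W w) \<partial>N)" .
  qed
  also have "\<dots> = (\<integral>\<^sup>+w. ?f (C * W w) \<partial>N)"
    by (rule ennreal_add_self_half)
  finally show ?thesis by (simp add: C_def)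
qed

section \<open>Gaussian lower tails against subgaussian upper tails\<close>

lemma std_gauss_tail:
  assumes "\<tau> \<ge> 0"
  shows "emeasure std_gauss {x. \<tau> \<le> x} \<ge> ennreal (exp (- (\<tau> + 1)\<^sup>2 / 2) / sqrt (2 * pi))"
proof -
  let ?c = "exp (- (\<tau> + 1)\<^sup>2 / 2) / sqrt (2 * pi)"
  have "ennreal ?c = (\<integral>\<^sup>+x. ennreal ?c * indicator {\<tau>..\<tau> + 1} x \<partial>lborel)"
    by (simp add: nn_integral_cmult_indicator)
  also have "\<dots> \<le> (\<integral>\<^sup>+x. ennreal (std_normal_density x) * indicator {x. \<tau> \<le> x} x \<partial>lborel)"
  proof (intro nn_integral_mono)
    fix x
    have "?c \<le> std_normal_density x" if "\<tau> \<le> x" "x \<le> \<tau> + 1"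
    proof -
      have "x\<^sup>2 \<le> (\<tau> + 1)\<^sup>2" using that assms by (intro power_mono) auto
      then show ?thesis by (simp add: std_normal_density_def divide_right_mono)
    qed
    then show "ennreal ?c * indicator {\<tau>..\<tau> + 1} x \<le> ennreal (std_normal_density x) * indicator {x. \<tau> \<le> x} x"
      by (auto simp: indicator_def intro!: ennreal_leI)
  qed
  also have "\<dots> = emeasure std_gauss {x. \<tau> \<le> x}"
    by (simp add: std_gauss_def emeasure_density)
  finally show ?thesis .
qed

lemma std_gauss_abs: "integrable std_gauss (\<lambda>x. x)" "(\<integral>x. \<bar>x\<bar> \<partial>std_gauss) = sqrt (2 / pi)"
  "(\<integral>x. x \<partial>std_gauss) = 0"
  using integrable_std_normal_moment[of 1] integral_std_normal_moment_abs_odd[of 0]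
    integral_std_normal_moment_odd[of 0]
  by (simp_all add: std_gauss_def integrable_density integral_density)

lemma emeasure_std_gauss_abs_ge:
  assumes "\<tau> \<ge> 0"
  shows "emeasure std_gauss {x. \<tau> \<le> \<bar>x\<bar>} \<ge> ennreal (exp (- (\<tau> + 1)\<^sup>2 / 2) / sqrt (2 * pi))"
  using std_gauss_tail[OF assms]
  by (rule order_trans) (intro emeasure_mono, auto)

text \<open>The left side collects the factor 2 of the subgaussian tail and the normalization in the
  Gaussian lower tail. Numerically: 2 pi is below 8, hence below 2.9^2, and exp(1/4) is at least
  5/4, whose eighth power exceeds 5.8.\<close>

lemma sqrt_2pi_bound: "2 * sqrt (2 * pi) \<le> exp 2"
proof -
  have "sqrt (2 * pi) \<le> sqrt ((29 / 10)\<^sup>2)"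
    using pi_less_4 by (intro real_sqrt_le_mono) (simp add: power2_eq_square)
  then have "2 * sqrt (2 * pi) \<le> 29 / 5" by simp
  also have "29 / 5 \<le> (1 + 1 / 4 :: real) ^ 8" by (simp add: eval_nat_numeral)
  also have "\<dots> \<le> exp (1 / 4) ^ 8" by (intro power_mono exp_ge_add_one_self) auto
  also have "\<dots> = exp 2" by (simp add: exp_of_nat_mult[symmetric])
  finally show ?thesis .
qed

lemma emeasure_le_1_tail:
  fixes W :: "'a \<Rightarrow> real"
  assumes "prob_space N" "\<kappa> > 0" "t \<le> \<kappa>" "W \<in> borel_measurable N"
  shows "emeasure N {w \<in> space N. t \<le> \<kappa> * (1 + \<bar>W w\<bar>)} = 1"
proof -
  interpret prob_space N by fact
  have "t \<le> \<kappa> * (1 + \<bar>W w\<bar>)" for w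
  proof -
    have "\<kappa> * 1 \<le> \<kappa> * (1 + \<bar>W w\<bar>)" using assms(2) by (intro mult_left_mono) auto
    then show ?thesis using assms(3) by linarith
  qed
  then show ?thesis by (simp add: emeasure_space_1)
qed

text \<open>The summand 1 makes thresholds up to \<open>sqrt 5 * L\<close> trivial. Beyond it,
  \<open>\<tau> + 1 = t / \<kappa>\<close>, and the factor 5 leaves an exponent gap 2 t^2 / (5 L^2),
  at least 2, which absorbs the constants by \<open>sqrt_2pi_bound\<close>.\<close>

lemma (in prob_space) subgaussian_tail_le_std_gauss:
  fixes X :: "'a \<Rightarrow> complex"
  assumes L: "L > 0" and sg: "subgaussian L X" and X[measurable]: "X \<in> borel_measurable M"
  shows "emeasure M {w \<in> space M. t \<le> cmod (X w)} \<le>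
    emeasure std_gauss {x \<in> space std_gauss. t \<le> (sqrt 5 * L) * (1 + \<bar>x\<bar>)}"
proof (cases "t \<le> sqrt 5 * L")
  case True
  then show ?thesis
    using emeasure_le_1_tail[OF prob_space_std_gauss, of "sqrt 5 * L" t "\<lambda>x. x"] L
    by (simp add: emeasure_le_1)
next
  case False
  define \<kappa> where "\<kappa> = sqrt 5 * L"
  define \<tau> where "\<tau> = t / \<kappa> - 1"
  have \<kappa>: "\<kappa> > 0" "\<kappa>\<^sup>2 = 5 * L\<^sup>2" using L by (auto simp: \<kappa>_def power_mult_distrib)
  have t: "t > \<kappa>" using False by (simp add: \<kappa>_def)
  have \<tau>: "\<tau> \<ge> 0" using t \<kappa> by (simp add: \<tau>_def field_simps)
  have t2: "\<kappa>\<^sup>2 \<le> t\<^sup>2" using t \<kappa> by (intro power_mono) auto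
  have "emeasure M {w \<in> space M. t \<le> cmod (X w)} = ennreal (prob {w \<in> space M. t \<le> cmod (X w)})"
    by (simp add: emeasure_eq_measure)
  also have "\<dots> \<le> ennreal (2 * exp (- (t\<^sup>2 / (2 * L\<^sup>2))))"
    using sg t \<kappa>(1) by (intro ennreal_leI) (auto simp: subgaussian_def)
  also have "2 * exp (- (t\<^sup>2 / (2 * L\<^sup>2))) \<le> exp (- (\<tau> + 1)\<^sup>2 / 2) / sqrt (2 * pi)"
  proof -
    have "2 * sqrt (2 * pi) \<le> exp (t\<^sup>2 / (2 * L\<^sup>2) - (\<tau> + 1)\<^sup>2 / 2)"
    proof -
      have "(\<tau> + 1)\<^sup>2 = t\<^sup>2 / (5 * L\<^sup>2)" using \<kappa> by (simp add: \<tau>_def power_divide)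
      then have "t\<^sup>2 / (2 * L\<^sup>2) - (\<tau> + 1)\<^sup>2 / 2 = 2 * (t\<^sup>2 / (5 * L\<^sup>2))"
        using arg_cong[OF \<open>(\<tau> + 1)\<^sup>2 = t\<^sup>2 / (5 * L\<^sup>2)\<close>, of "\<lambda>x. 5 / 2 * x"] by simp
      moreover have "t\<^sup>2 / (5 * L\<^sup>2) \<ge> 1" using t2 \<kappa>(2) L by (simp add: field_simps)
      ultimately have "exp 2 \<le> exp (t\<^sup>2 / (2 * L\<^sup>2) - (\<tau> + 1)\<^sup>2 / 2)" by simp
      then show ?thesis using sqrt_2pi_bound by linarith
    qed
    then have "2 * sqrt (2 * pi) * exp (- (t\<^sup>2 / (2 * L\<^sup>2))) \<le> exp (t\<^sup>2 / (2 * L\<^sup>2) - (\<tau> + 1)\<^sup>2 / 2) * exp (- (t\<^sup>2 / (2 * L\<^sup>2)))"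
      by (intro mult_right_mono) auto
    then show ?thesis by (simp add: exp_add[symmetric] field_simps)
  qed
  also have "ennreal (exp (- (\<tau> + 1)\<^sup>2 / 2) / sqrt (2 * pi)) \<le> emeasure std_gauss {x. \<tau> \<le> \<bar>x\<bar>}"
    by (rule emeasure_std_gauss_abs_ge[OF \<tau>])
  also have "{x. \<tau> \<le> \<bar>x\<bar>} = {x \<in> space std_gauss. t \<le> \<kappa> * (1 + \<bar>x\<bar>)}"
    using \<kappa> by (auto simp: \<tau>_def field_simps)
  finally show ?thesis by (simp add: \<kappa>_def ennreal_leI)
qed

text \<open>The squared modulus has an exponential tail, as has a product of two independent
  Gaussians: the product is at least \<open>\<tau>\<^sup>2\<close> when both factors are at least
  \<open>\<tau>\<close>. With \<open>\<kappa> = 12 * L\<^sup>2\<close> the exponent is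
  \<open>6 * (t / \<kappa>)\<close>, while the Gaussian side loses at most
  \<open>2 * (t / \<kappa>)\<close>; the gap of at least 4 absorbs the constants.\<close>

lemma (in prob_space) subgaussian_sq_tail_le_std_gauss:
  fixes X :: "'a \<Rightarrow> complex"
  assumes L: "L > 0" and sg: "subgaussian L X" and X[measurable]: "X \<in> borel_measurable M"
  shows "emeasure M {w \<in> space M. t \<le> (cmod (X w))\<^sup>2} \<le>
    emeasure (std_gauss \<Otimes>\<^sub>M std_gauss) {p \<in> space (std_gauss \<Otimes>\<^sub>M std_gauss). t \<le> (12 * L\<^sup>2) * (1 + \<bar>fst p * snd p\<bar>)}"
proof (cases "t \<le> 12 * L\<^sup>2")
  case True
  then show ?thesis
    using emeasure_le_1_tail[OF prob_space_pair[OF prob_space_std_gauss prob_space_std_gauss], of "12 * L\<^sup>2" t "\<lambda>p. fst p * snd p"] L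
    by (simp add: emeasure_le_1)
next
  case False
  define \<kappa> where "\<kappa> = 12 * L\<^sup>2"
  define \<tau> where "\<tau> = sqrt (t / \<kappa> - 1)"
  have \<kappa>: "\<kappa> > 0" using L by (auto simp: \<kappa>_def)
  have t: "t > \<kappa>" using False by (simp add: \<kappa>_def)
  have "t / \<kappa> - 1 \<ge> 0" using t \<kappa> by (simp add: field_simps)
  then have \<tau>: "\<tau> \<ge> 0" "\<tau>\<^sup>2 = t / \<kappa> - 1" by (auto simp: \<tau>_def)
  have t0: "t > 0" using t \<kappa> by simp
  have "{w \<in> space M. t \<le> (cmod (X w))\<^sup>2} = {w \<in> space M. sqrt t \<le> cmod (X w)}"
    using t0 by (auto simp: real_le_rsqrt real_sqrt_le_iff intro: real_le_lsqrt sqrt_le_D)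
  then have "emeasure M {w \<in> space M. t \<le> (cmod (X w))\<^sup>2} = ennreal (prob {w \<in> space M. sqrt t \<le> cmod (X w)})"
    by (simp add: emeasure_eq_measure)
  also have "\<dots> \<le> ennreal (2 * exp (- (t / (2 * L\<^sup>2))))"
    using sg t0 unfolding subgaussian_def
    by (intro ennreal_leI) (drule spec[of _ "sqrt t"], simp)
  also have "2 * exp (- (t / (2 * L\<^sup>2))) \<le> (exp (- (\<tau> + 1)\<^sup>2 / 2) / sqrt (2 * pi))\<^sup>2"
  proof -
    have "2 * (2 * pi) \<le> (2 * sqrt (2 * pi))\<^sup>2" by (simp add: power_mult_distrib)
    also have "\<dots> \<le> (exp 2)\<^sup>2" by (intro power_mono sqrt_2pi_bound) auto
    also have "\<dots> = exp 4" by (simp add: exp_double[symmetric])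
    also have "4 \<le> t / (2 * L\<^sup>2) - (\<tau> + 1)\<^sup>2"
    proof -
      have a: "t / (2 * L\<^sup>2) = 6 * (t / \<kappa>)" using L by (simp add: \<kappa>_def field_simps)
      have "(\<tau> + 1)\<^sup>2 \<le> 2 * \<tau>\<^sup>2 + 2" using sum_squares_bound[of \<tau> 1] by (simp add: power2_eq_square algebra_simps)
      also have "\<dots> = 2 * (t / \<kappa>)" using \<tau> by simp
      finally have "(\<tau> + 1)\<^sup>2 \<le> 2 * (t / \<kappa>)" .
      moreover have "t / \<kappa> \<ge> 1" using t \<kappa> by simp
      ultimately show ?thesis using a by linarith
    qed
    finally have "2 * (2 * pi) \<le> exp (t / (2 * L\<^sup>2) - (\<tau> + 1)\<^sup>2)" by simp
    then have "2 * (2 * pi) * exp (- (t / (2 * L\<^sup>2))) \<le> exp (t / (2 * L\<^sup>2) - (\<tau> + 1)\<^sup>2) * exp (- (t / (2 * L\<^sup>2)))"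
      by (intro mult_right_mono) auto
    then have "2 * exp (- (t / (2 * L\<^sup>2))) \<le> exp (- (\<tau> + 1)\<^sup>2) / (2 * pi)"
      by (simp add: exp_add[symmetric] field_simps)
    also have "\<dots> = (exp (- (\<tau> + 1)\<^sup>2 / 2) / sqrt (2 * pi))\<^sup>2"
      by (simp add: power_divide exp_double[symmetric])
    finally show ?thesis .
  qed
  also have "ennreal ((exp (- (\<tau> + 1)\<^sup>2 / 2) / sqrt (2 * pi))\<^sup>2) \<le>
      emeasure std_gauss {x. \<tau> \<le> x} * emeasure std_gauss {x. \<tau> \<le> x}"
  proof -
    have e: "ennreal (c\<^sup>2) = ennreal c * ennreal c" if "c \<ge> 0" for c
      using that by (simp add: power2_eq_square ennreal_mult)
    show ?thesis by (subst e, simp) (intro mult_mono std_gauss_tail[OF \<tau>(1)]; simp)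
  qed
  also have "\<dots> = emeasure (std_gauss \<Otimes>\<^sub>M std_gauss) ({x. \<tau> \<le> x} \<times> {x. \<tau> \<le> x})"
    by (subst std_gauss.emeasure_pair_measure_Times) auto
  also have "\<dots> \<le> emeasure (std_gauss \<Otimes>\<^sub>M std_gauss) {p \<in> space (std_gauss \<Otimes>\<^sub>M std_gauss). t \<le> \<kappa> * (1 + \<bar>fst p * snd p\<bar>)}"
  proof (intro emeasure_mono)
    have "t \<le> \<kappa> * (1 + \<bar>x * y\<bar>)" if "\<tau> \<le> x" "\<tau> \<le> y" for x y
    proof -
      have "\<tau>\<^sup>2 \<le> \<bar>x * y\<bar>" using that \<tau> mult_mono[of \<tau> x \<tau> y] by (simp add: power2_eq_square abs_mult)
      then have "\<kappa> * (1 + \<tau>\<^sup>2) \<le> \<kappa> * (1 + \<bar>x * y\<bar>)" using \<kappa> by (intro mult_left_mono) auto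
      moreover have "\<kappa> * (1 + \<tau>\<^sup>2) = t" using \<tau> \<kappa> by simp
      ultimately show ?thesis by simp
    qed
    then show "{x. \<tau> \<le> x} \<times> {x. \<tau> \<le> x} \<subseteq> {p \<in> space (std_gauss \<Otimes>\<^sub>M std_gauss). t \<le> \<kappa> * (1 + \<bar>fst p * snd p\<bar>)}"
      by (auto simp: space_pair_measure)
  qed measurable
  finally show ?thesis by (simp add: \<kappa>_def ennreal_leI)
qed

lemma nn_integral_std_gauss_even_affine:
  assumes F: "finite F"
  shows "(\<integral>\<^sup>+x. even_affine p F \<alpha> \<beta> ((C * x) *\<^sub>R v) \<partial>std_gauss) = (\<integral>\<^sup>+x. sup_affine p F \<alpha> \<beta> ((C * x) *\<^sub>R v) \<partial>std_gauss)"
proof -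
  note sup_affine_measurable[OF F, measurable]
  have "(\<integral>\<^sup>+x. sup_affine p F \<alpha> \<beta> (- ((C * x) *\<^sub>R v)) \<partial>std_gauss) = (\<integral>\<^sup>+x. sup_affine p F \<alpha> \<beta> ((C * x) *\<^sub>R v) \<partial>std_gauss)"
    using std_gauss_uminus[of "\<lambda>x. sup_affine p F \<alpha> \<beta> ((C * x) *\<^sub>R v)"] by simp
  then show ?thesis
    unfolding even_affine_def
    by (simp add: nn_integral_divide nn_integral_add ennreal_add_self_half)
qed

text \<open>Independent centred noise can only increase the mean of a convex function. This supplies
  the Gaussian component that a one-dimensional comparison leaves out.\<close>

lemma sup_affine_le_mean_shift:
  assumes F: "finite F"
  shows "sup_affine p F \<alpha> \<beta> y \<le> (\<integral>\<^sup>+x. sup_affine p F \<alpha> \<beta> (y + (C * x) *\<^sub>R v) \<partial>std_gauss)"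
  using std_gauss.sup_affine_expectation_le[of "\<lambda>x. y + (C * x) *\<^sub>R v" p F \<alpha> \<beta>] std_gauss_abs
  by (simp add: std_gauss.prob_space[simplified])

text \<open>The real and the imaginary part are treated separately because the modulus and the argument of
  \<open>X\<close> may be dependent.\<close>

lemma (in prob_space) sup_affine_subgaussian_le_cgauss:
  fixes X :: "'a \<Rightarrow> complex"
  assumes L: "L > 0" and sg: "subgaussian L X" and X: "integrable M X" "expectation X = 0" and F: "finite F"
    and C: "C = 8 * (sqrt 5 * L) * (1 + 1 / sqrt (2 / pi))"
  shows "(\<integral>\<^sup>+w. sup_affine p F \<alpha> \<beta> (X w) \<partial>M) \<le> (\<integral>\<^sup>+z. sup_affine p F \<alpha> \<beta> (C *\<^sub>R z) \<partial>cgauss)"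
proof -
  let ?s = "sup_affine p F \<alpha> \<beta>" and ?e = "even_affine p F \<alpha> \<beta>"
  define \<kappa> where "\<kappa> = sqrt 5 * L"
  define D where "D = 2 * \<kappa> * (1 + 1 / sqrt (2 / pi))"
  \<comment> \<open>One factor 2 comes from symmetrization and one from the midpoint split into real
    and imaginary part; \<open>D\<close> is the factor of
    \<open>even_affine_tail_dominated\<close>.\<close>
  have CD: "4 * D = C" by (simp add: C D_def \<kappa>_def)
  have [measurable]: "X \<in> borel_measurable M" using X by simp
  note even_affine_measurable[OF F, measurable] sup_affine_measurable[OF F, measurable]
  have \<kappa>: "\<kappa> > 0" using L by (simp add: \<kappa>_def)
  have dom: "(\<integral>\<^sup>+w. ?e ((4 * cmod (X w)) *\<^sub>R v) \<partial>M) \<le> (\<integral>\<^sup>+x. ?s ((C * x) *\<^sub>R v) \<partial>std_gauss)" for v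
  proof -
    have "(\<integral>\<^sup>+w. ?e (cmod (X w) *\<^sub>R (4 *\<^sub>R v)) \<partial>M) \<le> (\<integral>\<^sup>+x. ?e ((D * x) *\<^sub>R (4 *\<^sub>R v)) \<partial>std_gauss)"
      unfolding D_def
      by (rule even_affine_tail_dominated[OF F prob_space_axioms prob_space_std_gauss _ _ std_gauss_abs(1,2) _ \<kappa>])
        (use subgaussian_tail_le_std_gauss[OF L sg] in \<open>auto simp: \<kappa>_def\<close>)
    also have "\<dots> = (\<integral>\<^sup>+x. ?e ((C * x) *\<^sub>R v) \<partial>std_gauss)"
      by (simp add: CD[symmetric] mult_ac)
    also have "\<dots> = (\<integral>\<^sup>+x. ?s ((C * x) *\<^sub>R v) \<partial>std_gauss)"
      by (rule nn_integral_std_gauss_even_affine[OF F])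
    finally show ?thesis by (simp add: mult.commute)
  qed
  have p1: "(\<integral>\<^sup>+x. ?s ((C * x) *\<^sub>R 1) \<partial>std_gauss) \<le> (\<integral>\<^sup>+z. ?s (C *\<^sub>R z) \<partial>cgauss)"
  proof -
    have "(\<integral>\<^sup>+x. ?s ((C * x) *\<^sub>R 1) \<partial>std_gauss) \<le> (\<integral>\<^sup>+x. \<integral>\<^sup>+y. ?s ((C * x) *\<^sub>R 1 + (C * y) *\<^sub>R \<i>) \<partial>std_gauss \<partial>std_gauss)"
      by (intro nn_integral_mono sup_affine_le_mean_shift[OF F])
    also have "\<dots> = (\<integral>\<^sup>+z. ?s (C *\<^sub>R z) \<partial>cgauss)"
      by (subst nn_integral_cgauss) (auto intro!: nn_integral_cong arg_cong[of _ _ ?s] simp: complex_eq_iff)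
    finally show ?thesis .
  qed
  have p2: "(\<integral>\<^sup>+y. ?s ((C * y) *\<^sub>R \<i>) \<partial>std_gauss) \<le> (\<integral>\<^sup>+z. ?s (C *\<^sub>R z) \<partial>cgauss)"
  proof -
    interpret S: pair_sigma_finite std_gauss std_gauss ..
    have "(\<integral>\<^sup>+y. ?s ((C * y) *\<^sub>R \<i>) \<partial>std_gauss) \<le> (\<integral>\<^sup>+y. \<integral>\<^sup>+x. ?s ((C * y) *\<^sub>R \<i> + (C * x) *\<^sub>R 1) \<partial>std_gauss \<partial>std_gauss)"
      by (intro nn_integral_mono sup_affine_le_mean_shift[OF F])
    also have "\<dots> = (\<integral>\<^sup>+y. \<integral>\<^sup>+x. ?s (C *\<^sub>R Complex x y) \<partial>std_gauss \<partial>std_gauss)"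
      by (intro nn_integral_cong arg_cong[of _ _ ?s]) (auto simp: complex_eq_iff)
    also have "\<dots> = (\<integral>\<^sup>+x. \<integral>\<^sup>+y. ?s (C *\<^sub>R Complex x y) \<partial>std_gauss \<partial>std_gauss)"
      by (rule S.Fubini') (simp add: split_beta')
    also have "\<dots> = (\<integral>\<^sup>+z. ?s (C *\<^sub>R z) \<partial>cgauss)"
      by (subst nn_integral_cgauss) auto
    finally show ?thesis .
  qed
  have "(\<integral>\<^sup>+w. ?s (X w) \<partial>M) \<le> (\<integral>\<^sup>+w. ?e (2 *\<^sub>R X w) \<partial>M)"
    using sup_affine_symmetrize[OF F X, of p \<alpha> \<beta>] by simp
  also have "\<dots> \<le> (\<integral>\<^sup>+w. (?e ((4 * cmod (X w)) *\<^sub>R 1) + ?e ((4 * cmod (X w)) *\<^sub>R \<i>)) / 2 \<partial>M)"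
  proof (rule nn_integral_mono)
    fix w
    have "2 *\<^sub>R X w = (2 * Re (X w)) *\<^sub>R 1 + (2 * Im (X w)) *\<^sub>R \<i>" by (simp add: complex_eq_iff)
    then have "?e (2 *\<^sub>R X w) \<le> (?e ((4 * Re (X w)) *\<^sub>R 1) + ?e ((4 * Im (X w)) *\<^sub>R \<i>)) / 2"
      using even_affine_midpoint[of p F \<alpha> \<beta> "(2 * Re (X w)) *\<^sub>R 1" "(2 * Im (X w)) *\<^sub>R \<i>"] by simp
    also have "\<dots> \<le> (?e ((4 * cmod (X w)) *\<^sub>R 1) + ?e ((4 * cmod (X w)) *\<^sub>R \<i>)) / 2"
      by (intro divide_right_mono_ennreal add_mono even_affine_scale_mono) (auto simp: abs_Re_le_cmod abs_Im_le_cmod abs_mult)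
    finally show "?e (2 *\<^sub>R X w) \<le> (?e ((4 * cmod (X w)) *\<^sub>R 1) + ?e ((4 * cmod (X w)) *\<^sub>R \<i>)) / 2" .
  qed
  also have "\<dots> = ((\<integral>\<^sup>+w. ?e ((4 * cmod (X w)) *\<^sub>R 1) \<partial>M) + (\<integral>\<^sup>+w. ?e ((4 * cmod (X w)) *\<^sub>R \<i>) \<partial>M)) / 2"
    by (simp add: nn_integral_divide nn_integral_add)
  also have "\<dots> \<le> ((\<integral>\<^sup>+z. ?s (C *\<^sub>R z) \<partial>cgauss) + (\<integral>\<^sup>+z. ?s (C *\<^sub>R z) \<partial>cgauss)) / 2"
    by (intro divide_right_mono_ennreal add_mono order_trans[OF dom] p1 p2)
  also have "\<dots> = (\<integral>\<^sup>+z. ?s (C *\<^sub>R z) \<partial>cgauss)"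
    by (rule ennreal_add_self_half)
  finally show ?thesis .
qed

text \<open>Tail comparison yields a product of two real Gaussians \<open>x * y\<close>. A mean
  shift by \<open>x' * y'\<close> completes it to the real part of
  \<open>Complex x x' * cnj (Complex y y')\<close>, the random factor in each summand of the
  decoupled diagonal chaos.\<close>

lemma (in prob_space) sup_affine_subgaussian_sq_le_cgauss:
  fixes X :: "'a \<Rightarrow> complex"
  assumes L: "L > 0" and sg: "subgaussian L X" and X[measurable]: "X \<in> borel_measurable M"
    and X2: "integrable M (\<lambda>w. (cmod (X w))\<^sup>2)" "expectation (\<lambda>w. (cmod (X w))\<^sup>2) = 1" and F: "finite F"
    and C: "C = 4 * (12 * L\<^sup>2) * (1 + 1 / (2 / pi))"
  shows "(\<integral>\<^sup>+w. sup_affine p F \<alpha> \<beta> ((cmod (X w))\<^sup>2 - 1) \<partial>M) \<le>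
    (\<integral>\<^sup>+a. \<integral>\<^sup>+b. sup_affine p F \<alpha> \<beta> (C * Re (a * cnj b)) \<partial>cgauss \<partial>cgauss)"
proof -
  let ?s = "sup_affine p F \<alpha> \<beta>" and ?e = "even_affine p F \<alpha> \<beta>"
  interpret S: pair_prob_space std_gauss std_gauss ..
  define \<kappa> where "\<kappa> = 12 * L\<^sup>2"
  define D where "D = 2 * \<kappa> * (1 + 1 / (2 / pi))"
  have CD: "2 * D = C" by (simp add: C D_def \<kappa>_def)
  note even_affine_measurable[OF F, measurable] sup_affine_measurable[OF F, measurable]
  have \<kappa>: "\<kappa> > 0" using L by (simp add: \<kappa>_def)
  have W: "integrable (std_gauss \<Otimes>\<^sub>M std_gauss) (\<lambda>p. fst p * snd p)"
    "(\<integral>p. \<bar>fst p * snd p\<bar> \<partial>(std_gauss \<Otimes>\<^sub>M std_gauss)) = 2 / pi"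
  proof -
    have n: "(\<integral>\<^sup>+x. ennreal \<bar>x\<bar> \<partial>std_gauss) = ennreal (sqrt (2 / pi))"
      using std_gauss_abs(1,2) by (subst nn_integral_eq_integral) auto
    have nn: "(\<integral>\<^sup>+p. ennreal \<bar>fst p * snd p\<bar> \<partial>(std_gauss \<Otimes>\<^sub>M std_gauss)) = ennreal (2 / pi)"
    proof -
      have "(\<integral>\<^sup>+p. ennreal \<bar>fst p * snd p\<bar> \<partial>(std_gauss \<Otimes>\<^sub>M std_gauss)) =
        (\<integral>\<^sup>+x. \<integral>\<^sup>+y. ennreal \<bar>x\<bar> * ennreal \<bar>y\<bar> \<partial>std_gauss \<partial>std_gauss)"
        by (subst std_gauss.nn_integral_fst[symmetric]) (auto simp: abs_mult ennreal_mult')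
      also have "\<dots> = ennreal (sqrt (2 / pi)) * ennreal (sqrt (2 / pi))"
        by (simp add: nn_integral_cmult nn_integral_multc n)
      finally show ?thesis by (simp add: ennreal_mult'[symmetric])
    qed
    then show "integrable (std_gauss \<Otimes>\<^sub>M std_gauss) (\<lambda>p. fst p * snd p)"
      by (intro integrableI_bounded) auto
    show "(\<integral>p. \<bar>fst p * snd p\<bar> \<partial>(std_gauss \<Otimes>\<^sub>M std_gauss)) = 2 / pi"
      using nn by (subst integral_eq_nn_integral) auto
  qed
  have "(\<integral>\<^sup>+w. ?s ((cmod (X w))\<^sup>2 - 1) \<partial>M) \<le> (\<integral>\<^sup>+w. ?e (2 *\<^sub>R (cmod (X w))\<^sup>2) \<partial>M)"
    by (rule sup_affine_symmetrize[OF F X2])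
  also have "\<dots> = (\<integral>\<^sup>+w. ?e ((cmod (X w))\<^sup>2 *\<^sub>R 2) \<partial>M)" by (simp add: mult.commute)
  also have "\<dots> \<le> (\<integral>\<^sup>+p. ?e ((D * (fst p * snd p)) *\<^sub>R 2) \<partial>(std_gauss \<Otimes>\<^sub>M std_gauss))"
    unfolding D_def
    by (rule even_affine_tail_dominated[OF F prob_space_axioms prob_space_pair[OF prob_space_std_gauss prob_space_std_gauss] _ _ W _ \<kappa>])
      (use subgaussian_sq_tail_le_std_gauss[OF L sg] in \<open>auto simp: \<kappa>_def\<close>)
  also have "\<dots> = (\<integral>\<^sup>+x. \<integral>\<^sup>+y. ?e ((C * x * y) *\<^sub>R 1) \<partial>std_gauss \<partial>std_gauss)"
    by (subst std_gauss.nn_integral_fst[symmetric]) (auto simp: CD[symmetric] mult_ac)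
  also have "\<dots> = (\<integral>\<^sup>+x. \<integral>\<^sup>+y. ?s (C * x * y) \<partial>std_gauss \<partial>std_gauss)"
    by (subst nn_integral_std_gauss_even_affine[OF F]) simp
  also have "\<dots> \<le> (\<integral>\<^sup>+x. \<integral>\<^sup>+y. \<integral>\<^sup>+x'. \<integral>\<^sup>+y'. ?s (C * Re (Complex x x' * cnj (Complex y y'))) \<partial>std_gauss \<partial>std_gauss \<partial>std_gauss \<partial>std_gauss)"
  proof (intro nn_integral_mono)
    fix x y
    have "?s (C * x * y) = (\<integral>\<^sup>+x'. ?s (C * x * y) \<partial>std_gauss)" by (simp add: std_gauss.emeasure_space_1[simplified])
    also have "\<dots> \<le> (\<integral>\<^sup>+x'. \<integral>\<^sup>+y'. ?s (C * x * y + (C * x' * y') *\<^sub>R 1) \<partial>std_gauss \<partial>std_gauss)"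
      by (intro nn_integral_mono sup_affine_le_mean_shift[OF F])
    finally show "?s (C * x * y) \<le> (\<integral>\<^sup>+x'. \<integral>\<^sup>+y'. ?s (C * Re (Complex x x' * cnj (Complex y y'))) \<partial>std_gauss \<partial>std_gauss)"
      by (simp add: algebra_simps)
  qed
  also have "\<dots> = (\<integral>\<^sup>+x. \<integral>\<^sup>+x'. \<integral>\<^sup>+y. \<integral>\<^sup>+y'. ?s (C * Re (Complex x x' * cnj (Complex y y'))) \<partial>std_gauss \<partial>std_gauss \<partial>std_gauss \<partial>std_gauss)"
    by (intro nn_integral_cong S.Fubini') (simp add: split_beta')
  also have "\<dots> = (\<integral>\<^sup>+a. \<integral>\<^sup>+b. ?s (C * Re (a * cnj b)) \<partial>cgauss \<partial>cgauss)"
  proof -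
    have m: "(\<lambda>(a, b). ?s (C * Re (a * cnj b))) \<in> borel_measurable (borel \<Otimes>\<^sub>M borel)"
      by (simp add: split_beta')
    have "(\<lambda>a. \<integral>\<^sup>+b. ?s (C * Re (a * cnj b)) \<partial>cgauss) \<in> borel_measurable borel"
      by (intro cgauss.borel_measurable_nn_integral) (simp add: split_beta')
    then have "(\<integral>\<^sup>+a. \<integral>\<^sup>+b. ?s (C * Re (a * cnj b)) \<partial>cgauss \<partial>cgauss) =
      (\<integral>\<^sup>+x. \<integral>\<^sup>+x'. \<integral>\<^sup>+b. ?s (C * Re (Complex x x' * cnj b)) \<partial>cgauss \<partial>std_gauss \<partial>std_gauss)"
      by (rule nn_integral_cgauss)
    also have "\<dots> = (\<integral>\<^sup>+x. \<integral>\<^sup>+x'. \<integral>\<^sup>+y. \<integral>\<^sup>+y'. ?s (C * Re (Complex x x' * cnj (Complex y y'))) \<partial>std_gauss \<partial>std_gauss \<partial>std_gauss \<partial>std_gauss)"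
      using measurable_Pair2[OF m] by (intro nn_integral_cong nn_integral_cgauss) simp
    finally show ?thesis by simp
  qed
  finally show ?thesis .
qed

section \<open>Chaining for Gaussian chaos\<close>

text \<open>Vectors of dimension \<open>m\<close> and \<open>m \<times> m\<close> matrices are represented by functions on \<open>nat\<close> whose values
  outside \<open>{..<m}\<close> are irrelevant.\<close>

definition app :: "nat \<Rightarrow> (nat \<Rightarrow> nat \<Rightarrow> complex) \<Rightarrow> (nat \<Rightarrow> complex) \<Rightarrow> nat \<Rightarrow> complex" where
  "app m B a i = (\<Sum>j<m. B i j * a j)"

definition nrm2 :: "nat \<Rightarrow> (nat \<Rightarrow> complex) \<Rightarrow> real" where
  "nrm2 m v = (\<Sum>i<m. (cmod (v i))\<^sup>2)"

definition rip :: "nat \<Rightarrow> (nat \<Rightarrow> complex) \<Rightarrow> (nat \<Rightarrow> complex) \<Rightarrow> real" where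
  "rip m v w = (\<Sum>i<m. Re (v i * cnj (w i)))"

definition adj :: "(nat \<Rightarrow> nat \<Rightarrow> complex) \<Rightarrow> nat \<Rightarrow> nat \<Rightarrow> complex" where
  "adj B i j = cnj (B j i)"

text \<open>Phrased with squared norms, so that no square roots occur; the sign of \<open>u\<close>
  is then immaterial, which is why some lemmas below ask for \<open>u \<ge> 0\<close>.\<close>

definition op_bound :: "nat \<Rightarrow> (nat \<Rightarrow> nat \<Rightarrow> complex) \<Rightarrow> real \<Rightarrow> bool" where
  "op_bound m B u \<longleftrightarrow> (\<forall>a. nrm2 m (app m B a) \<le> u\<^sup>2 * nrm2 m a)"

definition cgauss_vec :: "nat \<Rightarrow> (nat \<Rightarrow> complex) measure" where
  "cgauss_vec m = PiM {..<m} (\<lambda>_. cgauss)"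

lemma prob_space_cgauss_vec: "prob_space (cgauss_vec m)"
  unfolding cgauss_vec_def by (rule prob_space_PiM_cgauss)

interpretation cgv: prob_space "cgauss_vec m" for m by (rule prob_space_cgauss_vec)

lemma sets_cgauss_vec [measurable_cong]: "sets (cgauss_vec m) = sets (PiM {..<m} (\<lambda>_. borel))"
  unfolding cgauss_vec_def by (intro sets_PiM_cong) auto

lemma nrm2_nonneg [simp]: "nrm2 m v \<ge> 0"
  by (simp add: nrm2_def sum_nonneg)

lemma rip_self: "rip m v v = nrm2 m v"
  by (auto simp: rip_def nrm2_def cmod_power2 intro!: sum.cong) (simp add: power2_eq_square)

lemma rip_commute: "rip m v w = rip m w v"
  by (simp add: rip_def mult.commute)

lemma rip_add_left: "rip m (\<lambda>i. v i + w i) z = rip m v z + rip m w z"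
  by (simp add: rip_def sum.distrib[symmetric] algebra_simps)

lemma rip_diff_left: "rip m (\<lambda>i. v i - w i) z = rip m v z - rip m w z"
  by (simp add: rip_def sum_subtractf[symmetric] algebra_simps)

lemma rip_Cauchy_Schwarz: "(rip m v w)\<^sup>2 \<le> nrm2 m v * nrm2 m w"
proof -
  have "\<bar>rip m v w\<bar> \<le> (\<Sum>i<m. cmod (v i) * cmod (w i))"
    unfolding rip_def
    by (rule order_trans[OF sum_abs]) (intro sum_mono, metis abs_Re_le_cmod norm_mult complex_mod_cnj)
  then have "\<bar>rip m v w\<bar>\<^sup>2 \<le> (\<Sum>i<m. cmod (v i) * cmod (w i))\<^sup>2"
    by (intro power_mono) auto
  also have "\<dots> \<le> nrm2 m v * nrm2 m w"
    unfolding nrm2_def by (rule Cauchy_Schwarz_ineq_sum)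
  finally show ?thesis by simp
qed

lemma nrm2_add: "nrm2 m (\<lambda>i. v i + w i) = nrm2 m v + 2 * rip m v w + nrm2 m w"
  by (simp add: rip_self[symmetric] rip_add_left rip_commute[of m _ "\<lambda>i. v i + w i"] rip_commute[of m w v])

lemma nrm2_diff: "nrm2 m (\<lambda>i. v i - w i) = nrm2 m v - 2 * rip m v w + nrm2 m w"
  by (simp add: rip_self[symmetric] rip_diff_left rip_commute[of m _ "\<lambda>i. v i - w i"] rip_commute[of m w v])

lemma app_diff: "app m (\<lambda>i j. B i j - C i j) a i = app m B a i - app m C a i"
  by (simp add: app_def left_diff_distrib sum_subtractf)

text \<open>For fixed \<open>c\<close> this displays the form as a linear functional of
  \<open>a\<close> in the shape that \<open>PiM_cgauss_moment\<close> treats.\<close>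

lemma rip_app_adj: "rip m (app m B a) c = (\<Sum>j<m. Re (a j * cnj (app m (adj B) c j)))"
proof -
  have "rip m (app m B a) c = (\<Sum>i<m. \<Sum>j<m. Re (B i j * a j * cnj (c i)))"
    by (simp add: rip_def app_def sum_distrib_right)
  also have "\<dots> = (\<Sum>j<m. \<Sum>i<m. Re (B i j * a j * cnj (c i)))"
    by (rule sum.swap)
  also have "\<dots> = (\<Sum>j<m. Re (a j * cnj (app m (adj B) c j)))"
    by (simp add: app_def adj_def sum_distrib_left mult_ac)
  finally show ?thesis .
qed

lemma rip_adjoint: "rip m (app m B a) c = rip m a (app m (adj B) c)"
  by (simp only: rip_app_adj) (simp add: rip_def)

text \<open>With x the squared norm of \<open>adj B\<close> applied to \<open>c\<close>, adjointness
  and Cauchy-Schwarz give x^2 at most u^2 x times the squared norm of \<open>c\<close>; then x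
  cancels.\<close>

lemma op_bound_adj:
  assumes "op_bound m B u"
  shows "op_bound m (adj B) u"
  unfolding op_bound_def
proof
  fix c
  define x where "x = nrm2 m (app m (adj B) c)"
  have "x = rip m (app m B (app m (adj B) c)) c"
    using rip_adjoint[of m B "app m (adj B) c" c] by (simp add: x_def rip_self)
  then have "x\<^sup>2 \<le> nrm2 m (app m B (app m (adj B) c)) * nrm2 m c"
    using rip_Cauchy_Schwarz by simp
  also have "\<dots> \<le> (u\<^sup>2 * x) * nrm2 m c"
    using assms by (intro mult_right_mono) (auto simp: op_bound_def x_def)
  finally have "x * x \<le> (u\<^sup>2 * nrm2 m c) * x" by (simp add: power2_eq_square mult_ac)
  moreover have "x \<ge> 0" by (simp add: x_def)
  ultimately show "nrm2 m (app m (adj B) c) \<le> u\<^sup>2 * nrm2 m c"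
    unfolding x_def[symmetric] by (cases "x = 0") auto
qed

lemma measurable_cnj [measurable (raw)]:
  assumes "f \<in> borel_measurable M"
  shows "(\<lambda>x. cnj (f x)) \<in> borel_measurable M"
proof -
  have "cnj \<in> borel_measurable borel" by (intro borel_measurable_continuous_onI continuous_intros)
  then show ?thesis using assms by (rule measurable_compose[rotated])
qed

lemma app_measurable [measurable (raw)]:
  assumes "f \<in> N \<rightarrow>\<^sub>M PiM {..<m} (\<lambda>_. borel)"
  shows "(\<lambda>w. app m B (f w) i) \<in> borel_measurable N"
  unfolding app_def using assms by measurable

definition max_norm :: "nat \<Rightarrow> 'x set \<Rightarrow> ('x \<Rightarrow> nat \<Rightarrow> nat \<Rightarrow> complex) \<Rightarrow> (nat \<Rightarrow> complex) \<Rightarrow> real" where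
  "max_norm m F A a = sqrt (Max ((\<lambda>x. nrm2 m (app m (A x) a)) ` F))"

lemma max_norm_upper:
  assumes "finite F" "x \<in> F"
  shows "nrm2 m (app m (A x) a) \<le> (max_norm m F A a)\<^sup>2"
proof -
  have *: "nrm2 m (app m (A x) a) \<le> Max ((\<lambda>x. nrm2 m (app m (A x) a)) ` F)"
    using assms by (intro Max_ge) auto
  then have "0 \<le> Max ((\<lambda>x. nrm2 m (app m (A x) a)) ` F)"
    by (rule order_trans[rotated]) simp
  with * show ?thesis by (simp add: max_norm_def)
qed

lemma max_norm_attained:
  assumes "finite F" "F \<noteq> {}"
  obtains x where "x \<in> F" "(max_norm m F A a)\<^sup>2 = nrm2 m (app m (A x) a)"
proof -
  have "Max ((\<lambda>x. nrm2 m (app m (A x) a)) ` F) \<in> (\<lambda>x. nrm2 m (app m (A x) a)) ` F"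
    using assms by (intro Max_in) auto
  then obtain x where "x \<in> F" "Max ((\<lambda>x. nrm2 m (app m (A x) a)) ` F) = nrm2 m (app m (A x) a)"
    by auto
  then show ?thesis using that[of x] by (simp add: max_norm_def)
qed

lemma max_norm_nonneg:
  assumes "finite F" "F \<noteq> {}"
  shows "0 \<le> max_norm m F A a"
proof -
  obtain x where "x \<in> F" using assms by auto
  then have "nrm2 m (app m (A x) a) \<le> Max ((\<lambda>x. nrm2 m (app m (A x) a)) ` F)"
    using assms by (intro Max_ge) auto
  then have "0 \<le> Max ((\<lambda>x. nrm2 m (app m (A x) a)) ` F)"
    by (rule order_trans[rotated]) simp
  then show ?thesis by (simp add: max_norm_def)
qed

lemma max_norm_measurable [measurable (raw)]:
  assumes "finite F" "f \<in> N \<rightarrow>\<^sub>M PiM {..<m} (\<lambda>_. borel)"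
  shows "(\<lambda>w. max_norm m F A (f w)) \<in> borel_measurable N"
  unfolding max_norm_def nrm2_def using assms by measurable

definition chaos_moment :: "nat \<Rightarrow> nat \<Rightarrow> 'x set \<Rightarrow> ('x \<Rightarrow> nat \<Rightarrow> nat \<Rightarrow> complex) \<Rightarrow> ennreal" where
  "chaos_moment p m F A = (\<integral>\<^sup>+a. \<integral>\<^sup>+b. (SUP x\<in>F. ennreal (\<bar>rip m (app m (A x) a) (app m (A x) b)\<bar> ^ p)) \<partial>cgauss_vec m \<partial>cgauss_vec m)"

lemma rip_app_moment:
  assumes u: "op_bound m B u" and q: "q \<ge> 1" and c: "nrm2 m c \<le> N\<^sup>2"
  shows "(\<integral>\<^sup>+a. ennreal (rip m (app m B a) c ^ (2 * q)) \<partial>cgauss_vec m) \<le> ennreal ((2 * exp 1 * q * (u\<^sup>2 * N\<^sup>2)) ^ q)"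
proof -
  have "nrm2 m (app m (adj B) c) \<le> u\<^sup>2 * nrm2 m c"
    using op_bound_adj[OF u] by (simp add: op_bound_def)
  also have "\<dots> \<le> u\<^sup>2 * N\<^sup>2" using c by (intro mult_left_mono) auto
  finally have n: "(\<Sum>j<m. (cmod (app m (adj B) c j))\<^sup>2) \<le> u\<^sup>2 * N\<^sup>2" by (simp add: nrm2_def)
  have "(\<integral>\<^sup>+a. ennreal (rip m (app m B a) c ^ (2 * q)) \<partial>cgauss_vec m) \<le>
      ennreal ((2 * exp 1 * q * (\<Sum>j<m. (cmod (app m (adj B) c j))\<^sup>2)) ^ q)"
    unfolding rip_app_adj cgauss_vec_def using q by (intro PiM_cgauss_moment) auto
  also have "\<dots> \<le> ennreal ((2 * exp 1 * q * (u\<^sup>2 * N\<^sup>2)) ^ q)"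
    using n by (intro ennreal_leI power_mono mult_left_mono) (auto intro!: mult_nonneg_nonneg sum_nonneg)
  finally show ?thesis .
qed

text \<open>The approximations stay in \<open>F\<close> because increments are conditioned on
  vectors \<open>A (\<pi> r x) b\<close>, whose norms must be bounded by the maximum over
  \<open>F\<close>. The number \<open>q r\<close> has two roles: \<open>exp (q r)\<close> bounds the
  number of links at level \<open>r\<close>, and \<open>2 * q r\<close> is the moment order used
  there. The condition \<open>p \<le> 2 * q r\<close> lets this moment dominate the p-th one, and
  \<open>r + 1 \<le> q r\<close> makes the sum over the levels converge.\<close>

locale chain =
  fixes m p R :: nat and F :: "'x set" and A :: "'x \<Rightarrow> nat \<Rightarrow> nat \<Rightarrow> complex"
    and \<pi> :: "nat \<Rightarrow> 'x \<Rightarrow> 'x" and u :: "nat \<Rightarrow> real" and q :: "nat \<Rightarrow> nat"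
  assumes F: "finite F" "F \<noteq> {}"
    and \<pi>F: "\<And>r x. x \<in> F \<Longrightarrow> r \<le> R \<Longrightarrow> \<pi> r x \<in> F"
    and \<pi>0: "\<And>x a. x \<in> F \<Longrightarrow> nrm2 m (app m (A (\<pi> 0 x)) a) = 0"
    and \<pi>R: "\<And>x. x \<in> F \<Longrightarrow> \<pi> R x = x"
    and u: "\<And>r. r < R \<Longrightarrow> u r > 0"
    and inc: "\<And>r x. x \<in> F \<Longrightarrow> r < R \<Longrightarrow> op_bound m (\<lambda>i j. A (\<pi> (Suc r) x) i j - A (\<pi> r x) i j) (u r)"
    and crd: "\<And>r. r < R \<Longrightarrow> real (card ((\<lambda>x. (\<pi> r x, \<pi> (Suc r) x)) ` F)) \<le> exp (q r)"
    and q: "\<And>r. r < R \<Longrightarrow> r + 1 \<le> q r" "\<And>r. r < R \<Longrightarrow> p \<le> 2 * q r"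
    and p: "p \<ge> 1"
begin

definition pairs :: "nat \<Rightarrow> ('x \<times> 'x) set" where
  "pairs r = (\<lambda>x. (\<pi> r x, \<pi> (Suc r) x)) ` F"

definition dif :: "'x \<times> 'x \<Rightarrow> nat \<Rightarrow> nat \<Rightarrow> complex" where
  "dif k = (\<lambda>i j. A (snd k) i j - A (fst k) i j)"

definition \<alpha> :: "nat \<Rightarrow> real" where
  "\<alpha> r = exp 1 * sqrt (2 * exp 1 * q r) * u r"

abbreviation "N \<equiv> max_norm m F A"

text \<open>One random variable that dominates all normalized increments at once. \<open>c\<close>
  holds the conditioning vectors, functions of the other Gaussian vector, and \<open>n\<close> is a
  bound on their norms.\<close>

definition Z :: "(nat \<Rightarrow> 'x \<times> 'x \<Rightarrow> nat \<Rightarrow> complex) \<Rightarrow> real \<Rightarrow> (nat \<Rightarrow> complex) \<Rightarrow> real" where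
  "Z c n a = 1 + (\<Sum>r<R. \<Sum>k\<in>pairs r. (rip m (app m (dif k) a) (c r k) / (\<alpha> r * n)) ^ (2 * q r))"

lemma N_measurable [measurable (raw)]:
  "f \<in> M \<rightarrow>\<^sub>M PiM {..<m} (\<lambda>_. borel) \<Longrightarrow> (\<lambda>w. N (f w)) \<in> borel_measurable M"
  using F(1) by (rule max_norm_measurable)

lemma \<alpha>_pos: "r < R \<Longrightarrow> \<alpha> r > 0"
  using u[of r] q(1)[of r] by (simp add: \<alpha>_def)

lemma finite_pairs: "finite (pairs r)"
  using F by (simp add: pairs_def)

lemma dif_bound: "r < R \<Longrightarrow> k \<in> pairs r \<Longrightarrow> op_bound m (dif k) (u r)"
  using inc by (auto simp: pairs_def dif_def)

lemma Z_measurable [measurable]: "Z c n \<in> borel_measurable (cgauss_vec m)"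
  unfolding Z_def[abs_def] rip_def by measurable

text \<open>The normalization by \<open>\<alpha> r\<close> makes every increment at level \<open>r\<close> contribute at most \<open>exp (-2 * q r)\<close>,
  which beats the number of increments at that level.\<close>

lemma Z_expectation:
  assumes c: "\<And>r k. r < R \<Longrightarrow> k \<in> pairs r \<Longrightarrow> nrm2 m (c r k) \<le> n\<^sup>2" and n: "n \<ge> 0"
  shows "(\<integral>\<^sup>+a. ennreal (Z c n a) \<partial>cgauss_vec m) \<le> 2"
proof -
  have term_le: "(\<integral>\<^sup>+a. ennreal ((rip m (app m (dif k) a) (c r k) / (\<alpha> r * n)) ^ (2 * q r)) \<partial>cgauss_vec m) \<le> ennreal (exp (- 2 * real (q r)))"
    if r: "r < R" and k: "k \<in> pairs r" for r k
  proof (cases "n = 0")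
    case True
    \<comment> \<open>Division by \<open>n = 0\<close> gives 0, and its power is 0 because
      \<open>q r\<close> is positive.\<close>
    then show ?thesis using q(1)[OF r] by (simp add: power_0_left)
  next
    case False
    then have n: "n > 0" using n by simp
    have q1: "q r \<ge> 1" using q(1)[OF r] by simp
    define X where "X a = rip m (app m (dif k) a) (c r k)" for a
    have [measurable]: "X \<in> borel_measurable (cgauss_vec m)" unfolding X_def[abs_def] rip_def by measurable
    have an: "\<alpha> r * n > 0" using \<alpha>_pos[OF r] n by simp
    have "(\<integral>\<^sup>+a. ennreal ((X a / (\<alpha> r * n)) ^ (2 * q r)) \<partial>cgauss_vec m) =
      (\<integral>\<^sup>+a. ennreal (1 / (\<alpha> r * n) ^ (2 * q r)) * ennreal (X a ^ (2 * q r)) \<partial>cgauss_vec m)"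
      using an by (simp add: power_divide ennreal_mult'[symmetric])
    also have "\<dots> = ennreal (1 / (\<alpha> r * n) ^ (2 * q r)) * (\<integral>\<^sup>+a. ennreal (X a ^ (2 * q r)) \<partial>cgauss_vec m)"
      by (rule nn_integral_cmult) measurable
    also have "\<dots> \<le> ennreal (1 / (\<alpha> r * n) ^ (2 * q r)) * ennreal ((2 * exp 1 * q r * ((u r)\<^sup>2 * n\<^sup>2)) ^ q r)"
      unfolding X_def by (intro mult_left_mono rip_app_moment dif_bound q1 c r k) auto
    also have "\<dots> = ennreal ((2 * exp 1 * q r * ((u r)\<^sup>2 * n\<^sup>2) / (\<alpha> r * n)\<^sup>2) ^ q r)"
      using an by (simp add: ennreal_mult'[symmetric] power_divide power_mult)
    also have "2 * exp 1 * q r * ((u r)\<^sup>2 * n\<^sup>2) / (\<alpha> r * n)\<^sup>2 = exp (- 2)"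
    proof -
      have "(\<alpha> r * n)\<^sup>2 = (exp 1)\<^sup>2 * (2 * exp 1 * q r * ((u r)\<^sup>2 * n\<^sup>2))"
        by (simp add: \<alpha>_def power_mult_distrib)
      moreover have "2 * exp 1 * q r * ((u r)\<^sup>2 * n\<^sup>2) > 0" using q1 u[OF r] n by simp
      moreover have "y / (E * y) = 1 / E" if "y > 0" for y E :: real using that by simp
      ultimately have "2 * exp 1 * q r * ((u r)\<^sup>2 * n\<^sup>2) / (\<alpha> r * n)\<^sup>2 = 1 / (exp 1)\<^sup>2" by presburger
      also have "\<dots> = exp (- 2)" by (simp add: exp_double[symmetric] exp_minus inverse_eq_divide)
      finally show ?thesis .
    qed
    also have "exp (- 2) ^ q r = exp (- 2 * real (q r))"
      by (simp add: exp_of_nat_mult[symmetric] mult.commute)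
    finally show ?thesis by (simp add: X_def)
  qed
  have "(\<integral>\<^sup>+a. ennreal (Z c n a) \<partial>cgauss_vec m) =
    1 + (\<Sum>r<R. \<Sum>k\<in>pairs r. (\<integral>\<^sup>+a. ennreal ((rip m (app m (dif k) a) (c r k) / (\<alpha> r * n)) ^ (2 * q r)) \<partial>cgauss_vec m))"
  proof -
    have [measurable]: "(\<lambda>a. ennreal ((rip m (app m (dif k) a) (c r k) / (\<alpha> r * n)) ^ (2 * q r))) \<in> borel_measurable (cgauss_vec m)" for r k
      unfolding rip_def by measurable
    have "ennreal (Z c n a) = 1 + (\<Sum>r<R. \<Sum>k\<in>pairs r. ennreal ((rip m (app m (dif k) a) (c r k) / (\<alpha> r * n)) ^ (2 * q r)))" for a
      unfolding Z_def by (simp add: sum_nonneg sum_ennreal[symmetric] ennreal_plus del: sum_ennreal)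
    then show ?thesis
      by (simp add: nn_integral_add nn_integral_sum cgv.emeasure_space_1 del: sum_ennreal)
        (intro sum.cong refl nn_integral_sum, measurable)
  qed
  also have "\<dots> \<le> 1 + (\<Sum>r<R. \<Sum>k\<in>pairs r. ennreal (exp (- 2 * real (q r))))"
    by (intro add_mono sum_mono term_le) auto
  also have "\<dots> = ennreal (1 + (\<Sum>r<R. real (card (pairs r)) * exp (- 2 * real (q r))))"
    by (simp add: sum_nonneg sum_ennreal[symmetric] ennreal_mult' ennreal_of_nat_eq_real_of_nat)
  also have "\<dots> \<le> ennreal 2"
  proof (rule ennreal_leI)
    have "(\<Sum>r<R. real (card (pairs r)) * exp (- 2 * real (q r))) \<le> (\<Sum>r<R. (1 / 2) ^ Suc r)"
    proof (rule sum_mono)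
      fix r assume "r \<in> {..<R}"
      then have r: "r < R" by simp
      have "real (card (pairs r)) * exp (- 2 * real (q r)) \<le> exp (q r) * exp (- 2 * real (q r))"
        using crd[OF r] by (intro mult_right_mono) (auto simp: pairs_def)
      also have "\<dots> = exp (- real (q r))" by (simp add: exp_add[symmetric])
      also have "\<dots> \<le> exp (- real (Suc r))" using q(1)[OF r] by simp
      also have "\<dots> = exp (- 1) ^ Suc r" by (subst exp_of_nat_mult[symmetric]) simp
      also have "\<dots> \<le> (1 / 2) ^ Suc r"
        using exp_ge_add_one_self[of 1] by (intro power_mono) (auto simp: exp_minus field_simps)
      finally show "real (card (pairs r)) * exp (- 2 * real (q r)) \<le> (1 / 2) ^ Suc r" .
    qed
    also have "\<dots> = 1 - (1 / 2) ^ R" by (induction R) (auto simp: field_simps)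
    also have "\<dots> \<le> 1" by simp
    finally show "1 + (\<Sum>r<R. real (card (pairs r)) * exp (- 2 * real (q r))) \<le> 2" by simp
  qed
  finally show ?thesis by simp
qed

lemma Z_ge_1: "Z c n a \<ge> 1"
  by (simp add: Z_def sum_nonneg)

text \<open>For the normalized increment \<open>t\<close>, \<open>p \<le> 2 * q r\<close> gives that
  the p-th power of its modulus is at most \<open>1 + t ^ (2 * q r)\<close>, and both summands occur
  in \<open>Z\<close>. Thus a single p-th root controls all levels although their moment orders
  differ.\<close>

lemma increment_le_Z:
  assumes r: "r < R" and k: "k \<in> pairs r" and c: "nrm2 m (c r k) \<le> n\<^sup>2" and n: "n \<ge> 0"
  shows "\<bar>rip m (app m (dif k) a) (c r k)\<bar> \<le> \<alpha> r * n * root p (Z c n a)"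
proof (cases "n = 0")
  case True
  have "(rip m (app m (dif k) a) (c r k))\<^sup>2 \<le> nrm2 m (app m (dif k) a) * nrm2 m (c r k)"
    by (rule rip_Cauchy_Schwarz)
  moreover have "nrm2 m (c r k) = 0" using c True by (intro antisym) auto
  ultimately have "(rip m (app m (dif k) a) (c r k))\<^sup>2 \<le> 0" by simp
  then show ?thesis using True by simp
next
  case False
  define t where "t = rip m (app m (dif k) a) (c r k) / (\<alpha> r * n)"
  have an: "\<alpha> r * n > 0" using \<alpha>_pos[OF r] n False by simp
  have "\<bar>t\<bar> ^ p \<le> 1 + t ^ (2 * q r)"
  proof (cases "\<bar>t\<bar> \<le> 1")
    case True
    then have "\<bar>t\<bar> ^ p \<le> 1" by (simp add: power_le_one)
    then show ?thesis using zero_le_even_power'[of t "q r"] by linarith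
  next
    case False
    then have "\<bar>t\<bar> ^ p \<le> \<bar>t\<bar> ^ (2 * q r)" using q(2)[OF r] by (intro power_increasing) auto
    then show ?thesis by (simp add: power_even_abs)
  qed
  also have "1 + t ^ (2 * q r) \<le> Z c n a"
  proof -
    have "t ^ (2 * q r) \<le> (\<Sum>k\<in>pairs r. (rip m (app m (dif k) a) (c r k) / (\<alpha> r * n)) ^ (2 * q r))"
      unfolding t_def using k finite_pairs by (intro member_le_sum) auto
    also have "\<dots> \<le> (\<Sum>r<R. \<Sum>k\<in>pairs r. (rip m (app m (dif k) a) (c r k) / (\<alpha> r * n)) ^ (2 * q r))"
      using r by (intro member_le_sum) (auto intro!: sum_nonneg)
    finally show ?thesis by (simp add: Z_def)
  qed
  finally have "\<bar>t\<bar> ^ p \<le> Z c n a" .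
  then have "root p (\<bar>t\<bar> ^ p) \<le> root p (Z c n a)" using p by (subst real_root_le_iff) auto
  then have "\<bar>t\<bar> \<le> root p (Z c n a)" using p by (simp add: real_root_power_cancel)
  then have "(\<alpha> r * n) * \<bar>t\<bar> \<le> (\<alpha> r * n) * root p (Z c n a)" using an by (intro mult_left_mono) auto
  moreover have "\<bar>rip m (app m (dif k) a) (c r k)\<bar> = (\<alpha> r * n) * \<bar>t\<bar>"
  proof -
    have "rip m (app m (dif k) a) (c r k) = (\<alpha> r * n) * t" using \<alpha>_pos[OF r] False by (simp add: t_def)
    then show ?thesis by (metis abs_mult abs_of_pos an)
  qed
  ultimately show ?thesis by simp
qed

text \<open>The bilinear form is telescoped along the chain. A difference of consecutive forms
  splits into \<open>dif\<close> applied to \<open>a\<close> against the finer operator at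
  \<open>b\<close>, plus the coarser operator at \<open>a\<close> against \<open>dif\<close> applied
  to \<open>b\<close>; hence \<open>snd\<close> in \<open>cb\<close> and \<open>fst\<close> in
  \<open>ca\<close>. Each part is linear in one vector when the other is fixed.\<close>

lemma chaos_pointwise:
  assumes x: "x \<in> F"
  defines "cb b \<equiv> \<lambda>r k. app m (A (snd k)) b" and "ca a \<equiv> \<lambda>r k. app m (A (fst k)) a"
  shows "\<bar>rip m (app m (A x) a) (app m (A x) b)\<bar> ^ p \<le>
    (2 * (\<Sum>r<R. \<alpha> r)) ^ p * (N b ^ p * Z (cb b) (N b) a + N a ^ p * Z (ca a) (N a) b)"
proof -
  define S where "S = (\<Sum>r<R. \<alpha> r)"
  have S: "S \<ge> 0" unfolding S_def using \<alpha>_pos by (intro sum_nonneg) (auto simp: less_imp_le)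
  define B where "B = N b * root p (Z (cb b) (N b) a)"
  define B' where "B' = N a * root p (Z (ca a) (N a) b)"
  have N0: "N v \<ge> 0" for v using max_norm_nonneg F by blast
  have rt: "root p (Z c n v) \<ge> 0" for c n v using Z_ge_1[of c n v] by (simp add: real_root_ge_zero)
  have B0: "B \<ge> 0" "B' \<ge> 0" using N0 rt by (auto simp: B_def B'_def)
  define f where "f r = rip m (app m (A (\<pi> r x)) a) (app m (A (\<pi> r x)) b)" for r
  have f0: "f 0 = 0"
    using rip_Cauchy_Schwarz[of m "app m (A (\<pi> 0 x)) a" "app m (A (\<pi> 0 x)) b"] \<pi>0[OF x] by (simp add: f_def)
  have "\<bar>f (Suc r) - f r\<bar> \<le> \<alpha> r * (B + B')" if r: "r < R" for r
  proof -
    define k where "k = (\<pi> r x, \<pi> (Suc r) x)"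
    have k: "k \<in> pairs r" using x by (auto simp: k_def pairs_def)
    have "app m (dif k) v = (\<lambda>i. app m (A (\<pi> (Suc r) x)) v i - app m (A (\<pi> r x)) v i)" for v
      by (simp add: dif_def k_def app_diff[abs_def] fun_eq_iff)
    then have "f (Suc r) - f r = rip m (app m (dif k) a) (cb b r k) + rip m (app m (dif k) b) (ca a r k)"
      by (simp add: f_def cb_def ca_def k_def rip_diff_left rip_commute[of m "app m (A (\<pi> (Suc r) x)) b"] rip_commute[of m "app m (A (\<pi> r x)) b"])
    moreover have "\<bar>rip m (app m (dif k) a) (cb b r k)\<bar> \<le> \<alpha> r * N b * root p (Z (cb b) (N b) a)"
      using r x by (intro increment_le_Z[OF r k]) (auto simp: cb_def k_def intro!: max_norm_upper F \<pi>F N0)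
    moreover have "\<bar>rip m (app m (dif k) b) (ca a r k)\<bar> \<le> \<alpha> r * N a * root p (Z (ca a) (N a) b)"
      using r x by (intro increment_le_Z[OF r k]) (auto simp: ca_def k_def intro!: max_norm_upper F \<pi>F N0)
    ultimately show ?thesis by (simp add: B_def B'_def distrib_left mult.assoc)
  qed
  then have "(\<Sum>r<R. \<bar>f (Suc r) - f r\<bar>) \<le> (\<Sum>r<R. \<alpha> r * (B + B'))"
    by (intro sum_mono) auto
  moreover have "\<bar>f R\<bar> \<le> (\<Sum>r<R. \<bar>f (Suc r) - f r\<bar>)"
    using sum_abs[of "\<lambda>r. f (Suc r) - f r" "{..<R}"] f0 by (simp add: sum_lessThan_telescope)
  ultimately have "\<bar>f R\<bar> \<le> S * (B + B')"
    by (simp only: S_def sum_distrib_right)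
  then have "\<bar>f R\<bar> ^ p \<le> (S * (B + B')) ^ p" by (intro power_mono) auto
  also have "\<dots> \<le> (S * (2 * max B B')) ^ p" using B0 S by (intro power_mono mult_left_mono) auto
  also have "\<dots> = (2 * S) ^ p * (max B B') ^ p" by (simp add: power_mult_distrib)
  also have "\<dots> \<le> (2 * S) ^ p * (B ^ p + B' ^ p)" using B0 S by (intro mult_left_mono) (auto simp: max_def)
  also have "B ^ p = N b ^ p * Z (cb b) (N b) a"
    using p Z_ge_1[of "cb b" "N b" a] by (simp add: B_def power_mult_distrib)
  also have "B' ^ p = N a ^ p * Z (ca a) (N a) b"
    using p Z_ge_1[of "ca a" "N a" b] by (simp add: B'_def power_mult_distrib)
  finally show ?thesis using x by (simp add: f_def \<pi>R S_def)
qed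

text \<open>The conditioning vectors in the first summand depend on \<open>b\<close> alone, so
  integrating over \<open>a\<close> first replaces \<open>Z\<close> by 2 and leaves the power of
  \<open>N b\<close>. The second summand is symmetric; together they give the factor 4.\<close>

lemma chaos_moment_le_max_norm:
  "chaos_moment p m F A \<le> ennreal (4 * (2 * (\<Sum>r<R. \<alpha> r)) ^ p) * (\<integral>\<^sup>+a. ennreal (max_norm m F A a ^ p) \<partial>cgauss_vec m)"
proof -
  define T where "T = (2 * (\<Sum>r<R. \<alpha> r)) ^ p"
  have T: "T \<ge> 0" unfolding T_def using \<alpha>_pos by (intro zero_le_power mult_nonneg_nonneg sum_nonneg) (auto simp: less_imp_le)
  define cb where "cb b = (\<lambda>(r :: nat) (k :: 'x \<times> 'x). app m (A (snd k)) b)" for b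
  define ca where "ca a = (\<lambda>(r :: nat) (k :: 'x \<times> 'x). app m (A (fst k)) a)" for a
  let ?P = "cgauss_vec m"
  interpret PP: pair_sigma_finite ?P ?P ..
  have N0: "N v \<ge> 0" for v using max_norm_nonneg F by blast
  have [measurable]: "N \<in> borel_measurable ?P" using F by measurable
  have Zm: "(\<lambda>(a, b). Z (cb b) (N b) a) \<in> borel_measurable (?P \<Otimes>\<^sub>M ?P)"
    "(\<lambda>(a, b). Z (ca a) (N a) b) \<in> borel_measurable (?P \<Otimes>\<^sub>M ?P)"
    unfolding Z_def rip_def cb_def ca_def split_beta' using F by measurable
  have [measurable (raw)]: "(\<lambda>x. Z (cb (g x)) (N (g x)) (f x)) \<in> borel_measurable M"
      "(\<lambda>x. Z (ca (f x)) (N (f x)) (g x)) \<in> borel_measurable M"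
    if "f \<in> M \<rightarrow>\<^sub>M PiM {..<m} (\<lambda>_. borel)" "g \<in> M \<rightarrow>\<^sub>M PiM {..<m} (\<lambda>_. borel)" for f g and M :: "'z measure"
  proof -
    have "f \<in> M \<rightarrow>\<^sub>M ?P" "g \<in> M \<rightarrow>\<^sub>M ?P" using that by measurable
    note p = measurable_Pair[OF this]
    show "(\<lambda>x. Z (cb (g x)) (N (g x)) (f x)) \<in> borel_measurable M" "(\<lambda>x. Z (ca (f x)) (N (f x)) (g x)) \<in> borel_measurable M"
      using measurable_compose[OF p Zm(1)] measurable_compose[OF p Zm(2)] by simp_all
  qed
  have Z1: "(\<integral>\<^sup>+a. ennreal (Z (cb b) (N b) a) \<partial>?P) \<le> 2" for b
    using N0 \<pi>F by (intro Z_expectation) (auto simp: cb_def pairs_def intro!: max_norm_upper F)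
  have Z2: "(\<integral>\<^sup>+b. ennreal (Z (ca a) (N a) b) \<partial>?P) \<le> 2" for a
    using N0 \<pi>F by (intro Z_expectation) (auto simp: ca_def pairs_def intro!: max_norm_upper F)
  have i1: "(\<integral>\<^sup>+a. \<integral>\<^sup>+b. ennreal (N b ^ p * Z (cb b) (N b) a) \<partial>?P \<partial>?P) \<le> 2 * (\<integral>\<^sup>+b. ennreal (N b ^ p) \<partial>?P)"
  proof -
    have "(\<integral>\<^sup>+a. \<integral>\<^sup>+b. ennreal (N b ^ p * Z (cb b) (N b) a) \<partial>?P \<partial>?P) = (\<integral>\<^sup>+b. \<integral>\<^sup>+a. ennreal (N b ^ p * Z (cb b) (N b) a) \<partial>?P \<partial>?P)"
      by (rule PP.Fubini') (simp add: split_beta')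
    also have "\<dots> = (\<integral>\<^sup>+b. ennreal (N b ^ p) * (\<integral>\<^sup>+a. ennreal (Z (cb b) (N b) a) \<partial>?P) \<partial>?P)"
      using N0 by (subst nn_integral_cmult[symmetric]) (auto simp: ennreal_mult')
    also have "\<dots> \<le> (\<integral>\<^sup>+b. ennreal (N b ^ p) * 2 \<partial>?P)"
      by (intro nn_integral_mono mult_left_mono Z1) auto
    also have "\<dots> = 2 * (\<integral>\<^sup>+b. ennreal (N b ^ p) \<partial>?P)"
      by (subst nn_integral_multc) (auto simp: mult.commute)
    finally show ?thesis .
  qed
  have i2: "(\<integral>\<^sup>+a. \<integral>\<^sup>+b. ennreal (N a ^ p * Z (ca a) (N a) b) \<partial>?P \<partial>?P) \<le> 2 * (\<integral>\<^sup>+b. ennreal (N b ^ p) \<partial>?P)"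
  proof -
    have "(\<integral>\<^sup>+a. \<integral>\<^sup>+b. ennreal (N a ^ p * Z (ca a) (N a) b) \<partial>?P \<partial>?P) = (\<integral>\<^sup>+a. ennreal (N a ^ p) * (\<integral>\<^sup>+b. ennreal (Z (ca a) (N a) b) \<partial>?P) \<partial>?P)"
      using N0 by (subst nn_integral_cmult[symmetric]) (auto simp: ennreal_mult')
    also have "\<dots> \<le> (\<integral>\<^sup>+b. ennreal (N b ^ p) * 2 \<partial>?P)"
      by (intro nn_integral_mono mult_left_mono Z2) auto
    also have "\<dots> = 2 * (\<integral>\<^sup>+b. ennreal (N b ^ p) \<partial>?P)"
      by (subst nn_integral_multc) (auto simp: mult.commute)
    finally show ?thesis .
  qed
  have "chaos_moment p m F A \<le> (\<integral>\<^sup>+a. \<integral>\<^sup>+b. ennreal T * (ennreal (N b ^ p * Z (cb b) (N b) a) + ennreal (N a ^ p * Z (ca a) (N a) b)) \<partial>?P \<partial>?P)"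
    unfolding chaos_moment_def
  proof (intro nn_integral_mono SUP_least)
    fix a b x assume "x \<in> F"
    have "0 \<le> N b ^ p * Z (cb b) (N b) a" "0 \<le> N a ^ p * Z (ca a) (N a) b"
      using N0 Z_ge_1[of "cb b" "N b" a] Z_ge_1[of "ca a" "N a" b] by auto
    with chaos_pointwise[OF \<open>x \<in> F\<close>, of a b] T
    show "ennreal (\<bar>rip m (app m (A x) a) (app m (A x) b)\<bar> ^ p) \<le> ennreal T * (ennreal (N b ^ p * Z (cb b) (N b) a) + ennreal (N a ^ p * Z (ca a) (N a) b))"
      by (simp add: T_def cb_def ca_def ennreal_plus[symmetric] ennreal_mult'[symmetric] ennreal_leI del: ennreal_plus)
  qed
  also have "\<dots> = ennreal T * ((\<integral>\<^sup>+a. \<integral>\<^sup>+b. ennreal (N b ^ p * Z (cb b) (N b) a) \<partial>?P \<partial>?P) + (\<integral>\<^sup>+a. \<integral>\<^sup>+b. ennreal (N a ^ p * Z (ca a) (N a) b) \<partial>?P \<partial>?P))"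
  proof -
    let ?f = "\<lambda>a b. ennreal (N b ^ p * Z (cb b) (N b) a)" and ?g = "\<lambda>a b. ennreal (N a ^ p * Z (ca a) (N a) b)"
    have "(\<integral>\<^sup>+b. ennreal T * (?f a b + ?g a b) \<partial>?P) = ennreal T * ((\<integral>\<^sup>+b. ?f a b \<partial>?P) + (\<integral>\<^sup>+b. ?g a b \<partial>?P))"
      if a: "a \<in> space ?P" for a
    proof -
      have [measurable]: "(\<lambda>b. Z (cb b) (N b) a) \<in> borel_measurable ?P"
        using measurable_Pair2[OF Zm(1) a] by simp
      show ?thesis by (simp add: nn_integral_cmult nn_integral_add)
    qed
    then have "(\<integral>\<^sup>+a. \<integral>\<^sup>+b. ennreal T * (?f a b + ?g a b) \<partial>?P \<partial>?P) =
       (\<integral>\<^sup>+a. ennreal T * ((\<integral>\<^sup>+b. ?f a b \<partial>?P) + (\<integral>\<^sup>+b. ?g a b \<partial>?P)) \<partial>?P)"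
      by (intro nn_integral_cong)
    also have "\<dots> = ennreal T * ((\<integral>\<^sup>+a. \<integral>\<^sup>+b. ?f a b \<partial>?P \<partial>?P) + (\<integral>\<^sup>+a. \<integral>\<^sup>+b. ?g a b \<partial>?P \<partial>?P))"
    proof -
      have "(\<lambda>(a, b). ?f a b) \<in> borel_measurable (?P \<Otimes>\<^sub>M ?P)" "(\<lambda>(a, b). ?g a b) \<in> borel_measurable (?P \<Otimes>\<^sub>M ?P)"
        by (simp_all add: split_beta')
      from cgv.borel_measurable_nn_integral[OF this(1)] cgv.borel_measurable_nn_integral[OF this(2)]
      show ?thesis by (simp add: nn_integral_cmult nn_integral_add)
    qed
    finally show ?thesis .
  qed
  also have "\<dots> \<le> ennreal T * (2 * (\<integral>\<^sup>+b. ennreal (N b ^ p) \<partial>?P) + 2 * (\<integral>\<^sup>+b. ennreal (N b ^ p) \<partial>?P))"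
    by (intro mult_left_mono add_mono i1 i2) auto
  also have "\<dots> = ennreal (4 * T) * (\<integral>\<^sup>+b. ennreal (N b ^ p) \<partial>?P)"
    using T by (simp add: ennreal_mult' distrib_right[symmetric] mult_ac)
  finally show ?thesis by (simp add: T_def)
qed

end

section \<open>Decoupling and comparison of chaos\<close>

lemma nn_integral_PiM_map:
  fixes \<mu> :: "'i \<Rightarrow> 'b measure"
  assumes J: "finite J" and \<mu>: "\<And>i. prob_space (\<mu> i)"
    and f: "\<And>i. i \<in> J \<Longrightarrow> f i \<in> \<mu> i \<rightarrow>\<^sub>M \<mu> i" and d: "\<And>i. i \<in> J \<Longrightarrow> distr (\<mu> i) (\<mu> i) (f i) = \<mu> i"
    and \<Phi>: "\<Phi> \<in> borel_measurable (PiM J \<mu>)"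
  shows "(\<integral>\<^sup>+w. \<Phi> (\<lambda>i\<in>J. f i (w i)) \<partial>PiM J \<mu>) = (\<integral>\<^sup>+w. \<Phi> w \<partial>PiM J \<mu>)"
proof -
  interpret product_sigma_finite \<mu>
    using \<mu> by (simp add: product_sigma_finite_def prob_space_imp_sigma_finite)
  let ?T = "\<lambda>w. \<lambda>i\<in>J. f i (w i)"
  have T: "?T \<in> PiM J \<mu> \<rightarrow>\<^sub>M PiM J \<mu>"
    using f by (intro measurable_restrict measurable_compose[OF measurable_component_singleton])
  have "distr (PiM J \<mu>) (PiM J \<mu>) ?T = PiM J \<mu>"
  proof (rule PiM_eqI[OF J])
    fix A assume A: "\<And>i. i \<in> J \<Longrightarrow> A i \<in> sets (\<mu> i)"
    have "emeasure (distr (PiM J \<mu>) (PiM J \<mu>) ?T) (PiE J A) = emeasure (PiM J \<mu>) (?T -` PiE J A \<inter> space (PiM J \<mu>))"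
      using A J by (intro emeasure_distr T sets_PiM_I_finite) auto
    also have "?T -` PiE J A \<inter> space (PiM J \<mu>) = PiE J (\<lambda>i. f i -` A i \<inter> space (\<mu> i))"
      by (auto simp: space_PiM PiE_iff)
    also have "emeasure (PiM J \<mu>) \<dots> = (\<Prod>i\<in>J. emeasure (\<mu> i) (f i -` A i \<inter> space (\<mu> i)))"
      using A f by (intro emeasure_PiM J) (auto intro: measurable_sets)
    also have "\<dots> = (\<Prod>i\<in>J. emeasure (\<mu> i) (A i))"
      using A f d by (intro prod.cong refl) (metis emeasure_distr)
    finally show "emeasure (distr (PiM J \<mu>) (PiM J \<mu>) ?T) (PiE J A) = (\<Prod>i\<in>J. emeasure (\<mu> i) (A i))" .
  qed simp
  then show ?thesis using nn_integral_distr[OF T, of \<Phi>] \<Phi> by simp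
qed

lemma distr_cgauss_uminus: "distr cgauss cgauss uminus = cgauss"
proof (rule measure_eqI)
  fix X assume "X \<in> sets (distr cgauss cgauss uminus)"
  then have X[measurable]: "X \<in> sets borel" by simp
  have "emeasure (distr cgauss cgauss uminus) X = (\<integral>\<^sup>+z. indicator X z \<partial>distr cgauss cgauss uminus)"
    by (simp cong: measurable_cong_sets)
  also have "\<dots> = (\<integral>\<^sup>+z. indicator X (- z) \<partial>cgauss)"
    by (rule nn_integral_distr) (auto cong: measurable_cong_sets)
  also have "\<dots> = (\<integral>\<^sup>+z. indicator X z \<partial>cgauss)" by (rule cgauss_uminus) simp
  finally show "emeasure (distr cgauss cgauss uminus) X = emeasure cgauss X" by simp
qed simp

text \<open>The orthogonal map behind decoupling: normalized sum and difference of two independent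
  Gaussians are again independent Gaussians.\<close>

definition rot :: "complex \<times> complex \<Rightarrow> complex \<times> complex" where
  "rot = (\<lambda>(z, w). ((z + w) / of_real (sqrt 2), (z - w) / of_real (sqrt 2)))"

lemma rot_measurable [measurable]: "rot \<in> borel \<Otimes>\<^sub>M borel \<rightarrow>\<^sub>M borel \<Otimes>\<^sub>M borel"
  unfolding rot_def by measurable

lemma distr_cgauss_rot:
  "distr (cgauss \<Otimes>\<^sub>M cgauss) (cgauss \<Otimes>\<^sub>M cgauss) rot = cgauss \<Otimes>\<^sub>M cgauss"
proof (rule measure_eqI)
  have s[measurable_cong]: "sets (cgauss \<Otimes>\<^sub>M cgauss) = sets (borel \<Otimes>\<^sub>M borel)"
    by (intro sets_pair_measure_cong) auto
  fix X assume "X \<in> sets (distr (cgauss \<Otimes>\<^sub>M cgauss) (cgauss \<Otimes>\<^sub>M cgauss) rot)"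
  then have X[measurable]: "X \<in> sets (borel \<Otimes>\<^sub>M borel)" using s by simp
  have m: "(\<lambda>(z, w). indicator X (z, w) :: ennreal) \<in> borel_measurable (borel \<Otimes>\<^sub>M borel)" by simp
  have "emeasure (distr (cgauss \<Otimes>\<^sub>M cgauss) (cgauss \<Otimes>\<^sub>M cgauss) rot) X = (\<integral>\<^sup>+p. indicator X p \<partial>distr (cgauss \<Otimes>\<^sub>M cgauss) (cgauss \<Otimes>\<^sub>M cgauss) rot)"
    using s by simp
  also have "\<dots> = (\<integral>\<^sup>+p. indicator X (rot p) \<partial>(cgauss \<Otimes>\<^sub>M cgauss))"
    by (rule nn_integral_distr) measurable
  also have "\<dots> = (\<integral>\<^sup>+z. \<integral>\<^sup>+w. indicator X (rot (z, w)) \<partial>cgauss \<partial>cgauss)"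
    by (rule cgauss.nn_integral_fst[symmetric]) measurable
  also have "\<dots> = (\<integral>\<^sup>+z. \<integral>\<^sup>+w. indicator X (z, w) \<partial>cgauss \<partial>cgauss)"
    using cgauss_rotate[OF m] by (simp add: rot_def)
  also have "\<dots> = (\<integral>\<^sup>+p. indicator X p \<partial>(cgauss \<Otimes>\<^sub>M cgauss))"
    by (rule cgauss.nn_integral_fst) measurable
  finally show "emeasure (distr (cgauss \<Otimes>\<^sub>M cgauss) (cgauss \<Otimes>\<^sub>M cgauss) rot) X = emeasure (cgauss \<Otimes>\<^sub>M cgauss) X"
    using s by simp
qed simp

lemma cgauss_vec_rotate:
  assumes \<Phi>: "(\<lambda>(a, b). \<Phi> a b) \<in> borel_measurable (cgauss_vec m \<Otimes>\<^sub>M cgauss_vec m)"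
  shows "(\<integral>\<^sup>+a. \<integral>\<^sup>+b. \<Phi> (\<lambda>j\<in>{..<m}. (a j + b j) / of_real (sqrt 2)) (\<lambda>j\<in>{..<m}. (a j - b j) / of_real (sqrt 2))
      \<partial>cgauss_vec m \<partial>cgauss_vec m) = (\<integral>\<^sup>+a. \<integral>\<^sup>+b. \<Phi> a b \<partial>cgauss_vec m \<partial>cgauss_vec m)"
proof -
  let ?J = "{..<m}" and ?P = "PiM {..<m} (\<lambda>_. cgauss \<Otimes>\<^sub>M cgauss)"
  define r where "r a b = (\<lambda>j\<in>?J. (a j + b j) / of_real (sqrt 2) :: complex)" for a b :: "nat \<Rightarrow> complex"
  define s where "s a b = (\<lambda>j\<in>?J. (a j - b j) / of_real (sqrt 2) :: complex)" for a b :: "nat \<Rightarrow> complex"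
  have s2[measurable_cong]: "sets (cgauss \<Otimes>\<^sub>M cgauss) = sets (borel \<Otimes>\<^sub>M borel)"
    by (intro sets_pair_measure_cong) auto
  have rs: "(\<lambda>p. r (fst p) (snd p)) \<in> cgauss_vec m \<Otimes>\<^sub>M cgauss_vec m \<rightarrow>\<^sub>M cgauss_vec m"
    "(\<lambda>p. s (fst p) (snd p)) \<in> cgauss_vec m \<Otimes>\<^sub>M cgauss_vec m \<rightarrow>\<^sub>M cgauss_vec m"
    unfolding r_def s_def
    by (subst measurable_cong_sets[OF refl sets_cgauss_vec], intro measurable_restrict, measurable)+
  have m1: "(\<lambda>(a, b). \<Phi> a b) \<in> borel_measurable (PiM ?J (\<lambda>_. cgauss) \<Otimes>\<^sub>M PiM ?J (\<lambda>_. cgauss))"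
    using \<Phi> by (simp add: cgauss_vec_def)
  have m2: "(\<lambda>(a, b). \<Phi> (r a b) (s a b)) \<in> borel_measurable (PiM ?J (\<lambda>_. cgauss) \<Otimes>\<^sub>M PiM ?J (\<lambda>_. cgauss))"
    using measurable_compose[OF measurable_Pair[OF rs] \<Phi>] by (simp add: cgauss_vec_def split_beta')
  have m3: "(\<lambda>w. \<Phi> (\<lambda>j\<in>?J. fst (w j)) (\<lambda>j\<in>?J. snd (w j))) \<in> borel_measurable ?P"
  proof -
    have "(\<lambda>w. ((\<lambda>j\<in>?J. fst (w j)), (\<lambda>j\<in>?J. snd (w j)))) \<in> ?P \<rightarrow>\<^sub>M PiM ?J (\<lambda>_. cgauss) \<Otimes>\<^sub>M PiM ?J (\<lambda>_. cgauss)"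
      by (intro measurable_Pair measurable_restrict) measurable
    from measurable_compose[OF this m1] show ?thesis by simp
  qed
  have "(\<integral>\<^sup>+a. \<integral>\<^sup>+b. \<Phi> (r a b) (s a b) \<partial>cgauss_vec m \<partial>cgauss_vec m) =
      (\<integral>\<^sup>+w. \<Phi> (r (\<lambda>j\<in>?J. fst (w j)) (\<lambda>j\<in>?J. snd (w j))) (s (\<lambda>j\<in>?J. fst (w j)) (\<lambda>j\<in>?J. snd (w j))) \<partial>?P)"
    unfolding cgauss_vec_def
    by (rule nn_integral_PiM_pair[OF _ prob_space_cgauss prob_space_cgauss m2, symmetric]) simp
  also have "\<dots> = (\<integral>\<^sup>+w. \<Phi> (\<lambda>j\<in>?J. fst ((\<lambda>i\<in>?J. rot (w i)) j)) (\<lambda>j\<in>?J. snd ((\<lambda>i\<in>?J. rot (w i)) j)) \<partial>?P)"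
    by (intro nn_integral_cong arg_cong2[of _ _ _ _ \<Phi>]) (auto simp: r_def s_def rot_def split_beta fun_eq_iff)
  also have "\<dots> = (\<integral>\<^sup>+w. \<Phi> (\<lambda>j\<in>?J. fst (w j)) (\<lambda>j\<in>?J. snd (w j)) \<partial>?P)"
    by (rule nn_integral_PiM_map[where f = "\<lambda>_. rot", OF _ prob_space_pair[OF prob_space_cgauss prob_space_cgauss] _ distr_cgauss_rot m3])
      (auto cong: measurable_cong_sets)
  also have "\<dots> = (\<integral>\<^sup>+a. \<integral>\<^sup>+b. \<Phi> a b \<partial>cgauss_vec m \<partial>cgauss_vec m)"
    unfolding cgauss_vec_def
    by (rule nn_integral_PiM_pair[OF _ prob_space_cgauss prob_space_cgauss m1]) simp
  finally show ?thesis by (simp add: r_def s_def)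
qed

definition flip :: "nat \<Rightarrow> nat \<Rightarrow> (nat \<Rightarrow> complex) \<Rightarrow> nat \<Rightarrow> complex" where
  "flip m i a = (\<lambda>j\<in>{..<m}. if j = i then - a j else a j)"

lemma cgauss_vec_flip:
  assumes \<Phi>: "\<Phi> \<in> borel_measurable (cgauss_vec m)"
  shows "(\<integral>\<^sup>+a. \<Phi> (flip m i a) \<partial>cgauss_vec m) = (\<integral>\<^sup>+a. \<Phi> a \<partial>cgauss_vec m)"
proof -
  have "flip m i a = (\<lambda>j\<in>{..<m}. (if j = i then uminus else (\<lambda>z. z)) (a j))" for a
    by (auto simp: flip_def fun_eq_iff)
  moreover have "distr cgauss cgauss (\<lambda>z. z) = cgauss" by (rule distr_id[unfolded id_def])
  ultimately show ?thesis
    unfolding cgauss_vec_def using \<Phi>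
    by (simp only:, intro nn_integral_PiM_map)
      (auto simp: prob_space_cgauss distr_cgauss_uminus cgauss_vec_def cong: measurable_cong_sets)
qed

section \<open>Second moments, Frobenius norms and crude moment bounds\<close>

lemma std_gauss_sq: "(\<integral>\<^sup>+x. ennreal (x\<^sup>2) \<partial>std_gauss) = 1"
proof -
  have "(\<integral>\<^sup>+x. ennreal (x\<^sup>2) \<partial>std_gauss) = (\<integral>\<^sup>+x. ennreal (std_normal_density x * x\<^sup>2) \<partial>lborel)"
    unfolding std_gauss_def by (subst nn_integral_density) (auto simp: ennreal_mult')
  also have "\<dots> = ennreal (\<integral>x. std_normal_density x * x\<^sup>2 \<partial>lborel)"
    using integrable_std_normal_moment[of 2] by (intro nn_integral_eq_integral) auto
  also have "(\<integral>x. std_normal_density x * x\<^sup>2 \<partial>lborel) = 1"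
    using integral_std_normal_moment_even[of 1] by (simp add: fact_numeral)
  finally show ?thesis by simp
qed

lemma cgauss_sq: "integrable cgauss (\<lambda>z. (cmod z)\<^sup>2)" "(\<integral>z. (cmod z)\<^sup>2 \<partial>cgauss) = 2"
proof -
  have n: "(\<integral>\<^sup>+z. ennreal ((cmod z)\<^sup>2) \<partial>cgauss) = 2"
  proof -
    have "(\<integral>\<^sup>+z. ennreal ((cmod z)\<^sup>2) \<partial>cgauss) = (\<integral>\<^sup>+x. \<integral>\<^sup>+y. ennreal (x\<^sup>2) + ennreal (y\<^sup>2) \<partial>std_gauss \<partial>std_gauss)"
      by (subst nn_integral_cgauss) (auto simp: cmod_power2 ennreal_plus)
    also have "\<dots> = 2"
      by (simp add: nn_integral_add std_gauss_sq std_gauss.emeasure_space_1[simplified])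
    finally show ?thesis .
  qed
  then show "integrable cgauss (\<lambda>z. (cmod z)\<^sup>2)" by (intro integrableI_bounded) auto
  show "(\<integral>z. (cmod z)\<^sup>2 \<partial>cgauss) = 2" using n by (subst integral_eq_nn_integral) auto
qed

lemma cgauss_mean: "integrable cgauss (\<lambda>z. z)" "(\<integral>z. z \<partial>cgauss) = 0"
proof -
  have "cmod z \<le> 1 + (cmod z)\<^sup>2" for z
    using sum_squares_bound[of "cmod z" 1] norm_ge_zero[of z] unfolding power_one mult_1_right by linarith
  note le = this
  show i: "integrable cgauss (\<lambda>z. z)"
  proof (rule Bochner_Integration.integrable_bound[where f = "\<lambda>z. 1 + (cmod z)\<^sup>2"])
    show "integrable cgauss (\<lambda>z. 1 + (cmod z)\<^sup>2)" using cgauss_sq(1) by simp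
    show "AE z in cgauss. norm z \<le> norm (1 + (cmod z)\<^sup>2)"
      using le by (intro AE_I2) (simp add: abs_of_nonneg add_nonneg_nonneg)
  qed measurable
  have "(\<integral>z. z \<partial>cgauss) = (\<integral>z. z \<partial>distr cgauss cgauss uminus)" by (simp add: distr_cgauss_uminus)
  also have "\<dots> = (\<integral>z. - z \<partial>cgauss)" by (rule integral_distr) (auto cong: measurable_cong_sets)
  also have "\<dots> = - (\<integral>z. z \<partial>cgauss)" by simp
  finally show "(\<integral>z. z \<partial>cgauss) = 0" by simp
qed

lemma cgauss_vec_second_moment:
  assumes j: "j < m" and k: "k < m"
  shows "integrable (cgauss_vec m) (\<lambda>g. g j * cnj (g k))"
    and "(\<integral>g. g j * cnj (g k) \<partial>cgauss_vec m) = (if j = k then 2 else 0)"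
proof -
  interpret product_sigma_finite "\<lambda>_. cgauss"
    by (simp add: product_sigma_finite_def cgauss.sigma_finite_measure_axioms)
  define f where "f i z = (if i = j then z else 1) * (if i = k then cnj z else 1)" for i :: nat and z :: complex
  have pr: "g j * cnj (g k) = (\<Prod>i<m. f i (g i))" for g
    using j k by (simp add: f_def prod.distrib)
  have zz: "(\<lambda>z. z * cnj z) = (\<lambda>z. complex_of_real ((cmod z)\<^sup>2))"
    by (simp add: fun_eq_iff complex_norm_square[symmetric])
  have int: "integrable cgauss (f i)" for i
  proof -
    consider "i = j \<and> i = k" | "i = j \<and> i \<noteq> k" | "i \<noteq> j \<and> i = k" | "i \<noteq> j \<and> i \<noteq> k" by blast
    then show ?thesis
    proof cases
      case 1
      then have "f i = (\<lambda>z. complex_of_real ((cmod z)\<^sup>2))" using zz by (simp add: f_def[abs_def])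
      then show ?thesis using integrable_of_real[OF cgauss_sq(1)] by (simp only:)
    qed (use cgauss_mean in \<open>simp_all add: f_def[abs_def]\<close>)
  qed
  show "integrable (cgauss_vec m) (\<lambda>g. g j * cnj (g k))"
    unfolding pr cgauss_vec_def by (rule product_integrable_prod) (auto intro: int)
  have "(\<integral>g. g j * cnj (g k) \<partial>cgauss_vec m) = (\<Prod>i<m. \<integral>z. f i z \<partial>cgauss)"
    unfolding pr cgauss_vec_def by (rule product_integral_prod) (auto intro: int)
  also have "\<dots> = (if j = k then 2 else 0)"
  proof (cases "j = k")
    case True
    have "(\<integral>z. f i z \<partial>cgauss) = (if i = j then 2 else 1)" for i
    proof (cases "i = j")
      case True
      then have "f i = (\<lambda>z. complex_of_real ((cmod z)\<^sup>2))" using zz \<open>j = k\<close> by (simp add: f_def[abs_def])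
      then show ?thesis using True integral_complex_of_real[of cgauss "\<lambda>z. (cmod z)\<^sup>2"] cgauss_sq(2) by (simp only:) simp
    qed (use \<open>j = k\<close> cgauss.prob_space in \<open>simp add: f_def[abs_def]\<close>)
    then show ?thesis using True j by simp
  next
    case False
    then have "(\<integral>z. f j z \<partial>cgauss) = 0" using cgauss_mean by (simp add: f_def[abs_def])
    then show ?thesis using False j by (auto intro!: prod_zero)
  qed
  finally show "(\<integral>g. g j * cnj (g k) \<partial>cgauss_vec m) = (if j = k then 2 else 0)" .
qed

definition col_sq :: "nat \<Rightarrow> (nat \<Rightarrow> nat \<Rightarrow> complex) \<Rightarrow> nat \<Rightarrow> real" where
  "col_sq m B j = (\<Sum>i<m. (cmod (B i j))\<^sup>2)"

definition frob_sq :: "nat \<Rightarrow> (nat \<Rightarrow> nat \<Rightarrow> complex) \<Rightarrow> real" where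
  "frob_sq m B = (\<Sum>j<m. col_sq m B j)"

text \<open>At \<open>a = b\<close> this is the part of \<open>nrm2 m (app m B a)\<close> that
  contains the squared moduli of the entries.\<close>

definition diag_chaos :: "nat \<Rightarrow> (nat \<Rightarrow> nat \<Rightarrow> complex) \<Rightarrow> (nat \<Rightarrow> complex) \<Rightarrow> (nat \<Rightarrow> complex) \<Rightarrow> real" where
  "diag_chaos m B a b = (\<Sum>j<m. Re (a j * cnj (b j)) * col_sq m B j)"

lemma rip_app_app:
  "rip m (app m B a) (app m B b) = (\<Sum>j<m. \<Sum>k<m. Re (a j * cnj (b k) * (\<Sum>i<m. B i j * cnj (B i k))))"
proof -
  have "rip m (app m B a) (app m B b) = (\<Sum>i<m. \<Sum>j<m. \<Sum>k<m. Re (a j * cnj (b k) * (B i j * cnj (B i k))))"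
    unfolding rip_def app_def
    by (intro sum.cong refl) (simp add: sum_product mult_ac del: times_complex.sel)
  also have "\<dots> = (\<Sum>j<m. \<Sum>i<m. \<Sum>k<m. Re (a j * cnj (b k) * (B i j * cnj (B i k))))"
    by (rule sum.swap)
  also have "\<dots> = (\<Sum>j<m. \<Sum>k<m. \<Sum>i<m. Re (a j * cnj (b k) * (B i j * cnj (B i k))))"
    by (intro sum.cong refl sum.swap)
  also have "\<dots> = (\<Sum>j<m. \<Sum>k<m. Re (a j * cnj (b k) * (\<Sum>i<m. B i j * cnj (B i k))))"
    by (simp only: sum_distrib_left Re_sum)
  finally show ?thesis .
qed

lemma col_sq_eq: "(\<Sum>i<m. B i j * cnj (B i j)) = of_real (col_sq m B j)"
  by (simp add: col_sq_def complex_norm_square[symmetric])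

lemma nrm2_app_expectation:
  "integrable (cgauss_vec m) (\<lambda>g. nrm2 m (app m B g))"
  "(\<integral>g. nrm2 m (app m B g) \<partial>cgauss_vec m) = 2 * frob_sq m B"
proof -
  note sm = cgauss_vec_second_moment
  define G where "G j k = (\<Sum>i<m. B i j * cnj (B i k))" for j k
  have e: "nrm2 m (app m B g) = (\<Sum>j<m. \<Sum>k<m. Re (g j * cnj (g k) * G j k))" for g
    by (simp only: rip_self[symmetric] rip_app_app G_def)
  have i: "integrable (cgauss_vec m) (\<lambda>g. Re (g j * cnj (g k) * G j k))" if "j < m" "k < m" for j k
    using sm(1)[OF that] by (intro integrable_Re integrable_mult_left) auto
  then show "integrable (cgauss_vec m) (\<lambda>g. nrm2 m (app m B g))"
    unfolding e by (intro Bochner_Integration.integrable_sum) auto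
  have v: "(\<integral>g. Re (g j * cnj (g k) * G j k) \<partial>cgauss_vec m) = (if j = k then 2 * col_sq m B j else 0)" if "j < m" "k < m" for j k
  proof -
    have "(\<integral>g. Re (g j * cnj (g k) * G j k) \<partial>cgauss_vec m) = Re (\<integral>g. g j * cnj (g k) * G j k \<partial>cgauss_vec m)"
      using sm(1)[OF that] by (intro integral_Re integrable_mult_left) auto
    also have "\<dots> = Re ((if j = k then 2 else 0) * G j k)"
      using sm[OF that] by simp
    also have "\<dots> = (if j = k then 2 * col_sq m B j else 0)"
    proof -
      have "G j j = of_real (col_sq m B j)" by (simp only: G_def col_sq_eq)
      then show ?thesis by auto
    qed
    finally show ?thesis .
  qed
  have "(\<integral>g. nrm2 m (app m B g) \<partial>cgauss_vec m) = (\<Sum>j<m. \<Sum>k<m. (if j = k then 2 * col_sq m B j else 0))"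
    unfolding e using i v by (subst Bochner_Integration.integral_sum) (auto intro!: sum.cong)
  then show "(\<integral>g. nrm2 m (app m B g) \<partial>cgauss_vec m) = 2 * frob_sq m B"
    by (simp add: frob_sq_def sum_distrib_left)
qed

lemma diag_expectation:
  "integrable (cgauss_vec m) (\<lambda>g. diag_chaos m B g g)"
  "(\<integral>g. diag_chaos m B g g \<partial>cgauss_vec m) = 2 * frob_sq m B"
proof -
  note sm = cgauss_vec_second_moment
  have i: "integrable (cgauss_vec m) (\<lambda>g. Re (g j * cnj (g j)))" if "j < m" for j
    using sm(1)[OF that that] by (rule integrable_Re)
  have v: "(\<integral>g. Re (g j * cnj (g j)) \<partial>cgauss_vec m) = 2" if "j < m" for j
    using integral_Re[OF sm(1)[OF that that]] sm(2)[OF that that] by simp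
  show "integrable (cgauss_vec m) (\<lambda>g. diag_chaos m B g g)"
    unfolding diag_chaos_def using i by (intro Bochner_Integration.integrable_sum integrable_mult_left) auto
  have "(\<integral>g. diag_chaos m B g g \<partial>cgauss_vec m) = (\<Sum>j<m. 2 * col_sq m B j)"
    unfolding diag_chaos_def using i v
    by (subst Bochner_Integration.integral_sum) (auto intro!: sum.cong simp del: times_complex.sel)
  then show "(\<integral>g. diag_chaos m B g g \<partial>cgauss_vec m) = 2 * frob_sq m B"
    by (simp add: frob_sq_def sum_distrib_left)
qed

lemma nrm2_app_le_frob:
  "nrm2 m (app m B a) \<le> frob_sq m B * nrm2 m a"
proof -
  have "(cmod (app m B a i))\<^sup>2 \<le> (\<Sum>j<m. (cmod (B i j))\<^sup>2) * nrm2 m a" for i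
  proof -
    have "(cmod (app m B a i))\<^sup>2 \<le> (\<Sum>j<m. cmod (B i j) * cmod (a j))\<^sup>2"
      unfolding app_def by (intro power_mono) (auto simp: norm_mult[symmetric] norm_sum)
    also have "\<dots> \<le> (\<Sum>j<m. (cmod (B i j))\<^sup>2) * nrm2 m a"
      unfolding nrm2_def by (rule Cauchy_Schwarz_ineq_sum)
    finally show ?thesis .
  qed
  then have "nrm2 m (app m B a) \<le> (\<Sum>i<m. (\<Sum>j<m. (cmod (B i j))\<^sup>2) * nrm2 m a)"
    unfolding nrm2_def[of m "app m B a"] by (intro sum_mono)
  also have "\<dots> = frob_sq m B * nrm2 m a"
    unfolding frob_sq_def col_sq_def sum_distrib_right[symmetric] by (subst sum.swap) simp
  finally show ?thesis .
qed

lemma power_sum_le: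
  fixes f :: "'i \<Rightarrow> real"
  assumes "finite I" "\<And>i. i \<in> I \<Longrightarrow> f i \<ge> 0" and that: "p \<ge> 1"
  shows "(\<Sum>i\<in>I. f i) ^ p \<le> real (card I) ^ p * (\<Sum>i\<in>I. f i ^ p)"
proof (cases "I = {}")
  case False
  have "Max (f ` I) \<in> f ` I" using assms False by (intro Max_in) auto
  then obtain k where k: "k \<in> I" "Max (f ` I) = f k" by auto
  have "(\<Sum>i\<in>I. f i) \<le> (\<Sum>i\<in>I. f k)" using k assms by (intro sum_mono) (metis Max_ge finite_imageI imageI)
  then have "(\<Sum>i\<in>I. f i) ^ p \<le> (real (card I) * f k) ^ p" using assms by (intro power_mono) (auto intro: sum_nonneg)
  also have "\<dots> \<le> real (card I) ^ p * (\<Sum>i\<in>I. f i ^ p)"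
    using assms k by (auto simp: power_mult_distrib intro!: mult_left_mono member_le_sum)
  finally show ?thesis .
qed (use that in \<open>simp add: power_0_left\<close>)

text \<open>Only finiteness matters: it allows \<open>chaos_moment_bound\<close> to subtract a
  moment from both sides of an inequality.\<close>

lemma cgauss_vec_nrm2_moment_finite:
  assumes "p \<ge> 1"
  shows "(\<integral>\<^sup>+a. ennreal (nrm2 m a ^ p) \<partial>cgauss_vec m) < \<infinity>"
proof -
  have re: "(\<integral>\<^sup>+a. ennreal (Re (a j) ^ (2 * p)) \<partial>cgauss_vec m) < \<infinity>"
    and im: "(\<integral>\<^sup>+a. ennreal (Im (a j) ^ (2 * p)) \<partial>cgauss_vec m) < \<infinity>" if "j < m" for j
  proof -
    have "(\<Sum>i<m. Re (a i * cnj (if i = j then c else 0))) = Re (a j * cnj c)" for a c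
    proof -
      have "(\<Sum>i<m. Re (a i * cnj (if i = j then c else 0))) = (\<Sum>i<m. if i = j then Re (a j * cnj c) else 0)"
        by (intro sum.cong) auto
      then show ?thesis using that by simp
    qed
    note eq = this
    have "(\<integral>\<^sup>+a. ennreal (Re (a j * cnj c) ^ (2 * p)) \<partial>cgauss_vec m) < \<infinity>" for c
      using PiM_cgauss_moment[OF finite_lessThan assms, of m "\<lambda>i. if i = j then c else 0"]
      unfolding eq cgauss_vec_def by (rule order.strict_trans1) simp
    from this[of 1] this[of \<i>] show "(\<integral>\<^sup>+a. ennreal (Re (a j) ^ (2 * p)) \<partial>cgauss_vec m) < \<infinity>"
      "(\<integral>\<^sup>+a. ennreal (Im (a j) ^ (2 * p)) \<partial>cgauss_vec m) < \<infinity>" by simp_all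
  qed
  define c where "c = real m ^ p * 2 ^ p"
  have "nrm2 m a ^ p \<le> c * (\<Sum>j<m. Re (a j) ^ (2 * p) + Im (a j) ^ (2 * p))" for a
  proof -
    have "nrm2 m a ^ p \<le> real m ^ p * (\<Sum>j<m. ((cmod (a j))\<^sup>2) ^ p)"
      unfolding nrm2_def using power_sum_le[of "{..<m}" "\<lambda>j. (cmod (a j))\<^sup>2" p] assms by simp
    also have "\<dots> \<le> real m ^ p * (\<Sum>j<m. 2 ^ p * (Re (a j) ^ (2 * p) + Im (a j) ^ (2 * p)))"
    proof (intro mult_left_mono sum_mono)
      fix j
      have "((cmod (a j))\<^sup>2) ^ p \<le> (2 * max ((Re (a j))\<^sup>2) ((Im (a j))\<^sup>2)) ^ p"
        unfolding cmod_power2 by (intro power_mono) auto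
      also have "\<dots> \<le> 2 ^ p * (((Re (a j))\<^sup>2) ^ p + ((Im (a j))\<^sup>2) ^ p)"
        by (auto simp: power_mult_distrib max_def)
      finally show "((cmod (a j))\<^sup>2) ^ p \<le> 2 ^ p * (Re (a j) ^ (2 * p) + Im (a j) ^ (2 * p))"
        by (simp add: power_mult)
    qed simp
    also have "\<dots> = c * (\<Sum>j<m. Re (a j) ^ (2 * p) + Im (a j) ^ (2 * p))"
      by (simp add: c_def sum_distrib_left mult_ac)
    finally show ?thesis .
  qed
  then have "(\<integral>\<^sup>+a. ennreal (nrm2 m a ^ p) \<partial>cgauss_vec m) \<le>
      (\<integral>\<^sup>+a. ennreal c * (\<Sum>j<m. ennreal (Re (a j) ^ (2 * p)) + ennreal (Im (a j) ^ (2 * p))) \<partial>cgauss_vec m)"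
    by (intro nn_integral_mono) (simp add: c_def sum_ennreal ennreal_plus[symmetric] ennreal_mult'[symmetric] sum_nonneg ennreal_leI del: ennreal_plus)
  also have "\<dots> = ennreal c * (\<Sum>j<m. (\<integral>\<^sup>+a. ennreal (Re (a j) ^ (2 * p)) \<partial>cgauss_vec m) + (\<integral>\<^sup>+a. ennreal (Im (a j) ^ (2 * p)) \<partial>cgauss_vec m))"
    by (simp add: nn_integral_cmult nn_integral_sum nn_integral_add)
  also have "\<dots> < \<infinity>"
    using re im unfolding infinity_ennreal_def by (auto simp: ennreal_mult_less_top)
  finally show ?thesis .
qed

section \<open>Decoupling by rotation\<close>

lemma SUP_power_measurable:
  assumes "finite F" "\<And>x. x \<in> F \<Longrightarrow> f x \<in> borel_measurable N"
  shows "(\<lambda>w. SUP x\<in>F. ennreal (\<bar>f x w\<bar> ^ p)) \<in> borel_measurable N"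
  using assms countable_finite[OF assms(1)] by (intro borel_measurable_SUP) auto

lemma (in prob_space) SUP_power_centering:
  fixes f :: "'x \<Rightarrow> 'a \<Rightarrow> real"
  assumes i: "\<And>x. x \<in> F \<Longrightarrow> integrable M (f x)"
  shows "(\<integral>\<^sup>+w. (SUP x\<in>F. ennreal (\<bar>f x w - expectation (f x)\<bar> ^ p)) \<partial>M) \<le>
    (\<integral>\<^sup>+w. \<integral>\<^sup>+w'. (SUP x\<in>F. ennreal (\<bar>f x w - f x w'\<bar> ^ p)) \<partial>M \<partial>M)"
proof (intro nn_integral_mono SUP_least)
  fix w x assume x: "x \<in> F"
  have "f x w - expectation (f x) = expectation (\<lambda>w'. f x w - f x w')"
    using i[OF x] by (simp add: prob_space)
  then have "ennreal (\<bar>f x w - expectation (f x)\<bar> ^ p) \<le> (\<integral>\<^sup>+w'. ennreal (\<bar>f x w - f x w'\<bar> ^ p) \<partial>M)"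
    using abs_expectation_power_le[of "\<lambda>w'. f x w - f x w'" p] i[OF x]
    by (simp del: Bochner_Integration.integral_diff)
  also have "\<dots> \<le> (\<integral>\<^sup>+w'. (SUP x\<in>F. ennreal (\<bar>f x w - f x w'\<bar> ^ p)) \<partial>M)"
    using x by (intro nn_integral_mono SUP_upper)
  finally show "ennreal (\<bar>f x w - expectation (f x)\<bar> ^ p) \<le> \<dots>" .
qed

lemma app_restrict: "app m B (\<lambda>j\<in>{..<m}. v j) = app m B v"
  by (simp add: app_def fun_eq_iff)

lemma app_rot:
  "app m B (\<lambda>j\<in>{..<m}. (a j + b j) / c) = (\<lambda>i. (app m B a i + app m B b i) / c)"
  "app m B (\<lambda>j\<in>{..<m}. (a j - b j) / c) = (\<lambda>i. (app m B a i - app m B b i) / c)"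
  by (simp_all add: app_def fun_eq_iff sum_divide_distrib sum.distrib sum_subtractf field_simps flip: sum_divide_distrib)

lemma nrm2_div_sqrt2: "nrm2 m (\<lambda>i. v i / complex_of_real (sqrt 2)) = nrm2 m v / 2"
  by (simp add: nrm2_def norm_divide power_divide sum_divide_distrib)

text \<open>Polarization in rotated coordinates: a difference of two values of the quadratic form is
  a value of the bilinear form.\<close>

lemma nrm2_rot_diff:
  "nrm2 m (app m B (\<lambda>j\<in>{..<m}. (a j + b j) / of_real (sqrt 2))) - nrm2 m (app m B (\<lambda>j\<in>{..<m}. (a j - b j) / of_real (sqrt 2)))
    = 2 * rip m (app m B a) (app m B b)"
  by (simp add: app_rot nrm2_div_sqrt2 nrm2_add nrm2_diff field_simps)

lemma diag_rot_diff:
  assumes "r = (\<lambda>j\<in>{..<m}. (a j + b j) / complex_of_real (sqrt 2))" "s = (\<lambda>j\<in>{..<m}. (a j - b j) / complex_of_real (sqrt 2))"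
  shows "diag_chaos m B r r - diag_chaos m B s s = 2 * diag_chaos m B a b"
proof -
  have "Re (r j * cnj (r j)) - Re (s j * cnj (s j)) = 2 * Re (a j * cnj (b j))" if "j < m" for j
    using that by (simp add: assms field_simps)
  then have "(Re (r j * cnj (r j)) - Re (s j * cnj (s j))) * col_sq m B j = 2 * Re (a j * cnj (b j)) * col_sq m B j" if "j < m" for j
    using that by simp
  then show ?thesis
    unfolding diag_chaos_def sum_distrib_left sum_subtractf[symmetric]
    by (intro sum.cong) (auto simp: left_diff_distrib simp del: times_complex.sel)
qed

lemma rip_app_pair_measurable [measurable]:
  "(\<lambda>(a, b). rip m (app m B a) (app m B b)) \<in> borel_measurable (cgauss_vec m \<Otimes>\<^sub>M cgauss_vec m)"
  unfolding rip_def split_beta' by measurable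

lemma nrm2_app_measurable [measurable]: "(\<lambda>a. nrm2 m (app m B a)) \<in> borel_measurable (cgauss_vec m)"
  unfolding nrm2_def by measurable

lemma diag_pair_measurable [measurable]:
  "(\<lambda>(a, b). diag_chaos m B a b) \<in> borel_measurable (cgauss_vec m \<Otimes>\<^sub>M cgauss_vec m)"
  unfolding diag_chaos_def split_beta' by measurable

lemma abs_add_power_le: "\<bar>x + y\<bar> ^ p \<le> 2 ^ p * (\<bar>x\<bar> ^ p + \<bar>y\<bar> ^ p)" for x y :: real
proof -
  have "\<bar>x + y\<bar> ^ p \<le> (2 * max \<bar>x\<bar> \<bar>y\<bar>) ^ p" by (intro power_mono) auto
  also have "\<dots> = 2 ^ p * max \<bar>x\<bar> \<bar>y\<bar> ^ p" by (simp add: power_mult_distrib)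
  also have "\<dots> \<le> 2 ^ p * (\<bar>x\<bar> ^ p + \<bar>y\<bar> ^ p)" by (intro mult_left_mono) (auto simp: max_def)
  finally show ?thesis .
qed

definition diag_moment :: "nat \<Rightarrow> nat \<Rightarrow> 'x set \<Rightarrow> ('x \<Rightarrow> nat \<Rightarrow> nat \<Rightarrow> complex) \<Rightarrow> ennreal" where
  "diag_moment p m F A = (\<integral>\<^sup>+a. \<integral>\<^sup>+b. (SUP x\<in>F. ennreal (\<bar>diag_chaos m (A x) a b\<bar> ^ p)) \<partial>cgauss_vec m \<partial>cgauss_vec m)"

lemma SUP_power_cmult:
  assumes "c \<ge> 0"
  shows "(SUP x\<in>F. ennreal (\<bar>c * f x\<bar> ^ p)) = ennreal (c ^ p) * (SUP x\<in>F. ennreal (\<bar>f x\<bar> ^ p))"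
  using assms by (simp add: abs_mult power_mult_distrib ennreal_mult' SUP_mult_left_ennreal)

lemma iterated_nn_integral_cmult:
  assumes "(\<lambda>(a, b). f a b) \<in> borel_measurable (cgauss_vec m \<Otimes>\<^sub>M cgauss_vec m)"
  shows "(\<integral>\<^sup>+a. \<integral>\<^sup>+b. c * f a b \<partial>cgauss_vec m \<partial>cgauss_vec m) = c * (\<integral>\<^sup>+a. \<integral>\<^sup>+b. f a b \<partial>cgauss_vec m \<partial>cgauss_vec m)"
proof -
  have "(\<integral>\<^sup>+a. \<integral>\<^sup>+b. c * f a b \<partial>cgauss_vec m \<partial>cgauss_vec m) = (\<integral>\<^sup>+a. c * (\<integral>\<^sup>+b. f a b \<partial>cgauss_vec m) \<partial>cgauss_vec m)"
    using measurable_Pair2[OF assms] by (intro nn_integral_cong nn_integral_cmult) simp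
  also have "\<dots> = c * (\<integral>\<^sup>+a. \<integral>\<^sup>+b. f a b \<partial>cgauss_vec m \<partial>cgauss_vec m)"
    by (rule nn_integral_cmult[OF cgv.borel_measurable_nn_integral[OF assms]])
  finally show ?thesis .
qed

lemma iterated_nn_integral_add:
  assumes f: "(\<lambda>(a, b). f a b) \<in> borel_measurable (cgauss_vec m \<Otimes>\<^sub>M cgauss_vec m)"
    and g: "(\<lambda>(a, b). g a b) \<in> borel_measurable (cgauss_vec m \<Otimes>\<^sub>M cgauss_vec m)"
  shows "(\<integral>\<^sup>+a. \<integral>\<^sup>+b. f a b + g a b \<partial>cgauss_vec m \<partial>cgauss_vec m) =
    (\<integral>\<^sup>+a. \<integral>\<^sup>+b. f a b \<partial>cgauss_vec m \<partial>cgauss_vec m) + (\<integral>\<^sup>+a. \<integral>\<^sup>+b. g a b \<partial>cgauss_vec m \<partial>cgauss_vec m)"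
proof -
  have "(\<integral>\<^sup>+a. \<integral>\<^sup>+b. f a b + g a b \<partial>cgauss_vec m \<partial>cgauss_vec m) =
      (\<integral>\<^sup>+a. (\<integral>\<^sup>+b. f a b \<partial>cgauss_vec m) + (\<integral>\<^sup>+b. g a b \<partial>cgauss_vec m) \<partial>cgauss_vec m)"
    using measurable_Pair2[OF f] measurable_Pair2[OF g] by (intro nn_integral_cong nn_integral_add) simp_all
  also have "\<dots> = (\<integral>\<^sup>+a. \<integral>\<^sup>+b. f a b \<partial>cgauss_vec m \<partial>cgauss_vec m) + (\<integral>\<^sup>+a. \<integral>\<^sup>+b. g a b \<partial>cgauss_vec m \<partial>cgauss_vec m)"
    by (rule nn_integral_add[OF cgv.borel_measurable_nn_integral[OF f] cgv.borel_measurable_nn_integral[OF g]])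
  finally show ?thesis .
qed

text \<open>Centring with an independent copy produces the form at \<open>g\<close> minus the form
  at \<open>h\<close>. The pair may be replaced by its rotation without changing the law, and the
  difference becomes exactly twice the decoupled form.\<close>

lemma total_moment_le:
  assumes F: "finite F"
  shows "(\<integral>\<^sup>+g. (SUP x\<in>F. ennreal (\<bar>nrm2 m (app m (A x) g) - 2 * frob_sq m (A x)\<bar> ^ p)) \<partial>cgauss_vec m) \<le>
    ennreal (2 ^ p) * chaos_moment p m F A"
proof -
  have "(\<integral>\<^sup>+g. (SUP x\<in>F. ennreal (\<bar>nrm2 m (app m (A x) g) - 2 * frob_sq m (A x)\<bar> ^ p)) \<partial>cgauss_vec m) \<le>
    (\<integral>\<^sup>+g. \<integral>\<^sup>+h. (SUP x\<in>F. ennreal (\<bar>nrm2 m (app m (A x) g) - nrm2 m (app m (A x) h)\<bar> ^ p)) \<partial>cgauss_vec m \<partial>cgauss_vec m)"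
    using cgv.SUP_power_centering[of F m "\<lambda>x g. nrm2 m (app m (A x) g)" p] by (simp add: nrm2_app_expectation)
  also have "\<dots> = (\<integral>\<^sup>+a. \<integral>\<^sup>+b. (SUP x\<in>F. ennreal (\<bar>2 * rip m (app m (A x) a) (app m (A x) b)\<bar> ^ p)) \<partial>cgauss_vec m \<partial>cgauss_vec m)"
    unfolding nrm2_rot_diff[symmetric]
    by (rule cgauss_vec_rotate[symmetric]) (auto simp: split_beta' intro!: SUP_power_measurable F)
  also have "\<dots> = (\<integral>\<^sup>+a. \<integral>\<^sup>+b. ennreal (2 ^ p) * (SUP x\<in>F. ennreal (\<bar>rip m (app m (A x) a) (app m (A x) b)\<bar> ^ p)) \<partial>cgauss_vec m \<partial>cgauss_vec m)"
    by (simp only: SUP_power_cmult zero_le_numeral)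
  also have "\<dots> = ennreal (2 ^ p) * chaos_moment p m F A"
    unfolding chaos_moment_def
    by (intro iterated_nn_integral_cmult) (use F rip_app_pair_measurable in \<open>auto simp: split_beta' intro!: SUP_power_measurable\<close>)
  finally show ?thesis .
qed

text \<open>The rotation argument again, for a form whose mean vanishes because both parts have mean
  \<open>2 * frob_sq\<close>. One factor 2 is from the rotation, the other from separating the two
  chaoses.\<close>

lemma off_diag_moment_le:
  assumes F: "finite F"
  shows "(\<integral>\<^sup>+g. (SUP x\<in>F. ennreal (\<bar>nrm2 m (app m (A x) g) - diag_chaos m (A x) g g\<bar> ^ p)) \<partial>cgauss_vec m) \<le>
    ennreal (4 ^ p) * (chaos_moment p m F A + diag_moment p m F A)"
proof -
  let ?f = "\<lambda>x g. nrm2 m (app m (A x) g) - diag_chaos m (A x) g g"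
  have i: "integrable (cgauss_vec m) (?f x)" "(\<integral>g. ?f x g \<partial>cgauss_vec m) = 0" for x
    by (simp_all add: nrm2_app_expectation diag_expectation)
  let ?R = "\<lambda>a b. (SUP x\<in>F. ennreal (\<bar>rip m (app m (A x) a) (app m (A x) b)\<bar> ^ p))"
  let ?D = "\<lambda>a b. (SUP x\<in>F. ennreal (\<bar>diag_chaos m (A x) a b\<bar> ^ p))"
  have mR: "(\<lambda>(a, b). ?R a b) \<in> borel_measurable (cgauss_vec m \<Otimes>\<^sub>M cgauss_vec m)"
    using F rip_app_pair_measurable by (auto simp: split_beta' intro!: SUP_power_measurable)
  have mD: "(\<lambda>(a, b). ?D a b) \<in> borel_measurable (cgauss_vec m \<Otimes>\<^sub>M cgauss_vec m)"
    using F diag_pair_measurable by (auto simp: split_beta' intro!: SUP_power_measurable)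
  have "(\<integral>\<^sup>+g. (SUP x\<in>F. ennreal (\<bar>?f x g\<bar> ^ p)) \<partial>cgauss_vec m) \<le>
    (\<integral>\<^sup>+g. \<integral>\<^sup>+h. (SUP x\<in>F. ennreal (\<bar>?f x g - ?f x h\<bar> ^ p)) \<partial>cgauss_vec m \<partial>cgauss_vec m)"
    using cgv.SUP_power_centering[of F m ?f p] i by simp
  also have "\<dots> = (\<integral>\<^sup>+a. \<integral>\<^sup>+b. (SUP x\<in>F. ennreal (\<bar>?f x (\<lambda>j\<in>{..<m}. (a j + b j) / of_real (sqrt 2)) -
      ?f x (\<lambda>j\<in>{..<m}. (a j - b j) / of_real (sqrt 2))\<bar> ^ p)) \<partial>cgauss_vec m \<partial>cgauss_vec m)"
    by (rule cgauss_vec_rotate[symmetric]) (auto simp: split_beta' intro!: SUP_power_measurable F)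
  also have "\<dots> = (\<integral>\<^sup>+a. \<integral>\<^sup>+b. (SUP x\<in>F. ennreal (\<bar>2 * rip m (app m (A x) a) (app m (A x) b) - 2 * diag_chaos m (A x) a b\<bar> ^ p)) \<partial>cgauss_vec m \<partial>cgauss_vec m)"
    using nrm2_rot_diff[of m] diag_rot_diff[OF refl refl, of m]
    by (intro nn_integral_cong SUP_cong refl arg_cong[of _ _ ennreal] arg_cong[of _ _ "\<lambda>x. \<bar>x\<bar> ^ p"]) (smt (verit))
  also have "\<dots> \<le> (\<integral>\<^sup>+a. \<integral>\<^sup>+b. ennreal (4 ^ p) * (?R a b + ?D a b) \<partial>cgauss_vec m \<partial>cgauss_vec m)"
  proof (intro nn_integral_mono SUP_least)
    fix a b x assume x: "x \<in> F"
    let ?r = "rip m (app m (A x) a) (app m (A x) b)" and ?d = "diag_chaos m (A x) a b"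
    have "\<bar>2 * ?r - 2 * ?d\<bar> ^ p \<le> 2 ^ p * (\<bar>2 * ?r\<bar> ^ p + \<bar>2 * ?d\<bar> ^ p)"
      using abs_add_power_le[of "2 * ?r" "- (2 * ?d)" p] by simp
    also have "\<dots> = (2 * 2) ^ p * (\<bar>?r\<bar> ^ p + \<bar>?d\<bar> ^ p)"
      by (simp only: power_mult_distrib abs_mult abs_numeral distrib_left mult.assoc)
    finally have "ennreal (\<bar>2 * ?r - 2 * ?d\<bar> ^ p) \<le> ennreal (4 ^ p) * (ennreal (\<bar>?r\<bar> ^ p) + ennreal (\<bar>?d\<bar> ^ p))"
      by (simp add: ennreal_plus[symmetric] ennreal_mult'[symmetric] ennreal_leI del: ennreal_plus)
    also have "\<dots> \<le> ennreal (4 ^ p) * (?R a b + ?D a b)"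
      using x by (intro mult_left_mono add_mono SUP_upper) auto
    finally show "ennreal (\<bar>2 * ?r - 2 * ?d\<bar> ^ p) \<le> ennreal (4 ^ p) * (?R a b + ?D a b)" .
  qed
  also have "\<dots> = ennreal (4 ^ p) * (chaos_moment p m F A + diag_moment p m F A)"
    unfolding chaos_moment_def diag_moment_def
    by (subst iterated_nn_integral_cmult) (use mR mD in \<open>auto simp: iterated_nn_integral_add split_beta' intro!: borel_measurable_add\<close>)
  finally show ?thesis .
qed

text \<open>Interpolates between the full decoupled chaos (\<open>S\<close> empty) and its diagonal
  (\<open>S\<close> everything): off-diagonal terms survive only if both indices lie outside
  \<open>S\<close>.\<close>

definition partial_chaos :: "nat set \<Rightarrow> nat \<Rightarrow> (nat \<Rightarrow> nat \<Rightarrow> complex) \<Rightarrow> (nat \<Rightarrow> complex) \<Rightarrow> (nat \<Rightarrow> complex) \<Rightarrow> real" where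
  "partial_chaos S m B a b = (\<Sum>j<m. \<Sum>k<m. if j = k \<or> (j \<notin> S \<and> k \<notin> S) then Re (a j * cnj (b k) * (\<Sum>i<m. B i j * cnj (B i k))) else 0)"

lemma partial_chaos_empty: "partial_chaos {} m B a b = rip m (app m B a) (app m B b)"
  by (simp add: partial_chaos_def rip_app_app)

lemma partial_chaos_full: "partial_chaos {..<m} m B a b = diag_chaos m B a b"
proof -
  have "partial_chaos {..<m} m B a b = (\<Sum>j<m. \<Sum>k<m. if j = k then Re (a j * cnj (b j) * (\<Sum>i<m. B i j * cnj (B i j))) else 0)"
    unfolding partial_chaos_def by (intro sum.cong refl) auto
  also have "\<dots> = diag_chaos m B a b"
    unfolding col_sq_eq by (simp add: diag_chaos_def algebra_simps)
  finally show ?thesis .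
qed

text \<open>Flipping the sign of coordinate \<open>i\<close> cancels all off-diagonal terms that involve \<open>i\<close>.\<close>

lemma partial_chaos_insert:
  assumes "i \<notin> S"
  shows "partial_chaos (insert i S) m B a b = (partial_chaos S m B a b + partial_chaos S m B (flip m i a) (flip m i b)) / 2"
proof -
  define G where "G j k = (\<Sum>i<m. B i j * cnj (B i k))" for j k
  let ?t = "\<lambda>S a b j k. if j = k \<or> (j \<notin> S \<and> k \<notin> S) then Re (a j * cnj (b k) * G j k) else 0"
  have "?t (insert i S) a b j k = (?t S a b j k + ?t S (flip m i a) (flip m i b) j k) / 2" if "j < m" "k < m" for j k
    using that assms by (auto simp: flip_def algebra_simps)
  then have "partial_chaos (insert i S) m B a b = (\<Sum>j<m. \<Sum>k<m. (?t S a b j k + ?t S (flip m i a) (flip m i b) j k) / 2)"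
    unfolding partial_chaos_def G_def by (intro sum.cong refl) auto
  then show ?thesis
    by (simp only: partial_chaos_def G_def sum.distrib sum_divide_distrib[symmetric])
qed

lemma partial_chaos_measurable [measurable]:
  "(\<lambda>(a, b). partial_chaos S m B a b) \<in> borel_measurable (cgauss_vec m \<Otimes>\<^sub>M cgauss_vec m)"
  unfolding partial_chaos_def split_beta' by measurable

lemma flip_measurable: "flip m i \<in> cgauss_vec m \<rightarrow>\<^sub>M cgauss_vec m"
  unfolding flip_def[abs_def]
  by (subst measurable_cong_sets[OF refl sets_cgauss_vec], intro measurable_restrict) measurable

lemma ennreal_convex_comb:
  assumes "x \<ge> 0" "y \<ge> 0" "c \<ge> 0" "d \<ge> 0"
  shows "ennreal (c * x + d * y) = ennreal c * ennreal x + ennreal d * ennreal y"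
  using assms by (simp add: ennreal_mult ennreal_plus)

text \<open>Each enlargement of \<open>S\<close> by one index averages the chaos over a sign flip of
  that coordinate in both vectors. The flip preserves the law, so by convexity the moment does not
  grow.\<close>

lemma diag_moment_le:
  assumes F: "finite F"
  shows "diag_moment p m F A \<le> chaos_moment p m F A"
proof -
  let ?P = "cgauss_vec m"
  define h where "h S a b = (SUP x\<in>F. ennreal (\<bar>partial_chaos S m (A x) a b\<bar> ^ p))" for S a b
  have hm: "(\<lambda>(a, b). h S a b) \<in> borel_measurable (?P \<Otimes>\<^sub>M ?P)" for S
    unfolding h_def using F partial_chaos_measurable by (auto simp: split_beta' intro!: SUP_power_measurable)
  have step: "(\<integral>\<^sup>+a. \<integral>\<^sup>+b. h (insert i S) a b \<partial>?P \<partial>?P) \<le> (\<integral>\<^sup>+a. \<integral>\<^sup>+b. h S a b \<partial>?P \<partial>?P)" if i: "i \<notin> S" for i S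
  proof -
    have half: "ennreal (1 / 2) * x + ennreal (1 / 2) * x = x" for x
    proof -
      have "ennreal (1 / 2) + ennreal (1 / 2) = 1" by (subst ennreal_plus[symmetric]) auto
      then show ?thesis unfolding distrib_right[symmetric] by (simp only: mult_1)
    qed
    have hf: "(\<lambda>(a, b). h S (flip m i a) (flip m i b)) \<in> borel_measurable (?P \<Otimes>\<^sub>M ?P)"
      using measurable_compose[OF measurable_Pair[OF measurable_compose[OF measurable_fst flip_measurable] measurable_compose[OF measurable_snd flip_measurable]] hm]
      by (simp add: split_beta')
    have "(\<integral>\<^sup>+a. \<integral>\<^sup>+b. h (insert i S) a b \<partial>?P \<partial>?P) \<le>
      (\<integral>\<^sup>+a. \<integral>\<^sup>+b. ennreal (1 / 2) * h S a b + ennreal (1 / 2) * h S (flip m i a) (flip m i b) \<partial>?P \<partial>?P)"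
    proof (intro nn_integral_mono)
      fix a b
      show "h (insert i S) a b \<le> ennreal (1 / 2) * h S a b + ennreal (1 / 2) * h S (flip m i a) (flip m i b)"
        unfolding h_def
      proof (rule SUP_least)
        fix x assume x: "x \<in> F"
        let ?u = "partial_chaos S m (A x) a b" and ?v = "partial_chaos S m (A x) (flip m i a) (flip m i b)"
        have "\<bar>partial_chaos (insert i S) m (A x) a b\<bar> ^ p \<le> (1 / 2) * \<bar>?u\<bar> ^ p + (1 / 2) * \<bar>?v\<bar> ^ p"
          using convex_onD[OF convex_on_abs_power, of "1 / 2" ?u ?v p]
          by (simp add: partial_chaos_insert[OF i] add_divide_distrib)
        then have "ennreal (\<bar>partial_chaos (insert i S) m (A x) a b\<bar> ^ p) \<le> ennreal (1 / 2) * ennreal (\<bar>?u\<bar> ^ p) + ennreal (1 / 2) * ennreal (\<bar>?v\<bar> ^ p)"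
          by (subst ennreal_convex_comb[symmetric]) (simp_all only: ennreal_leI, simp_all)
        also have "\<dots> \<le> ennreal (1 / 2) * (SUP x\<in>F. ennreal (\<bar>partial_chaos S m (A x) a b\<bar> ^ p)) +
           ennreal (1 / 2) * (SUP x\<in>F. ennreal (\<bar>partial_chaos S m (A x) (flip m i a) (flip m i b)\<bar> ^ p))"
          using x by (intro add_mono mult_left_mono SUP_upper) auto
        finally show "ennreal (\<bar>partial_chaos (insert i S) m (A x) a b\<bar> ^ p) \<le> \<dots>" .
      qed
    qed
    also have "\<dots> = ennreal (1 / 2) * (\<integral>\<^sup>+a. \<integral>\<^sup>+b. h S a b \<partial>?P \<partial>?P) + ennreal (1 / 2) * (\<integral>\<^sup>+a. \<integral>\<^sup>+b. h S (flip m i a) (flip m i b) \<partial>?P \<partial>?P)"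
      using hm[of S] hf by (subst iterated_nn_integral_add) (auto simp: iterated_nn_integral_cmult split_beta' intro!: borel_measurable_times_ennreal)
    also have "(\<integral>\<^sup>+a. \<integral>\<^sup>+b. h S (flip m i a) (flip m i b) \<partial>?P \<partial>?P) = (\<integral>\<^sup>+a. \<integral>\<^sup>+b. h S (flip m i a) b \<partial>?P \<partial>?P)"
    proof (rule nn_integral_cong)
      fix a assume "a \<in> space ?P"
      then have "flip m i a \<in> space ?P" using flip_measurable by (rule measurable_space[rotated])
      then have "(\<lambda>b. h S (flip m i a) b) \<in> borel_measurable ?P" using measurable_Pair2[OF hm[of S]] by simp
      then show "(\<integral>\<^sup>+b. h S (flip m i a) (flip m i b) \<partial>?P) = (\<integral>\<^sup>+b. h S (flip m i a) b \<partial>?P)"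
        by (rule cgauss_vec_flip)
    qed
    also have "\<dots> = (\<integral>\<^sup>+a. \<integral>\<^sup>+b. h S a b \<partial>?P \<partial>?P)"
      by (rule cgauss_vec_flip[where \<Phi> = "\<lambda>a. \<integral>\<^sup>+b. h S a b \<partial>?P"]) (rule cgv.borel_measurable_nn_integral[OF hm])
    finally show ?thesis by (simp only: half)
  qed
  have "(\<integral>\<^sup>+a. \<integral>\<^sup>+b. h {..<n} a b \<partial>?P \<partial>?P) \<le> (\<integral>\<^sup>+a. \<integral>\<^sup>+b. h {} a b \<partial>?P \<partial>?P)" for n :: nat
  proof (induction n)
    case (Suc n)
    then show ?case using step[of n "{..<n}"] by (simp add: lessThan_Suc)
  qed simp
  from this[of m] show ?thesis
    by (simp add: diag_moment_def chaos_moment_def h_def partial_chaos_full partial_chaos_empty)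
qed

text \<open>The bound on the norm of the vectors \<open>A\<^sub>x g\<close> depends on the chaos itself; for small \<open>K\<close> the
  resulting inequality can be solved for the moment because that moment is finite.\<close>

lemma chaos_moment_bound:
  assumes F: "finite F" "F \<noteq> {}" and p: "p \<ge> 1"
    and fr: "\<And>x. x \<in> F \<Longrightarrow> frob_sq m (A x) \<le> 1"
    and K: "0 \<le> K" "K \<le> 1 / 16"
    and H: "chaos_moment p m F A \<le> ennreal (4 * K ^ p) * (\<integral>\<^sup>+a. ennreal (max_norm m F A a ^ p) \<partial>cgauss_vec m)"
  shows "chaos_moment p m F A \<le> ennreal ((32 * K) ^ p)"
proof -
  let ?P = "cgauss_vec m"
  let ?N = "max_norm m F A"
  have N0: "?N a \<ge> 0" for a using max_norm_nonneg F by blast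
  have [measurable]: "?N \<in> borel_measurable ?P" using F by measurable
  define Mo where "Mo = (\<integral>\<^sup>+a. ennreal (?N a ^ (2 * p)) \<partial>?P)"
  have Nle: "(?N a)\<^sup>2 \<le> nrm2 m a" for a
  proof -
    obtain x where x: "x \<in> F" "(?N a)\<^sup>2 = nrm2 m (app m (A x) a)" using max_norm_attained[OF F] by metis
    have "nrm2 m (app m (A x) a) \<le> 1 * nrm2 m a"
      by (rule order_trans[OF nrm2_app_le_frob mult_right_mono[OF fr[OF x(1)]]]) simp
    then show ?thesis using x by simp
  qed
  have "Mo \<le> (\<integral>\<^sup>+a. ennreal (nrm2 m a ^ p) \<partial>?P)"
    unfolding Mo_def using Nle by (intro nn_integral_mono ennreal_leI) (simp add: power_mult power_mono)
  also have "\<dots> < \<infinity>" by (rule cgauss_vec_nrm2_moment_finite[OF p])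
  finally have fin: "Mo < \<infinity>" .
  then obtain \<mu> where \<mu>: "Mo = ennreal \<mu>" "\<mu> \<ge> 0" by (cases Mo) auto
  \<comment> \<open>The inequality 2 y \<le> 1 + y^2 brings the moment in the assumption to the
    order \<open>2 * p\<close>, so that the argument closes on the single number
    \<open>\<mu>\<close>.\<close>
  have EN: "(\<integral>\<^sup>+a. ennreal (?N a ^ p) \<partial>?P) \<le> ennreal ((1 + \<mu>) / 2)"
  proof -
    have "(\<integral>\<^sup>+a. ennreal (?N a ^ p) \<partial>?P) \<le> (\<integral>\<^sup>+a. ennreal (1 / 2) * (1 + ennreal (?N a ^ (2 * p))) \<partial>?P)"
    proof (intro nn_integral_mono)
      fix a
      have "?N a ^ p \<le> 1 / 2 * (1 + ?N a ^ (2 * p))"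
        using sum_squares_bound[of "?N a ^ p" 1] by (simp add: power_mult[symmetric] mult.commute)
      then have "ennreal (?N a ^ p) \<le> ennreal (1 / 2 * (1 + ?N a ^ (2 * p)))" by (rule ennreal_leI)
      also have "\<dots> = ennreal (1 / 2) * ennreal (1 + ?N a ^ (2 * p))"
        using N0 by (intro ennreal_mult) auto
      also have "ennreal (1 + ?N a ^ (2 * p)) = 1 + ennreal (?N a ^ (2 * p))"
        using N0 by (simp add: ennreal_plus)
      finally show "ennreal (?N a ^ p) \<le> ennreal (1 / 2) * (1 + ennreal (?N a ^ (2 * p)))" .
    qed
    also have "\<dots> = ennreal (1 / 2) * (1 + Mo)"
      by (simp add: nn_integral_cmult nn_integral_add cgv.emeasure_space_1 Mo_def)
    also have "\<dots> = ennreal ((1 + \<mu>) / 2)"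
    proof -
      have "ennreal ((1 + \<mu>) / 2) = ennreal (1 / 2 * 1 + 1 / 2 * \<mu>)" by (simp add: add_divide_distrib)
      also have "\<dots> = ennreal (1 / 2) * ennreal 1 + ennreal (1 / 2) * ennreal \<mu>"
        using \<mu>(2) by (intro ennreal_convex_comb) auto
      finally show ?thesis by (simp only: \<mu>(1) ennreal_1 distrib_left)
    qed
    finally show ?thesis .
  qed
  define Q where "Q = 4 * K ^ p * ((1 + \<mu>) / 2)"
  have "chaos_moment p m F A \<le> ennreal (4 * K ^ p) * ennreal ((1 + \<mu>) / 2)"
    using H EN by (rule order_trans[OF _ mult_left_mono]) simp
  then have cQ: "chaos_moment p m F A \<le> ennreal Q"
    using K \<mu> by (simp add: Q_def ennreal_mult'[symmetric])
  have Q0: "Q \<ge> 0" using K \<mu> by (simp add: Q_def)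
  let ?T = "\<lambda>g. (SUP x\<in>F. ennreal (\<bar>nrm2 m (app m (A x) g) - 2 * frob_sq m (A x)\<bar> ^ p))"
  have mT: "?T \<in> borel_measurable ?P" by (intro SUP_power_measurable F) measurable
  have "Mo \<le> (\<integral>\<^sup>+g. ennreal (2 ^ p) * (ennreal (2 ^ p) + ?T g) \<partial>?P)"
    unfolding Mo_def
  proof (intro nn_integral_mono)
    fix a
    obtain x where x: "x \<in> F" "(?N a)\<^sup>2 = nrm2 m (app m (A x) a)" using max_norm_attained[OF F] by metis
    define t where "t = \<bar>nrm2 m (app m (A x) a) - 2 * frob_sq m (A x)\<bar>"
    have "nrm2 m (app m (A x) a) \<le> 2 + t" using fr[OF x(1)] by (simp add: t_def abs_if split: if_splits)
    then have "?N a ^ (2 * p) \<le> \<bar>2 + t\<bar> ^ p"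
      using x by (simp add: power_mult) (intro power_mono, auto)
    also have "\<dots> \<le> 2 ^ p * (2 ^ p + t ^ p)" using abs_add_power_le[of 2 t p] by (simp add: t_def)
    finally have "ennreal (?N a ^ (2 * p)) \<le> ennreal (2 ^ p) * (ennreal (2 ^ p) + ennreal (t ^ p))"
      by (simp add: t_def ennreal_plus[symmetric] ennreal_mult'[symmetric] ennreal_leI del: ennreal_plus)
    also have "\<dots> \<le> ennreal (2 ^ p) * (ennreal (2 ^ p) + ?T a)"
      using x unfolding t_def by (intro mult_left_mono add_left_mono SUP_upper) auto
    finally show "ennreal (?N a ^ (2 * p)) \<le> ennreal (2 ^ p) * (ennreal (2 ^ p) + ?T a)" .
  qed
  also have "\<dots> = ennreal (2 ^ p) * (ennreal (2 ^ p) + (\<integral>\<^sup>+g. ?T g \<partial>?P))"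
    using mT by (simp add: nn_integral_cmult nn_integral_add cgv.emeasure_space_1)
  also have "\<dots> \<le> ennreal (2 ^ p) * (ennreal (2 ^ p) + ennreal (2 ^ p) * ennreal Q)"
    by (intro mult_left_mono add_left_mono order_trans[OF total_moment_le[OF F(1)]] cQ) auto
  also have "\<dots> = ennreal (2 ^ p * (2 ^ p + 2 ^ p * Q))"
    using Q0 by (simp add: ennreal_plus[symmetric] ennreal_mult'[symmetric] del: ennreal_plus)
  finally have "\<mu> \<le> 2 ^ p * (2 ^ p + 2 ^ p * Q)"
    using \<mu> Q0 by (simp add: ennreal_le_iff)
  also have "\<dots> = 4 ^ p + 2 * (4 * K) ^ p * (1 + \<mu>)"
  proof -
    have "(4 :: real) ^ p = 2 ^ p * 2 ^ p" by (simp flip: power_mult_distrib)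
    then show ?thesis by (simp add: Q_def power_mult_distrib algebra_simps)
  qed
  \<comment> \<open>This is where \<open>K \<le> 1 / 16\<close> enters: the coefficient of
    \<open>\<mu>\<close> drops to 1/2, and the term can be moved to the left side.\<close>
  also have "\<dots> \<le> 4 ^ p + 1 / 2 * (1 + \<mu>)"
  proof -
    have "(4 * K) ^ p \<le> (1 / 4) ^ p" using K by (intro power_mono) auto
    also have "\<dots> \<le> (1 / 4) ^ 1" using p by (intro power_decreasing) auto
    finally have "2 * (4 * K) ^ p \<le> 1 / 2" by simp
    then show ?thesis using \<mu> by (intro add_left_mono mult_right_mono) auto
  qed
  finally have *: "\<mu> \<le> 4 ^ p + 1 / 2 * (1 + \<mu>)" .
  have "1 + \<mu> \<le> 2 * X + 2" if "\<mu> \<le> X + 1 / 2 * (1 + \<mu>)" for X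
    using that by (simp add: field_simps)
  from this[OF *] have "1 + \<mu> \<le> 2 * 4 ^ p + 2" .
  also have "\<dots> \<le> 2 * 4 ^ p + 2 * 4 ^ p" by simp
  also have "(2 * 4 ^ p + 2 * 4 ^ p :: real) = 4 * 4 ^ p" by simp
  finally have m: "1 + \<mu> \<le> 4 * 4 ^ p" .
  have "4 * K ^ p \<ge> 0" using K by simp
  with m have "Q \<le> 4 * K ^ p * ((4 * 4 ^ p) / 2)"
    unfolding Q_def by (intro mult_left_mono divide_right_mono) simp_all
  also have "\<dots> = 8 * (4 * K) ^ p" by (simp add: power_mult_distrib)
  also have "\<dots> \<le> 8 ^ p * (4 * K) ^ p"
  proof (rule mult_right_mono)
    show "(8 :: real) \<le> 8 ^ p" using p power_increasing[of 1 p "8 :: real"] by simp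
    show "0 \<le> (4 * K) ^ p" using K by simp
  qed
  also have "\<dots> = (8 * (4 * K)) ^ p" by (rule power_mult_distrib[symmetric])
  also have "8 * (4 * K) = 32 * K" by simp
  finally show ?thesis using cQ by (meson ennreal_leI order_trans)
qed

section \<open>Exchanging subgaussian entries for Gaussian ones\<close>

lemma nn_integral_indep_vars:
  assumes "prob_space M" and J: "finite J" "J \<noteq> {}" and ind: "prob_space.indep_vars M (\<lambda>_. N) X J"
    and \<Phi>: "\<Phi> \<in> borel_measurable (PiM J (\<lambda>_. N))"
  shows "(\<integral>\<^sup>+w. \<Phi> (\<lambda>j\<in>J. X j w) \<partial>M) = (\<integral>\<^sup>+v. \<Phi> v \<partial>PiM J (\<lambda>j. distr M N (X j)))"
proof -
  interpret prob_space M by fact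
  have rv: "X j \<in> M \<rightarrow>\<^sub>M N" if "j \<in> J" for j
    using ind that by (simp add: indep_vars_def)
  have T: "(\<lambda>w. \<lambda>j\<in>J. X j w) \<in> M \<rightarrow>\<^sub>M PiM J (\<lambda>_. N)"
    using rv by (rule measurable_restrict)
  have "distr M (PiM J (\<lambda>_. N)) (\<lambda>w. \<lambda>j\<in>J. X j w) = PiM J (\<lambda>j. distr M N (X j))"
    using indep_vars_iff_distr_eq_PiM'[where I = J and M' = "\<lambda>_. N" and X = X] J rv ind by simp
  then show ?thesis using nn_integral_distr[OF T, of \<Phi>] \<Phi> by simp
qed

text \<open>The quadratic terms in \<open>y\<close> of the squared norm and of the diagonal chaos
  are both the squared modulus of \<open>y\<close> times \<open>col_sq m B j\<close>, and they
  cancel. What remains is affine in \<open>y\<close>.\<close>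

lemma off_diag_coordinate:
  fixes w :: "nat \<Rightarrow> complex" and B :: "nat \<Rightarrow> nat \<Rightarrow> complex"
  assumes j: "j < m"
  defines "v \<equiv> app m B (w(j := 0))"
  shows "nrm2 m (app m B (w(j := y))) - diag_chaos m B (w(j := y)) (w(j := y)) =
    (nrm2 m v - diag_chaos m B (w(j := 0)) (w(j := 0))) + inner (2 * (\<Sum>i<m. v i * cnj (B i j))) y"
proof -
  have a: "app m B (w(j := y)) = (\<lambda>i. v i + B i j * y)"
  proof
    fix i
    have "app m B (w(j := y)) i = (\<Sum>k<m. B i k * (w(j := 0)) k + (if k = j then B i j * y else 0))"
      unfolding app_def by (intro sum.cong) auto
    then show "app m B (w(j := y)) i = v i + B i j * y"
      using j by (simp add: v_def app_def sum.distrib)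
  qed
  have d: "diag_chaos m B (w(j := y)) (w(j := y)) = diag_chaos m B (w(j := 0)) (w(j := 0)) + (cmod y)\<^sup>2 * col_sq m B j"
  proof -
    have "diag_chaos m B (w(j := y)) (w(j := y)) = (\<Sum>k<m. Re ((w(j := 0)) k * cnj ((w(j := 0)) k)) * col_sq m B k + (if k = j then (cmod y)\<^sup>2 * col_sq m B j else 0))"
      unfolding diag_chaos_def by (intro sum.cong) (auto simp: cmod_power2, simp add: power2_eq_square)
    then show ?thesis using j by (simp add: diag_chaos_def sum.distrib del: times_complex.sel)
  qed
  have n: "nrm2 m (\<lambda>i. B i j * y) = (cmod y)\<^sup>2 * col_sq m B j"
    by (simp add: nrm2_def col_sq_def norm_mult power_mult_distrib sum_distrib_left mult.commute)
  have r: "rip m v (\<lambda>i. B i j * y) = inner (\<Sum>i<m. v i * cnj (B i j)) y"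
    unfolding rip_def inner_sum_left by (intro sum.cong) (auto simp: inner_complex_def algebra_simps)
  have "inner (2 * z) y = 2 * inner z y" for z :: complex by (simp add: inner_complex_def algebra_simps)
  then show ?thesis unfolding a nrm2_add d n r by simp
qed

lemma app_scale: "app m B (\<lambda>j\<in>{..<m}. C *\<^sub>R a j) = (\<lambda>i. C *\<^sub>R app m B a i)"
  by (simp add: app_def fun_eq_iff scaleR_sum_right scaleR_conv_of_real sum_distrib_left mult_ac)

lemma nrm2_scale: "nrm2 m (\<lambda>i. C *\<^sub>R v i) = C\<^sup>2 * nrm2 m v"
  by (simp add: nrm2_def power_mult_distrib sum_distrib_left)

lemma diag_restrict: "diag_chaos m B (\<lambda>j\<in>{..<m}. a j) (\<lambda>j\<in>{..<m}. b j) = diag_chaos m B a b"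
  by (simp add: diag_chaos_def)

text \<open>The one-coordinate comparison \<open>sup_affine_subgaussian_le_cgauss\<close> is fed
  into \<open>nn_integral_PiM_coord_mono\<close>. All Gaussian entries end up scaled by
  \<open>C\<close>, which a quadratic form turns into the square of \<open>C\<close>.\<close>

lemma (in prob_space) off_diag_subgaussian_le:
  fixes \<xi> :: "nat \<Rightarrow> 'a \<Rightarrow> complex"
  assumes L: "L > 0" and m: "m \<ge> 1" and ind: "indep_vars (\<lambda>_. borel) \<xi> {..<m}"
    and \<xi>: "\<And>j. j < m \<Longrightarrow> integrable M (\<xi> j)" "\<And>j. j < m \<Longrightarrow> expectation (\<xi> j) = 0" "\<And>j. j < m \<Longrightarrow> subgaussian L (\<xi> j)"
    and F: "finite F" and C: "C = 8 * (sqrt 5 * L) * (1 + 1 / sqrt (2 / pi))"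
  shows "(\<integral>\<^sup>+w. (SUP x\<in>F. ennreal (\<bar>nrm2 m (app m (A x) (\<lambda>j. \<xi> j w)) - diag_chaos m (A x) (\<lambda>j. \<xi> j w) (\<lambda>j. \<xi> j w)\<bar> ^ p)) \<partial>M) \<le>
    ennreal ((C\<^sup>2) ^ p) * (\<integral>\<^sup>+g. (SUP x\<in>F. ennreal (\<bar>nrm2 m (app m (A x) g) - diag_chaos m (A x) g g\<bar> ^ p)) \<partial>cgauss_vec m)"
proof -
  let ?f = "\<lambda>x g. nrm2 m (app m (A x) g) - diag_chaos m (A x) g g"
  define \<Phi> where "\<Phi> g = (SUP x\<in>F. ennreal (\<bar>?f x g\<bar> ^ p))" for g
  have \<Phi>m: "\<Phi> \<in> borel_measurable (cgauss_vec m)"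
    unfolding \<Phi>_def[abs_def] by (intro SUP_power_measurable F) measurable
  then have \<Phi>m': "\<Phi> \<in> borel_measurable (PiM {..<m} (\<lambda>_. borel))"
    by (simp cong: measurable_cong_sets)
  \<comment> \<open>Padding beyond \<open>m\<close>: the exchange lemma asks for a probability
    measure at every index.\<close>
  define X where "X j = (if j < m then \<xi> j else (\<lambda>_. 0))" for j
  have Xm: "X j \<in> borel_measurable M" for j using \<xi>(1) by (auto simp: X_def)
  let ?g = "\<lambda>z :: complex. C *\<^sub>R z"
  have gm: "?g \<in> cgauss \<rightarrow>\<^sub>M cgauss" by (simp cong: measurable_cong_sets)
  have "(\<integral>\<^sup>+w. \<Phi> (\<lambda>j. \<xi> j w) \<partial>M) = (\<integral>\<^sup>+w. \<Phi> (\<lambda>j\<in>{..<m}. \<xi> j w) \<partial>M)"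
    by (simp add: \<Phi>_def app_restrict diag_restrict)
  also have "\<dots> = (\<integral>\<^sup>+v. \<Phi> v \<partial>PiM {..<m} (\<lambda>j. distr M borel (\<xi> j)))"
    using m by (intro nn_integral_indep_vars prob_space_axioms ind \<Phi>m') (auto simp: lessThan_empty_iff)
  also have "PiM {..<m} (\<lambda>j. distr M borel (\<xi> j)) = PiM {..<m} (\<lambda>j. distr M borel (X j))"
    by (intro PiM_cong) (auto simp: X_def)
  also have "(\<integral>\<^sup>+v. \<Phi> v \<partial>PiM {..<m} (\<lambda>j. distr M borel (X j))) \<le> (\<integral>\<^sup>+v. \<Phi> v \<partial>PiM {..<m} (\<lambda>j. distr cgauss cgauss ?g))"
  proof (rule nn_integral_PiM_coord_mono[where B = borel])
    show "prob_space (distr M borel (X j))" for j by (rule prob_space_distr[OF Xm])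
    show "prob_space (distr cgauss cgauss ?g)" by (rule cgauss.prob_space_distr[OF gm])
    fix j w assume "j \<in> {..<m}"
    then have j: "j < m" by simp
    define v where "v x = app m (A x) (w(j := 0))" for x
    define \<alpha> where "\<alpha> x = ?f x (w(j := 0))" for x
    define \<beta> where "\<beta> x = 2 * (\<Sum>i<m. v x i * cnj (A x i j))" for x
    have e: "\<Phi> (w(j := y)) = sup_affine p F \<alpha> \<beta> y" for y
      unfolding \<Phi>_def sup_affine_def \<alpha>_def \<beta>_def v_def off_diag_coordinate[OF j, of _ w y] ..
    note sup_affine_measurable[OF F, measurable]
    have "(\<integral>\<^sup>+y. \<Phi> (w(j := y)) \<partial>distr M borel (X j)) = (\<integral>\<^sup>+w. sup_affine p F \<alpha> \<beta> (\<xi> j w) \<partial>M)"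
      unfolding e using Xm[of j] j by (subst nn_integral_distr) (auto simp: X_def)
    also have "\<dots> \<le> (\<integral>\<^sup>+z. sup_affine p F \<alpha> \<beta> (C *\<^sub>R z) \<partial>cgauss)"
      by (rule sup_affine_subgaussian_le_cgauss[OF L \<xi>(3)[OF j] \<xi>(1)[OF j] \<xi>(2)[OF j] F C])
    also have "\<dots> = (\<integral>\<^sup>+y. \<Phi> (w(j := y)) \<partial>distr cgauss cgauss ?g)"
      unfolding e using gm by (subst nn_integral_distr) (auto cong: measurable_cong_sets)
    finally show "(\<integral>\<^sup>+y. \<Phi> (w(j := y)) \<partial>distr M borel (X j)) \<le> (\<integral>\<^sup>+y. \<Phi> (w(j := y)) \<partial>distr cgauss cgauss ?g)" .
  qed (auto intro: \<Phi>m')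
  also have "PiM {..<m} (\<lambda>j. distr cgauss cgauss ?g) = distr (cgauss_vec m) (cgauss_vec m) (compose {..<m} ?g)"
    unfolding cgauss_vec_def using gm
    by (intro distr_PiM_finite_prob_space'[symmetric]) (auto intro: prob_space_cgauss)
  also have "(\<integral>\<^sup>+v. \<Phi> v \<partial>\<dots>) = (\<integral>\<^sup>+a. \<Phi> (compose {..<m} ?g a) \<partial>cgauss_vec m)"
  proof (rule nn_integral_distr)
    show "\<Phi> \<in> borel_measurable (distr (cgauss_vec m) (cgauss_vec m) (compose {..<m} ?g))"
      using \<Phi>m by simp
    show "compose {..<m} ?g \<in> cgauss_vec m \<rightarrow>\<^sub>M cgauss_vec m"
      unfolding compose_def
      by (subst measurable_cong_sets[OF refl sets_cgauss_vec], intro measurable_restrict) measurable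
  qed
  also have "\<dots> = (\<integral>\<^sup>+a. ennreal ((C\<^sup>2) ^ p) * \<Phi> a \<partial>cgauss_vec m)"
  proof (intro nn_integral_cong)
    fix a
    have "?f x (compose {..<m} ?g a) = C\<^sup>2 * ?f x a" for x
    proof -
      have "diag_chaos m (A x) (compose {..<m} ?g a) (compose {..<m} ?g a) = C\<^sup>2 * diag_chaos m (A x) a a"
        by (simp add: diag_chaos_def compose_def sum_distrib_left power2_eq_square algebra_simps)
      moreover have "nrm2 m (app m (A x) (compose {..<m} ?g a)) = C\<^sup>2 * nrm2 m (app m (A x) a)"
        by (simp add: compose_def app_scale nrm2_scale)
      ultimately show ?thesis by (simp add: right_diff_distrib)
    qed
    then show "\<Phi> (compose {..<m} ?g a) = ennreal ((C\<^sup>2) ^ p) * \<Phi> a"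
      unfolding \<Phi>_def by (simp only: SUP_power_cmult zero_le_power2)
  qed
  also have "\<dots> = ennreal ((C\<^sup>2) ^ p) * (\<integral>\<^sup>+a. \<Phi> a \<partial>cgauss_vec m)"
    by (rule nn_integral_cmult[OF \<Phi>m])
  finally show ?thesis by (simp add: \<Phi>_def)
qed

text \<open>The centred diagonal is linear in the independent variables given by the squared modulus
  minus 1. Each is exchanged for \<open>C\<close> times the real part of a product of two Gaussians;
  the vector of Gaussian pairs is then read as a pair of Gaussian vectors.\<close>

lemma (in prob_space) diag_subgaussian_le:
  fixes \<xi> :: "nat \<Rightarrow> 'a \<Rightarrow> complex"
  assumes L: "L > 0" and m: "m \<ge> 1" and ind: "indep_vars (\<lambda>_. borel) \<xi> {..<m}"
    and \<xi>: "\<And>j. j < m \<Longrightarrow> integrable M (\<lambda>w. (cmod (\<xi> j w))\<^sup>2)" "\<And>j. j < m \<Longrightarrow> expectation (\<lambda>w. (cmod (\<xi> j w))\<^sup>2) = 1"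
      "\<And>j. j < m \<Longrightarrow> subgaussian L (\<xi> j)"
    and F: "finite F" and C: "C = 4 * (12 * L\<^sup>2) * (1 + 1 / (2 / pi))"
  shows "(\<integral>\<^sup>+w. (SUP x\<in>F. ennreal (\<bar>diag_chaos m (A x) (\<lambda>j. \<xi> j w) (\<lambda>j. \<xi> j w) - frob_sq m (A x)\<bar> ^ p)) \<partial>M) \<le>
    ennreal (C ^ p) * diag_moment p m F A"
proof -
  define \<Phi> where "\<Phi> y = (SUP x\<in>F. ennreal (\<bar>\<Sum>j<m. y j * col_sq m (A x) j\<bar> ^ p))" for y
  have \<Phi>m: "\<Phi> \<in> borel_measurable (PiM {..<m} (\<lambda>_. borel))"
    unfolding \<Phi>_def[abs_def] by (intro SUP_power_measurable F) measurable
  have rv: "\<xi> j \<in> borel_measurable M" if "j < m" for j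
    using ind that by (auto simp: indep_vars_def)
  let ?h = "\<lambda>z :: complex. (cmod z)\<^sup>2 - 1"
  define X where "X j = (if j < m then (\<lambda>w. ?h (\<xi> j w)) else (\<lambda>_. 0))" for j
  have Xm: "X j \<in> borel_measurable M" for j using rv[of j] by (auto simp: X_def)
  let ?C2 = "cgauss \<Otimes>\<^sub>M cgauss"
  have s2[measurable_cong]: "sets ?C2 = sets (borel \<Otimes>\<^sub>M borel)" by (intro sets_pair_measure_cong) auto
  let ?g = "\<lambda>p. C * Re (fst p * cnj (snd p))"
  \<comment> \<open>Here \<open>std_gauss\<close> is only a target with the Borel sets that is a
    probability space, as the transport of a product measure along a coordinatewise map
    requires.\<close>
  have gm: "?g \<in> ?C2 \<rightarrow>\<^sub>M std_gauss" by (subst measurable_cong_sets[OF refl sets_std_gauss]) measurable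
  have indX: "indep_vars (\<lambda>_. borel) (\<lambda>j w. ?h (\<xi> j w)) {..<m}"
    by (rule indep_vars_compose2[OF ind]) auto
  have "diag_chaos m (A x) (\<lambda>j. \<xi> j w) (\<lambda>j. \<xi> j w) - frob_sq m (A x) = (\<Sum>j<m. (\<lambda>j\<in>{..<m}. ?h (\<xi> j w)) j * col_sq m (A x) j)" for x w
    unfolding diag_chaos_def frob_sq_def sum_subtractf[symmetric]
    by (intro sum.cong) (auto simp: cmod_power2 algebra_simps, simp add: power2_eq_square)
  then have "(\<integral>\<^sup>+w. (SUP x\<in>F. ennreal (\<bar>diag_chaos m (A x) (\<lambda>j. \<xi> j w) (\<lambda>j. \<xi> j w) - frob_sq m (A x)\<bar> ^ p)) \<partial>M)
     = (\<integral>\<^sup>+w. \<Phi> (\<lambda>j\<in>{..<m}. ?h (\<xi> j w)) \<partial>M)"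
    by (simp only: \<Phi>_def)
  also have "\<dots> = (\<integral>\<^sup>+v. \<Phi> v \<partial>PiM {..<m} (\<lambda>j. distr M borel (\<lambda>w. ?h (\<xi> j w))))"
    using m by (intro nn_integral_indep_vars prob_space_axioms indX \<Phi>m) (auto simp: lessThan_empty_iff)
  also have "PiM {..<m} (\<lambda>j. distr M borel (\<lambda>w. ?h (\<xi> j w))) = PiM {..<m} (\<lambda>j. distr M borel (X j))"
    by (intro PiM_cong) (auto simp: X_def)
  also have "(\<integral>\<^sup>+v. \<Phi> v \<partial>PiM {..<m} (\<lambda>j. distr M borel (X j))) \<le> (\<integral>\<^sup>+v. \<Phi> v \<partial>PiM {..<m} (\<lambda>j. distr ?C2 std_gauss ?g))"
  proof (rule nn_integral_PiM_coord_mono[where B = borel])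
    show "prob_space (distr M borel (X j))" for j by (rule prob_space_distr[OF Xm])
    show "prob_space (distr ?C2 std_gauss ?g)"
      by (rule prob_space.prob_space_distr[OF prob_space_pair[OF prob_space_cgauss prob_space_cgauss] gm])
    fix j w assume "j \<in> {..<m}"
    then have j: "j < m" by simp
    define \<alpha> where "\<alpha> x = (\<Sum>k\<in>{..<m} - {j}. w k * col_sq m (A x) k)" for x
    define \<beta> where "\<beta> x = col_sq m (A x) j" for x
    have e: "\<Phi> (w(j := y)) = sup_affine p F \<alpha> \<beta> y" for y
    proof -
      have "(\<Sum>k<m. (w(j := y)) k * col_sq m (A x) k) = \<alpha> x + inner (\<beta> x) y" for x
        using j by (subst sum.remove[of _ j]) (auto simp: \<alpha>_def \<beta>_def)
      then show ?thesis by (simp only: \<Phi>_def sup_affine_def)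
    qed
    note sup_affine_measurable[OF F, measurable]
    have "(\<integral>\<^sup>+y. \<Phi> (w(j := y)) \<partial>distr M borel (X j)) = (\<integral>\<^sup>+w. sup_affine p F \<alpha> \<beta> (?h (\<xi> j w)) \<partial>M)"
      unfolding e using Xm[of j] j by (subst nn_integral_distr) (auto simp: X_def)
    also have "\<dots> \<le> (\<integral>\<^sup>+a. \<integral>\<^sup>+b. sup_affine p F \<alpha> \<beta> (C * Re (a * cnj b)) \<partial>cgauss \<partial>cgauss)"
      by (rule sup_affine_subgaussian_sq_le_cgauss[OF L \<xi>(3)[OF j] rv[OF j] \<xi>(1)[OF j] \<xi>(2)[OF j] F C])
    also have "\<dots> = (\<integral>\<^sup>+q. sup_affine p F \<alpha> \<beta> (?g q) \<partial>?C2)"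
    proof -
      have "(\<lambda>q. sup_affine p F \<alpha> \<beta> (?g q)) \<in> borel_measurable ?C2"
        by (rule measurable_compose[OF gm]) (simp cong: measurable_cong_sets)
      from cgauss.nn_integral_fst[OF this] show ?thesis by simp
    qed
    also have "\<dots> = (\<integral>\<^sup>+y. \<Phi> (w(j := y)) \<partial>distr ?C2 std_gauss ?g)"
      unfolding e using gm by (subst nn_integral_distr) (auto cong: measurable_cong_sets)
    finally show "(\<integral>\<^sup>+y. \<Phi> (w(j := y)) \<partial>distr M borel (X j)) \<le> (\<integral>\<^sup>+y. \<Phi> (w(j := y)) \<partial>distr ?C2 std_gauss ?g)" .
  qed (auto intro: \<Phi>m)
  also have "PiM {..<m} (\<lambda>j. distr ?C2 std_gauss ?g) = distr (PiM {..<m} (\<lambda>_. ?C2)) (PiM {..<m} (\<lambda>_. std_gauss)) (compose {..<m} ?g)"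
    using gm by (intro distr_PiM_finite_prob_space'[symmetric]) (auto intro: prob_space_std_gauss prob_space_pair prob_space_cgauss)
  also have "(\<integral>\<^sup>+v. \<Phi> v \<partial>\<dots>) = (\<integral>\<^sup>+q. \<Phi> (compose {..<m} ?g q) \<partial>PiM {..<m} (\<lambda>_. ?C2))"
  proof (rule nn_integral_distr)
    show "compose {..<m} ?g \<in> PiM {..<m} (\<lambda>_. ?C2) \<rightarrow>\<^sub>M PiM {..<m} (\<lambda>_. std_gauss)"
      unfolding compose_def by (intro measurable_restrict measurable_compose[OF _ gm]) measurable
    show "\<Phi> \<in> borel_measurable (distr (PiM {..<m} (\<lambda>_. ?C2)) (PiM {..<m} (\<lambda>_. std_gauss)) (compose {..<m} ?g))"
      using \<Phi>m by (simp cong: measurable_cong_sets sets_PiM_cong)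
  qed
  also have "\<dots> = (\<integral>\<^sup>+q. (SUP x\<in>F. ennreal (\<bar>C * diag_chaos m (A x) (\<lambda>j\<in>{..<m}. fst (q j)) (\<lambda>j\<in>{..<m}. snd (q j))\<bar> ^ p)) \<partial>PiM {..<m} (\<lambda>_. ?C2))"
    unfolding \<Phi>_def diag_restrict
    by (intro nn_integral_cong SUP_cong refl arg_cong[of _ _ ennreal] arg_cong[of _ _ "\<lambda>x. \<bar>x\<bar> ^ p"])
      (simp add: diag_chaos_def compose_def sum_distrib_left mult.assoc del: times_complex.sel)
  also have "\<dots> = (\<integral>\<^sup>+a. \<integral>\<^sup>+b. (SUP x\<in>F. ennreal (\<bar>C * diag_chaos m (A x) a b\<bar> ^ p)) \<partial>cgauss_vec m \<partial>cgauss_vec m)"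
    unfolding cgauss_vec_def
    by (rule nn_integral_PiM_pair[OF _ prob_space_cgauss prob_space_cgauss])
      (use diag_pair_measurable in \<open>auto simp: split_beta' cgauss_vec_def intro!: SUP_power_measurable F\<close>)
  also have "\<dots> = ennreal (C ^ p) * diag_moment p m F A"
  proof -
    have "C \<ge> 0" by (simp add: C)
    then show ?thesis
      unfolding diag_moment_def SUP_power_cmult[OF \<open>C \<ge> 0\<close>]
      by (intro iterated_nn_integral_cmult) (use F diag_pair_measurable in \<open>auto simp: split_beta' intro!: SUP_power_measurable\<close>)
  qed
  finally show ?thesis .
qed

text \<open>The deviation is the off-diagonal form plus the centred diagonal, and separating them
  costs a factor 2. In the off-diagonal part 4 comes from \<open>off_diag_moment_le\<close> and
  another 2 from bounding the diagonal moment by the full one; hence 16.\<close>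

theorem (in prob_space) subgaussian_chaos_moment:
  fixes \<xi> :: "nat \<Rightarrow> 'a \<Rightarrow> complex"
  assumes L: "L > 0" and m: "m \<ge> 1" and ind: "indep_vars (\<lambda>_. borel) \<xi> {..<m}"
    and \<xi>: "\<And>j. j < m \<Longrightarrow> integrable M (\<xi> j)" "\<And>j. j < m \<Longrightarrow> expectation (\<xi> j) = 0"
      "\<And>j. j < m \<Longrightarrow> complex_variance (\<xi> j) = 1" "\<And>j. j < m \<Longrightarrow> subgaussian L (\<xi> j)"
    and F: "finite F" and p: "p \<ge> 1"
    and C1: "C1 = 8 * (sqrt 5 * L) * (1 + 1 / sqrt (2 / pi))" and C2: "C2 = 4 * (12 * L\<^sup>2) * (1 + 1 / (2 / pi))"
  shows "(\<integral>\<^sup>+w. (SUP x\<in>F. ennreal (\<bar>nrm2 m (app m (A x) (\<lambda>j. \<xi> j w)) - frob_sq m (A x)\<bar> ^ p)) \<partial>M) \<le>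
    ennreal ((16 * C1\<^sup>2 + 2 * C2) ^ p) * chaos_moment p m F A"
proof -
  let ?Q = "chaos_moment p m F A"
  let ?O = "\<lambda>w. (SUP x\<in>F. ennreal (\<bar>nrm2 m (app m (A x) (\<lambda>j. \<xi> j w)) - diag_chaos m (A x) (\<lambda>j. \<xi> j w) (\<lambda>j. \<xi> j w)\<bar> ^ p))"
  let ?D = "\<lambda>w. (SUP x\<in>F. ennreal (\<bar>diag_chaos m (A x) (\<lambda>j. \<xi> j w) (\<lambda>j. \<xi> j w) - frob_sq m (A x)\<bar> ^ p))"
  have v: "expectation (\<lambda>w. (cmod (\<xi> j w))\<^sup>2) = 1" if "j < m" for j
    using \<xi>(2,3)[OF that] by (simp add: complex_variance_def)
  \<comment> \<open>The integral of a non-integrable function is 0 by convention, so variance one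
    already entails integrability.\<close>
  have vi: "integrable M (\<lambda>w. (cmod (\<xi> j w))\<^sup>2)" if "j < m" for j
    using v[OF that] not_integrable_integral_eq by fastforce
  have C0: "C1 \<ge> 0" "C2 \<ge> 0" using L by (auto simp: C1 C2)
  have rv: "\<xi> j \<in> borel_measurable M" if "j < m" for j using \<xi>(1)[OF that] by simp
  have mO: "?O \<in> borel_measurable M" and mD: "?D \<in> borel_measurable M"
    unfolding nrm2_def app_def diag_chaos_def by (intro SUP_power_measurable F; use rv in measurable)+
  have D: "diag_moment p m F A \<le> ?Q" by (rule diag_moment_le[OF F])
  have "(\<integral>\<^sup>+w. ?O w \<partial>M) \<le> ennreal ((C1\<^sup>2) ^ p) * (ennreal (4 ^ p) * (?Q + diag_moment p m F A))"
    by (rule order_trans[OF off_diag_subgaussian_le[OF L m ind \<xi>(1,2,4) F C1] mult_left_mono[OF off_diag_moment_le[OF F]]]) auto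
  also have "\<dots> \<le> ennreal ((C1\<^sup>2) ^ p) * (ennreal (4 ^ p) * (?Q + ?Q))"
    by (intro mult_left_mono add_left_mono D) auto
  also have "\<dots> = ennreal (2 * (4 * C1\<^sup>2) ^ p) * ?Q"
    by (simp add: power_mult_distrib ennreal_mult' mult_2[symmetric] mult_ac)
  finally have O: "(\<integral>\<^sup>+w. ?O w \<partial>M) \<le> ennreal (2 * (4 * C1\<^sup>2) ^ p) * ?Q" .
  have D': "(\<integral>\<^sup>+w. ?D w \<partial>M) \<le> ennreal (C2 ^ p) * ?Q"
    by (rule order_trans[OF diag_subgaussian_le[OF L m ind vi v \<xi>(4) F C2] mult_left_mono[OF D]]) auto
  have "(\<integral>\<^sup>+w. (SUP x\<in>F. ennreal (\<bar>nrm2 m (app m (A x) (\<lambda>j. \<xi> j w)) - frob_sq m (A x)\<bar> ^ p)) \<partial>M) \<le>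
      (\<integral>\<^sup>+w. ennreal (2 ^ p) * (?O w + ?D w) \<partial>M)"
  proof (intro nn_integral_mono SUP_least)
    fix w x assume x: "x \<in> F"
    let ?o = "nrm2 m (app m (A x) (\<lambda>j. \<xi> j w)) - diag_chaos m (A x) (\<lambda>j. \<xi> j w) (\<lambda>j. \<xi> j w)"
    let ?d = "diag_chaos m (A x) (\<lambda>j. \<xi> j w) (\<lambda>j. \<xi> j w) - frob_sq m (A x)"
    have "\<bar>nrm2 m (app m (A x) (\<lambda>j. \<xi> j w)) - frob_sq m (A x)\<bar> ^ p \<le> 2 ^ p * (\<bar>?o\<bar> ^ p + \<bar>?d\<bar> ^ p)"
      using abs_add_power_le[of ?o ?d p] by simp
    then have "ennreal (\<bar>nrm2 m (app m (A x) (\<lambda>j. \<xi> j w)) - frob_sq m (A x)\<bar> ^ p) \<le> ennreal (2 ^ p) * (ennreal (\<bar>?o\<bar> ^ p) + ennreal (\<bar>?d\<bar> ^ p))"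
      by (simp add: ennreal_plus[symmetric] ennreal_mult'[symmetric] ennreal_leI del: ennreal_plus)
    also have "\<dots> \<le> ennreal (2 ^ p) * (?O w + ?D w)"
      using x by (intro mult_left_mono add_mono SUP_upper) auto
    finally show "ennreal (\<bar>nrm2 m (app m (A x) (\<lambda>j. \<xi> j w)) - frob_sq m (A x)\<bar> ^ p) \<le> ennreal (2 ^ p) * (?O w + ?D w)" .
  qed
  also have "\<dots> = ennreal (2 ^ p) * ((\<integral>\<^sup>+w. ?O w \<partial>M) + (\<integral>\<^sup>+w. ?D w \<partial>M))"
    using mO mD by (simp add: nn_integral_cmult nn_integral_add)
  also have "\<dots> \<le> ennreal (2 ^ p) * (ennreal (2 * (4 * C1\<^sup>2) ^ p) * ?Q + ennreal (C2 ^ p) * ?Q)"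
    by (intro mult_left_mono add_mono O D') auto
  also have "\<dots> = ennreal (2 ^ p * (2 * (4 * C1\<^sup>2) ^ p + C2 ^ p)) * ?Q"
    using C0 by (simp add: ennreal_mult' ennreal_plus algebra_simps)
  also have "\<dots> \<le> ennreal ((16 * C1\<^sup>2 + 2 * C2) ^ p) * ?Q"
  proof (intro mult_right_mono ennreal_leI)
    have "(2 :: real) \<le> 2 ^ p" using power_increasing[of 1 p "2 :: real"] p by simp
    then have "2 * (4 * C1\<^sup>2) ^ p \<le> 2 ^ p * (4 * C1\<^sup>2) ^ p" by (intro mult_right_mono) auto
    then have "2 ^ p * (2 * (4 * C1\<^sup>2) ^ p + C2 ^ p) \<le> 2 ^ p * (2 ^ p * (4 * C1\<^sup>2) ^ p + C2 ^ p)"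
      by (intro mult_left_mono) auto
    also have "\<dots> = (2 * (2 * (4 * C1\<^sup>2))) ^ p + (2 * C2) ^ p"
      by (simp only: power_mult_distrib distrib_left)
    also have "\<dots> \<le> (16 * C1\<^sup>2 + 2 * C2) ^ p"
    proof -
      have "x ^ p + y ^ p \<le> (x + y) ^ p" if "x \<ge> 0" "y \<ge> 0" for x y :: real
        using p
      proof (induction p rule: dec_induct)
        case (step n)
        have "x ^ Suc n + y ^ Suc n \<le> (x + y) * (x ^ n + y ^ n)"
          using that by (simp add: algebra_simps)
        also have "\<dots> \<le> (x + y) * (x + y) ^ n" using step that by (intro mult_left_mono) auto
        finally show ?case by simp
      qed simp
      from this[of "16 * C1\<^sup>2" "2 * C2"] show ?thesis using C0 by simp
    qed
    finally show "2 ^ p * (2 * (4 * C1\<^sup>2) ^ p + C2 ^ p) \<le> (16 * C1\<^sup>2 + 2 * C2) ^ p" .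
  qed simp
  finally show ?thesis .
qed

section \<open>Signed sums of operators\<close>

text \<open>Hoeffding's lemma for a symmetric sign, taken at probability 1/2 and interval length
  \<open>2 * t\<close>.\<close>

lemma cosh_le_exp_half_sq:
  fixes t :: real
  assumes "t \<ge> 0"
  shows "exp t + exp (- t) \<le> 2 * exp (t\<^sup>2 / 2)"
proof -
  have "- (2 * t) * (1 / 2) + ln (1 + 1 / 2 * (exp (2 * t) - 1)) \<le> (2 * t)\<^sup>2 / 8"
    using assms by (intro Hoeffdings_lemma_aux) auto
  then have "ln ((1 + exp (2 * t)) / 2) \<le> t\<^sup>2 / 2 + t"
    by (simp add: power2_eq_square field_simps)
  then have "exp (ln ((1 + exp (2 * t)) / 2)) \<le> exp (t\<^sup>2 / 2 + t)"
    by (simp only: exp_le_cancel_iff)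
  moreover have "0 < (1 + exp (2 * t)) / 2" by (simp add: add_pos_pos)
  ultimately have "(1 + exp (2 * t)) / 2 \<le> exp (t\<^sup>2 / 2 + t)"
    by (simp only: exp_ln)
  then have "(1 + exp (2 * t)) / 2 * exp (- t) \<le> exp (t\<^sup>2 / 2 + t) * exp (- t)"
    by (rule mult_right_mono) simp
  then show ?thesis by (simp add: exp_add[symmetric] field_simps)
qed

text \<open>A sign pattern is encoded by the set of its positive indices, so that averages over
  patterns are finite sums over \<open>Pow I\<close>.\<close>

definition sgn_of :: "'i set \<Rightarrow> 'i \<Rightarrow> real" where
  "sgn_of J i = (if i \<in> J then 1 else - 1)"

lemma sum_Pow_prod_sgn_of:
  assumes "finite I"
  shows "(\<Sum>J\<in>Pow I. \<Prod>i\<in>I. f i (sgn_of J i)) = (\<Prod>i\<in>I. f i 1 + f i (- 1) :: real)"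
proof -
  have "(\<Prod>i\<in>I. f i 1 + f i (- 1)) = (\<Sum>J\<in>Pow I. (\<Prod>i\<in>J. f i 1) * (\<Prod>i\<in>I - J. f i (- 1)))"
    by (rule prod_add[OF assms])
  also have "\<dots> = (\<Sum>J\<in>Pow I. \<Prod>i\<in>I. f i (sgn_of J i))"
  proof (rule sum.cong[OF refl])
    fix J assume J: "J \<in> Pow I"
    then have "(\<Prod>i\<in>I. f i (sgn_of J i)) = (\<Prod>i\<in>I - J. f i (sgn_of J i)) * (\<Prod>i\<in>J. f i (sgn_of J i))"
      using assms by (intro prod.subset_diff) auto
    also have "\<dots> = (\<Prod>i\<in>J. f i 1) * (\<Prod>i\<in>I - J. f i (- 1))"
      by (simp add: sgn_of_def mult.commute)
    finally show "(\<Prod>i\<in>J. f i 1) * (\<Prod>i\<in>I - J. f i (- 1)) = (\<Prod>i\<in>I. f i (sgn_of J i))" by simp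
  qed
  finally show ?thesis by simp
qed

lemma prod_list_eq_prod_power:
  fixes f :: "'i \<Rightarrow> real"
  assumes "finite I" "set xs \<subseteq> I"
  shows "prod_list (map f xs) = (\<Prod>i\<in>I. f i ^ count_list xs i)"
  using assms(2)
proof (induction xs)
  case (Cons x xs)
  have "(\<Prod>i\<in>I. f i ^ count_list (x # xs) i) = (\<Prod>i\<in>I. (if i = x then f x else 1) * f i ^ count_list xs i)"
    by (intro prod.cong) auto
  then show ?case using Cons assms(1) by (simp add: prod.distrib)
qed simp

text \<open>The sum factorizes over the indices into terms \<open>1 + (- 1) ^ n\<close>, with
  \<open>n\<close> the multiplicity of the index in the word, and each of them is 0 or 2.\<close>

lemma sum_Pow_prod_list_nonneg:
  assumes "finite I" "set xs \<subseteq> I"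
  shows "(\<Sum>J\<in>Pow I. prod_list (map (sgn_of J) xs)) \<ge> 0"
proof -
  have "(\<Sum>J\<in>Pow I. prod_list (map (sgn_of J) xs)) = (\<Sum>J\<in>Pow I. \<Prod>i\<in>I. sgn_of J i ^ count_list xs i)"
    using assms by (simp add: prod_list_eq_prod_power)
  also have "\<dots> = (\<Prod>i\<in>I. 1 ^ count_list xs i + (- 1) ^ count_list xs i)"
    by (rule sum_Pow_prod_sgn_of[OF assms(1), of "\<lambda>i x. x ^ count_list xs i"])
  also have "\<dots> \<ge> 0"
    by (intro prod_nonneg ballI) (metis add_nonneg_nonneg add.right_inverse neg_one_even_power neg_one_odd_power order_refl power_one zero_le_one)
  finally show ?thesis .
qed

abbreviation words :: "'i set \<Rightarrow> nat \<Rightarrow> 'i list set" where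
  "words I q \<equiv> {xs. set xs \<subseteq> I \<and> length xs = q}"

lemma sum_words_Suc:
  assumes "finite I"
  shows "(\<Sum>xs\<in>words I (Suc q). f xs) = (\<Sum>xs\<in>words I q. \<Sum>i\<in>I. f (i # xs))"
proof -
  have "(\<Sum>xs\<in>words I (Suc q). f xs) = (\<Sum>p\<in>words I q \<times> I. f (snd p # fst p))"
    unfolding lists_length_Suc_eq by (subst sum.reindex) (auto simp: inj_on_def split_beta)
  then show ?thesis by (simp add: sum.cartesian_product split_beta)
qed

lemma sum_power_words:
  fixes f :: "'i \<Rightarrow> real"
  assumes "finite I"
  shows "(\<Sum>i\<in>I. f i) ^ q = (\<Sum>xs\<in>words I q. prod_list (map f xs))"
proof (induction q)
  case 0
  have "words I 0 = {[]}" by auto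
  then show ?case by simp
next
  case (Suc q)
  have "(\<Sum>i\<in>I. f i) ^ Suc q = (\<Sum>xs\<in>words I q. prod_list (map f xs)) * (\<Sum>i\<in>I. f i)"
    by (simp add: Suc mult.commute)
  then show ?case
    unfolding sum_words_Suc[OF assms] by (simp add: sum_product mult.commute) (rule sum.swap)
qed

text \<open>The argument of \<open>PiM_cgauss_moment\<close> with the cosh bound in place of the
  Gaussian exponential moment; the variance is replaced by \<open>card I\<close>.\<close>

lemma rademacher_moment:
  assumes I: "finite I" "I \<noteq> {}" and q: "q \<ge> 1"
  shows "(\<Sum>J\<in>Pow I. (\<Sum>i\<in>I. sgn_of J i) ^ (2 * q)) \<le> 2 ^ card I * (2 * exp 1 * q * card I) ^ q"
proof -
  define N where "N = real (card I)"
  have N: "N > 0" using I by (simp add: N_def card_gt_0_iff)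
  define t where "t = sqrt (2 * q / N)"
  have t: "t > 0" "t\<^sup>2 = 2 * q / N" using q N by (auto simp: t_def)
  define C where "C = real (2 * q) ^ (2 * q) / 2 / t ^ (2 * q)"
  have C: "C \<ge> 0" using t by (simp add: C_def)
  let ?X = "\<lambda>J. \<Sum>i\<in>I. sgn_of J i"
  have mg: "(\<Sum>J\<in>Pow I. exp (c * ?X J)) \<le> 2 ^ card I * exp (N * (t\<^sup>2 / 2))" if c: "c = t \<or> c = - t" for c
  proof -
    have "(\<Sum>J\<in>Pow I. exp (c * ?X J)) = (\<Sum>J\<in>Pow I. \<Prod>i\<in>I. exp (c * sgn_of J i))"
      using I by (simp add: exp_sum sum_distrib_left)
    also have "\<dots> = (\<Prod>i\<in>I. exp (c * 1) + exp (c * (- 1)))"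
      by (rule sum_Pow_prod_sgn_of[OF I(1)])
    also have "\<dots> = (exp t + exp (- t)) ^ card I" using c by (auto simp: add.commute)
    also have "\<dots> \<le> (2 * exp (t\<^sup>2 / 2)) ^ card I"
      using t by (intro power_mono cosh_le_exp_half_sq) (auto simp: add_nonneg_nonneg)
    also have "\<dots> = 2 ^ card I * exp (N * (t\<^sup>2 / 2))"
      by (simp only: power_mult_distrib exp_of_nat_mult N_def)
    finally show ?thesis .
  qed
  have "?X J ^ (2 * q) \<le> C * (exp (t * ?X J) + exp (- t * ?X J))" for J
    using even_power_le_exp_moment[OF q, of "t * ?X J"] t
    by (simp add: C_def power_mult_distrib field_simps)
  then have "(\<Sum>J\<in>Pow I. ?X J ^ (2 * q)) \<le> (\<Sum>J\<in>Pow I. C * (exp (t * ?X J) + exp (- t * ?X J)))"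
    by (intro sum_mono)
  also have "\<dots> = C * ((\<Sum>J\<in>Pow I. exp (t * ?X J)) + (\<Sum>J\<in>Pow I. exp (- t * ?X J)))"
    by (simp only: sum_distrib_left sum.distrib distrib_left)
  also have "\<dots> \<le> C * (2 ^ card I * exp (N * (t\<^sup>2 / 2)) + 2 ^ card I * exp (N * (t\<^sup>2 / 2)))"
    using C by (intro mult_left_mono add_mono mg) auto
  also have "\<dots> = 2 ^ card I * (C * (2 * exp q))"
    using t N by (simp add: algebra_simps)
  also have "C * (2 * exp q) = (2 * exp 1 * q * card I) ^ q"
  proof -
    have "t ^ (2 * q) = (2 * q / N) ^ q" using t by (simp add: power_mult)
    moreover have "exp (real q) = exp 1 ^ q" by (simp add: exp_of_nat_mult[symmetric])
    ultimately have "C * (2 * exp q) = ((real (2 * q))\<^sup>2) ^ q / (2 * q / N) ^ q * exp 1 ^ q"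
      by (simp add: C_def power_mult)
    also have "\<dots> = ((real (2 * q))\<^sup>2 / (2 * q / N) * exp 1) ^ q"
      by (simp only: power_divide power_mult_distrib)
    also have "(real (2 * q))\<^sup>2 / (2 * q / N) * exp 1 = 2 * exp 1 * q * card I"
      using q by (simp add: power2_eq_square N_def)
    finally show ?thesis .
  qed
  finally show ?thesis by simp
qed

section \<open>Alternating powers of a signed sum and their expansion into words\<close>

definition signed_sum :: "'i set \<Rightarrow> ('i \<Rightarrow> nat \<Rightarrow> nat \<Rightarrow> complex) \<Rightarrow> ('i \<Rightarrow> real) \<Rightarrow> nat \<Rightarrow> nat \<Rightarrow> complex" where
  "signed_sum I B c = (\<lambda>k l. \<Sum>i\<in>I. of_real (c i) * B i k l)"

lemma adj_adj [simp]: "adj (adj B) = B"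
  by (simp add: adj_def fun_eq_iff)

lemma adj_signed_sum: "adj (signed_sum I B c) = signed_sum I (\<lambda>i. adj (B i)) c"
  by (simp add: adj_def signed_sum_def fun_eq_iff)

lemma app_signed_sum: "app m (signed_sum I B c) v k = (\<Sum>i\<in>I. of_real (c i) * app m (B i) v k)"
  unfolding app_def signed_sum_def sum_distrib_right sum_distrib_left
  by (subst sum.swap) (simp add: mult_ac)

lemma app_sum: "app m B (\<lambda>l. \<Sum>x\<in>X. c x * f x l) k = (\<Sum>x\<in>X. c x * app m B (f x) k)"
  unfolding app_def sum_distrib_left by (subst sum.swap) (simp add: mult_ac)

definition par :: "nat \<Rightarrow> (nat \<Rightarrow> nat \<Rightarrow> complex) \<Rightarrow> nat \<Rightarrow> nat \<Rightarrow> complex" where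
  "par q B = (if even q then B else adj B)"

text \<open>Applies \<open>S\<close>, \<open>adj S\<close>, \<open>S\<close>, ... in turn,
  \<open>q\<close> operators in all. For even \<open>q\<close> this is a power of
  \<open>adj S\<close> composed with \<open>S\<close>, so powers make sense although
  \<open>S\<close> is not self-adjoint.\<close>

fun alt_pow :: "nat \<Rightarrow> (nat \<Rightarrow> nat \<Rightarrow> complex) \<Rightarrow> nat \<Rightarrow> (nat \<Rightarrow> complex) \<Rightarrow> nat \<Rightarrow> complex" where
  "alt_pow m S 0 v = v"
| "alt_pow m S (Suc q) v = app m (par q S) (alt_pow m S q v)"

text \<open>One term in the expansion of \<open>alt_pow\<close>. The head of the list is applied
  last, so \<open>length xs\<close> operators precede it and decide whether it occurs as an
  adjoint.\<close>

fun word_app :: "nat \<Rightarrow> ('i \<Rightarrow> nat \<Rightarrow> nat \<Rightarrow> complex) \<Rightarrow> 'i list \<Rightarrow> (nat \<Rightarrow> complex) \<Rightarrow> nat \<Rightarrow> complex" where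
  "word_app m B [] v = v"
| "word_app m B (i # xs) v = app m (par (length xs) (B i)) (word_app m B xs v)"

lemma alt_pow_signed_sum:
  assumes "finite I"
  shows "alt_pow m (signed_sum I B c) q v k = (\<Sum>xs\<in>words I q. of_real (prod_list (map c xs)) * word_app m B xs v k)"
proof (induction q arbitrary: k)
  case 0
  have "words I 0 = {[]}" by auto
  then show ?case by simp
next
  case (Suc q)
  have p: "par q (signed_sum I B c) = signed_sum I (\<lambda>i. par q (B i)) c"
    by (simp add: par_def adj_signed_sum)
  have "alt_pow m (signed_sum I B c) (Suc q) v k =
      (\<Sum>i\<in>I. of_real (c i) * app m (par q (B i)) (\<lambda>k. \<Sum>xs\<in>words I q. of_real (prod_list (map c xs)) * word_app m B xs v k) k)"
    by (simp add: p app_signed_sum Suc[abs_def])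
  also have "\<dots> = (\<Sum>i\<in>I. \<Sum>xs\<in>words I q. of_real (c i) * (of_real (prod_list (map c xs)) * app m (par q (B i)) (word_app m B xs v) k))"
    by (simp only: app_sum sum_distrib_left)
  also have "\<dots> = (\<Sum>xs\<in>words I q. \<Sum>i\<in>I. of_real (c i) * (of_real (prod_list (map c xs)) * app m (par q (B i)) (word_app m B xs v) k))"
    by (rule sum.swap)
  also have "\<dots> = (\<Sum>xs\<in>words I (Suc q). of_real (prod_list (map c xs)) * word_app m B xs v k)"
    unfolding sum_words_Suc[OF assms] by (intro sum.cong refl) (auto simp: mult_ac)
  finally show ?case .
qed

lemma nrm2_word_app_le:
  assumes "\<And>i. i \<in> I \<Longrightarrow> op_bound m (B i) 1" "set xs \<subseteq> I"
  shows "nrm2 m (word_app m B xs v) \<le> nrm2 m v"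
  using assms(2)
proof (induction xs)
  case (Cons i xs)
  have "op_bound m (par (length xs) (B i)) 1"
    using assms(1)[of i] Cons.prems op_bound_adj by (auto simp: par_def)
  then have "nrm2 m (word_app m B (i # xs) v) \<le> nrm2 m (word_app m B xs v)"
    by (simp add: op_bound_def)
  then show ?case using Cons by simp
qed simp

text \<open>All coefficients of the expansion are nonnegative after summation over the signs, so the
  operators may be replaced by scalars of modulus one.\<close>

lemma sum_signs_alt_pow:
  assumes I: "finite I" and B: "\<And>i. i \<in> I \<Longrightarrow> op_bound m (B i) 1"
  shows "(\<Sum>J\<in>Pow I. nrm2 m (alt_pow m (signed_sum I B (sgn_of J)) q v)) \<le>
    nrm2 m v * (\<Sum>J\<in>Pow I. (\<Sum>i\<in>I. sgn_of J i) ^ (2 * q))"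
proof -
  let ?W = "words I q"
  let ?s = "\<lambda>J xs. prod_list (map (sgn_of J) xs)"
  have e: "nrm2 m (alt_pow m (signed_sum I B (sgn_of J)) q v) =
    (\<Sum>xs\<in>?W. \<Sum>ys\<in>?W. ?s J (xs @ ys) * rip m (word_app m B xs v) (word_app m B ys v))" for J
  proof -
    have "nrm2 m (alt_pow m (signed_sum I B (sgn_of J)) q v) =
      rip m (\<lambda>k. \<Sum>xs\<in>?W. of_real (?s J xs) * word_app m B xs v k) (\<lambda>k. \<Sum>xs\<in>?W. of_real (?s J xs) * word_app m B xs v k)"
      unfolding rip_self[symmetric] alt_pow_signed_sum[OF I, abs_def] ..
    also have "\<dots> = (\<Sum>k<m. \<Sum>xs\<in>?W. \<Sum>ys\<in>?W. ?s J (xs @ ys) * Re (word_app m B xs v k * cnj (word_app m B ys v k)))"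
      unfolding rip_def by (intro sum.cong refl) (simp add: sum_product algebra_simps)
    also have "\<dots> = (\<Sum>xs\<in>?W. \<Sum>k<m. \<Sum>ys\<in>?W. ?s J (xs @ ys) * Re (word_app m B xs v k * cnj (word_app m B ys v k)))"
      by (rule sum.swap)
    also have "\<dots> = (\<Sum>xs\<in>?W. \<Sum>ys\<in>?W. \<Sum>k<m. ?s J (xs @ ys) * Re (word_app m B xs v k * cnj (word_app m B ys v k)))"
      by (intro sum.cong refl sum.swap)
    finally show ?thesis by (simp only: rip_def sum_distrib_left)
  qed
  have "(\<Sum>J\<in>Pow I. nrm2 m (alt_pow m (signed_sum I B (sgn_of J)) q v)) =
      (\<Sum>xs\<in>?W. \<Sum>J\<in>Pow I. \<Sum>ys\<in>?W. ?s J (xs @ ys) * rip m (word_app m B xs v) (word_app m B ys v))"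
    unfolding e by (rule sum.swap)
  also have "\<dots> = (\<Sum>xs\<in>?W. \<Sum>ys\<in>?W. \<Sum>J\<in>Pow I. ?s J (xs @ ys) * rip m (word_app m B xs v) (word_app m B ys v))"
    by (intro sum.cong refl sum.swap)
  also have "\<dots> = (\<Sum>xs\<in>?W. \<Sum>ys\<in>?W. (\<Sum>J\<in>Pow I. ?s J (xs @ ys)) * rip m (word_app m B xs v) (word_app m B ys v))"
    by (simp only: sum_distrib_right)
  also have "\<dots> \<le> (\<Sum>xs\<in>?W. \<Sum>ys\<in>?W. (\<Sum>J\<in>Pow I. ?s J (xs @ ys)) * nrm2 m v)"
  proof (intro sum_mono mult_left_mono)
    fix xs ys assume "xs \<in> ?W" "ys \<in> ?W"
    then have w: "set xs \<subseteq> I" "set ys \<subseteq> I" by auto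
    have "(rip m (word_app m B xs v) (word_app m B ys v))\<^sup>2 \<le> nrm2 m v * nrm2 m v"
      using nrm2_word_app_le[OF B w(1)] nrm2_word_app_le[OF B w(2)]
      by (intro order_trans[OF rip_Cauchy_Schwarz] mult_mono) auto
    then have "(rip m (word_app m B xs v) (word_app m B ys v))\<^sup>2 \<le> (nrm2 m v)\<^sup>2" by (simp add: power2_eq_square)
    then show "rip m (word_app m B xs v) (word_app m B ys v) \<le> nrm2 m v"
      by (rule power2_le_imp_le) simp
    show "0 \<le> (\<Sum>J\<in>Pow I. ?s J (xs @ ys))"
      using sum_Pow_prod_list_nonneg[OF I, of "xs @ ys"] w by simp
  qed
  also have "\<dots> = nrm2 m v * (\<Sum>xs\<in>?W. \<Sum>ys\<in>?W. \<Sum>J\<in>Pow I. ?s J xs * ?s J ys)"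
    by (simp add: sum_distrib_left sum_distrib_right mult.commute)
  also have "(\<Sum>xs\<in>?W. \<Sum>ys\<in>?W. \<Sum>J\<in>Pow I. ?s J xs * ?s J ys) = (\<Sum>xs\<in>?W. \<Sum>J\<in>Pow I. \<Sum>ys\<in>?W. ?s J xs * ?s J ys)"
    by (intro sum.cong refl sum.swap)
  also have "\<dots> = (\<Sum>J\<in>Pow I. \<Sum>xs\<in>?W. \<Sum>ys\<in>?W. ?s J xs * ?s J ys)"
    by (rule sum.swap)
  also have "\<dots> = (\<Sum>J\<in>Pow I. (\<Sum>i\<in>I. sgn_of J i) ^ (2 * q))"
    by (simp add: sum_power_words[OF I, symmetric] sum_product[symmetric] mult_2 power_add)
  finally show ?thesis .
qed

section \<open>From alternating powers to the operator norm\<close>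

lemma rip_alt_pow_shift:
  assumes "even (q + r)"
  shows "rip m (alt_pow m S q v) (alt_pow m S r v) = rip m v (alt_pow m S (q + r) v)"
  using assms
proof (induction q arbitrary: r)
  case (Suc q)
  have "adj (par q S) = par r S" using Suc.prems by (auto simp: par_def)
  then have "rip m (alt_pow m S (Suc q) v) (alt_pow m S r v) = rip m (alt_pow m S q v) (alt_pow m S (Suc r) v)"
    by (simp add: rip_adjoint)
  then show ?case using Suc.IH[of "Suc r"] Suc.prems by simp
qed simp

text \<open>Moving operators across the inner product, the squared norm of the power of order 2^k is
  the inner product of \<open>v\<close> with the power of order 2^(k+1); Cauchy-Schwarz then doubles
  the order. This takes the place of the spectral theorem.\<close>

lemma nrm2_app_power_le:
  "nrm2 m (app m S v) ^ (2 ^ k) \<le> nrm2 m v ^ (2 ^ k - 1) * nrm2 m (alt_pow m S (2 ^ k) v)"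
proof (induction k)
  case 0
  show ?case by (simp add: par_def)
next
  case (Suc k)
  let ?t = "nrm2 m (alt_pow m S (2 ^ k) v)"
  have "?t = rip m v (alt_pow m S (2 ^ Suc k) v)"
    using rip_alt_pow_shift[of "2 ^ k" "2 ^ k" m S v] by (simp add: rip_self mult_2)
  then have t: "?t\<^sup>2 \<le> nrm2 m v * nrm2 m (alt_pow m S (2 ^ Suc k) v)" using rip_Cauchy_Schwarz by simp
  have "nrm2 m (app m S v) ^ (2 ^ Suc k) = (nrm2 m (app m S v) ^ (2 ^ k))\<^sup>2"
    by (simp add: power_mult[symmetric] mult.commute)
  also have "\<dots> \<le> (nrm2 m v ^ (2 ^ k - 1) * ?t)\<^sup>2" by (intro power_mono Suc) simp
  also have "\<dots> = nrm2 m v ^ (2 * (2 ^ k - 1)) * ?t\<^sup>2"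
    by (simp add: power_mult_distrib power_mult[symmetric] mult.commute)
  also have "\<dots> \<le> nrm2 m v ^ (2 * (2 ^ k - 1)) * (nrm2 m v * nrm2 m (alt_pow m S (2 ^ Suc k) v))"
    by (intro mult_left_mono t) simp
  also have "\<dots> = nrm2 m v ^ Suc (2 * (2 ^ k - 1)) * nrm2 m (alt_pow m S (2 ^ Suc k) v)" by simp
  also have "Suc (2 * (2 ^ k - 1)) = 2 ^ Suc k - 1"
    by (cases "(2 :: nat) ^ k") auto
  finally show ?case .
qed

definition std_basis :: "nat \<Rightarrow> nat \<Rightarrow> complex" where
  "std_basis l i = (if i = l then 1 else 0)"

lemma alt_pow_basis:
  "k < m \<Longrightarrow> alt_pow m S q v k = app m (\<lambda>k l. alt_pow m S q (std_basis l) k) v k"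
proof (induction q arbitrary: k)
  case 0
  have "(\<Sum>j<m. (if k = j then 1 else 0) * v j) = (\<Sum>j<m. if k = j then v j else 0)" by (intro sum.cong) auto
  then show ?case using 0 by (simp add: app_def std_basis_def)
next
  case (Suc q)
  have "alt_pow m S (Suc q) v k = app m (par q S) (\<lambda>i. \<Sum>l<m. v l * alt_pow m S q (std_basis l) i) k"
    using Suc.IH by (simp add: app_def mult.commute)
  also have "\<dots> = (\<Sum>l<m. v l * app m (par q S) (alt_pow m S q (std_basis l)) k)"
    by (rule app_sum)
  finally show ?case by (simp add: app_def[of m "\<lambda>k l. app m (par q S) (alt_pow m S q (std_basis l)) k"] mult.commute)
qed

text \<open>The sum over the basis is the squared Frobenius norm of the alternating power, a trace,
  which unlike the operator norm can be averaged over the signs.\<close>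

lemma nrm2_alt_pow_le:
  "nrm2 m (alt_pow m S q v) \<le> (\<Sum>l<m. nrm2 m (alt_pow m S q (std_basis l))) * nrm2 m v"
proof -
  have "nrm2 m (alt_pow m S q v) = nrm2 m (app m (\<lambda>k l. alt_pow m S q (std_basis l) k) v)"
    unfolding nrm2_def by (intro sum.cong refl) (simp add: alt_pow_basis[symmetric])
  also have "\<dots> \<le> frob_sq m (\<lambda>k l. alt_pow m S q (std_basis l) k) * nrm2 m v" by (rule nrm2_app_le_frob)
  finally show ?thesis by (simp add: frob_sq_def col_sq_def nrm2_def)
qed

lemma nrm2_std_basis: "l < m \<Longrightarrow> nrm2 m (std_basis l) = 1"
proof -
  assume "l < m"
  have "nrm2 m (std_basis l) = (\<Sum>i<m. if i = l then 1 else 0)"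
    unfolding nrm2_def std_basis_def by (intro sum.cong) auto
  then show ?thesis using \<open>l < m\<close> by simp
qed

text \<open>\<open>nrm2_app_power_le\<close> provides orders that are powers of two. An order
  comparable to \<open>ln m\<close> makes the q-th root of the dimension bounded.\<close>

lemma ex_power2_near_ln:
  assumes "m \<ge> (2 :: nat)"
  obtains k where "ln m \<le> 2 ^ k" "2 ^ k \<le> 2 * ln m"
proof -
  have ln2: "ln m \<ge> 1 / 2"
  proof -
    have "(1 :: real) / 2 \<le> ln 2" using ln2_ge_two_thirds by simp
    also have "\<dots> \<le> ln m" using assms by simp
    finally show ?thesis .
  qed
  obtain n :: nat where n: "ln m < 2 ^ n" using real_arch_pow[of 2 "ln m"] by auto
  define k where "k = (LEAST k. ln m \<le> 2 ^ k)"
  have k: "ln m \<le> 2 ^ k" unfolding k_def by (rule LeastI[of _ n]) (use n in simp)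
  show ?thesis
  proof (cases k)
    case 0
    then show ?thesis using that[of k] k ln2 by simp
  next
    case (Suc j)
    have "\<not> ln m \<le> 2 ^ j" using not_less_Least[of j "\<lambda>k. ln m \<le> 2 ^ k"] Suc by (simp add: k_def)
    then show ?thesis using that[of k] k Suc by simp
  qed
qed

text \<open>Some sign pattern is no worse than the average, and the averaged trace is at most
  \<open>m\<close> times a scalar Rademacher moment. As \<open>q\<close> is at least
  \<open>ln m\<close>, the factor \<open>m\<close> costs no more than
  \<open>exp 1 ^ q\<close>.\<close>

lemma ex_signs_op_bound:
  fixes B :: "'i \<Rightarrow> nat \<Rightarrow> nat \<Rightarrow> complex"
  assumes I: "finite I" and B: "\<And>i. i \<in> I \<Longrightarrow> op_bound m (B i) 1" and m: "m \<ge> 2"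
  shows "\<exists>J\<subseteq>I. op_bound m (signed_sum I B (sgn_of J)) (2 * exp 1 * sqrt (ln m * card I))"
proof (cases "I = {}")
  case True
  have "nrm2 m (app m (signed_sum {} B c) a) = 0" for a c
    by (simp add: signed_sum_def app_def nrm2_def)
  then show ?thesis using True by (auto simp: op_bound_def)
next
  case False
  obtain k where k: "ln m \<le> 2 ^ k" "2 ^ k \<le> 2 * ln m" using ex_power2_near_ln[OF m] .
  define q :: nat where "q = 2 ^ k"
  have q: "q \<ge> 1" "ln m \<le> q" "q \<le> 2 * ln m" using k by (auto simp: q_def)
  define N where "N = real (card I)"
  define Y where "Y J = (\<Sum>l<m. nrm2 m (alt_pow m (signed_sum I B (sgn_of J)) q (std_basis l)))" for J
  have "(\<Sum>J\<in>Pow I. Y J) = (\<Sum>l<m. \<Sum>J\<in>Pow I. nrm2 m (alt_pow m (signed_sum I B (sgn_of J)) q (std_basis l)))"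
    unfolding Y_def by (rule sum.swap)
  also have "\<dots> \<le> (\<Sum>l<m. nrm2 m (std_basis l) * (\<Sum>J\<in>Pow I. (\<Sum>i\<in>I. sgn_of J i) ^ (2 * q)))"
    by (intro sum_mono sum_signs_alt_pow I B)
  also have "\<dots> = m * (\<Sum>J\<in>Pow I. (\<Sum>i\<in>I. sgn_of J i) ^ (2 * q))"
    by (simp add: nrm2_std_basis)
  also have "\<dots> \<le> m * (2 ^ card I * (2 * exp 1 * q * N) ^ q)"
    unfolding N_def by (intro mult_left_mono rademacher_moment I False q) simp
  finally have tot: "(\<Sum>J\<in>Pow I. Y J) \<le> (\<Sum>J\<in>Pow I. m * (2 * exp 1 * q * N) ^ q)"
    using I by (simp add: card_Pow mult.left_commute)
  have "\<exists>J\<in>Pow I. Y J \<le> m * (2 * exp 1 * q * N) ^ q"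
  proof (rule ccontr)
    assume "\<not> ?thesis"
    then have "(\<Sum>J\<in>Pow I. m * (2 * exp 1 * q * N) ^ q) < (\<Sum>J\<in>Pow I. Y J)"
      using I by (intro sum_strict_mono) (auto simp: not_le)
    then show False using tot by simp
  qed
  then obtain J where J: "J \<subseteq> I" "Y J \<le> m * (2 * exp 1 * q * N) ^ q" by auto
  let ?S = "signed_sum I B (sgn_of J)"
  have N0: "N \<ge> 0" by (simp add: N_def)
  have lnm: "ln m \<ge> 0" using m by simp
  have "nrm2 m (app m ?S a) \<le> (2 * exp 1 * sqrt (ln m * N))\<^sup>2 * nrm2 m a" for a
  proof -
    have "real m \<le> exp 1 ^ q"
    proof -
      have "real m = exp (ln m)" using m by simp
      also have "\<dots> \<le> exp q" using q by simp
      finally show ?thesis by (simp add: exp_of_nat_mult[symmetric])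
    qed
    then have "m * (2 * exp 1 * q * N) ^ q \<le> exp 1 ^ q * (2 * exp 1 * q * N) ^ q"
      using N0 by (intro mult_right_mono) auto
    also have "\<dots> = (2 * (exp 1)\<^sup>2 * q * N) ^ q"
      by (simp add: power_mult_distrib power2_eq_square)
    also have "\<dots> \<le> ((2 * exp 1 * sqrt (ln m * N))\<^sup>2) ^ q"
    proof (rule power_mono)
      have "2 * (exp 1)\<^sup>2 * q * N \<le> 2 * (exp 1)\<^sup>2 * (2 * ln m) * N"
        using q N0 by (intro mult_right_mono mult_left_mono) auto
      also have "\<dots> = (2 * exp 1 * sqrt (ln m * N))\<^sup>2"
        using lnm N0 by (simp add: power_mult_distrib)
      finally show "2 * (exp 1)\<^sup>2 * q * N \<le> (2 * exp 1 * sqrt (ln m * N))\<^sup>2" .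
    qed (use N0 in simp)
    finally have Yle: "Y J \<le> ((2 * exp 1 * sqrt (ln m * N))\<^sup>2) ^ q" using J(2) by linarith
    have "nrm2 m (app m ?S a) ^ q \<le> nrm2 m a ^ (q - 1) * nrm2 m (alt_pow m ?S q a)"
      unfolding q_def by (rule nrm2_app_power_le)
    also have "\<dots> \<le> nrm2 m a ^ (q - 1) * (Y J * nrm2 m a)"
      unfolding Y_def by (intro mult_left_mono nrm2_alt_pow_le) simp
    also have "\<dots> = Y J * nrm2 m a ^ q"
      using q(1) by (cases q) auto
    also have "\<dots> \<le> ((2 * exp 1 * sqrt (ln m * N))\<^sup>2) ^ q * nrm2 m a ^ q"
      using Yle by (intro mult_right_mono) auto
    also have "\<dots> = ((2 * exp 1 * sqrt (ln m * N))\<^sup>2 * nrm2 m a) ^ q"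
      by (simp only: power_mult_distrib)
    finally show ?thesis
      using q(1) by (subst (asm) power_mono_iff) auto
  qed
  then show ?thesis using J(1) by (auto simp: op_bound_def N_def)
qed

lemma nrm2_add_le:
  assumes "nrm2 m v \<le> x\<^sup>2" "nrm2 m w \<le> y\<^sup>2" "x \<ge> 0" "y \<ge> 0"
  shows "nrm2 m (\<lambda>i. v i + w i) \<le> (x + y)\<^sup>2"
proof -
  have "(rip m v w)\<^sup>2 \<le> (x * y)\<^sup>2"
    unfolding power_mult_distrib
    by (rule order_trans[OF rip_Cauchy_Schwarz]) (intro mult_mono assms, auto)
  then have "rip m v w \<le> x * y" by (rule power2_le_imp_le) (use assms(3,4) in simp)
  then show ?thesis using assms(1,2) power2_sum[of x y] unfolding nrm2_add by linarith
qed

lemma op_bound_add: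
  assumes "op_bound m B u" "op_bound m C v" "u \<ge> 0" "v \<ge> 0"
  shows "op_bound m (\<lambda>k l. B k l + C k l) (u + v)"
  unfolding op_bound_def
proof
  fix a
  have "app m (\<lambda>k l. B k l + C k l) a = (\<lambda>k. app m B a k + app m C a k)"
    by (simp add: app_def fun_eq_iff distrib_right sum.distrib)
  moreover have h: "nrm2 m (app m B a) \<le> (u * sqrt (nrm2 m a))\<^sup>2" "nrm2 m (app m C a) \<le> (v * sqrt (nrm2 m a))\<^sup>2"
    using assms by (auto simp: op_bound_def power_mult_distrib)
  ultimately have "nrm2 m (app m (\<lambda>k l. B k l + C k l) a) \<le> (u * sqrt (nrm2 m a) + v * sqrt (nrm2 m a))\<^sup>2"
    using nrm2_add_le[OF h] assms(3,4) by simp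
  also have "\<dots> = (u + v)\<^sup>2 * nrm2 m a" by (simp add: distrib_right[symmetric] power_mult_distrib)
  finally show "nrm2 m (app m (\<lambda>k l. B k l + C k l) a) \<le> (u + v)\<^sup>2 * nrm2 m a" .
qed

lemma op_bound_cmult:
  assumes "op_bound m B u"
  shows "op_bound m (\<lambda>k l. c * B k l) (cmod c * u)"
  unfolding op_bound_def
proof
  fix a
  have "app m (\<lambda>k l. c * B k l) a = (\<lambda>k. c * app m B a k)"
    by (simp add: app_def fun_eq_iff sum_distrib_left mult.assoc)
  then have "nrm2 m (app m (\<lambda>k l. c * B k l) a) = (cmod c)\<^sup>2 * nrm2 m (app m B a)"
    by (simp add: nrm2_def norm_mult power_mult_distrib sum_distrib_left)
  then show "nrm2 m (app m (\<lambda>k l. c * B k l) a) \<le> (cmod c * u)\<^sup>2 * nrm2 m a"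
    using assms by (simp add: op_bound_def power_mult_distrib mult.assoc mult_left_mono)
qed

lemma op_bound_mono:
  assumes "op_bound m B u" "0 \<le> u" "u \<le> v"
  shows "op_bound m B v"
proof -
  have "u\<^sup>2 \<le> v\<^sup>2" using assms by (intro power_mono) auto
  then have "u\<^sup>2 * nrm2 m a \<le> v\<^sup>2 * nrm2 m a" for a by (intro mult_right_mono) auto
  then show ?thesis using assms(1) unfolding op_bound_def by (meson order_trans)
qed

text \<open>Repeated halving: keep the smaller of the two classes of a good choice of signs.\<close>

lemma ex_subset_approx:
  fixes B :: "'i \<Rightarrow> nat \<Rightarrow> nat \<Rightarrow> complex"
  assumes I: "finite I" and B: "\<And>i. i \<in> I \<Longrightarrow> op_bound m (B i) 1" and m: "m \<ge> 2"
  shows "\<exists>J\<subseteq>I. 2 ^ k * card J \<le> card I \<and>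
    op_bound m (\<lambda>a b. (\<Sum>i\<in>I. B i a b) - 2 ^ k * (\<Sum>i\<in>J. B i a b))
      (2 * exp 1 * sqrt (ln m * card I) * (\<Sum>i<k. sqrt 2 ^ i))"
proof (induction k)
  case 0
  show ?case by (intro exI[of _ I]) (simp add: op_bound_def app_def nrm2_def)
next
  case (Suc k)
  define c where "c = 2 * exp 1 * sqrt (ln m)"
  have c: "c \<ge> 0" using m by (simp add: c_def)
  obtain J where J: "J \<subseteq> I" "2 ^ k * card J \<le> card I"
    "op_bound m (\<lambda>a b. (\<Sum>i\<in>I. B i a b) - 2 ^ k * (\<Sum>i\<in>J. B i a b)) (2 * exp 1 * sqrt (ln m * card I) * (\<Sum>i<k. sqrt 2 ^ i))"
    using Suc by auto
  have fJ: "finite J" using J I finite_subset by blast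
  obtain J1 where J1: "J1 \<subseteq> J" "op_bound m (signed_sum J B (sgn_of J1)) (2 * exp 1 * sqrt (ln m * card J))"
    using ex_signs_op_bound[OF fJ _ m, of B] B J(1) by blast
  have fJ1: "finite J1" using J1 fJ finite_subset by blast
  have two: "signed_sum J B (sgn_of J') a b = 2 * (\<Sum>i\<in>J'. B i a b) - (\<Sum>i\<in>J. B i a b)" if "J' \<subseteq> J" for J' a b
  proof -
    have "signed_sum J B (sgn_of J') a b = (\<Sum>i\<in>J. 2 * (if i \<in> J' then B i a b else 0) - B i a b)"
      unfolding signed_sum_def sgn_of_def by (intro sum.cong) auto
    also have "\<dots> = 2 * (\<Sum>i\<in>J. if i \<in> J' then B i a b else 0) - (\<Sum>i\<in>J. B i a b)"
      by (simp add: sum_subtractf sum_distrib_left)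
    also have "(\<Sum>i\<in>J. if i \<in> J' then B i a b else 0) = (\<Sum>i\<in>J'. B i a b)"
      using fJ that by (simp add: sum.inter_restrict[symmetric] Int_absorb1)
    finally show ?thesis .
  qed
  obtain J2 where J2: "J2 \<subseteq> J" "2 * card J2 \<le> card J" "op_bound m (signed_sum J B (sgn_of J2)) (2 * exp 1 * sqrt (ln m * card J))"
  proof (cases "2 * card J1 \<le> card J")
    case True
    then show ?thesis using that J1 by blast
  next
    case False
    have "card (J - J1) = card J - card J1" using fJ1 J1 by (simp add: card_Diff_subset)
    then have "2 * card (J - J1) \<le> card J" using False by simp
    moreover have "signed_sum J B (sgn_of (J - J1)) = (\<lambda>a b. (- 1) * signed_sum J B (sgn_of J1) a b)"
      unfolding signed_sum_def sum_distrib_left by (intro ext sum.cong) (auto simp: sgn_of_def)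
    then have "op_bound m (signed_sum J B (sgn_of (J - J1))) (2 * exp 1 * sqrt (ln m * card J))"
      using op_bound_cmult[OF J1(2), of "- 1"] by simp
    ultimately show ?thesis using that[of "J - J1"] by auto
  qed
  \<comment> \<open>Going from \<open>2 ^ k\<close> copies of \<open>J\<close> to twice as many
    copies of \<open>J2\<close> changes the sum by \<open>2 ^ k\<close> times the signed sum, which
    the choice of signs keeps small.\<close>
  have e: "(\<Sum>i\<in>I. B i a b) - 2 ^ Suc k * (\<Sum>i\<in>J2. B i a b) =
      ((\<Sum>i\<in>I. B i a b) - 2 ^ k * (\<Sum>i\<in>J. B i a b)) + (- (2 ^ k)) * signed_sum J B (sgn_of J2) a b" for a b
    unfolding two[OF J2(1)] by (simp add: algebra_simps)
  \<comment> \<open>The weight doubles in each round while the root of the number of summands falls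
    by sqrt 2, so the error of a round grows only by the factor sqrt 2.\<close>
  have s: "2 ^ k * (2 * exp 1 * sqrt (ln m * card J)) \<le> 2 * exp 1 * sqrt (ln m * card I) * sqrt 2 ^ k"
  proof -
    have "real (2 ^ k * card J) \<le> real (card I)" using J(2) by (simp only: of_nat_le_iff)
    then have "sqrt (2 ^ k * card J) \<le> sqrt (card I)" by (simp add: real_sqrt_le_iff)
    then have "sqrt 2 ^ k * sqrt (card J) \<le> sqrt (card I)" by (simp add: real_sqrt_mult real_sqrt_power)
    moreover have "(2 :: real) ^ k = sqrt 2 ^ k * sqrt 2 ^ k" by (simp add: power_mult_distrib[symmetric])
    ultimately have "2 ^ k * sqrt (card J) \<le> sqrt 2 ^ k * sqrt (card I)"
      by (simp add: mult.assoc mult_left_mono)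
    then have "c * (2 ^ k * sqrt (card J)) \<le> c * (sqrt 2 ^ k * sqrt (card I))"
      using c by (rule mult_left_mono)
    then show ?thesis by (simp add: c_def real_sqrt_mult mult_ac)
  qed
  have "op_bound m (\<lambda>a b. (- (2 ^ k)) * signed_sum J B (sgn_of J2) a b) (cmod (- (2 ^ k)) * (2 * exp 1 * sqrt (ln m * card J)))"
    by (rule op_bound_cmult[OF J2(3)])
  moreover have cm: "cmod (- (2 ^ k)) = 2 ^ k" by (simp add: norm_power)
  ultimately have "op_bound m (\<lambda>a b. (- (2 ^ k)) * signed_sum J B (sgn_of J2) a b) (2 ^ k * (2 * exp 1 * sqrt (ln m * card J)))"
    by (simp only: cm)
  moreover have "0 \<le> 2 ^ k * (2 * exp 1 * sqrt (ln m * card J))" using m by simp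
  ultimately have "op_bound m (\<lambda>a b. (- (2 ^ k)) * signed_sum J B (sgn_of J2) a b) (2 * exp 1 * sqrt (ln m * card I) * sqrt 2 ^ k)"
    using s by (rule op_bound_mono)
  from op_bound_add[OF J(3) this]
  have "op_bound m (\<lambda>a b. (\<Sum>i\<in>I. B i a b) - 2 ^ Suc k * (\<Sum>i\<in>J2. B i a b))
      (2 * exp 1 * sqrt (ln m * card I) * (\<Sum>i<Suc k. sqrt 2 ^ i))"
    unfolding e using m by (simp add: distrib_left sum_nonneg)
  moreover have "2 ^ Suc k * card J2 \<le> card I"
  proof -
    have "2 ^ Suc k * card J2 = 2 ^ k * (2 * card J2)" by simp
    also have "\<dots> \<le> 2 ^ k * card J" using J2(2) by (intro mult_left_mono) auto
    finally show ?thesis using J(2) by (rule order_trans)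
  qed
  ultimately show ?case using J(1) J2(1) by blast
qed

section \<open>Time-frequency shifts\<close>

definition shift_idx :: "nat \<Rightarrow> nat \<Rightarrow> nat \<Rightarrow> nat" where
  "shift_idx m k i = nat ((int i - int k) mod int m)"

text \<open>The matrix of the time-frequency shift with translation \<open>fst p\<close> and
  modulation \<open>snd p\<close>.\<close>

definition tf_kernel :: "nat \<Rightarrow> nat \<times> nat \<Rightarrow> nat \<Rightarrow> nat \<Rightarrow> complex" where
  "tf_kernel m p i j = (if j = shift_idx m (fst p) i then exp (2 * of_real pi * \<i> / of_nat m) ^ (snd p * i) else 0)"

definition tf_plane :: "nat \<Rightarrow> (nat \<times> nat) set" where
  "tf_plane m = {..<m} \<times> {..<m}"

definition gabor_op :: "nat \<Rightarrow> (nat \<times> nat \<Rightarrow> complex) \<Rightarrow> nat \<Rightarrow> nat \<Rightarrow> complex" where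
  "gabor_op m x i j = of_real (1 / sqrt m) * (\<Sum>p\<in>tf_plane m. x p * tf_kernel m p i j)"

lemma finite_tf_plane [simp]: "finite (tf_plane m)"
  by (simp add: tf_plane_def)

lemma card_tf_plane: "card (tf_plane m) = m * m"
  by (simp add: tf_plane_def card_cartesian_product)

lemma shift_idx_less: "m > 0 \<Longrightarrow> shift_idx m k i < m"
  by (simp add: shift_idx_def nat_less_iff)

lemma mod_diff_eq_imp_eq:
  fixes a b c :: int
  assumes "0 \<le> a" "a < n" "0 \<le> b" "b < n" "(a - c) mod n = (b - c) mod n"
  shows "a = b"
proof -
  have "n dvd (a - c) - (b - c)" using assms(5) by (simp add: mod_eq_dvd_iff)
  then have "n dvd a - b" by simp
  then show ?thesis using assms by (metis diff_add_cancel dvd_imp_mod_0 mod_add_left_eq mod_pos_pos_trivial add_0)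
qed

lemma inj_shift_idx: "inj_on (shift_idx m k) {..<m}"
proof (rule inj_onI)
  fix i j assume *: "i \<in> {..<m}" "j \<in> {..<m}" "shift_idx m k i = shift_idx m k j"
  then have "m > 0" by auto
  then have "(int i - int k) mod int m = (int j - int k) mod int m"
    using * by (simp add: shift_idx_def eq_nat_nat_iff)
  then show "i = j" using * mod_diff_eq_imp_eq[of "int i" "int m" "int j" "int k"] by auto
qed

lemma bij_shift_idx: "m > 0 \<Longrightarrow> bij_betw (shift_idx m k) {..<m} {..<m}"
  using inj_shift_idx[of m k] shift_idx_less[of m k]
  by (intro bij_betw_imageI endo_inj_surj) auto

lemma inj_shift_idx2: "inj_on (\<lambda>k. shift_idx m k i) {..<m}"
proof (rule inj_onI)
  fix k l assume *: "k \<in> {..<m}" "l \<in> {..<m}" "shift_idx m k i = shift_idx m l i"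
  then have m: "m > 0" by auto
  then have "(int i - int k) mod int m = (int i - int l) mod int m"
    using * by (simp add: shift_idx_def eq_nat_nat_iff)
  then have "int m dvd (int i - int k) - (int i - int l)" by (simp add: mod_eq_dvd_iff)
  then have "int m dvd (int l - int k)" by simp
  then have "(int l - 0) mod int m = (int k - 0) mod int m" by (simp add: mod_eq_dvd_iff)
  then show "k = l" using * mod_diff_eq_imp_eq[of "int l" "int m" "int k" 0] by auto
qed

lemma bij_shift_idx2: "m > 0 \<Longrightarrow> bij_betw (\<lambda>k. shift_idx m k i) {..<m} {..<m}"
  using inj_shift_idx2[of m i] shift_idx_less[of m _ i]
  by (intro bij_betw_imageI endo_inj_surj) auto

lemma app_tf_kernel:
  assumes "m > 0"
  shows "app m (tf_kernel m p) a i = exp (2 * of_real pi * \<i> / of_nat m) ^ (snd p * i) * a (shift_idx m (fst p) i)"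
proof -
  let ?e = "exp (2 * of_real pi * \<i> / of_nat m) ^ (snd p * i)"
  have "app m (tf_kernel m p) a i = (\<Sum>j<m. if j = shift_idx m (fst p) i then ?e * a (shift_idx m (fst p) i) else 0)"
    unfolding app_def tf_kernel_def by (intro sum.cong) auto
  then show ?thesis using shift_idx_less[OF assms] by simp
qed

lemma cmod_root_power: "cmod (exp (2 * of_real pi * \<i> / of_nat m) ^ k) = 1"
  by (simp add: norm_power)

lemma nrm2_tf_kernel:
  assumes "m > 0"
  shows "nrm2 m (app m (tf_kernel m p) a) = nrm2 m a"
proof -
  have "nrm2 m (app m (tf_kernel m p) a) = (\<Sum>i<m. (cmod (a (shift_idx m (fst p) i)))\<^sup>2)"
    unfolding nrm2_def by (intro sum.cong) (simp_all add: app_tf_kernel[OF assms] norm_mult cmod_root_power)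
  also have "\<dots> = nrm2 m a"
    unfolding nrm2_def by (rule sum.reindex_bij_betw[OF bij_shift_idx[OF assms]])
  finally show ?thesis .
qed

lemma tf_kernel_op_bound: "m > 0 \<Longrightarrow> op_bound m (tf_kernel m p) 1"
  by (simp add: op_bound_def nrm2_tf_kernel)

lemma root_sum:
  assumes m: "m > 0" and l: "l < m" "l' < m"
  defines "\<omega> \<equiv> exp (2 * of_real pi * \<i> / of_nat m)"
  shows "(\<Sum>i<m. \<omega> ^ (l * i) * cnj (\<omega> ^ (l' * i))) = (if l = l' then of_nat m else 0)"
proof -
  have w: "\<omega> ^ l * cnj (\<omega> ^ l') = exp (2 * of_real pi * \<i> * of_int (int l - int l') / of_nat m)"
  proof -
    have "\<omega> ^ l = exp (2 * of_real pi * \<i> * of_nat l / of_nat m)"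
      by (simp add: \<omega>_def exp_of_nat_mult[symmetric] mult_ac)
    moreover have "cnj (\<omega> ^ l') = exp (- (2 * of_real pi * \<i> * of_nat l' / of_nat m))"
      by (simp add: \<omega>_def exp_cnj exp_of_nat_mult[symmetric] mult_ac)
    ultimately show ?thesis by (simp add: exp_add[symmetric] diff_divide_distrib algebra_simps)
  qed
  define z where "z = \<omega> ^ l * cnj (\<omega> ^ l')"
  have "(\<Sum>i<m. \<omega> ^ (l * i) * cnj (\<omega> ^ (l' * i))) = (\<Sum>i<m. z ^ i)"
    by (simp add: z_def power_mult power_mult_distrib)
  also have "\<dots> = (if l = l' then of_nat m else 0)"
  proof (cases "l = l'")
    case True
    then have "z = 1" unfolding z_def w by simp
    then show ?thesis using True by simp
  next
    case False
    have "z \<noteq> 1"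
    proof
      assume "z = 1"
      then obtain n :: int where "Im (2 * of_real pi * \<i> * of_int (int l - int l') / of_nat m) = of_int (2 * n) * pi"
        unfolding z_def w exp_eq_1 by auto
      then have "2 * pi * real_of_int (int l - int l') / real m = 2 * pi * real_of_int n" by (simp add: mult_ac)
      then have "(2 * pi) * real_of_int (int l - int l') = (2 * pi) * (real_of_int n * real m)"
        using m by (simp add: field_simps)
      then have "real_of_int (int l - int l') = real_of_int n * real m"
        by (subst (asm) mult_left_cancel) simp_all
      then have eq: "int l - int l' = n * int m" by (metis of_int_eq_iff of_int_mult of_int_of_nat_eq)
      have "\<bar>n * int m\<bar> < int m" unfolding eq[symmetric] using l by auto
      then have "n = 0" by (metis abs_mult abs_of_nat mult_less_cancel_right1 not_less_iff_gr_or_eq of_nat_0_le_iff zero_less_abs_iff int_one_le_iff_zero_less mult_le_cancel_right1 not_less)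
      then show False using eq False by simp
    qed
    moreover have "z ^ m = 1"
    proof -
      have "z ^ m = exp (of_nat m * (2 * of_real pi * \<i> * of_int (int l - int l') / of_nat m))"
        unfolding z_def w by (rule exp_of_nat_mult[symmetric])
      also have "of_nat m * (2 * of_real pi * \<i> * of_int (int l - int l') / of_nat m) = of_int (int l - int l') * (2 * of_real pi * \<i>)"
        using m by simp
      finally show ?thesis using exp_integer_2pi[of "of_int (int l - int l')"] by (simp add: mult_ac)
    qed
    ultimately show ?thesis using False by (simp add: sum_gp_strict)
  qed
  finally show ?thesis .
qed

lemma root_Parseval:
  assumes m: "m > 0"
  shows "(\<Sum>i<m. (cmod (\<Sum>l<m. c l * exp (2 * of_real pi * \<i> / of_nat m) ^ (l * i)))\<^sup>2) = m * (\<Sum>l<m. (cmod (c l))\<^sup>2)"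
proof -
  define \<omega> where "\<omega> = exp (2 * of_real pi * \<i> / of_nat m)"
  have "of_real (\<Sum>i<m. (cmod (\<Sum>l<m. c l * \<omega> ^ (l * i)))\<^sup>2) =
      (\<Sum>i<m. \<Sum>l<m. \<Sum>l'<m. c l * cnj (c l') * (\<omega> ^ (l * i) * cnj (\<omega> ^ (l' * i))))"
    unfolding of_real_sum complex_norm_square by (intro sum.cong refl) (simp add: sum_product mult_ac)
  also have "\<dots> = (\<Sum>l<m. \<Sum>i<m. \<Sum>l'<m. c l * cnj (c l') * (\<omega> ^ (l * i) * cnj (\<omega> ^ (l' * i))))"
    by (rule sum.swap)
  also have "\<dots> = (\<Sum>l<m. \<Sum>l'<m. \<Sum>i<m. c l * cnj (c l') * (\<omega> ^ (l * i) * cnj (\<omega> ^ (l' * i))))"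
    by (intro sum.cong refl sum.swap)
  also have "\<dots> = (\<Sum>l<m. \<Sum>l'<m. c l * cnj (c l') * (if l = l' then of_nat m else 0))"
    unfolding sum_distrib_left[symmetric] \<omega>_def by (intro sum.cong refl, subst root_sum[OF m], auto)
  also have "\<dots> = (\<Sum>l<m. c l * cnj (c l) * of_nat m)"
  proof (rule sum.cong[OF refl])
    fix l assume "l \<in> {..<m}"
    have "(\<Sum>l'<m. c l * cnj (c l') * (if l = l' then of_nat m else 0)) = (\<Sum>l'<m. if l' = l then c l * cnj (c l) * of_nat m else 0)"
      by (intro sum.cong) auto
    then show "(\<Sum>l'<m. c l * cnj (c l') * (if l = l' then of_nat m else 0)) = c l * cnj (c l) * of_nat m"
      using \<open>l \<in> {..<m}\<close> by simp
  qed
  also have "\<dots> = of_real (m * (\<Sum>l<m. (cmod (c l))\<^sup>2))"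
    by (simp add: complex_norm_square[symmetric] sum_distrib_left mult.commute flip: of_real_power)
  finally show ?thesis unfolding \<omega>_def of_real_eq_iff .
qed

text \<open>In row \<open>i\<close> the columns are listed as \<open>shift_idx m k i\<close>, and
  the entry there is a Fourier sum of \<open>x (k, l)\<close> over \<open>l\<close>, evaluated at
  \<open>i\<close>. Parseval in \<open>i\<close> yields a factor \<open>m\<close> that the
  normalization cancels.\<close>

lemma frob_sq_gabor_op:
  assumes m: "m > 0"
  shows "frob_sq m (gabor_op m x) = (\<Sum>p\<in>tf_plane m. (cmod (x p))\<^sup>2)"
proof -
  let ?w = "exp (2 * of_real pi * \<i> / of_nat m) :: complex"
  have g: "gabor_op m x i (shift_idx m k i) = of_real (1 / sqrt m) * (\<Sum>l<m. x (k, l) * ?w ^ (l * i))" if k: "k < m" for k i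
  proof -
    have "(\<Sum>p\<in>tf_plane m. x p * tf_kernel m p i (shift_idx m k i)) =
        (\<Sum>k'<m. \<Sum>l<m. x (k', l) * tf_kernel m (k', l) i (shift_idx m k i))"
      unfolding tf_plane_def by (simp add: sum.cartesian_product)
    also have "\<dots> = (\<Sum>k'<m. if k' = k then (\<Sum>l<m. x (k, l) * ?w ^ (l * i)) else 0)"
    proof (rule sum.cong[OF refl])
      fix k' assume "k' \<in> {..<m}"
      then have "shift_idx m k i = shift_idx m k' i \<longleftrightarrow> k' = k"
        using inj_shift_idx2[of m i] k by (auto simp: inj_on_def)
      then show "(\<Sum>l<m. x (k', l) * tf_kernel m (k', l) i (shift_idx m k i)) = (if k' = k then (\<Sum>l<m. x (k, l) * ?w ^ (l * i)) else 0)"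
        by (simp add: tf_kernel_def)
    qed
    finally show ?thesis using k by (simp add: gabor_op_def)
  qed
  have "frob_sq m (gabor_op m x) = (\<Sum>i<m. \<Sum>j<m. (cmod (gabor_op m x i j))\<^sup>2)"
    unfolding frob_sq_def col_sq_def by (rule sum.swap)
  also have "\<dots> = (\<Sum>i<m. \<Sum>k<m. (cmod (gabor_op m x i (shift_idx m k i)))\<^sup>2)"
    by (intro sum.cong refl sum.reindex_bij_betw[OF bij_shift_idx2[OF m], symmetric])
  also have "\<dots> = (\<Sum>i<m. \<Sum>k<m. (1 / m) * (cmod (\<Sum>l<m. x (k, l) * ?w ^ (l * i)))\<^sup>2)"
    by (intro sum.cong refl) (simp add: g norm_mult norm_divide power_mult_distrib power_divide)
  also have "\<dots> = (\<Sum>k<m. \<Sum>i<m. (1 / m) * (cmod (\<Sum>l<m. x (k, l) * ?w ^ (l * i)))\<^sup>2)"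
    by (rule sum.swap)
  also have "\<dots> = (\<Sum>k<m. \<Sum>l<m. (cmod (x (k, l)))\<^sup>2)"
    unfolding sum_distrib_left[symmetric] root_Parseval[OF m] using m by simp
  finally show ?thesis by (simp add: tf_plane_def sum.cartesian_product)
qed

lemma gabor_op_diff: "gabor_op m x i j - gabor_op m y i j = gabor_op m (\<lambda>p. x p - y p) i j"
  by (simp add: gabor_op_def left_diff_distrib sum_subtractf right_diff_distrib)

lemma op_bound_sum:
  assumes "finite X" "\<And>p. p \<in> X \<Longrightarrow> op_bound m (B p) 1"
  shows "op_bound m (\<lambda>i j. \<Sum>p\<in>X. c p * B p i j) (\<Sum>p\<in>X. cmod (c p))"
  using assms
proof (induction X rule: finite_induct)
  case empty
  show ?case by (simp add: op_bound_def app_def nrm2_def)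
next
  case (insert p X)
  have "op_bound m (\<lambda>i j. c p * B p i j + (\<Sum>p\<in>X. c p * B p i j)) (cmod (c p) * 1 + (\<Sum>p\<in>X. cmod (c p)))"
    using insert by (intro op_bound_add op_bound_cmult) (auto intro: sum_nonneg)
  then show ?case using insert by simp
qed

lemma gabor_op_bound:
  assumes m: "m > 0" and x: "(\<Sum>p\<in>tf_plane m. cmod (x p)) \<le> c"
  shows "op_bound m (gabor_op m x) (c / sqrt m)"
proof -
  have "op_bound m (\<lambda>i j. of_real (1 / sqrt m) * (\<Sum>p\<in>tf_plane m. x p * tf_kernel m p i j)) (cmod (of_real (1 / sqrt m)) * (\<Sum>p\<in>tf_plane m. cmod (x p)))"
    by (intro op_bound_cmult op_bound_sum tf_kernel_op_bound m) simp
  then show ?thesis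
    unfolding gabor_op_def[abs_def]
    by (rule op_bound_mono) (use x in \<open>auto simp: norm_divide divide_right_mono intro!: sum_nonneg divide_nonneg_nonneg\<close>)
qed

text \<open>The points with coordinates in the lattice \<open>(\<int> + \<i>\<int>) / N\<close>: every one of them is \<open>1 / N\<close> times a sum of
  unit multiples of basis vectors, so that the halving argument applies without rounding.\<close>

definition grid :: "nat \<Rightarrow> nat \<Rightarrow> nat \<Rightarrow> (nat \<times> nat \<Rightarrow> complex) set" where
  "grid m s N = {x. (\<forall>p. p \<notin> tf_plane m \<longrightarrow> x p = 0) \<and> card {p \<in> tf_plane m. x p \<noteq> 0} \<le> s \<and>
     (\<Sum>p\<in>tf_plane m. (cmod (x p))\<^sup>2) \<le> 1 \<and> (\<forall>p. N * Re (x p) \<in> \<int> \<and> N * Im (x p) \<in> \<int>)}"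

lemma zero_in_grid: "(\<lambda>_. 0) \<in> grid m s N"
  by (simp add: grid_def)

lemma gridD:
  assumes "x \<in> grid m s N"
  shows "p \<notin> tf_plane m \<Longrightarrow> x p = 0" "card {p \<in> tf_plane m. x p \<noteq> 0} \<le> s"
    "(\<Sum>p\<in>tf_plane m. (cmod (x p))\<^sup>2) \<le> 1" "N * Re (x p) \<in> \<int>" "N * Im (x p) \<in> \<int>"
  using assms unfolding grid_def by blast+

lemma cmod_le_1_grid: "x \<in> grid m s N \<Longrightarrow> cmod (x p) \<le> 1"
proof -
  assume x: "x \<in> grid m s N"
  show ?thesis
  proof (cases "p \<in> tf_plane m")
    case True
    then have "(cmod (x p))\<^sup>2 \<le> (\<Sum>p\<in>tf_plane m. (cmod (x p))\<^sup>2)" by (intro member_le_sum) auto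
    then have "(cmod (x p))\<^sup>2 \<le> 1\<^sup>2" using gridD(3)[OF x] by simp
    then show ?thesis by (rule power2_le_imp_le) simp
  qed (use gridD(1)[OF x] in simp)
qed

lemma finite_grid:
  assumes "N > 0"
  shows "finite (grid m s N)"
proof -
  define G where "G = (\<lambda>(a, b). Complex (of_int a / N) (of_int b / N)) ` ({- int N..int N} \<times> {- int N..int N})"
  have "x p \<in> G" if x: "x \<in> grid m s N" for x p
  proof -
    obtain a where a: "N * Re (x p) = of_int a" using gridD(4)[OF x] by (rule Ints_cases)
    obtain b where b: "N * Im (x p) = of_int b" using gridD(5)[OF x] by (rule Ints_cases)
    note ab = a b
    have "\<bar>Re (x p)\<bar> \<le> 1" "\<bar>Im (x p)\<bar> \<le> 1"
      using cmod_le_1_grid[OF x, of p] abs_Re_le_cmod[of "x p"] abs_Im_le_cmod[of "x p"] by linarith+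
    then have "\<bar>N * Re (x p)\<bar> \<le> N" "\<bar>N * Im (x p)\<bar> \<le> N"
      by (auto simp: abs_mult mult_left_le)
    then have "\<bar>of_int a :: real\<bar> \<le> real N" "\<bar>of_int b :: real\<bar> \<le> real N" unfolding ab .
    then have "a \<in> {- int N..int N}" "b \<in> {- int N..int N}" by auto
    moreover have "x p = Complex (of_int a / N) (of_int b / N)"
      using ab assms by (simp add: complex_eq_iff field_simps)
    ultimately show ?thesis by (auto simp: G_def)
  qed
  then have "grid m s N \<subseteq> {x. \<forall>p. (p \<in> tf_plane m \<longrightarrow> x p \<in> G) \<and> (p \<notin> tf_plane m \<longrightarrow> x p = 0)}"
    using gridD(1) by blast
  moreover have "finite \<dots>" by (rule finite_set_of_finite_funs) (auto simp: G_def)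
  ultimately show ?thesis by (rule finite_subset)
qed

lemma sum_sparse_le:
  assumes f: "\<And>p. p \<in> X \<Longrightarrow> 0 \<le> f p" and X: "finite X" and s: "card {p \<in> X. f p \<noteq> 0} \<le> s"
    and sq: "(\<Sum>p\<in>X. (f p)\<^sup>2) \<le> b"
  shows "(\<Sum>p\<in>X. f p) \<le> sqrt (s * b)"
proof -
  let ?S = "{p \<in> X. f p \<noteq> 0}"
  have "(\<Sum>p\<in>X. f p) = (\<Sum>p\<in>?S. 1 * f p)" using X by (intro sum.mono_neutral_cong_right) auto
  then have "(\<Sum>p\<in>X. f p)\<^sup>2 \<le> (\<Sum>p\<in>?S. 1\<^sup>2) * (\<Sum>p\<in>?S. (f p)\<^sup>2)"
    using Cauchy_Schwarz_ineq_sum[of "\<lambda>_. 1" f ?S] by (simp only:)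
  also have "\<dots> \<le> s * b"
  proof (intro mult_mono)
    show "(\<Sum>p\<in>?S. 1\<^sup>2) \<le> real s" using s by simp
    have "(\<Sum>p\<in>?S. (f p)\<^sup>2) \<le> (\<Sum>p\<in>X. (f p)\<^sup>2)" using X by (intro sum_mono2) auto
    then show "(\<Sum>p\<in>?S. (f p)\<^sup>2) \<le> b" using sq by simp
  qed (auto intro: sum_nonneg)
  finally show ?thesis by (rule real_le_rsqrt)
qed

lemma grid_l1:
  assumes "x \<in> grid m s N"
  shows "(\<Sum>p\<in>tf_plane m. cmod (x p)) \<le> sqrt s"
  using sum_sparse_le[of "tf_plane m" "\<lambda>p. cmod (x p)" s 1] gridD(2,3)[OF assms] by simp

text \<open>Times \<open>N\<close>, this is the number of unit summands of a grid point. Real and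
  imaginary parts are counted separately, which turns \<open>s\<close> into
  \<open>2 * s\<close>.\<close>

lemma grid_l1_parts:
  assumes "x \<in> grid m s N"
  shows "(\<Sum>p\<in>tf_plane m. \<bar>Re (x p)\<bar> + \<bar>Im (x p)\<bar>) \<le> sqrt (2 * s)"
proof -
  have z: "\<bar>Re z\<bar> + \<bar>Im z\<bar> \<noteq> 0 \<longleftrightarrow> z \<noteq> 0" for z by (auto simp: complex_eq_iff add_nonneg_eq_0_iff)
  have "(\<bar>Re z\<bar> + \<bar>Im z\<bar>)\<^sup>2 \<le> 2 * (cmod z)\<^sup>2" for z
    using sum_squares_bound[of "\<bar>Re z\<bar>" "\<bar>Im z\<bar>"] by (simp add: cmod_power2 power2_sum)
  then have "(\<Sum>p\<in>tf_plane m. (\<bar>Re (x p)\<bar> + \<bar>Im (x p)\<bar>)\<^sup>2) \<le> (\<Sum>p\<in>tf_plane m. 2 * (cmod (x p))\<^sup>2)"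
    by (intro sum_mono)
  also have "\<dots> \<le> 2" using gridD(3)[OF assms] by (simp add: sum_distrib_left[symmetric])
  finally have "(\<Sum>p\<in>tf_plane m. \<bar>Re (x p)\<bar> + \<bar>Im (x p)\<bar>) \<le> sqrt (real s * 2)"
    using gridD(2)[OF assms] by (intro sum_sparse_le) (simp_all only: z, simp_all)
  then show ?thesis by (simp add: mult.commute)
qed

lemma grid_op_bound: "m > 0 \<Longrightarrow> x \<in> grid m s N \<Longrightarrow> op_bound m (gabor_op m x) (sqrt (s / m))"
  using gabor_op_bound[OF _ grid_l1] by (simp add: real_sqrt_divide)

section \<open>Coding grid points by short words of labelled shifts\<close>

definition labels :: "nat \<Rightarrow> ((nat \<times> nat) \<times> complex) set" where
  "labels m = tf_plane m \<times> {1, - 1, \<i>, - \<i>}"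

definition label_kernel :: "nat \<Rightarrow> (nat \<times> nat) \<times> complex \<Rightarrow> nat \<Rightarrow> nat \<Rightarrow> complex" where
  "label_kernel m a i j = snd a * tf_kernel m (fst a) i j"

lemma label_kernel_op_bound: "m > 0 \<Longrightarrow> a \<in> labels m \<Longrightarrow> op_bound m (label_kernel m a) 1"
  using op_bound_cmult[OF tf_kernel_op_bound, of m "snd a" "fst a"]
  by (auto simp: labels_def label_kernel_def[abs_def])

lemma card_labels: "card (labels m) \<le> 4 * (m * m)"
proof -
  have "card {1, - 1, \<i>, - \<i>} \<le> 4" using card_length[of "[1, - 1, \<i>, - \<i>]"] by simp
  then show ?thesis by (simp add: labels_def card_cartesian_product card_tf_plane)
qed

text \<open>Lists instead of sets, because the same label may remain several times after
  thinning.\<close>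

definition word_kernel :: "nat \<Rightarrow> ((nat \<times> nat) \<times> complex) list \<Rightarrow> nat \<Rightarrow> nat \<Rightarrow> complex" where
  "word_kernel m xs i j = (\<Sum>a\<leftarrow>xs. label_kernel m a i j)"

text \<open>Each coordinate is broken into \<open>N\<close> times its real part and \<open>N\<close>
  times its imaginary part many copies of a label; an index carries the point, the part and the copy
  number. \<open>ex_subset_approx\<close> thins the index set, and the labels of the surviving
  indices form the word. At \<open>k = 0\<close> the error bound is an empty sum, so the code is
  exact.\<close>

lemma grid_code:
  assumes x: "x \<in> grid m s N" and N: "N > 0" and m: "m \<ge> 2"
  shows "\<exists>xs. set xs \<subseteq> labels m \<and> 2 ^ k * real (length xs) \<le> N * sqrt (2 * s) \<and>
    op_bound m (\<lambda>i j. gabor_op m x i j - of_real (2 ^ k / (N * sqrt m)) * word_kernel m xs i j)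
      (1 / (N * sqrt m) * (2 * exp 1 * sqrt (ln m * (N * sqrt (2 * s))) * (\<Sum>i<k. sqrt 2 ^ i)))"
proof -
  define cnt where "cnt p c = nat \<lfloor>N * \<bar>if c then Re (x p) else Im (x p)\<bar>\<rfloor>" for p c
  define unit where "unit p c = (if c then of_real (sgn (Re (x p))) else of_real (sgn (Im (x p))) * \<i>)" for p c
  define I where "I = Sigma (tf_plane m \<times> UNIV) (\<lambda>q. {..<cnt (fst q) (snd q)})"
  define lab where "lab = (\<lambda>((p, c), t :: nat). (p, unit p c))"
  have fI: "finite I" unfolding I_def by (intro finite_SigmaI) auto
  have cnt: "real (cnt p c) = N * \<bar>if c then Re (x p) else Im (x p)\<bar>" for p c
  proof -
    have "N * \<bar>if c then Re (x p) else Im (x p)\<bar> \<in> \<int>"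
    proof -
      have "N * (if c then Re (x p) else Im (x p)) \<in> \<int>" using gridD(4,5)[OF x] by simp
      then have "\<bar>N * (if c then Re (x p) else Im (x p))\<bar> \<in> \<int>" by (rule Ints_abs)
      then show ?thesis by (simp add: abs_mult)
    qed
    then show ?thesis by (auto simp: cnt_def elim!: Ints_cases)
  qed
  have labI: "lab i \<in> labels m" if i: "i \<in> I" for i
  proof -
    obtain p c t where pct: "i = ((p, c), t)" "p \<in> tf_plane m" "t < cnt p c" using i by (auto simp: I_def)
    then have "0 < real (cnt p c)" by simp
    then have "(if c then Re (x p) else Im (x p)) \<noteq> 0" unfolding cnt by auto
    then have "unit p c \<in> {1, - 1, \<i>, - \<i>}" by (cases c) (auto simp: unit_def sgn_if)
    then show ?thesis using pct by (simp add: lab_def labels_def)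
  qed
  have rep: "(\<Sum>i\<in>I. label_kernel m (lab i) a b) = of_real (N * sqrt m) * gabor_op m x a b" for a b
  proof -
    have "(\<Sum>i\<in>I. label_kernel m (lab i) a b) = (\<Sum>q\<in>tf_plane m \<times> UNIV. \<Sum>t<cnt (fst q) (snd q). unit (fst q) (snd q) * tf_kernel m (fst q) a b)"
    proof -
      have "(\<Sum>q\<in>tf_plane m \<times> UNIV. \<Sum>t<cnt (fst q) (snd q). label_kernel m (lab (q, t)) a b) = (\<Sum>i\<in>I. label_kernel m (lab i) a b)"
        unfolding I_def by (subst sum.Sigma) (auto simp: split_beta)
      then show ?thesis by (simp add: lab_def label_kernel_def split_beta)
    qed
    also have "\<dots> = (\<Sum>p\<in>tf_plane m. \<Sum>c\<in>UNIV. of_nat (cnt p c) * (unit p c * tf_kernel m p a b))"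
      by (simp add: sum.cartesian_product split_beta)
    also have "\<dots> = (\<Sum>p\<in>tf_plane m. of_nat N * (x p * tf_kernel m p a b))"
    proof (rule sum.cong[OF refl])
      fix p
      have r: "of_nat (cnt p c) = (of_real (N * \<bar>if c then Re (x p) else Im (x p)\<bar>) :: complex)" for c
        unfolding cnt[symmetric] by simp
      have "(\<Sum>c\<in>UNIV. of_nat (cnt p c) * (unit p c * tf_kernel m p a b)) =
        (of_nat (cnt p True) * unit p True + of_nat (cnt p False) * unit p False) * tf_kernel m p a b"
        by (simp add: UNIV_bool algebra_simps)
      also have "of_nat (cnt p True) * unit p True + of_nat (cnt p False) * unit p False = of_nat N * x p"
        unfolding r unit_def by (simp add: complex_eq_iff sgn_if abs_if)
      finally show "(\<Sum>c\<in>UNIV. of_nat (cnt p c) * (unit p c * tf_kernel m p a b)) = of_nat N * (x p * tf_kernel m p a b)"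
        by simp
    qed
    also have "\<dots> = of_real (N * sqrt m) * gabor_op m x a b"
      using m by (simp add: gabor_op_def sum_distrib_left)
    finally show ?thesis .
  qed
  have cI: "real (card I) \<le> N * sqrt (2 * s)"
  proof -
    have "card I = (\<Sum>q\<in>tf_plane m \<times> UNIV. cnt (fst q) (snd q))"
      unfolding I_def by (subst card_SigmaI) (auto simp: split_beta)
    also have "\<dots> = (\<Sum>p\<in>tf_plane m. cnt p True + cnt p False)"
    proof -
      have "(\<Sum>q\<in>tf_plane m \<times> UNIV. cnt (fst q) (snd q)) = (\<Sum>p\<in>tf_plane m. \<Sum>c\<in>UNIV. cnt p c)"
        by (simp add: sum.cartesian_product split_beta)
      then show ?thesis by (simp add: UNIV_bool add.commute)
    qed
    finally have "real (card I) = (\<Sum>p\<in>tf_plane m. N * (\<bar>Re (x p)\<bar> + \<bar>Im (x p)\<bar>))"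
      by (simp add: cnt distrib_left)
    also have "\<dots> \<le> N * sqrt (2 * s)"
      unfolding sum_distrib_left[symmetric] using grid_l1_parts[OF x] by (intro mult_left_mono) auto
    finally show ?thesis .
  qed
  obtain J where J: "J \<subseteq> I" "2 ^ k * card J \<le> card I"
    "op_bound m (\<lambda>a b. (\<Sum>i\<in>I. label_kernel m (lab i) a b) - 2 ^ k * (\<Sum>i\<in>J. label_kernel m (lab i) a b))
      (2 * exp 1 * sqrt (ln m * card I) * (\<Sum>i<k. sqrt 2 ^ i))"
  proof -
    have "op_bound m (label_kernel m (lab i)) 1" if "i \<in> I" for i
      using m labI[OF that] by (intro label_kernel_op_bound) auto
    then show ?thesis
      using ex_subset_approx[OF fI _ m, of "\<lambda>i. label_kernel m (lab i)" k] that by blast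
  qed
  have fJ: "finite J" using J fI finite_subset by blast
  obtain ys where ys: "set ys = J" "distinct ys" using finite_distinct_list[OF fJ] by blast
  define xs where "xs = map lab ys"
  have len: "length xs = card J" using ys distinct_card[of ys] by (simp add: xs_def)
  have wk: "word_kernel m xs a b = (\<Sum>i\<in>J. label_kernel m (lab i) a b)" for a b
    using ys by (simp add: word_kernel_def xs_def comp_def sum_list_distinct_conv_sum_set)
  have Ns: "N * sqrt m > 0" using N m by simp
  have "op_bound m (\<lambda>a b. of_real (1 / (N * sqrt m)) * ((\<Sum>i\<in>I. label_kernel m (lab i) a b) - 2 ^ k * (\<Sum>i\<in>J. label_kernel m (lab i) a b)))
      (cmod (of_real (1 / (N * sqrt m))) * (2 * exp 1 * sqrt (ln m * card I) * (\<Sum>i<k. sqrt 2 ^ i)))"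
    by (rule op_bound_cmult[OF J(3)])
  moreover have "of_real (1 / (N * sqrt m)) * ((\<Sum>i\<in>I. label_kernel m (lab i) a b) - 2 ^ k * (\<Sum>i\<in>J. label_kernel m (lab i) a b)) =
      gabor_op m x a b - of_real (2 ^ k / (N * sqrt m)) * word_kernel m xs a b" for a b
    unfolding rep wk using N m by (simp add: right_diff_distrib)
  moreover have "cmod (of_real (1 / (N * sqrt m))) = 1 / (N * sqrt m)" using Ns by (simp add: norm_divide norm_mult)
  ultimately have ob: "op_bound m (\<lambda>a b. gabor_op m x a b - of_real (2 ^ k / (N * sqrt m)) * word_kernel m xs a b)
      (1 / (N * sqrt m) * (2 * exp 1 * sqrt (ln m * card I) * (\<Sum>i<k. sqrt 2 ^ i)))"
    by (simp only:)
  have "op_bound m (\<lambda>a b. gabor_op m x a b - of_real (2 ^ k / (N * sqrt m)) * word_kernel m xs a b)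
      (1 / (N * sqrt m) * (2 * exp 1 * sqrt (ln m * (N * sqrt (2 * s))) * (\<Sum>i<k. sqrt 2 ^ i)))"
  proof (rule op_bound_mono[OF ob])
    have l: "ln m \<ge> 0" using m by simp
    show "0 \<le> 1 / (N * sqrt m) * (2 * exp 1 * sqrt (ln m * card I) * (\<Sum>i<k. sqrt 2 ^ i))"
      using l by (intro mult_nonneg_nonneg sum_nonneg) auto
    show "1 / (N * sqrt m) * (2 * exp 1 * sqrt (ln m * card I) * (\<Sum>i<k. sqrt 2 ^ i)) \<le>
      1 / (N * sqrt m) * (2 * exp 1 * sqrt (ln m * (N * sqrt (2 * s))) * (\<Sum>i<k. sqrt 2 ^ i))"
      using l cI by (intro mult_left_mono mult_right_mono real_sqrt_le_mono) (auto intro!: sum_nonneg)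
  qed
  moreover have "set xs \<subseteq> labels m" using labI J(1) ys by (auto simp: xs_def)
  moreover have "2 ^ k * real (length xs) \<le> N * sqrt (2 * s)"
  proof -
    have "2 ^ k * real (length xs) = real (2 ^ k * card J)" by (simp add: len)
    also have "\<dots> \<le> real (card I)" using J(2) by (simp only: of_nat_le_iff)
    finally show ?thesis using cI by simp
  qed
  ultimately show ?thesis unfolding of_nat_mult of_nat_numeral by (intro exI[of _ xs] conjI)
qed

lemma sum_powers_le: "(\<Sum>i\<le>n. a ^ i) \<le> (a + 1) ^ n" for a :: nat
proof (induction n)
  case (Suc n)
  have "(\<Sum>i\<le>Suc n. a ^ i) \<le> (a + 1) ^ n + a * a ^ n" using Suc by simp
  also have "\<dots> \<le> (a + 1) ^ n + a * (a + 1) ^ n" by (intro add_left_mono mult_left_mono power_mono) auto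
  finally show ?case by simp
qed simp

text \<open>With one spare symbol for padding there are at most 4 m^2 + 1 choices per letter, and
  for \<open>m \<ge> 2\<close> this is at most 8 m^2, hence at most m^5; this is the 5 in the
  exponent.\<close>

lemma card_short_words:
  assumes m: "m \<ge> 2" and h: "h \<ge> 0"
  shows "finite {xs. set xs \<subseteq> labels m \<and> real (length xs) \<le> h}"
    and "real (card {xs. set xs \<subseteq> labels m \<and> real (length xs) \<le> h}) \<le> exp (5 * h * ln m)"
proof -
  define n where "n = nat \<lfloor>h\<rfloor>"
  have fin: "finite (labels m)" by (simp add: labels_def)
  have eq: "{xs. set xs \<subseteq> labels m \<and> real (length xs) \<le> h} = {xs. set xs \<subseteq> labels m \<and> length xs \<le> n}"
    using h by (auto simp: n_def le_nat_floor le_nat_iff le_floor_iff)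
  show "finite {xs. set xs \<subseteq> labels m \<and> real (length xs) \<le> h}"
    unfolding eq by (rule finite_lists_length_le[OF fin])
  have "card {xs. set xs \<subseteq> labels m \<and> length xs \<le> n} \<le> (card (labels m) + 1) ^ n"
    unfolding card_lists_length_le[OF fin] by (rule sum_powers_le)
  also have "\<dots> \<le> (m ^ 5) ^ n"
  proof (rule power_mono)
    have "card (labels m) + 1 \<le> 4 * (m * m) + 1" using card_labels by simp
    also have "\<dots> \<le> 8 * (m * m)" using m by (simp add: Suc_le_eq)
    also have "\<dots> \<le> m ^ 3 * (m * m)" using m power_mono[of 2 m 3] by (intro mult_right_mono) auto
    also have "\<dots> = m ^ 5" by (simp add: eval_nat_numeral)
    finally show "card (labels m) + 1 \<le> m ^ 5" .
  qed simp
  finally have "real (card {xs. set xs \<subseteq> labels m \<and> length xs \<le> n}) \<le> real ((m ^ 5) ^ n)"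
    by (simp only: of_nat_le_iff)
  also have "\<dots> = exp (5 * n * ln m)"
  proof -
    have "real ((m ^ 5) ^ n) = exp (ln m) ^ (5 * n)" using m by (simp add: power_mult)
    also have "\<dots> = exp (5 * n * ln m)" by (simp add: exp_of_nat_mult[symmetric])
    finally show ?thesis .
  qed
  also have "\<dots> \<le> exp (5 * h * ln m)"
    using h m by (simp add: n_def mult_right_mono of_nat_floor)
  finally show "real (card {xs. set xs \<subseteq> labels m \<and> real (length xs) \<le> h}) \<le> exp (5 * h * ln m)"
    unfolding eq .
qed

lemma op_bound_uminus: "op_bound m B u \<Longrightarrow> op_bound m (\<lambda>i j. - B i j) u"
  using op_bound_cmult[of m B u "- 1"] by simp

lemma op_bound_diff:
  assumes "op_bound m B u" "op_bound m C v" "u \<ge> 0" "v \<ge> 0"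
  shows "op_bound m (\<lambda>i j. B i j - C i j) (u + v)"
  using op_bound_add[OF assms(1) op_bound_uminus[OF assms(2)] assms(3,4)] by simp

lemma app_std_basis: "l < m \<Longrightarrow> app m B (std_basis l) i = B i l"
proof -
  assume l: "l < m"
  have "app m B (std_basis l) i = (\<Sum>j<m. if j = l then B i l else 0)"
    unfolding app_def std_basis_def by (intro sum.cong) auto
  then show ?thesis using l by simp
qed

text \<open>A zero operator has zero Frobenius norm, which by \<open>frob_sq_gabor_op\<close> is the
  Euclidean norm of the difference. Needed at the finest level of the chain, where equal codes must
  mean equal points.\<close>

lemma gabor_op_eqI:
  assumes m: "m > 0" and x: "x \<in> grid m s N" "y \<in> grid m s N"
    and b: "op_bound m (\<lambda>i j. gabor_op m x i j - gabor_op m y i j) 0"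
  shows "x = y"
proof -
  let ?B = "gabor_op m (\<lambda>p. x p - y p)"
  have "col_sq m ?B l = 0" if "l < m" for l
  proof -
    have "nrm2 m (app m ?B (std_basis l)) \<le> 0"
      using b unfolding op_bound_def gabor_op_diff[abs_def] by simp
    then show ?thesis using that by (simp add: app_std_basis nrm2_def col_sq_def sum_nonneg antisym)
  qed
  then have "(\<Sum>p\<in>tf_plane m. (cmod (x p - y p))\<^sup>2) = 0"
    by (simp add: frob_sq_gabor_op[OF m, symmetric] frob_sq_def)
  then have "x p = y p" if "p \<in> tf_plane m" for p
    using that by (simp add: sum_nonneg_eq_0_iff)
  then show ?thesis using gridD(1)[OF x(1)] gridD(1)[OF x(2)] by fastforce
qed

text \<open>Twice \<open>48 * (exp 1)\<^sup>2 * sqrt (60 * exp 1)\<close>: the 48 and one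
  \<open>exp 1\<close> come from the increments \<open>u r\<close>, the other \<open>exp 1\<close>
  from \<open>\<alpha> r\<close>, the root from the moment orders; the factor 2 is that of
  \<open>chaos_moment_le_max_norm\<close>.\<close>

definition chain_const :: real where
  "chain_const = 96 * (exp 1)\<^sup>2 * sqrt (60 * exp 1)"

lemma inv_sqrt2: "1 / sqrt 2 \<le> 3 / 4" "1 / sqrt 2 > (0 :: real)"
proof -
  have "4 / 3 \<le> sqrt (2 :: real)" by (rule real_le_rsqrt) (simp add: power2_eq_square)
  then show "1 / sqrt 2 \<le> (3 / 4 :: real)" by (simp add: field_simps)
qed simp

lemma geometric_inv_sqrt2: "(\<Sum>r<R. (1 / sqrt 2) ^ r) \<le> 4"
proof -
  have "(\<Sum>r<R. (1 / sqrt 2) ^ r) \<le> 4 - 4 * (1 / sqrt 2 :: real) ^ R"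
  proof (induction R)
    case (Suc R)
    have "(1 / sqrt 2) ^ R * (1 / sqrt 2) \<le> (1 / sqrt 2) ^ R * (3 / 4 :: real)"
      using inv_sqrt2 by (intro mult_left_mono) auto
    moreover have "(\<Sum>r<Suc R. (1 / sqrt 2) ^ r) = (\<Sum>r<R. (1 / sqrt 2) ^ r) + (1 / sqrt 2 :: real) ^ R"
      by simp
    moreover have "(1 / sqrt 2 :: real) ^ Suc R = (1 / sqrt 2) ^ R * (1 / sqrt 2)"
      by (simp only: power_Suc mult.commute)
    ultimately show ?case using Suc by linarith
  qed simp
  then show ?thesis by (smt (verit) inv_sqrt2(2) zero_less_power)
qed

lemma geometric_sqrt2: "(\<Sum>i<k. sqrt 2 ^ i) \<le> 3 * sqrt 2 ^ k"
proof (induction k)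
  case (Suc k)
  have "4 / 3 \<le> sqrt (2 :: real)" by (rule real_le_rsqrt) (simp add: power2_eq_square)
  then have "sqrt 2 ^ k * (4 / 3) \<le> sqrt 2 ^ k * sqrt (2 :: real)" by (intro mult_left_mono) auto
  moreover have "(\<Sum>i<Suc k. sqrt 2 ^ i) = (\<Sum>i<k. sqrt 2 ^ i) + sqrt 2 ^ k" by simp
  moreover have "sqrt 2 ^ Suc k = sqrt 2 ^ k * sqrt 2" by (simp only: power_Suc mult.commute)
  ultimately show ?case using Suc by linarith
qed simp

lemma ln_ge_two_thirds: "m \<ge> (2 :: nat) \<Longrightarrow> ln m \<ge> 2 / 3"
proof -
  assume "m \<ge> 2"
  then have "ln 2 \<le> ln (real m)" by simp
  then show ?thesis using ln2_ge_two_thirds by linarith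
qed

text \<open>Thinning stops at depth \<open>k1\<close>, when at most \<open>2 * ln m\<close> summands
  are left; by then the error has reached the order of the trivial operator bound
  \<open>sqrt (s / m)\<close>, and thinning further would gain nothing.\<close>

lemma gabor_chain:
  assumes m: "m \<ge> 2" and s: "s \<ge> 1" and N: "N \<ge> 1" and p: "p \<ge> 1"
    and k1: "N * sqrt (2 * s) \<le> 2 ^ (k1 + 1) * ln m" "k1 = 0 \<or> 2 ^ k1 * ln m \<le> N * sqrt (2 * s)"
    and K: "K = chain_const * sqrt (s / m) * ((k1 + 1) * ln m + sqrt p)" "K \<le> 1 / 16"
  shows "chaos_moment p m (grid m s N) (gabor_op m) \<le> ennreal ((32 * K) ^ p)"
proof -
  define F where "F = grid m s N"
  define H where "H = N * sqrt (2 * s)"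
  define \<sigma> where "\<sigma> = sqrt (s / m)"
  define e where "e = exp (1 :: real)"
  have e0: "e > 0" "e \<ge> 1" by (auto simp: e_def)
  have lnm: "ln m \<ge> 2 / 3" by (rule ln_ge_two_thirds[OF m])
  have m0: "m > 0" using m by simp
  have \<sigma>: "\<sigma> > 0" using s m by (simp add: \<sigma>_def)
  have H0: "H \<ge> 0" by (simp add: H_def)
  define err where "err k = 1 / (N * sqrt m) * (2 * exp 1 * sqrt (ln m * (N * sqrt (2 * s))) * (\<Sum>i<k. sqrt 2 ^ i))" for k
  define W where "W k xs i j = of_real (2 ^ k / (N * sqrt m)) * word_kernel m xs i j" for k :: nat and xs i j
  define P where "P k x xs \<longleftrightarrow> set xs \<subseteq> labels m \<and> 2 ^ k * real (length xs) \<le> H \<and>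
      op_bound m (\<lambda>i j. gabor_op m x i j - W k xs i j) (err k)" for k x xs
  define code where "code k x = (SOME xs. P k x xs)" for k x
  have code: "P k x (code k x)" if "x \<in> F" for k x
    unfolding code_def using grid_code[of x m s N k] that N m
    by (intro someI_ex[of "P k x"]) (auto simp: P_def F_def W_def err_def H_def)
  \<comment> \<open>The thinned sum need not come from a grid point, so a grid point with the same
    code represents it. The chain thereby stays in \<open>F\<close>, and the error at most
    doubles.\<close>
  define pick where "pick k c = (SOME y. y \<in> F \<and> code k y = c)" for k c
  define rep where "rep k x = pick k (code k x)" for k x
  have rep: "rep k x \<in> F" "code k (rep k x) = code k x" if "x \<in> F" for k x
    using someI[of "\<lambda>y. y \<in> F \<and> code k y = code k x" x] that by (auto simp: rep_def pick_def)
  have err0: "err k \<ge> 0" for k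
    unfolding err_def using lnm by (intro mult_nonneg_nonneg sum_nonneg) auto
  have close: "op_bound m (\<lambda>i j. gabor_op m (rep k x) i j - gabor_op m x i j) (2 * err k)" if x: "x \<in> F" for k x
  proof -
    have "op_bound m (\<lambda>i j. gabor_op m (rep k x) i j - W k (code k x) i j) (err k)"
      using code[OF rep(1)[OF x], of k k] rep(2)[OF x] by (simp add: P_def)
    moreover have "op_bound m (\<lambda>i j. gabor_op m x i j - W k (code k x) i j) (err k)"
      using code[OF x] by (simp add: P_def)
    ultimately show ?thesis using op_bound_diff[OF _ _ err0 err0] by fastforce
  qed
  \<comment> \<open>At depth 0 nothing is thinned and \<open>err 0\<close> is 0, so the last level
    of the chain is exact.\<close>
  have rep0: "rep 0 x = x" if "x \<in> F" for x
  proof (rule gabor_op_eqI[OF m0])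
    show "rep 0 x \<in> grid m s N" "x \<in> grid m s N" using rep(1)[OF that] that by (simp_all add: F_def)
    show "op_bound m (\<lambda>i j. gabor_op m (rep 0 x) i j - gabor_op m x i j) 0"
      using close[OF that, of 0] by (simp add: err_def)
  qed
  have crd1: "real (card (rep k ` F)) \<le> exp (5 * (H / 2 ^ k) * ln m)" for k
  proof -
    have sub: "code k ` F \<subseteq> {xs. set xs \<subseteq> labels m \<and> real (length xs) \<le> H / 2 ^ k}"
      using code by (auto simp: P_def field_simps)
    have h: "H / 2 ^ k \<ge> 0" using H0 by simp
    have "rep k ` F = pick k ` (code k ` F)" by (auto simp: rep_def)
    then have "card (rep k ` F) \<le> card (code k ` F)"
      using finite_subset[OF sub card_short_words(1)[OF m h]] card_image_le by metis
    also have "\<dots> \<le> card {xs. set xs \<subseteq> labels m \<and> real (length xs) \<le> H / 2 ^ k}"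
      by (rule card_mono[OF card_short_words(1)[OF m h] sub])
    finally show ?thesis using card_short_words(2)[OF m h] by linarith
  qed
  define R where "R = k1 + 1"
  \<comment> \<open>Chain level and thinning depth run in opposite directions: level 0 is the zero
    vector, level 1 the deepest thinning \<open>k1\<close>, and level \<open>R = k1 + 1\<close> has
    depth 0.\<close>
  define \<pi> where "\<pi> r x = (if r = 0 then (\<lambda>_. 0) else rep (k1 + 1 - r) x)" for r x
  define u where "u r = 48 * e * \<sigma> * (1 / sqrt 2) ^ r" for r :: nat
  \<comment> \<open>A level has at most exp(5 2^r (ln m)^2) points and the next one twice that
    exponent, so pairs of consecutive points need 15. The summand \<open>p\<close> secures
    \<open>p \<le> 2 * q r\<close>.\<close>
  define q where "q r = nat \<lceil>15 * 2 ^ r * (ln m)\<^sup>2\<rceil> + p" for r :: nat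
  have qge: "15 * 2 ^ r * (ln m)\<^sup>2 \<le> q r" for r
    unfolding q_def by (simp add: le_nat_iff) linarith
  have lnm2: "(ln m)\<^sup>2 \<ge> 4 / 9" using power_mono[OF lnm, of 2] by (simp add: power2_eq_square)
  have one15: "1 \<le> 15 * 2 ^ r * (ln m)\<^sup>2" for r
  proof -
    have "1 \<le> (2 :: real) ^ r" by simp
    then have "1 * (1 :: real) \<le> (15 * 2 ^ r) * (4 / 9)" by linarith
    also have "\<dots> \<le> (15 * 2 ^ r) * (ln m)\<^sup>2" using lnm2 by (intro mult_left_mono) auto
    finally show ?thesis by simp
  qed
  \<comment> \<open>Rounding up costs at most 1, and by \<open>one15\<close> at most a doubling;
    hence 30.\<close>
  have qle: "q r \<le> 30 * 2 ^ r * (ln m)\<^sup>2 + p" for r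
  proof -
    have "real (nat \<lceil>15 * 2 ^ r * (ln m)\<^sup>2\<rceil>) \<le> 15 * 2 ^ r * (ln m)\<^sup>2 + 1"
      using one15[of r] by linarith
    moreover have "real (q r) = real (nat \<lceil>15 * 2 ^ r * (ln m)\<^sup>2\<rceil>) + p" by (simp only: q_def of_nat_add)
    ultimately show ?thesis using one15[of r] by linarith
  qed
  have cardr: "real (card (\<pi> r ` F)) \<le> exp (5 * 2 ^ r * (ln m)\<^sup>2)" if r: "r \<le> R" for r
  proof (cases "r = 0")
    case True
    have "\<pi> 0 ` F = {\<lambda>_. 0}" using zero_in_grid by (auto simp: \<pi>_def F_def)
    then show ?thesis using True by simp
  next
    case False
    have "H / 2 ^ (k1 + 1 - r) \<le> 2 ^ r * ln m"
    proof -
      have "(2 :: real) ^ (k1 + 1 - r) * 2 ^ r = 2 ^ (k1 + 1)"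
        using r by (simp add: R_def power_add[symmetric])
      then have "H \<le> 2 ^ (k1 + 1 - r) * (2 ^ r * ln m)"
        using k1(1) by (simp add: H_def mult.assoc[symmetric])
      then show ?thesis by (simp add: field_simps)
    qed
    then have "5 * (H / 2 ^ (k1 + 1 - r)) * ln m \<le> 5 * (2 ^ r * ln m) * ln m"
      using lnm by (intro mult_right_mono mult_left_mono) auto
    moreover have "\<pi> r ` F = rep (k1 + 1 - r) ` F" using False by (simp add: \<pi>_def)
    ultimately show ?thesis
      using order_trans[OF crd1[of "k1 + 1 - r"], of "exp (5 * 2 ^ r * (ln m)\<^sup>2)"]
      by (simp add: power2_eq_square mult_ac)
  qed
  \<comment> \<open>At depth 0 the error vanishes, so the lower bound on \<open>H\<close> is called
    upon only when \<open>k1\<close> is positive, which is what the disjunction in the assumption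
    offers.\<close>
  have errb: "err k \<le> 6 * e * sqrt 2 * \<sigma> * (1 / sqrt 2) ^ (k1 - k)" if k: "k \<le> k1" for k
  proof (cases "k = 0")
    case True
    then show ?thesis using e0 \<sigma> by (simp add: err_def)
  next
    case False
    then have k1': "2 ^ k1 * ln m \<le> H" using k1(2) k by (auto simp: H_def)

    have "2 ^ k * ln m \<le> H * (1 / 2) ^ (k1 - k)"
    proof -
      have "(2 :: real) ^ k1 * (1 / 2) ^ (k1 - k) = 2 ^ k"
        using k by (simp add: power_divide) (metis le_add_diff_inverse2 nonzero_mult_div_cancel_left power_add power_not_zero zero_neq_numeral)
      then have "2 ^ k * ln m = (2 ^ k1 * ln m) * (1 / 2) ^ (k1 - k)" by (simp add: mult_ac)
      also have "\<dots> \<le> H * (1 / 2) ^ (k1 - k)" using k1' by (intro mult_right_mono) auto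
      finally show ?thesis .
    qed
    then have "ln m * H * 2 ^ k \<le> H * (H * (1 / 2) ^ (k1 - k))"
      using H0 mult_left_mono[of "2 ^ k * ln m" "H * (1 / 2) ^ (k1 - k)" H] by (simp add: mult_ac)
    also have "\<dots> = (H * (1 / sqrt 2) ^ (k1 - k))\<^sup>2"
      by (simp add: power_mult_distrib power2_eq_square power_divide power_mult_distrib[symmetric] flip: power_mult_distrib)
    finally have "sqrt (ln m * H * 2 ^ k) \<le> H * (1 / sqrt 2) ^ (k1 - k)"
      using H0 by (intro real_le_lsqrt) auto
    then have sq: "sqrt (ln m * H) * sqrt 2 ^ k \<le> H * (1 / sqrt 2) ^ (k1 - k)"
      by (simp add: real_sqrt_mult real_sqrt_power)
    have "err k \<le> 1 / (N * sqrt m) * (2 * e * sqrt (ln m * H) * (3 * sqrt 2 ^ k))"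
      unfolding err_def e_def H_def[symmetric] using lnm H0 geometric_sqrt2
      by (intro mult_left_mono) auto
    also have "\<dots> = 1 / (N * sqrt m) * (6 * e) * (sqrt (ln m * H) * sqrt 2 ^ k)" by simp
    also have "\<dots> \<le> 1 / (N * sqrt m) * (6 * e) * (H * (1 / sqrt 2) ^ (k1 - k))"
      using sq e0 by (intro mult_left_mono) auto
    also have "\<dots> = 6 * e * (H / (N * sqrt m)) * (1 / sqrt 2) ^ (k1 - k)" by simp
    also have "H / (N * sqrt m) = sqrt 2 * \<sigma>"
      using N by (simp add: H_def \<sigma>_def real_sqrt_mult real_sqrt_divide)
    finally show ?thesis by (simp add: mult_ac)
  qed
  interpret chain m p R F "gabor_op m" \<pi> u q
  proof
    show "finite F" unfolding F_def by (rule finite_grid) (use N in simp)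
    show "F \<noteq> {}" using zero_in_grid by (auto simp: F_def)
    show "\<pi> r x \<in> F" if "x \<in> F" for r x using rep(1)[OF that] zero_in_grid by (simp add: \<pi>_def F_def)
    show "nrm2 m (app m (gabor_op m (\<pi> 0 x)) a) = 0" for x a
      by (simp add: \<pi>_def gabor_op_def app_def nrm2_def)
    show "\<pi> R x = x" if "x \<in> F" for x using rep0[OF that] by (simp add: \<pi>_def R_def)
    show "u r > 0" for r using e0 \<sigma> by (simp add: u_def)
    show "1 \<le> p" by (rule p)
    show "p \<le> 2 * q r" for r by (simp add: q_def)
    show "r + 1 \<le> q r" for r
    proof -
      have "real (r + 1) \<le> 2 ^ r" using of_nat_less_two_power[of r, where 'a = real] by (metis Suc_eq_plus1 Suc_leI less_exp of_nat_le_iff of_nat_numeral of_nat_power)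
      also have "\<dots> \<le> 15 * 2 ^ r * (ln m)\<^sup>2"
        using lnm2 mult_left_mono[of "4 / 9" "(ln m)\<^sup>2" "15 * 2 ^ r :: real"] by (simp add: power_one_over)
      also have "\<dots> \<le> q r" by (rule qge)
      finally show ?thesis by (simp only: of_nat_le_iff)
    qed
    show "real (card ((\<lambda>x. (\<pi> r x, \<pi> (Suc r) x)) ` F)) \<le> exp (q r)" if r: "r < R" for r
    proof -
      have fin: "finite F" unfolding F_def by (rule finite_grid) (use N in simp)
      have "card ((\<lambda>x. (\<pi> r x, \<pi> (Suc r) x)) ` F) \<le> card (\<pi> r ` F \<times> \<pi> (Suc r) ` F)"
        using fin by (intro card_mono) auto
      then have "real (card ((\<lambda>x. (\<pi> r x, \<pi> (Suc r) x)) ` F)) \<le> real (card (\<pi> r ` F)) * real (card (\<pi> (Suc r) ` F))"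
        by (simp only: card_cartesian_product of_nat_mult[symmetric] of_nat_le_iff)
      also have "\<dots> \<le> exp (5 * 2 ^ r * (ln m)\<^sup>2) * exp (5 * 2 ^ Suc r * (ln m)\<^sup>2)"
        using r by (intro mult_mono cardr) auto
      also have "\<dots> = exp (15 * 2 ^ r * (ln m)\<^sup>2)" by (simp add: exp_add[symmetric] algebra_simps)
      also have "\<dots> \<le> exp (q r)" using qge[of r] by simp
      finally show ?thesis .
    qed
    show "op_bound m (\<lambda>i j. gabor_op m (\<pi> (Suc r) x) i j - gabor_op m (\<pi> r x) i j) (u r)" if x: "x \<in> F" and r: "r < R" for r x
    proof (cases "r = 0")
      case True
      \<comment> \<open>The first link starts at zero, so its increment is the operator of a grid
        point itself, bounded through the l1 norm of a sparse unit vector.\<close>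
      have "op_bound m (gabor_op m (rep k1 x)) \<sigma>"
        using grid_op_bound[OF m0, of "rep k1 x" s N] rep(1)[OF x] by (simp add: F_def \<sigma>_def)
      moreover have "gabor_op m (\<lambda>_. 0) i j = 0" for i j by (simp add: gabor_op_def)
      ultimately have "op_bound m (\<lambda>i j. gabor_op m (\<pi> (Suc r) x) i j - gabor_op m (\<pi> r x) i j) \<sigma>"
        using True by (simp add: \<pi>_def)
      moreover have "\<sigma> \<le> u r" using True \<sigma> e0 mult_right_mono[of 1 "48 * e" \<sigma>] by (simp add: u_def)
      ultimately show ?thesis using \<sigma> op_bound_mono by (metis less_imp_le)
    next
      case False
      define k where "k = k1 - r"
      have k: "k1 + 1 - r = k + 1" "k1 + 1 - Suc r = k" "k + 1 \<le> k1" "k1 - k = r" "Suc (k1 - (k + 1)) = r"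
        using False r by (auto simp: k_def R_def)
      have "op_bound m (\<lambda>i j. (gabor_op m (rep k x) i j - gabor_op m x i j) - (gabor_op m (rep (k + 1) x) i j - gabor_op m x i j)) (2 * err k + 2 * err (k + 1))"
        by (intro op_bound_diff close x) (simp_all add: err0)
      then have ob: "op_bound m (\<lambda>i j. gabor_op m (\<pi> (Suc r) x) i j - gabor_op m (\<pi> r x) i j) (2 * err k + 2 * err (k + 1))"
        using False k(1,2) by (simp add: \<pi>_def)
      have "err k \<le> 6 * e * sqrt 2 * \<sigma> * (1 / sqrt 2) ^ r" using errb[of k] k by simp
      also have "\<dots> \<le> 12 * e * \<sigma> * (1 / sqrt 2) ^ r"
      proof -
        have "sqrt 2 \<le> (2 :: real)" by (rule real_le_lsqrt) auto
        then have "sqrt 2 * (6 * e * \<sigma> * (1 / sqrt 2) ^ r) \<le> 2 * (6 * e * \<sigma> * (1 / sqrt 2) ^ r)"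
          using e0 \<sigma> by (intro mult_right_mono) auto
        then show ?thesis by (simp add: mult_ac)
      qed
      finally have e1: "err k \<le> 12 * e * \<sigma> * (1 / sqrt 2) ^ r" .
      have "err (k + 1) \<le> 6 * e * sqrt 2 * \<sigma> * (1 / sqrt 2) ^ (k1 - (k + 1))" using errb[of "k + 1"] k by simp
      also have "\<dots> = 12 * e * \<sigma> * (1 / sqrt 2) ^ r"
        unfolding k(5)[symmetric] by (simp add: field_simps)
      finally have e2: "err (k + 1) \<le> 12 * e * \<sigma> * (1 / sqrt 2) ^ r" .
      have "2 * err k + 2 * err (k + 1) \<le> u r" using e1 e2 by (simp add: u_def)
      then show ?thesis by (intro op_bound_mono[OF ob]) (simp_all add: err0)
    qed
  qed
  define S where "S = (\<Sum>r<R. \<alpha> r)"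
  \<comment> \<open>The root of the moment order grows like sqrt 2 ^ r, exactly as fast as
    \<open>u r\<close> decays, so every level contributes the same multiple of \<open>ln m\<close>.
    The part with \<open>p\<close> decays geometrically; therefore sqrt p is not multiplied by the
    number of levels.\<close>
  have \<alpha>le: "\<alpha> r \<le> 48 * e\<^sup>2 * \<sigma> * (sqrt (60 * e) * ln m + sqrt (2 * e * p) * (1 / sqrt 2) ^ r)" for r
  proof -
    have "2 * e * q r \<le> 60 * e * 2 ^ r * (ln m)\<^sup>2 + 2 * e * p"
      using mult_left_mono[OF qle[of r], of "2 * e"] e0 by (simp add: algebra_simps)
    then have "sqrt (2 * e * q r) \<le> sqrt (60 * e * 2 ^ r * (ln m)\<^sup>2 + 2 * e * p)" by (rule real_sqrt_le_mono)
    also have "\<dots> \<le> sqrt (60 * e * 2 ^ r * (ln m)\<^sup>2) + sqrt (2 * e * p)"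
      using e0 by (intro sqrt_add_le_add_sqrt) auto
    also have "sqrt (60 * e * 2 ^ r * (ln m)\<^sup>2) = sqrt (60 * e) * ln m * sqrt 2 ^ r"
      using lnm by (simp add: real_sqrt_mult real_sqrt_power)
    finally have sq: "sqrt (2 * e * q r) \<le> sqrt (60 * e) * ln m * sqrt 2 ^ r + sqrt (2 * e * p)" .
    have "\<alpha> r = sqrt (2 * e * q r) * (48 * e\<^sup>2 * \<sigma> * (1 / sqrt 2) ^ r)"
      by (simp add: \<alpha>_def u_def e_def power2_eq_square)
    also have "\<dots> \<le> (sqrt (60 * e) * ln m * sqrt 2 ^ r + sqrt (2 * e * p)) * (48 * e\<^sup>2 * \<sigma> * (1 / sqrt 2) ^ r)"
      using sq e0 \<sigma> by (intro mult_right_mono) auto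
    also have "\<dots> = 48 * e\<^sup>2 * \<sigma> * (sqrt (60 * e) * ln m * (sqrt 2 ^ r * (1 / sqrt 2) ^ r) + sqrt (2 * e * p) * (1 / sqrt 2) ^ r)"
      by (simp add: algebra_simps)
    also have "sqrt 2 ^ r * (1 / sqrt 2) ^ r = (1 :: real)" by (simp add: power_mult_distrib[symmetric])
    finally show ?thesis by simp
  qed
  have "S \<le> (\<Sum>r<R. 48 * e\<^sup>2 * \<sigma> * (sqrt (60 * e) * ln m + sqrt (2 * e * p) * (1 / sqrt 2) ^ r))"
    unfolding S_def by (intro sum_mono \<alpha>le)
  also have "\<dots> = 48 * e\<^sup>2 * \<sigma> * (R * (sqrt (60 * e) * ln m) + sqrt (2 * e * p) * (\<Sum>r<R. (1 / sqrt 2) ^ r))"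
    by (simp add: sum_distrib_left[symmetric] sum.distrib)
  also have "\<dots> \<le> 48 * e\<^sup>2 * \<sigma> * (R * (sqrt (60 * e) * ln m) + sqrt (2 * e * p) * 4)"
    using e0 \<sigma> geometric_inv_sqrt2 by (intro mult_left_mono add_left_mono) auto
  also have "\<dots> \<le> 48 * e\<^sup>2 * \<sigma> * (R * (sqrt (60 * e) * ln m) + sqrt (60 * e) * sqrt p)"
  proof -
    have "sqrt 16 = (4 :: real)" by (rule real_sqrt_unique) auto
    then have "sqrt (2 * e * p) * 4 = sqrt (2 * e * p * 16)" by (simp only: real_sqrt_mult[of "2 * e * p" 16])
    also have "\<dots> \<le> sqrt (60 * e * p)" using e0 by (intro real_sqrt_le_mono) simp
    finally show ?thesis using e0 \<sigma> by (intro mult_left_mono add_left_mono) (auto simp: real_sqrt_mult)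
  qed
  also have "\<dots> = K / 2"
    by (simp add: K(1) chain_const_def e_def[symmetric] \<sigma>_def[symmetric] R_def algebra_simps)
  finally have SK: "2 * S \<le> K" by simp
  have S0: "S \<ge> 0" unfolding S_def using \<alpha>_pos by (intro sum_nonneg) (auto simp: less_imp_le)
  have "chaos_moment p m F (gabor_op m) \<le> ennreal (4 * (2 * S) ^ p) * (\<integral>\<^sup>+a. ennreal (max_norm m F (gabor_op m) a ^ p) \<partial>cgauss_vec m)"
    unfolding S_def by (rule chaos_moment_le_max_norm)
  also have "\<dots> \<le> ennreal (4 * K ^ p) * (\<integral>\<^sup>+a. ennreal (max_norm m F (gabor_op m) a ^ p) \<partial>cgauss_vec m)"
    using SK S0 by (intro mult_right_mono ennreal_leI mult_left_mono power_mono) auto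
  finally have H': "chaos_moment p m F (gabor_op m) \<le> ennreal (4 * K ^ p) * (\<integral>\<^sup>+a. ennreal (max_norm m F (gabor_op m) a ^ p) \<partial>cgauss_vec m)" .
  show ?thesis
    unfolding F_def[symmetric]
  proof (rule chaos_moment_bound[OF F p _ _ K(2) H'])
    show "frob_sq m (gabor_op m x) \<le> 1" if "x \<in> F" for x
      using gridD(3)[of x m s N] that by (simp add: frob_sq_gabor_op[OF m0] F_def)
    show "0 \<le> K" using SK S0 by simp
  qed
qed

section \<open>From the grid to sparse vectors\<close>

definition gabor_dev :: "nat \<Rightarrow> (nat \<Rightarrow> complex) \<Rightarrow> (nat \<times> nat \<Rightarrow> complex) \<Rightarrow> real" where
  "gabor_dev m a x = nrm2 m (app m (gabor_op m x) a) - (\<Sum>p\<in>tf_plane m. (cmod (x p))\<^sup>2)"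

text \<open>Rounding towards zero never increases a modulus and keeps zeros, so that the rounded
  vector stays in the unit ball and on the same support.\<close>

definition round_to_zero :: "real \<Rightarrow> int" where
  "round_to_zero a = (if a \<ge> 0 then \<lfloor>a\<rfloor> else \<lceil>a\<rceil>)"

lemma round_to_zero:
  shows "\<bar>real_of_int (round_to_zero a)\<bar> \<le> \<bar>a\<bar>" "\<bar>a - round_to_zero a\<bar> \<le> 1" "round_to_zero 0 = 0"
proof -
  show "\<bar>real_of_int (round_to_zero a)\<bar> \<le> \<bar>a\<bar>" unfolding round_to_zero_def by (cases "a \<ge> 0"; simp; linarith)
  show "\<bar>a - round_to_zero a\<bar> \<le> 1" unfolding round_to_zero_def by (cases "a \<ge> 0"; simp; linarith)
qed (simp add: round_to_zero_def)

lemma app_gabor_op: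
  assumes "m > 0"
  shows "app m (gabor_op m x) a i = of_real (1 / sqrt m) * (\<Sum>p\<in>tf_plane m. x p * app m (tf_kernel m p) a i)"
proof -
  have "app m (gabor_op m x) a i = (\<Sum>j<m. \<Sum>p\<in>tf_plane m. of_real (1 / sqrt m) * (x p * tf_kernel m p i j * a j))"
    by (simp add: app_def gabor_op_def sum_distrib_left sum_distrib_right mult.assoc)
  also have "\<dots> = (\<Sum>p\<in>tf_plane m. \<Sum>j<m. of_real (1 / sqrt m) * (x p * tf_kernel m p i j * a j))"
    by (rule sum.swap)
  also have "\<dots> = of_real (1 / sqrt m) * (\<Sum>p\<in>tf_plane m. x p * app m (tf_kernel m p) a i)"
    by (simp add: app_def sum_distrib_left mult.assoc)
  finally show ?thesis .
qed

lemma gabor_dev_cong: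
  assumes "m > 0" "\<And>p. p \<in> tf_plane m \<Longrightarrow> x p = y p"
  shows "gabor_dev m a x = gabor_dev m a y"
  using assms by (simp add: gabor_dev_def nrm2_def app_gabor_op)

lemma app_gabor_op_linear:
  assumes "m > 0"
  shows "app m (gabor_op m (\<lambda>p. c * x p + d * y p)) a i = c * app m (gabor_op m x) a i + d * app m (gabor_op m y) a i"
  unfolding app_gabor_op[OF assms] by (simp add: algebra_simps sum.distrib sum_distrib_left)

lemma gabor_dev_cmult:
  assumes "m > 0"
  shows "gabor_dev m a (\<lambda>p. c * x p) = (cmod c)\<^sup>2 * gabor_dev m a x"
proof -
  have "app m (gabor_op m (\<lambda>p. c * x p)) a i = c * app m (gabor_op m x) a i" for i
    using app_gabor_op_linear[OF assms, of c x 0 x a i] by simp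
  then show ?thesis
    by (simp add: gabor_dev_def nrm2_def norm_mult power_mult_distrib right_diff_distrib sum_distrib_left)
qed

text \<open>The weights \<open>1/2\<close> and \<open>2\<close> balance the two parts when \<open>y\<close> is about four times smaller than \<open>x\<close>.\<close>

lemma weighted_polarization:
  fixes u v :: complex
  shows "(cmod (u + v))\<^sup>2 = (cmod u)\<^sup>2 + (cmod v)\<^sup>2 + ((cmod (u / 2 + 2 * v))\<^sup>2 - (cmod (u / 2 - 2 * v))\<^sup>2) / 2"
    and "(cmod (u / 2 + 2 * v))\<^sup>2 + (cmod (u / 2 - 2 * v))\<^sup>2 = (cmod u)\<^sup>2 / 2 + 8 * (cmod v)\<^sup>2"
  unfolding cmod_power2 by (simp_all add: power2_eq_square algebra_simps add_divide_distrib diff_divide_distrib)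

lemma sum_weighted_polarization:
  fixes f g :: "'i \<Rightarrow> complex"
  shows "(\<Sum>i\<in>A. (cmod (f i + g i))\<^sup>2) = (\<Sum>i\<in>A. (cmod (f i))\<^sup>2) + (\<Sum>i\<in>A. (cmod (g i))\<^sup>2) +
    ((\<Sum>i\<in>A. (cmod (f i / 2 + 2 * g i))\<^sup>2) - (\<Sum>i\<in>A. (cmod (f i / 2 - 2 * g i))\<^sup>2)) / 2"
proof -
  have "(cmod (f i + g i))\<^sup>2 = (cmod (f i))\<^sup>2 + (cmod (g i))\<^sup>2 +
      ((cmod (f i / 2 + 2 * g i))\<^sup>2 - (cmod (f i / 2 - 2 * g i))\<^sup>2) / 2" for i
    by (rule weighted_polarization)
  then show ?thesis by (simp only: sum.distrib sum_subtractf sum_divide_distrib[symmetric])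
qed

lemma gabor_dev_add:
  assumes m: "m > 0"
  shows "gabor_dev m a (\<lambda>p. x p + y p) = gabor_dev m a x + gabor_dev m a y +
    (gabor_dev m a (\<lambda>p. x p / 2 + 2 * y p) - gabor_dev m a (\<lambda>p. x p / 2 - 2 * y p)) / 2"
proof -
  let ?G = "\<lambda>x. app m (gabor_op m x) a"
  have "?G (\<lambda>p. x p + y p) i = ?G x i + ?G y i" "?G (\<lambda>p. x p / 2 + 2 * y p) i = ?G x i / 2 + 2 * ?G y i"
    "?G (\<lambda>p. x p / 2 - 2 * y p) i = ?G x i / 2 - 2 * ?G y i" for i
    using app_gabor_op_linear[OF m, of 1 x 1 y a i] app_gabor_op_linear[OF m, of "1 / 2" x 2 y a i]
      app_gabor_op_linear[OF m, of "1 / 2" x "- 2" y a i] by simp_all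
  then have g: "nrm2 m (?G (\<lambda>p. x p + y p)) = nrm2 m (?G x) + nrm2 m (?G y) +
      (nrm2 m (?G (\<lambda>p. x p / 2 + 2 * y p)) - nrm2 m (?G (\<lambda>p. x p / 2 - 2 * y p))) / 2"
    unfolding nrm2_def by (simp only: sum_weighted_polarization[of "?G x" "?G y" "{..<m}"])
  have "A - B = (a1 - b1) + (a2 - b2) + ((a3 - b3) - (a4 - b4)) / 2"
    if "A = a1 + a2 + (a3 - a4) / 2" "B = b1 + b2 + (b3 - b4) / 2" for A B a1 a2 a3 a4 b1 b2 b3 b4 :: real
    unfolding that by (simp add: field_simps)
  from this[OF g sum_weighted_polarization] show ?thesis unfolding gabor_dev_def .
qed

text \<open>Mesh width 1 / (8 s): each of at most \<open>s\<close> coordinates has squared error at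
  most 2 / (8 s)^2, so the total is at most 1 / (32 s).\<close>

lemma grid_approx:
  assumes S: "S \<subseteq> tf_plane m" "card S \<le> s" and s: "s \<ge> 1"
    and y: "\<And>p. p \<notin> S \<Longrightarrow> y p = 0" "(\<Sum>p\<in>tf_plane m. (cmod (y p))\<^sup>2) \<le> 1"
  obtains x where "x \<in> grid m s (8 * s)" "\<And>p. p \<notin> S \<Longrightarrow> x p = 0"
    "(\<Sum>p\<in>tf_plane m. (cmod (y p - x p))\<^sup>2) \<le> 1 / 16"
proof -
  define N where "N = real (8 * s)"
  have N: "N > 0" using s by (simp add: N_def)
  define r where "r b = real_of_int (round_to_zero (N * b)) / N" for b
  have r1: "\<bar>r b\<bar> \<le> \<bar>b\<bar>" for b
    using round_to_zero(1)[of "N * b"] N by (simp add: r_def abs_mult divide_le_eq mult.commute)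
  have r2: "\<bar>b - r b\<bar> \<le> 1 / N" for b
  proof -
    have "b - r b = (N * b - round_to_zero (N * b)) / N" using N by (simp add: r_def diff_divide_distrib)
    then show ?thesis using round_to_zero(2)[of "N * b"] N by (simp add: divide_right_mono)
  qed
  have r0: "r 0 = 0" by (simp add: r_def round_to_zero(3))
  define x where "x p = Complex (r (Re (y p))) (r (Im (y p)))" for p
  have x0: "x p = 0" if "p \<notin> S" for p using y(1)[OF that] by (simp add: x_def r0 zero_complex.code)
  have sq: "(cmod (x p))\<^sup>2 \<le> (cmod (y p))\<^sup>2" for p
    unfolding cmod_power2 x_def using r1 by (auto intro!: add_mono abs_le_square_iff[THEN iffD1])
  have "x \<in> grid m s (8 * s)"
    unfolding grid_def
  proof (intro CollectI conjI allI impI)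
    show "x p = 0" if "p \<notin> tf_plane m" for p using x0 that S by blast
    have "card {p \<in> tf_plane m. x p \<noteq> 0} \<le> card S"
      using x0 S finite_subset by (intro card_mono) (auto intro: finite_subset)
    then show "card {p \<in> tf_plane m. x p \<noteq> 0} \<le> s" using S by simp
    show "(\<Sum>p\<in>tf_plane m. (cmod (x p))\<^sup>2) \<le> 1" by (rule order_trans[OF sum_mono[OF sq] y(2)])
    show "real (8 * s) * Re (x p) \<in> \<int>" "real (8 * s) * Im (x p) \<in> \<int>" for p
      unfolding N_def[symmetric] using N by (simp_all add: x_def r_def)
  qed
  moreover have "(\<Sum>p\<in>tf_plane m. (cmod (y p - x p))\<^sup>2) \<le> 1 / 16"
  proof -
    have d: "(cmod (y p - x p))\<^sup>2 \<le> 2 / N\<^sup>2" for p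
    proof -
      have "(b - r b)\<^sup>2 \<le> (1 / N)\<^sup>2" for b using power_mono[OF r2[of b], of 2] by simp
      from add_mono[OF this[of "Re (y p)"] this[of "Im (y p)"]] show ?thesis
        by (simp add: cmod_power2 x_def power_divide)
    qed
    have "(\<Sum>p\<in>tf_plane m. (cmod (y p - x p))\<^sup>2) = (\<Sum>p\<in>S. (cmod (y p - x p))\<^sup>2)"
      using S x0 y(1) by (intro sum.mono_neutral_right) auto
    also have "\<dots> \<le> (\<Sum>p\<in>S. 2 / N\<^sup>2)" by (intro sum_mono d)
    also have "\<dots> \<le> s * (2 / N\<^sup>2)" using S(2) by (simp add: divide_right_mono)
    also have "\<dots> \<le> 1 / 16" using s by (simp add: N_def power2_eq_square field_simps)
    finally show ?thesis .
  qed
  ultimately show ?thesis using x0 that by blast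
qed

text \<open>On one fixed support \<open>S\<close>, where sums of vectors remain sparse, let
  \<open>\<beta>\<close> be the supremum over the unit ball. Splitting into a grid point and a
  remainder of squared norm at most 1/16, the polarization identity gives
  \<open>\<beta> \<le> t + \<beta> * (1 / 4 + 5 / 16)\<close>. Solving yields 16/7, rounded up to
  8/3.\<close>

lemma gabor_dev_le_grid:
  assumes m: "m > 0" and s: "s \<ge> 1"
    and t: "\<And>x. x \<in> grid m s (8 * s) \<Longrightarrow> \<bar>gabor_dev m a x\<bar> \<le> t"
    and y: "card {p \<in> tf_plane m. y p \<noteq> 0} \<le> s"
  shows "\<bar>gabor_dev m a y\<bar> \<le> 8 / 3 * t * (\<Sum>p\<in>tf_plane m. (cmod (y p))\<^sup>2)"
proof -
  define S where "S = {p \<in> tf_plane m. y p \<noteq> 0}"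
  define sq where "sq x = (\<Sum>p\<in>tf_plane m. (cmod (x p))\<^sup>2)" for x :: "nat \<times> nat \<Rightarrow> complex"
  have S: "S \<subseteq> tf_plane m" "card S \<le> s" using y by (auto simp: S_def)
  have sq0: "sq x \<ge> 0" for x by (simp add: sq_def sum_nonneg)
  define V where "V = {x. (\<forall>p. p \<notin> S \<longrightarrow> x p = (0 :: complex)) \<and> sq x \<le> 1}"
  define \<beta> where "\<beta> = (SUP x\<in>V. \<bar>gabor_dev m a x\<bar>)"
  have V0: "(\<lambda>_. 0) \<in> V" by (simp add: V_def sq_def)
  \<comment> \<open>A crude bound depending on \<open>a\<close>; it only guarantees that
    \<open>\<beta>\<close> is a genuine supremum, so that the inequality for it can be
    solved.\<close>
  have bdd: "bdd_above ((\<lambda>x. \<bar>gabor_dev m a x\<bar>) ` V)"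
  proof (rule bdd_aboveI2)
    fix x assume x: "x \<in> V"
    have "card {p \<in> tf_plane m. cmod (x p) \<noteq> 0} \<le> card S"
      using x S by (intro card_mono) (auto simp: V_def intro: finite_subset)
    then have "(\<Sum>p\<in>tf_plane m. cmod (x p)) \<le> sqrt (real s * 1)"
      using x S by (intro sum_sparse_le) (auto simp: V_def sq_def)
    then have "op_bound m (gabor_op m x) (sqrt s / sqrt m)" by (intro gabor_op_bound[OF m]) simp
    then have "nrm2 m (app m (gabor_op m x) a) \<le> (sqrt s / sqrt m)\<^sup>2 * nrm2 m a" by (simp add: op_bound_def)
    moreover have "sq x \<le> 1" using x by (simp add: V_def)
    ultimately show "\<bar>gabor_dev m a x\<bar> \<le> (sqrt s / sqrt m)\<^sup>2 * nrm2 m a + 1"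
      using sq0[of x] nrm2_nonneg[of m "app m (gabor_op m x) a"] unfolding gabor_dev_def sq_def by linarith
  qed
  have up: "\<bar>gabor_dev m a x\<bar> \<le> \<beta>" if "x \<in> V" for x
    unfolding \<beta>_def by (rule cSUP_upper[OF that bdd])
  have hom: "\<bar>gabor_dev m a x\<bar> \<le> \<beta> * sq x" if x: "\<And>p. p \<notin> S \<Longrightarrow> x p = 0" for x
  proof (cases "sq x = 0")
    case True
    then have "x p = 0" if "p \<in> tf_plane m" for p using that by (simp add: sq_def sum_nonneg_eq_0_iff)
    then have "gabor_dev m a x = gabor_dev m a (\<lambda>p. 0 * x p)" by (intro gabor_dev_cong[OF m]) simp
    also have "\<dots> = 0" by (subst gabor_dev_cmult[OF m]) simp
    finally show ?thesis using True by simp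
  next
    case False
    then have pos: "sq x > 0" using sq0[of x] by simp
    define c where "c = 1 / sqrt (sq x)"
    have c2: "(cmod (of_real c))\<^sup>2 = 1 / sq x" using pos by (simp add: c_def norm_divide power_divide)
    have "sq (\<lambda>p. of_real c * x p) = (cmod (of_real c))\<^sup>2 * sq x"
      by (simp add: sq_def norm_mult power_mult_distrib sum_distrib_left)
    then have "(\<lambda>p. of_real c * x p) \<in> V" using x pos unfolding c2 by (simp add: V_def)
    from up[OF this] have "\<bar>1 / sq x * gabor_dev m a x\<bar> \<le> \<beta>" unfolding gabor_dev_cmult[OF m] c2 .
    then show ?thesis using pos by (simp add: abs_mult field_simps)
  qed
  have \<beta>0: "\<beta> \<ge> 0" using up[OF V0] by simp
  have step: "\<bar>gabor_dev m a z\<bar> \<le> t + 9 / 16 * \<beta>" if z: "z \<in> V" for z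
  proof -
    obtain x where x: "x \<in> grid m s (8 * s)" "\<And>p. p \<notin> S \<Longrightarrow> x p = 0" "sq (\<lambda>p. z p - x p) \<le> 1 / 16"
      using grid_approx[OF S s, of z] z unfolding V_def sq_def by blast
    define r where "r p = z p - x p" for p
    have rS: "r p = 0" if "p \<notin> S" for p using z x(2)[OF that] that unfolding r_def V_def by fastforce
    have r: "sq r \<le> 1 / 16" using x(3) by (simp add: r_def[abs_def])
    have "gabor_dev m a z = gabor_dev m a (\<lambda>p. x p + r p)" by (simp add: r_def)
    also have "\<dots> = gabor_dev m a x + gabor_dev m a r +
        (gabor_dev m a (\<lambda>p. x p / 2 + 2 * r p) - gabor_dev m a (\<lambda>p. x p / 2 - 2 * r p)) / 2"
      by (rule gabor_dev_add[OF m])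
    finally have "gabor_dev m a z = gabor_dev m a x + gabor_dev m a r +
        (gabor_dev m a (\<lambda>p. x p / 2 + 2 * r p) - gabor_dev m a (\<lambda>p. x p / 2 - 2 * r p)) / 2" .
    moreover have "\<bar>gabor_dev m a r\<bar> \<le> \<beta> * sq r" by (rule hom[OF rS])
    moreover have "\<bar>gabor_dev m a (\<lambda>p. x p / 2 + 2 * r p)\<bar> \<le> \<beta> * sq (\<lambda>p. x p / 2 + 2 * r p)"
      by (rule hom) (simp add: x(2) rS)
    moreover have "\<bar>gabor_dev m a (\<lambda>p. x p / 2 - 2 * r p)\<bar> \<le> \<beta> * sq (\<lambda>p. x p / 2 - 2 * r p)"
      by (rule hom) (simp add: x(2) rS)
    ultimately have "\<bar>gabor_dev m a z\<bar> \<le> t + \<beta> * sq r + \<beta> * (sq (\<lambda>p. x p / 2 + 2 * r p) + sq (\<lambda>p. x p / 2 - 2 * r p)) / 2"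
      using t[OF x(1)] unfolding distrib_left by argo
    also have "sq (\<lambda>p. x p / 2 + 2 * r p) + sq (\<lambda>p. x p / 2 - 2 * r p) = sq x / 2 + 8 * sq r"
      unfolding sq_def sum.distrib[symmetric] weighted_polarization(2) by (simp add: sum.distrib sum_distrib_left sum_divide_distrib)
    also have "t + \<beta> * sq r + \<beta> * (sq x / 2 + 8 * sq r) / 2 = t + \<beta> * (sq x / 4 + 5 * sq r)"
      by (simp add: algebra_simps)
    also have "\<dots> \<le> t + \<beta> * (1 / 4 + 5 * (1 / 16))"
      using gridD(3)[OF x(1)] r \<beta>0 by (intro add_left_mono mult_left_mono) (auto simp: sq_def)
    finally show ?thesis by simp
  qed
  have "\<beta> \<le> t + 9 / 16 * \<beta>" unfolding \<beta>_def[symmetric]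
    by (subst (1) \<beta>_def) (use V0 in \<open>intro cSUP_least step; blast\<close>)
  moreover have "t \<ge> 0" using t[OF zero_in_grid] by simp
  ultimately have "\<beta> \<le> 8 / 3 * t" by simp
  have Sy: "gabor_dev m a y = gabor_dev m a (\<lambda>p. if p \<in> S then y p else 0)" "sq y = sq (\<lambda>p. if p \<in> S then y p else 0)"
    by (intro gabor_dev_cong[OF m]) (auto simp: S_def sq_def intro!: sum.cong)
  have "\<bar>gabor_dev m a y\<bar> \<le> \<beta> * sq y" unfolding Sy by (rule hom) simp
  also have "\<dots> \<le> 8 / 3 * t * sq y" using \<open>\<beta> \<le> 8 / 3 * t\<close> sq0 by (rule mult_right_mono)
  finally show ?thesis by (simp add: sq_def)
qed

section \<open>One-sparse vectors\<close>

definition delta_plane :: "nat \<times> nat \<Rightarrow> complex" where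
  "delta_plane p = (if p = (0, 0) then 1 else 0)"

text \<open>Time-frequency shifts preserve norms, so all one-sparse vectors have the same deviation
  up to scaling, and one test vector decides them all.\<close>

lemma gabor_dev_single:
  assumes m: "m > 0" and q: "q \<in> tf_plane m" and x: "\<And>p. p \<in> tf_plane m \<Longrightarrow> p \<noteq> q \<Longrightarrow> x p = 0"
  shows "gabor_dev m a x = (cmod (x q))\<^sup>2 * (nrm2 m a / m - 1)"
proof -
  have "(\<Sum>p\<in>tf_plane m. x p * app m (tf_kernel m p) a i) = (\<Sum>p\<in>{q}. x p * app m (tf_kernel m p) a i)" for i
    using q x by (intro sum.mono_neutral_right) auto
  then have "app m (gabor_op m x) a i = of_real (1 / sqrt m) * x q * app m (tf_kernel m q) a i" for i
    by (simp add: app_gabor_op[OF m])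
  then have "nrm2 m (app m (gabor_op m x) a) = (cmod (of_real (1 / sqrt m) * x q))\<^sup>2 * nrm2 m (app m (tf_kernel m q) a)"
    by (simp add: nrm2_def norm_mult norm_divide power_mult_distrib power_divide sum_distrib_left)
  also have "\<dots> = (cmod (x q))\<^sup>2 * (nrm2 m a / m)"
    unfolding nrm2_tf_kernel[OF m] using m by (simp add: norm_mult norm_divide power_mult_distrib power_divide)
  finally have "nrm2 m (app m (gabor_op m x) a) = (cmod (x q))\<^sup>2 * (nrm2 m a / m)" .
  moreover have "(\<Sum>p\<in>tf_plane m. (cmod (x p))\<^sup>2) = (\<Sum>p\<in>{q}. (cmod (x p))\<^sup>2)"
    using q x by (intro sum.mono_neutral_right) auto
  ultimately show ?thesis by (simp add: gabor_dev_def right_diff_distrib)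
qed

text \<open>The factor 8/3 is chosen to agree with \<open>gabor_dev_le_grid\<close>, so that
  \<open>gabor_net\<close> can offer both nets under one interface.\<close>

lemma gabor_dev_le_delta:
  assumes m: "m > 0" and t: "\<bar>gabor_dev m a delta_plane\<bar> \<le> t"
    and y: "card {p \<in> tf_plane m. y p \<noteq> 0} \<le> 1"
  shows "\<bar>gabor_dev m a y\<bar> \<le> 8 / 3 * t * (\<Sum>p\<in>tf_plane m. (cmod (y p))\<^sup>2)"
proof -
  have "\<exists>q\<in>tf_plane m. \<forall>p\<in>tf_plane m. p \<noteq> q \<longrightarrow> y p = 0"
  proof (cases "\<exists>q\<in>tf_plane m. y q \<noteq> 0")
    case True
    then obtain q where q: "q \<in> tf_plane m" "y q \<noteq> 0" by blast
    have "y p = 0" if "p \<in> tf_plane m" "p \<noteq> q" for p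
    proof (rule ccontr)
      assume "y p \<noteq> 0"
      then have "card {p, q} \<le> card {p \<in> tf_plane m. y p \<noteq> 0}" using q that by (intro card_mono) auto
      then show False using y that by simp
    qed
    then show ?thesis using q by blast
  next
    case False
    have "(0, 0) \<in> tf_plane m" using m by (simp add: tf_plane_def)
    then show ?thesis using False by blast
  qed
  then obtain q where q: "q \<in> tf_plane m" "\<And>p. p \<in> tf_plane m \<Longrightarrow> p \<noteq> q \<Longrightarrow> y p = 0" by blast
  have "gabor_dev m a delta_plane = (cmod (delta_plane (0, 0)))\<^sup>2 * (nrm2 m a / m - 1)"
    by (rule gabor_dev_single[OF m]) (use m in \<open>auto simp: tf_plane_def delta_plane_def\<close>)
  then have t': "\<bar>nrm2 m a / m - 1\<bar> \<le> t" using t by (simp add: delta_plane_def)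
  have "(\<Sum>p\<in>tf_plane m. (cmod (y p))\<^sup>2) = (\<Sum>p\<in>{q}. (cmod (y p))\<^sup>2)"
    using q by (intro sum.mono_neutral_right) auto
  moreover have "\<bar>gabor_dev m a y\<bar> = \<bar>nrm2 m a / m - 1\<bar> * (cmod (y q))\<^sup>2"
    using gabor_dev_single[OF m q(1), of y a] q(2) by (simp add: abs_mult)
  moreover have "\<bar>nrm2 m a / m - 1\<bar> * (cmod (y q))\<^sup>2 \<le> 8 / 3 * t * (cmod (y q))\<^sup>2"
    using order_trans[OF abs_ge_zero t'] t' by (intro mult_right_mono) auto
  ultimately show ?thesis by simp
qed

lemma chain_const_ge: "chain_const \<ge> 1" "2 * exp 1 * sqrt (2 * exp 1) \<le> chain_const"
proof -
  have e: "exp 1 \<ge> (1 :: real)" by simp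
  have s: "sqrt (2 * exp 1) \<le> sqrt (60 * exp 1 :: real)" by (intro real_sqrt_le_mono) simp
  have "1 \<le> sqrt (2 * exp 1 :: real)" by (intro real_sqrt_ge_one order_trans[OF e]) simp
  have a: "2 * exp 1 \<le> 96 * (exp 1 :: real)\<^sup>2"
  proof -
    have "1 \<le> 48 * (exp 1 :: real)" by (rule order_trans[OF e]) simp
    then have "1 * (2 * exp 1) \<le> 48 * exp 1 * (2 * exp 1 :: real)" by (intro mult_right_mono) simp_all
    then show ?thesis by (simp add: power2_eq_square)
  qed
  have "2 * exp 1 * sqrt (2 * exp 1) \<le> 96 * (exp 1 :: real)\<^sup>2 * sqrt (60 * exp 1)"
    by (rule mult_mono[OF a s]) auto
  then show "2 * exp 1 * sqrt (2 * exp 1) \<le> chain_const" by (simp add: chain_const_def)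
  moreover have "1 * 1 \<le> 2 * exp 1 * sqrt (2 * exp 1 :: real)"
    using e \<open>1 \<le> sqrt (2 * exp 1)\<close> by (intro mult_mono) auto
  ultimately show "chain_const \<ge> 1" by simp
qed

text \<open>A chain with a single link from zero to the test vector; its cost is sqrt p without
  \<open>ln m\<close>, as required when \<open>ln s = 0\<close>.\<close>

lemma gabor_chain_single:
  assumes m: "m > 0" and p: "p \<ge> 1" and K: "K = chain_const * sqrt (1 / m) * sqrt p" "K \<le> 1 / 16"
  shows "chaos_moment p m {\<lambda>_. 0, delta_plane} (gabor_op m) \<le> ennreal ((32 * K) ^ p)"
proof -
  define F where "F = {\<lambda>_. 0, delta_plane}"
  have sumd: "(\<Sum>p\<in>tf_plane m. g (delta_plane p)) = g 1" if "g 0 = 0" for g :: "complex \<Rightarrow> real"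
  proof -
    have "(\<Sum>p\<in>tf_plane m. g (delta_plane p)) = (\<Sum>p\<in>{(0, 0)}. g (delta_plane p))"
      using m that by (intro sum.mono_neutral_right) (auto simp: tf_plane_def delta_plane_def)
    then show ?thesis by (simp add: delta_plane_def)
  qed
  define \<sigma> where "\<sigma> = sqrt (1 / m)"
  have \<sigma>: "\<sigma> > 0" using m by (simp add: \<sigma>_def)
  define \<pi> where "\<pi> r x = (if r = 0 then (\<lambda>_. 0) else x)" for r :: nat and x :: "nat \<times> nat \<Rightarrow> complex"
  define q where "q r = p + r" for r :: nat
  have ob: "op_bound m (gabor_op m x) \<sigma>" if "x \<in> F" for x
    using gabor_op_bound[OF m, of x 1] that sumd[of cmod] by (auto simp: F_def \<sigma>_def real_sqrt_divide)
  interpret chain m p 1 F "gabor_op m" \<pi> "\<lambda>_. \<sigma>" q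
  proof
    show "finite F" "F \<noteq> {}" by (auto simp: F_def)
    show "\<pi> r x \<in> F" if "x \<in> F" for r x using that by (simp add: \<pi>_def F_def)
    show "nrm2 m (app m (gabor_op m (\<pi> 0 x)) a) = 0" for x a
      by (simp add: \<pi>_def gabor_op_def app_def nrm2_def)
    show "\<pi> 1 x = x" for x by (simp add: \<pi>_def)
    show "\<sigma> > 0" by (rule \<sigma>)
    show "1 \<le> p" by (rule p)
    show "p \<le> 2 * q r" "r + 1 \<le> q r" for r using p by (simp_all add: q_def)
    show "real (card ((\<lambda>x. (\<pi> r x, \<pi> (Suc r) x)) ` F)) \<le> exp (q r)" for r
    proof -
      have "card ((\<lambda>x. (\<pi> r x, \<pi> (Suc r) x)) ` F) \<le> card F" by (rule card_image_le) (simp add: F_def)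
      also have "\<dots> \<le> 2" using card_insert_le_m1[of 2 "{delta_plane}" "\<lambda>_. 0"] by (simp add: F_def)
      finally have "real (card ((\<lambda>x. (\<pi> r x, \<pi> (Suc r) x)) ` F)) \<le> 2" by simp
      also have "\<dots> \<le> 1 + real (q r)" using p by (simp add: q_def)
      also have "\<dots> \<le> exp (q r)" by (rule exp_ge_add_one_self)
      finally show ?thesis .
    qed
    show "op_bound m (\<lambda>i j. gabor_op m (\<pi> (Suc r) x) i j - gabor_op m (\<pi> r x) i j) \<sigma>" if x: "x \<in> F" and r: "r < 1" for r x
    proof -
      have "gabor_op m (\<lambda>_. 0) i j = 0" for i j by (simp add: gabor_op_def)
      then show ?thesis using ob[OF x] r by (simp add: \<pi>_def)
    qed
  qed
  have S: "2 * (\<Sum>r<1. \<alpha> r) \<le> K"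
  proof -
    have "2 * (\<Sum>r<1. \<alpha> r) = (2 * exp 1 * sqrt (2 * exp 1)) * \<sigma> * sqrt p"
      by (simp add: \<alpha>_def q_def real_sqrt_mult)
    also have "\<dots> \<le> chain_const * \<sigma> * sqrt p"
      using chain_const_ge(2) \<sigma> by (intro mult_right_mono) auto
    finally show ?thesis by (simp add: K \<sigma>_def)
  qed
  have S0: "(\<Sum>r<1. \<alpha> r) \<ge> 0" using \<alpha>_pos[of 0] by simp
  have "chaos_moment p m F (gabor_op m) \<le> ennreal (4 * (2 * (\<Sum>r<1. \<alpha> r)) ^ p) * (\<integral>\<^sup>+a. ennreal (max_norm m F (gabor_op m) a ^ p) \<partial>cgauss_vec m)"
    by (rule chaos_moment_le_max_norm)
  also have "\<dots> \<le> ennreal (4 * K ^ p) * (\<integral>\<^sup>+a. ennreal (max_norm m F (gabor_op m) a ^ p) \<partial>cgauss_vec m)"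
    using S S0 by (intro mult_right_mono ennreal_leI mult_left_mono power_mono) auto
  finally have H: "chaos_moment p m F (gabor_op m) \<le> ennreal (4 * K ^ p) * (\<integral>\<^sup>+a. ennreal (max_norm m F (gabor_op m) a ^ p) \<partial>cgauss_vec m)" .
  show ?thesis
    unfolding F_def[symmetric]
  proof (rule chaos_moment_bound[OF _ _ p _ _ K(2) H])
    show "finite F" "F \<noteq> {}" by (auto simp: F_def)
    show "frob_sq m (gabor_op m x) \<le> 1" if "x \<in> F" for x
      using that sumd[of "\<lambda>z. (cmod z)\<^sup>2"] by (auto simp: frob_sq_gabor_op[OF m] F_def)
    show "0 \<le> K" using S S0 by simp
  qed
qed

text \<open>The least admissible depth. Since the number of summands is at most 8 s^2, a positive
  depth satisfies 2^k \<le> 16 s^2 \<le> s^6, so the number of levels is O(ln s), independently of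
  \<open>m\<close>.\<close>

lemma ex_chain_length:
  fixes m s :: nat
  assumes m: "m \<ge> 2" and s: "s \<ge> 2"
  shows "\<exists>k. real (8 * s) * sqrt (2 * s) \<le> 2 ^ (k + 1) * ln m \<and> (k = 0 \<or> 2 ^ k * ln m \<le> real (8 * s) * sqrt (2 * s)) \<and>
    real (k + 1) \<le> 12 * ln s"
proof -
  define H where "H = real (8 * s) * sqrt (2 * s)"
  have lnm: "ln m \<ge> 2 / 3" and lns: "ln s \<ge> 2 / 3" using ln_ge_two_thirds m s by auto
  have "\<exists>k. H \<le> 2 ^ (k + 1) * ln m"
  proof -
    obtain k where "H / ln m < 2 ^ k" using real_arch_pow[of 2 "H / ln m"] by auto
    then have "H < 2 ^ k * ln m" using lnm by (simp add: divide_less_eq)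
    also have "\<dots> \<le> 2 ^ (k + 1) * ln m" using lnm by (intro mult_right_mono) auto
    finally show ?thesis by (blast intro: less_imp_le)
  qed
  define k where "k = (LEAST k. H \<le> 2 ^ (k + 1) * ln m)"
  have k: "H \<le> 2 ^ (k + 1) * ln m" unfolding k_def by (rule LeastI_ex) fact
  have k': "2 ^ k * ln m \<le> H" if "k \<noteq> 0"
  proof -
    have "\<not> H \<le> 2 ^ (k - 1 + 1) * ln m" using not_less_Least[of "k - 1" "\<lambda>k. H \<le> 2 ^ (k + 1) * ln m"] that
      unfolding k_def[symmetric] by simp
    then show ?thesis using that by simp
  qed
  have "real (k + 1) \<le> 12 * ln s"
  proof (cases "k = 0")
    case True
    then show ?thesis using lns by simp
  next
    case False
    have "sqrt (2 * s) \<le> s" by (rule real_le_lsqrt) (use s in \<open>auto simp: power2_eq_square\<close>)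
    then have "H \<le> real (8 * s) * s" unfolding H_def by (intro mult_left_mono) auto
    moreover have "2 ^ k * (2 / 3) \<le> (2 :: real) ^ k * ln m" using lnm by (intro mult_left_mono) auto
    moreover have "real (8 * s) * s = 8 * (real s)\<^sup>2" by (simp add: power2_eq_square)
    ultimately have "(2 :: real) ^ k * (2 / 3) \<le> 8 * (real s)\<^sup>2" using k'[OF False] by linarith
    then have "(2 :: real) ^ k \<le> 16 * (real s)\<^sup>2" using zero_le_power2[of "real s"] by linarith
    also have "\<dots> \<le> real s ^ 4 * (real s)\<^sup>2" using power_mono[of 2 "real s" 4] s by (intro mult_right_mono) auto
    also have "\<dots> = real s ^ 6" by (simp add: power_add[symmetric])
    finally have "ln ((2 :: real) ^ k) \<le> ln (real s ^ 6)" using s by simp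
    then have "k * ln 2 \<le> 6 * ln s" using s by (simp add: ln_realpow)
    moreover have "k * (2 / 3) \<le> k * ln 2" using ln2_ge_two_thirds by (intro mult_left_mono) auto
    ultimately show ?thesis using lns by simp
  qed
  then show ?thesis using k k' unfolding H_def by (intro exI[of _ k]) auto
qed

lemma gabor_net:
  assumes m: "m \<ge> 2" and s: "s \<ge> 1" and p: "p \<ge> 1"
    and K: "K = chain_const * sqrt (s / m) * (12 * ln s * ln m + sqrt p)" "K \<le> 1 / 16"
  obtains F where "finite F" "chaos_moment p m F (gabor_op m) \<le> ennreal ((32 * K) ^ p)"
    "\<forall>a t y. (\<forall>x\<in>F. \<bar>gabor_dev m a x\<bar> \<le> t) \<longrightarrow> card {p \<in> tf_plane m. y p \<noteq> 0} \<le> s \<longrightarrow>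
      \<bar>gabor_dev m a y\<bar> \<le> 8 / 3 * t * (\<Sum>p\<in>tf_plane m. (cmod (y p))\<^sup>2)"
proof (cases "s = 1")
  case True
  have m0: "m > 0" using m by simp
  show ?thesis
  proof (rule that)
    show "finite {\<lambda>_. 0, delta_plane}" by simp
    show "chaos_moment p m {\<lambda>_. 0, delta_plane} (gabor_op m) \<le> ennreal ((32 * K) ^ p)"
      by (rule gabor_chain_single[OF m0 p]) (use K True in simp_all)
    show "\<forall>a t y. (\<forall>x\<in>{\<lambda>_. 0, delta_plane}. \<bar>gabor_dev m a x\<bar> \<le> t) \<longrightarrow> card {p \<in> tf_plane m. y p \<noteq> 0} \<le> s \<longrightarrow>
        \<bar>gabor_dev m a y\<bar> \<le> 8 / 3 * t * (\<Sum>p\<in>tf_plane m. (cmod (y p))\<^sup>2)"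
      using gabor_dev_le_delta[OF m0] True by simp
  qed
next
  case False
  then have s2: "s \<ge> 2" using s by simp
  obtain k where k: "real (8 * s) * sqrt (2 * s) \<le> 2 ^ (k + 1) * ln m"
      "k = 0 \<or> 2 ^ k * ln m \<le> real (8 * s) * sqrt (2 * s)" "real (k + 1) \<le> 12 * ln s"
    using ex_chain_length[OF m s2] by blast
  define K' where "K' = chain_const * sqrt (s / m) * ((k + 1) * ln m + sqrt p)"
  have lnm: "ln m \<ge> 0" using m by simp
  have K': "K' \<le> K" "K' \<ge> 0"
  proof -
    show "K' \<le> K" unfolding K'_def K
      using k(3) lnm chain_const_ge(1) by (intro mult_left_mono add_right_mono mult_right_mono) auto
    show "K' \<ge> 0" unfolding K'_def using lnm chain_const_ge(1) by (intro mult_nonneg_nonneg add_nonneg_nonneg) auto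
  qed
  show ?thesis
  proof (rule that)
    show "finite (grid m s (8 * s))" by (rule finite_grid) (use s in simp)
    have "chaos_moment p m (grid m s (8 * s)) (gabor_op m) \<le> ennreal ((32 * K') ^ p)"
      by (rule gabor_chain[OF m s _ p, where ?k1.0 = k]) (use k K K' s K'_def in \<open>simp_all add: add.commute\<close>)
    also have "\<dots> \<le> ennreal ((32 * K) ^ p)" using K' by (intro ennreal_leI power_mono) auto
    finally show "chaos_moment p m (grid m s (8 * s)) (gabor_op m) \<le> ennreal ((32 * K) ^ p)" .
    show "\<forall>a t y. (\<forall>x\<in>grid m s (8 * s). \<bar>gabor_dev m a x\<bar> \<le> t) \<longrightarrow> card {p \<in> tf_plane m. y p \<noteq> 0} \<le> s \<longrightarrow>
        \<bar>gabor_dev m a y\<bar> \<le> 8 / 3 * t * (\<Sum>p\<in>tf_plane m. (cmod (y p))\<^sup>2)"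
      using gabor_dev_le_grid[OF _ s] m by simp
  qed
qed

section \<open>The restricted isometry constant\<close>

definition plane_fun :: "nat \<Rightarrow> complex vec \<Rightarrow> nat \<times> nat \<Rightarrow> complex" where
  "plane_fun m x p = x $ (fst p * m + snd p)"

lemma bij_betw_lex: "bij_betw (\<lambda>p. fst p * m + snd p) (tf_plane m) {..<m * m}"
proof (rule bij_betwI[where g = "\<lambda>n. (n div m, n mod m)"])
  show "(\<lambda>p. fst p * m + snd p) \<in> tf_plane m \<rightarrow> {..<m * m}"
  proof
    fix p assume "p \<in> tf_plane m"
    then have p: "fst p < m" "snd p < m" by (auto simp: tf_plane_def)
    then have "fst p * m + snd p < Suc (fst p) * m" by simp
    also have "\<dots> \<le> m * m" using p by (intro mult_right_mono) auto
    finally show "fst p * m + snd p \<in> {..<m * m}" by simp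
  qed
  show "(\<lambda>n. (n div m, n mod m)) \<in> {..<m * m} \<rightarrow> tf_plane m"
  proof
    fix n assume n: "n \<in> {..<m * m}"
    then have "m > 0" by (cases m) auto
    then show "(n div m, n mod m) \<in> tf_plane m" using n by (simp add: tf_plane_def less_mult_imp_div_less)
  qed
qed (auto simp: tf_plane_def)

lemma sum_plane:
  fixes g :: "nat \<Rightarrow> 'b :: comm_monoid_add"
  shows "(\<Sum>n<m * m. g n) = (\<Sum>p\<in>tf_plane m. g (fst p * m + snd p))"
  using sum.reindex_bij_betw[OF bij_betw_lex, of g m] by simp

lemma sparse_vec_plane_fun:
  assumes "x \<in> carrier_vec (m * m)"
  shows "sparse_vec s x \<longleftrightarrow> card {p \<in> tf_plane m. plane_fun m x p \<noteq> 0} \<le> s"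
proof -
  let ?f = "\<lambda>p. fst p * m + snd p"
  have "inj_on ?f {p \<in> tf_plane m. plane_fun m x p \<noteq> 0}"
    by (rule inj_on_subset[OF bij_betw_imp_inj_on[OF bij_betw_lex]]) auto
  moreover have "?f ` {p \<in> tf_plane m. plane_fun m x p \<noteq> 0} = {i. i < dim_vec x \<and> x $ i \<noteq> 0}"
    using bij_betw_imp_surj_on[OF bij_betw_lex, of m] assms by (auto simp: plane_fun_def)
  ultimately have "bij_betw ?f {p \<in> tf_plane m. plane_fun m x p \<noteq> 0} {i. i < dim_vec x \<and> x $ i \<noteq> 0}"
    by (simp add: bij_betw_def)
  then show ?thesis by (simp add: sparse_vec_def bij_betw_same_card)
qed

lemma l2_norm_plane_fun:
  assumes "x \<in> carrier_vec (m * m)"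
  shows "(l2_norm x)\<^sup>2 = (\<Sum>p\<in>tf_plane m. (cmod (plane_fun m x p))\<^sup>2)"
  using assms by (simp add: l2_norm_sq sum_plane plane_fun_def)

text \<open>The exchange of roles on which the proof rests: the random matrix applied to the fixed
  vector \<open>x\<close> equals a fixed operator built from \<open>x\<close> applied to the random
  vector.\<close>

lemma gabor_synthesis_mat_mult:
  assumes m: "m > 0" and x: "x \<in> carrier_vec (m * m)" and i: "i < m"
  shows "(gabor_synthesis_mat (vec m (\<lambda>j. complex_of_real (1 / sqrt (real m)) * a j)) *\<^sub>v x) $ i =
    app m (gabor_op m (plane_fun m x)) a i"
proof -
  let ?h = "vec m (\<lambda>j. complex_of_real (1 / sqrt (real m)) * a j)"
  let ?A = "gabor_synthesis_mat ?h"
  have dim: "dim_row ?A = m" "dim_col ?A = m * m"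
    using gabor_synthesis_mat_carrier[of ?h] by (simp_all add: power2_eq_square)
  have entry: "?A $$ (i, fst p * m + snd p) = of_real (1 / sqrt m) * app m (tf_kernel m p) a i" if p: "p \<in> tf_plane m" for p
  proof -
    have p': "fst p < m" "snd p < m" using p by (auto simp: tf_plane_def)
    have n: "fst p * m + snd p < m * m" using bij_betw_apply[OF bij_betw_lex p] by simp
    have "?A $$ (i, fst p * m + snd p) = time_freq_shift (List.product [0..<m] [0..<m] ! (fst p * m + snd p)) ?h $ i"
      using n i by (simp add: gabor_synthesis_mat_def Let_def mat_of_cols_index)
    also have "List.product [0..<m] [0..<m] ! (fst p * m + snd p) = (fst p, snd p)"
      using n p' by (subst product_nth) (simp_all add: less_mult_imp_div_less)
    also have "time_freq_shift (fst p, snd p) ?h $ i =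
        exp (2 * of_real pi * \<i> / of_nat m) ^ (snd p * i) * ?h $ shift_idx m (fst p) i"
      using index_time_freq_shift[of i ?h "fst p" "snd p"] i by (simp add: shift_idx_def)
    also have "?h $ shift_idx m (fst p) i = complex_of_real (1 / sqrt (real m)) * a (shift_idx m (fst p) i)"
      using shift_idx_less[OF m] by simp
    finally show ?thesis by (simp add: app_tf_kernel[OF m] mult_ac)
  qed
  have "(?A *\<^sub>v x) $ i = (\<Sum>n<m * m. ?A $$ (i, n) * x $ n)"
    using i x dim by (auto simp: scalar_prod_def atLeast0LessThan intro!: sum.cong)
  also have "\<dots> = (\<Sum>p\<in>tf_plane m. ?A $$ (i, fst p * m + snd p) * plane_fun m x p)"
    by (simp only: sum_plane plane_fun_def)
  also have "\<dots> = (\<Sum>p\<in>tf_plane m. of_real (1 / sqrt m) * (plane_fun m x p * app m (tf_kernel m p) a i))"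
    by (intro sum.cong refl) (simp only: entry mult.assoc, simp only: mult.left_commute mult.commute)
  finally show ?thesis by (simp only: app_gabor_op[OF m] sum_distrib_left)
qed

lemma restricted_isometry_gabor_iff:
  assumes m: "m > 0"
  shows "restricted_isometry s (gabor_synthesis_mat (vec m (\<lambda>j. complex_of_real (1 / sqrt (real m)) * a j))) \<delta> \<longleftrightarrow>
    (\<forall>y. card {p \<in> tf_plane m. y p \<noteq> 0} \<le> s \<longrightarrow>
      \<bar>gabor_dev m a y\<bar> \<le> \<delta> * (\<Sum>p\<in>tf_plane m. (cmod (y p))\<^sup>2))"
    (is "restricted_isometry s ?A \<delta> \<longleftrightarrow> ?R")
proof -
  have dim: "dim_row ?A = m" "dim_col ?A = m * m"
    using gabor_synthesis_mat_carrier[of "vec m (\<lambda>j. complex_of_real (1 / sqrt (real m)) * a j)"]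
    by (simp_all add: power2_eq_square)
  have n: "(l2_norm (?A *\<^sub>v x))\<^sup>2 = nrm2 m (app m (gabor_op m (plane_fun m x)) a)" if x: "x \<in> carrier_vec (m * m)" for x :: "complex vec"
    unfolding l2_norm_sq nrm2_def dim_mult_mat_vec dim
    by (intro sum.cong refl) (simp only: lessThan_iff gabor_synthesis_mat_mult[OF m x])
  have key: "(1 - \<delta>) * (l2_norm x)\<^sup>2 \<le> (l2_norm (?A *\<^sub>v x))\<^sup>2 \<and> (l2_norm (?A *\<^sub>v x))\<^sup>2 \<le> (1 + \<delta>) * (l2_norm x)\<^sup>2 \<longleftrightarrow>
      \<bar>gabor_dev m a (plane_fun m x)\<bar> \<le> \<delta> * (\<Sum>p\<in>tf_plane m. (cmod (plane_fun m x p))\<^sup>2)"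
    if x: "x \<in> carrier_vec (m * m)" for x :: "complex vec"
    unfolding n[OF x] gabor_dev_def l2_norm_plane_fun[OF x] by (auto simp: abs_le_iff algebra_simps)
  show ?thesis
  proof
    assume R: ?R
    then show "restricted_isometry s ?A \<delta>"
      unfolding restricted_isometry_def dim using key sparse_vec_plane_fun by blast
  next
    assume ri: "restricted_isometry s ?A \<delta>"
    show ?R
    proof (intro allI impI)
      fix y :: "nat \<times> nat \<Rightarrow> complex" assume y: "card {p \<in> tf_plane m. y p \<noteq> 0} \<le> s"
      define x where "x = vec (m * m) (\<lambda>n. y (n div m, n mod m))"
      have x: "x \<in> carrier_vec (m * m)" by (simp add: x_def)
      have eq: "plane_fun m x p = y p" if "p \<in> tf_plane m" for p
        using bij_betw_apply[OF bij_betw_lex that] that by (auto simp: plane_fun_def x_def tf_plane_def)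
      have "{p \<in> tf_plane m. plane_fun m x p \<noteq> 0} = {p \<in> tf_plane m. y p \<noteq> 0}" using eq by auto
      then have "sparse_vec s x" using y by (simp add: sparse_vec_plane_fun[OF x])
      then have "\<bar>gabor_dev m a (plane_fun m x)\<bar> \<le> \<delta> * (\<Sum>p\<in>tf_plane m. (cmod (plane_fun m x p))\<^sup>2)"
        using ri x key[OF x] unfolding restricted_isometry_def dim by blast
      moreover have "gabor_dev m a (plane_fun m x) = gabor_dev m a y" by (rule gabor_dev_cong[OF m eq])
      moreover have "(\<Sum>p\<in>tf_plane m. (cmod (plane_fun m x p))\<^sup>2) = (\<Sum>p\<in>tf_plane m. (cmod (y p))\<^sup>2)"
        by (intro sum.cong) (simp_all add: eq)
      ultimately show "\<bar>gabor_dev m a y\<bar> \<le> \<delta> * (\<Sum>p\<in>tf_plane m. (cmod (y p))\<^sup>2)" by simp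
    qed
  qed
qed

section \<open>Measurability of the restricted isometry event\<close>

definition rational_planes :: "nat \<Rightarrow> (nat \<times> nat \<Rightarrow> complex) set" where
  "rational_planes m = PiE (tf_plane m) (\<lambda>_. case_prod Complex ` (\<rat> \<times> \<rat>))"

lemma countable_rational_planes: "countable (rational_planes m)"
  unfolding rational_planes_def by (intro countable_PiE) (auto intro: countable_rat)

lemma floor_mult_divide_tendsto: "(\<lambda>n. of_int \<lfloor>real n * b\<rfloor> / real n) \<longlonglongrightarrow> b"
proof (rule tendsto_sandwich)
  have "b - 1 / real n \<le> of_int \<lfloor>real n * b\<rfloor> / real n" if "n > 0" for n
  proof -
    have "(real n * b - 1) / real n \<le> of_int \<lfloor>real n * b\<rfloor> / real n" by (intro divide_right_mono) linarith+
    then show ?thesis using that by (simp add: diff_divide_distrib)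
  qed
  then show "\<forall>\<^sub>F n in sequentially. b - 1 / real n \<le> of_int \<lfloor>real n * b\<rfloor> / real n"
    by (auto intro: eventually_sequentiallyI[of 1])
  have "of_int \<lfloor>real n * b\<rfloor> / real n \<le> b" if "n > 0" for n
    using that by (simp add: divide_le_eq mult.commute)
  then show "\<forall>\<^sub>F n in sequentially. of_int \<lfloor>real n * b\<rfloor> / real n \<le> b"
    by (auto intro: eventually_sequentiallyI[of 1])
  show "(\<lambda>n. b - 1 / real n) \<longlonglongrightarrow> b"
    using tendsto_diff[OF tendsto_const lim_1_over_n, of b] by simp
qed simp

text \<open>Rounding a multiple of a coordinate down keeps zero coordinates zero, so the rational
  approximants are at least as sparse as \<open>y\<close>.\<close>

lemma rational_planes_dense:
  fixes y :: "nat \<times> nat \<Rightarrow> complex"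
  assumes y: "card {p \<in> tf_plane m. y p \<noteq> 0} \<le> s"
  obtains z where "\<And>n. z n \<in> rational_planes m" "\<And>n. card {p \<in> tf_plane m. z n p \<noteq> 0} \<le> s"
    "\<And>p. p \<in> tf_plane m \<Longrightarrow> (\<lambda>n. z n p) \<longlonglongrightarrow> y p"
proof -
  define z where "z n = restrict (\<lambda>p. Complex (of_int \<lfloor>real n * Re (y p)\<rfloor> / real n) (of_int \<lfloor>real n * Im (y p)\<rfloor> / real n)) (tf_plane m)" for n
  show ?thesis
  proof (rule that)
    show "z n \<in> rational_planes m" for n
      unfolding z_def rational_planes_def by (intro restrict_PiE[THEN iffD2] Pi_I image_eqI[where x = "(_, _)"]) auto
    show "card {p \<in> tf_plane m. z n p \<noteq> 0} \<le> s" for n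
    proof -
      have "card {p \<in> tf_plane m. z n p \<noteq> 0} \<le> card {p \<in> tf_plane m. y p \<noteq> 0}"
        by (intro card_mono) (auto simp: z_def zero_complex.code)
      then show ?thesis using y by simp
    qed
    show "(\<lambda>n. z n p) \<longlonglongrightarrow> y p" if "p \<in> tf_plane m" for p
      unfolding z_def using that
      by (auto simp: tendsto_complex_iff intro!: floor_mult_divide_tendsto)
  qed
qed

text \<open>Both sides of the inequality are continuous in \<open>y\<close>, so countably many
  sparse vectors decide it, and the event becomes a countable intersection.\<close>

lemma gabor_dev_rational_iff:
  assumes m: "m > 0"
  shows "(\<forall>y. card {p \<in> tf_plane m. y p \<noteq> 0} \<le> s \<longrightarrow> \<bar>gabor_dev m a y\<bar> \<le> \<delta> * (\<Sum>p\<in>tf_plane m. (cmod (y p))\<^sup>2)) \<longleftrightarrow>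
    (\<forall>y\<in>{y \<in> rational_planes m. card {p \<in> tf_plane m. y p \<noteq> 0} \<le> s}. \<bar>gabor_dev m a y\<bar> \<le> \<delta> * (\<Sum>p\<in>tf_plane m. (cmod (y p))\<^sup>2))"
    (is "?A \<longleftrightarrow> ?B")
proof
  assume B: ?B
  show ?A
  proof (intro allI impI)
    fix y :: "nat \<times> nat \<Rightarrow> complex" assume "card {p \<in> tf_plane m. y p \<noteq> 0} \<le> s"
    then obtain z where z: "\<And>n. z n \<in> rational_planes m" "\<And>n. card {p \<in> tf_plane m. z n p \<noteq> 0} \<le> s"
        "\<And>p. p \<in> tf_plane m \<Longrightarrow> (\<lambda>n. z n p) \<longlonglongrightarrow> y p"
      by (rule rational_planes_dense) blast
    have "(\<lambda>n. gabor_dev m a (z n)) \<longlonglongrightarrow> gabor_dev m a y"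
      unfolding gabor_dev_def nrm2_def app_gabor_op[OF m] by (intro tendsto_intros z(3))
    then have "(\<lambda>n. \<bar>gabor_dev m a (z n)\<bar>) \<longlonglongrightarrow> \<bar>gabor_dev m a y\<bar>" by (rule tendsto_rabs)
    moreover have "(\<lambda>n. \<delta> * (\<Sum>p\<in>tf_plane m. (cmod (z n p))\<^sup>2)) \<longlonglongrightarrow> \<delta> * (\<Sum>p\<in>tf_plane m. (cmod (y p))\<^sup>2)"
      by (intro tendsto_intros z(3))
    moreover have "\<bar>gabor_dev m a (z n)\<bar> \<le> \<delta> * (\<Sum>p\<in>tf_plane m. (cmod (z n p))\<^sup>2)" for n
      using B z(1,2) by blast
    ultimately show "\<bar>gabor_dev m a y\<bar> \<le> \<delta> * (\<Sum>p\<in>tf_plane m. (cmod (y p))\<^sup>2)"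
      by (intro LIMSEQ_le) auto
  qed
qed blast

lemma gabor_dev_measurable:
  assumes "\<And>j. j < m \<Longrightarrow> \<xi> j \<in> borel_measurable M"
  shows "(\<lambda>w. gabor_dev m (\<lambda>j. \<xi> j w) x) \<in> borel_measurable M"
  unfolding gabor_dev_def nrm2_def app_def using assms by measurable

lemma ri_const_gabor_le_iff:
  assumes m: "m > 0" and s: "s > 0"
  shows "ri_const s (gabor_synthesis_mat (vec m (\<lambda>j. complex_of_real (1 / sqrt (real m)) * a j))) \<le> \<delta> \<longleftrightarrow>
    (\<forall>y. card {p \<in> tf_plane m. y p \<noteq> 0} \<le> s \<longrightarrow> \<bar>gabor_dev m a y\<bar> \<le> \<delta> * (\<Sum>p\<in>tf_plane m. (cmod (y p))\<^sup>2))"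
proof -
  have "dim_col (gabor_synthesis_mat (vec m (\<lambda>j. complex_of_real (1 / sqrt (real m)) * a j))) > 0"
    using gabor_synthesis_mat_carrier[of "vec m (\<lambda>j. complex_of_real (1 / sqrt (real m)) * a j)"] m by simp
  from ri_const_le_iff[OF s this] show ?thesis by (simp only: restricted_isometry_gabor_iff[OF m])
qed

lemma ri_const_gabor_measurable:
  assumes m: "m > 0" and s: "s > 0" and \<xi>: "\<And>j. j < m \<Longrightarrow> \<xi> j \<in> borel_measurable M"
  shows "{w \<in> space M. ri_const s (gabor_synthesis_mat (vec m (\<lambda>j. complex_of_real (1 / sqrt (real m)) * \<xi> j w))) \<le> \<delta>} \<in> sets M"
proof -
  have [measurable]: "(\<lambda>w. gabor_dev m (\<lambda>j. \<xi> j w) x) \<in> borel_measurable M" for x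
    by (rule gabor_dev_measurable[OF \<xi>])
  have "countable {y \<in> rational_planes m. card {p \<in> tf_plane m. y p \<noteq> 0} \<le> s}"
    by (rule countable_subset[OF _ countable_rational_planes[of m]]) blast
  then have "Measurable.pred M (\<lambda>w. \<forall>y\<in>{y \<in> rational_planes m. card {p \<in> tf_plane m. y p \<noteq> 0} \<le> s}.
      \<bar>gabor_dev m (\<lambda>j. \<xi> j w) y\<bar> \<le> \<delta> * (\<Sum>p\<in>tf_plane m. (cmod (y p))\<^sup>2))"
    by (rule measurable_pred_countable(1)) measurable
  then show ?thesis
    by (simp only: ri_const_gabor_le_iff[OF m s] gabor_dev_rational_iff[OF m] pred_def)
qed

text \<open>Markov's inequality for the p-th moment of the maximal deviation over the net, at the
  threshold 3 \<delta> / 8; the transfer factor 8/3 turns this threshold into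
  \<open>\<delta>\<close>.\<close>

lemma (in prob_space) gabor_tail:
  fixes \<xi> :: "nat \<Rightarrow> 'a \<Rightarrow> complex"
  assumes L: "L > 0" and m: "m \<ge> 2" and ind: "indep_vars (\<lambda>_. borel) \<xi> {..<m}"
    and \<xi>: "\<And>j. j < m \<Longrightarrow> integrable M (\<xi> j)" "\<And>j. j < m \<Longrightarrow> expectation (\<xi> j) = 0"
      "\<And>j. j < m \<Longrightarrow> complex_variance (\<xi> j) = 1" "\<And>j. j < m \<Longrightarrow> subgaussian L (\<xi> j)"
    and s: "s \<ge> 1" and p: "p \<ge> 1"
    and C1: "C1 = 8 * (sqrt 5 * L) * (1 + 1 / sqrt (2 / pi))" and C2: "C2 = 4 * (12 * L\<^sup>2) * (1 + 1 / (2 / pi))"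
    and K: "K = chain_const * sqrt (s / m) * (12 * ln s * ln m + sqrt p)" "K \<le> 1 / 16" and \<delta>: "\<delta> > 0"
  shows "prob {w \<in> space M. ri_const s (gabor_synthesis_mat (vec m (\<lambda>j. complex_of_real (1 / sqrt (real m)) * \<xi> j w))) \<le> \<delta>}
    \<ge> 1 - ((16 * C1\<^sup>2 + 2 * C2) * (32 * K) * (8 / (3 * \<delta>))) ^ p"
proof -
  define C where "C = 16 * C1\<^sup>2 + 2 * C2"
  have C0: "C \<ge> 0" using L by (simp add: C_def C2)
  have K0: "K \<ge> 0" unfolding K using m s chain_const_ge(1) by (intro mult_nonneg_nonneg add_nonneg_nonneg) auto
  have m0: "m > 0" "m \<ge> 1" using m by auto
  have s0: "s > 0" using s by simp
  have rv: "\<xi> j \<in> borel_measurable M" if "j < m" for j using \<xi>(1)[OF that] by simp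
  obtain F where F: "finite F" "chaos_moment p m F (gabor_op m) \<le> ennreal ((32 * K) ^ p)"
    "\<forall>a t y. (\<forall>x\<in>F. \<bar>gabor_dev m a x\<bar> \<le> t) \<longrightarrow> card {p \<in> tf_plane m. y p \<noteq> 0} \<le> s \<longrightarrow>
      \<bar>gabor_dev m a y\<bar> \<le> 8 / 3 * t * (\<Sum>p\<in>tf_plane m. (cmod (y p))\<^sup>2)"
    by (rule gabor_net[OF m s p K])
  define U where "U w = (SUP x\<in>F. ennreal (\<bar>gabor_dev m (\<lambda>j. \<xi> j w) x\<bar> ^ p))" for w
  have [measurable]: "U \<in> borel_measurable M"
    unfolding U_def using F(1) gabor_dev_measurable[OF rv] by (intro borel_measurable_SUP) (auto intro: countable_finite)
  have dev: "gabor_dev m a x = nrm2 m (app m (gabor_op m x) a) - frob_sq m (gabor_op m x)" for a x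
    by (simp add: gabor_dev_def frob_sq_gabor_op[OF m0(1)])
  have "(\<integral>\<^sup>+w. U w \<partial>M) \<le> ennreal (C ^ p) * chaos_moment p m F (gabor_op m)"
    unfolding U_def dev C_def by (rule subgaussian_chaos_moment[OF L m0(2) ind \<xi> F(1) p C1 C2])
  also have "\<dots> \<le> ennreal (C ^ p) * ennreal ((32 * K) ^ p)" by (intro mult_left_mono F(2)) simp
  also have "\<dots> = ennreal ((C * (32 * K)) ^ p)" using C0 by (simp add: ennreal_mult[symmetric] power_mult_distrib K0)
  finally have EU: "(\<integral>\<^sup>+w. U w \<partial>M) \<le> ennreal ((C * (32 * K)) ^ p)" .
  define E where "E = {w \<in> space M. ri_const s (gabor_synthesis_mat (vec m (\<lambda>j. complex_of_real (1 / sqrt (real m)) * \<xi> j w))) \<le> \<delta>}"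
  have E: "E \<in> events" unfolding E_def by (rule ri_const_gabor_measurable[OF m0(1) s0 rv])
  define B where "B = {w \<in> space M. 1 \<le> ennreal ((8 / (3 * \<delta>)) ^ p) * U w}"
  have B: "B \<in> events" unfolding B_def by measurable
  have sub: "space M - E \<subseteq> B"
  proof
    fix w assume w: "w \<in> space M - E"
    show "w \<in> B"
    proof (rule ccontr)
      assume "w \<notin> B"
      then have lt: "ennreal ((8 / (3 * \<delta>)) ^ p) * U w < 1" using w by (auto simp: B_def)
      have "\<bar>gabor_dev m (\<lambda>j. \<xi> j w) x\<bar> \<le> 3 * \<delta> / 8" if x: "x \<in> F" for x
      proof -
        have "ennreal ((8 / (3 * \<delta>)) ^ p * \<bar>gabor_dev m (\<lambda>j. \<xi> j w) x\<bar> ^ p) \<le> ennreal ((8 / (3 * \<delta>)) ^ p) * U w"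
          unfolding U_def using \<delta> x by (subst ennreal_mult) (auto intro!: mult_left_mono SUP_upper)
        also have "\<dots> \<le> ennreal (1 ^ p)" using lt by simp
        finally have "(8 / (3 * \<delta>)) ^ p * \<bar>gabor_dev m (\<lambda>j. \<xi> j w) x\<bar> ^ p \<le> 1 ^ p"
          by simp
        then have "(8 / (3 * \<delta>) * \<bar>gabor_dev m (\<lambda>j. \<xi> j w) x\<bar>) ^ p \<le> 1 ^ p"
          by (simp only: power_mult_distrib)
        then have "8 / (3 * \<delta>) * \<bar>gabor_dev m (\<lambda>j. \<xi> j w) x\<bar> \<le> 1"
          using p by (subst (asm) power_mono_iff) (use \<delta> in auto)
        then show ?thesis using \<delta> by (simp add: field_simps)
      qed
      then have "\<bar>gabor_dev m (\<lambda>j. \<xi> j w) y\<bar> \<le> \<delta> * (\<Sum>p\<in>tf_plane m. (cmod (y p))\<^sup>2)"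
        if "card {p \<in> tf_plane m. y p \<noteq> 0} \<le> s" for y
        using F(3)[rule_format, of "\<lambda>j. \<xi> j w" "3 * \<delta> / 8" y] that by simp
      then have "w \<in> E" using w unfolding E_def ri_const_gabor_le_iff[OF m0(1) s0] by blast
      then show False using w by simp
    qed
  qed
  have "emeasure M B \<le> ennreal ((8 / (3 * \<delta>)) ^ p) * (\<integral>\<^sup>+w. U w * indicator (space M) w \<partial>M)"
    unfolding B_def by (rule nn_integral_Markov_inequality) auto
  also have "(\<integral>\<^sup>+w. U w * indicator (space M) w \<partial>M) = (\<integral>\<^sup>+w. U w \<partial>M)"
    by (intro nn_integral_cong) simp
  also have "ennreal ((8 / (3 * \<delta>)) ^ p) * (\<integral>\<^sup>+w. U w \<partial>M) \<le> ennreal ((8 / (3 * \<delta>)) ^ p) * ennreal ((C * (32 * K)) ^ p)"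
    by (intro mult_left_mono EU) simp
  also have "\<dots> = ennreal ((C * (32 * K) * (8 / (3 * \<delta>))) ^ p)"
    using \<delta> C0 K0 by (simp add: ennreal_mult[symmetric] power_mult_distrib[symmetric] mult_ac)
  finally have "prob B \<le> (C * (32 * K) * (8 / (3 * \<delta>))) ^ p"
    using \<delta> C0 K0 by (simp add: emeasure_eq_measure)
  moreover have "prob (space M - E) \<le> prob B" by (rule finite_measure_mono[OF sub B])
  ultimately show ?thesis using prob_compl[OF E] unfolding C_def E_def by simp
qed

lemma (in prob_space) gabor_rip:
  fixes \<xi> :: "nat \<Rightarrow> 'a \<Rightarrow> complex"
  assumes L: "L > 0" and m1: "m \<ge> 1" and ind: "indep_vars (\<lambda>_. borel) \<xi> {..<m}"
    and \<xi>: "\<And>j. j < m \<Longrightarrow> integrable M (\<xi> j)" "\<And>j. j < m \<Longrightarrow> expectation (\<xi> j) = 0"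
      "\<And>j. j < m \<Longrightarrow> complex_variance (\<xi> j) = 1" "\<And>j. j < m \<Longrightarrow> subgaussian L (\<xi> j)"
    and s: "s \<ge> 1" and \<delta>: "0 < \<delta>" "\<delta> < 1" and \<eta>: "0 < \<eta>" "\<eta> < 1" "s = 1 \<or> m = 1 \<Longrightarrow> \<eta> \<le> 1 / 2"
    and C1: "C1 = 8 * (sqrt 5 * L) * (1 + 1 / sqrt (2 / pi))" and C2: "C2 = 4 * (12 * L\<^sup>2) * (1 + 1 / (2 / pi))"
    and r: "r = 3840 * (16 * C1\<^sup>2 + 2 * C2 + 1) * chain_const"
    and m: "m \<ge> r\<^sup>2 * \<delta> powi (-2) * s * max ((ln s)\<^sup>2 * (ln m)\<^sup>2) (ln (inverse \<eta>))"
  shows "prob {w \<in> space M. ri_const s (gabor_synthesis_mat (vec m (\<lambda>j. complex_of_real (1 / sqrt (real m)) * \<xi> j w))) \<le> \<delta>} \<ge> 1 - \<eta>"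
proof -
  define X where "X = max ((ln s)\<^sup>2 * (ln m)\<^sup>2) (ln (inverse \<eta>))"
  define C where "C = 16 * C1\<^sup>2 + 2 * C2"
  have C0: "C \<ge> 0" using L by (simp add: C_def C2)
  have \<kappa>: "chain_const \<ge> 1" by (rule chain_const_ge(1))
  have r_eq: "r = 3840 * (C + 1) * chain_const" by (simp add: r C_def)
  have r1: "r \<ge> 3840"
    using mult_mono[of 1 "C + 1" 1 chain_const] C0 \<kappa> unfolding r_eq mult.assoc by linarith
  have l\<eta>: "ln (inverse \<eta>) > 0" using \<eta> by (simp add: ln_inverse)
  have half: "ln (inverse \<eta>) \<ge> 2 / 3" if "\<eta> \<le> 1 / 2"
  proof -
    have "ln 2 \<le> ln (inverse \<eta>)" using that \<eta> by (simp add: field_simps)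
    then show ?thesis using ln2_ge_two_thirds by linarith
  qed
  have X: "X \<ge> ln (inverse \<eta>)" "X \<ge> (ln s * ln m)\<^sup>2" by (simp_all add: X_def power_mult_distrib)
  have mX: "r\<^sup>2 * (s * X) \<le> \<delta>\<^sup>2 * m"
  proof -
    have "r\<^sup>2 * \<delta> powi (-2) * s * X * \<delta>\<^sup>2 \<le> m * \<delta>\<^sup>2" using m unfolding X_def by (intro mult_right_mono) auto
    moreover have "\<delta> powi (-2) = 1 / \<delta>\<^sup>2" by (simp add: power_int_minus divide_inverse)
    ultimately show ?thesis using \<delta> by (simp add: mult_ac)
  qed
  \<comment> \<open>In dimension one the size assumption fails: the right side of \<open>mX\<close>
    is at most 1, while \<open>r\<close> is at least 3840.\<close>
  have m2: "m \<ge> 2"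
  proof (rule ccontr)
    assume "\<not> m \<ge> 2"
    then have "m = 1" using m1 by simp
    then have "X \<ge> 2 / 3" using half \<eta>(3) X(1) by simp
    then have "1 * (2 / 3) \<le> s * X" using s by (intro mult_mono) auto
    then have "3840\<^sup>2 * (2 / 3) \<le> r\<^sup>2 * (s * X)" using r1 by (intro mult_mono power_mono) auto
    moreover have "\<delta>\<^sup>2 * m \<le> 1" using \<open>m = 1\<close> \<delta> by (simp add: power_le_one)
    ultimately show False using mX by simp
  qed
  \<comment> \<open>The lower bound absorbs the rounding of \<open>p\<close>: with it, ln(1 /
    \<eta>) + 1 is at most 7 X, hence at most 9 X, and sqrt p is at most 3 sqrt X.\<close>
  have X6: "X \<ge> 1 / 6"
  proof (cases "\<eta> \<le> 1 / 2")
    case True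
    then show ?thesis using half X(1) by simp
  next
    case False
    then have "s \<ge> 2" using \<eta>(3) s by fastforce
    then have "(2 / 3) * (2 / 3) \<le> ln s * ln m" using m2 ln_ge_two_thirds by (intro mult_mono) auto
    then have "((2 / 3) * (2 / 3))\<^sup>2 \<le> (ln s * ln m)\<^sup>2" by (intro power_mono) auto
    then show ?thesis using X(2) by (simp add: power2_eq_square)
  qed
  \<comment> \<open>The smallest integer order for which a base of at most exp(-1) in the tail bound
    gives \<open>\<eta>\<close>.\<close>
  define p where "p = nat \<lceil>ln (inverse \<eta>)\<rceil>"
  have p: "p \<ge> 1" using l\<eta> unfolding p_def by linarith
  have pl: "real p \<ge> ln (inverse \<eta>)" "real p \<le> ln (inverse \<eta>) + 1" using l\<eta> unfolding p_def by linarith+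
  define K where "K = chain_const * sqrt (s / m) * (12 * ln s * ln m + sqrt p)"
  \<comment> \<open>The two parts of \<open>K\<close> contribute 12 and 3 times sqrt X, and 15 times
    256 is the 3840 in \<open>r\<close>.\<close>
  have K: "K \<le> \<delta> / (256 * (C + 1))"
  proof -
    have "ln s * ln m \<le> sqrt X" using X(2) by (rule real_le_rsqrt)
    moreover have "sqrt p \<le> 3 * sqrt X"
    proof -
      have "sqrt p \<le> sqrt (3\<^sup>2 * X)" using pl(2) X(1) X6 by (intro real_sqrt_le_mono) simp
      then show ?thesis by (simp add: real_sqrt_mult)
    qed
    ultimately have "12 * ln s * ln m + sqrt p \<le> 15 * sqrt X" by simp
    then have "K \<le> chain_const * sqrt (s / m) * (15 * sqrt X)"
      unfolding K_def using \<kappa> by (intro mult_left_mono) auto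
    also have "\<dots> = 15 * chain_const * sqrt (s / m * X)" by (simp only: real_sqrt_mult mult_ac)
    also have "\<dots> \<le> 15 * chain_const * (\<delta> / r)"
    proof (intro mult_left_mono real_le_lsqrt)
      show "s / m * X \<le> (\<delta> / r)\<^sup>2" using mX m2 r1 by (simp add: power_divide field_simps)
    qed (use \<delta> r1 \<kappa> in auto)
    also have "\<dots> = \<delta> / (256 * (C + 1))"
    proof -
      have *: "15 * k * (\<delta> / (3840 * D * k)) = \<delta> / (256 * D)" if "k > 0" "D > 0" for k D :: real
        using that by (simp add: field_simps)
      show ?thesis unfolding r_eq by (rule *) (use \<kappa> C0 in auto)
    qed
    finally show ?thesis .
  qed
  have K16: "K \<le> 1 / 16"
  proof -
    have "\<delta> / (256 * (C + 1)) \<le> 1 / 16" using \<delta> C0 by (simp add: field_simps)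
    then show ?thesis using K by linarith
  qed
  have K0: "K \<ge> 0" unfolding K_def using m2 s \<kappa> by (intro mult_nonneg_nonneg add_nonneg_nonneg) auto
  \<comment> \<open>The number 256 is 32 times 8, so that exactly C / (3 (C + 1)) remains, which is
    below 1/3 and thus below exp(-1).\<close>
  have "C * (32 * K) * (8 / (3 * \<delta>)) \<le> C * (32 * (\<delta> / (256 * (C + 1)))) * (8 / (3 * \<delta>))"
    using K C0 \<delta> by (intro mult_right_mono mult_left_mono) auto
  also have "\<dots> = C / (3 * (C + 1))" using \<delta> C0 by (simp add: field_simps)
  also have "\<dots> \<le> 1 / 3" using C0 by (simp add: field_simps)
  also have "\<dots> \<le> exp (- 1)" using exp_le by (simp add: exp_minus field_simps)
  finally have "(C * (32 * K) * (8 / (3 * \<delta>))) ^ p \<le> exp (- 1) ^ p"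
    using C0 K0 \<delta> by (intro power_mono) auto
  also have "\<dots> = exp (- real p)" by (simp add: exp_of_nat_mult[symmetric])
  also have "\<dots> \<le> exp (- ln (inverse \<eta>))" using pl(1) by simp
  also have "\<dots> = \<eta>" using \<eta> by (simp add: ln_inverse)
  finally have "(C * (32 * K) * (8 / (3 * \<delta>))) ^ p \<le> \<eta>" .
  then show ?thesis
    using gabor_tail[OF L m2 ind \<xi> s p C1 C2 K_def K16 \<delta>(1)] unfolding C_def by linarith
qed

theorem theorem5p1:
  fixes L :: real
  assumes "L > 0"
  shows "\<exists>c>0. \<forall>(M :: 'a measure) (m :: nat) (\<xi> :: nat \<Rightarrow> 'a \<Rightarrow> complex) (s :: nat) (\<delta> :: real) (\<eta> :: real).
    prob_space M \<and> m \<ge> 1 \<and>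
    prob_space.indep_vars M (\<lambda>_. borel) \<xi> {..<m} \<and>
    (\<forall>j<m. integrable M (\<xi> j) \<and> prob_space.expectation M (\<xi> j) = 0 \<and>
       prob_space.complex_variance M (\<xi> j) = 1 \<and> prob_space.subgaussian M L (\<xi> j)) \<and>
    s \<ge> 1 \<and> \<delta> \<in> {0<..<1} \<and> \<eta> \<in> {0<..<1} \<and>
    (s = 1 \<or> m = 1 \<longrightarrow> \<eta> \<le> 1 / 2) \<and>
    real m \<ge> c * \<delta> powi (-2) * real s * max ((ln (real s))\<^sup>2 * (ln (real m))\<^sup>2) (ln (inverse \<eta>))
    \<longrightarrow> prob_space.prob M {\<omega> \<in> space M.
          ri_const s (gabor_synthesis_mat (vec m (\<lambda>j. complex_of_real (1 / sqrt (real m)) * \<xi> j \<omega>))) \<le> \<delta>}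
        \<ge> 1 - \<eta>"
proof -
  define C1 where "C1 = 8 * (sqrt 5 * L) * (1 + 1 / sqrt (2 / pi))"
  define C2 where "C2 = 4 * (12 * L\<^sup>2) * (1 + 1 / (2 / pi))"
  define r where "r = 3840 * (16 * C1\<^sup>2 + 2 * C2 + 1) * chain_const"
  have "C2 \<ge> 0" by (simp add: C2_def)
  then have "16 * C1\<^sup>2 + 2 * C2 + 1 > 0" by (intro add_nonneg_pos add_nonneg_nonneg) auto
  \<comment> \<open>The constant of the theorem is the square of \<open>r\<close>, because the
    moment parameter \<open>K\<close> is of the order of the square root of the ratio that the size
    assumption bounds.\<close>
  then have "r\<^sup>2 > 0" using chain_const_ge(1) unfolding r_def by simp
  then show ?thesis
  proof (intro exI[of _ "r\<^sup>2"] conjI allI impI, goal_cases)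
    case (2 M m \<xi> s \<delta> \<eta>)
    then interpret prob_space M by blast
    show ?case by (rule gabor_rip[OF assms _ _ _ _ _ _ _ _ _ _ _ _ C1_def C2_def r_def]) (use 2 in auto)
  qed simp
qed

end
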